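(* Let $K\in\{2,3,4\}$. Let $X_n$ be the number of key comparisons used by optimal $K$-pivot QuickSort and $Y_n:=(X_n-\mathbb{E}[X_n])/n$. Then for all $p\ge1$ and all $\varepsilon>0$ we have, as $n\to\infty$, $$\ell_p(Y_n,Z_K)=\mathrm{O}\left(n^{-1/2+\varepsilon}\right),\qquad \varrho(Y_n,Z_K)=\mathrm{O}\left(n^{-1/2+\varepsilon}\right).$$
   Context: Metrics. For probability measures $\mu,\nu$ on $\mathbb{R}$ with finite absolute $p$-th moment, $p\ge1$, $\ell_p(\mu,\nu)=\inf\{\|X-Y\|_p:\ X\text{ has law }\mu,\ Y\text{ has law }\nu\}$, where $\|\cdot\|_p$ is the $L_p$-norm. The Kolmogorov--Smirnov metric is $\varrho(\mu,\nu)=\sup_{x\in\mathbb{R}}|F_\mu(x)-F_\nu(x)|$, where $F_\mu,F_\nu$ are the distribution functions. Distances between random variables mean distances between their laws. Notation: $H_n=\sum_{i=1}^n \frac1i$. Probabilistic model. Fix $K\in\mathbb{N}$. Let $V_1,\dots,V_K,a_1,a_2,\dots$ be independent random variables, uniformly distributed on $[0,1]$. For $n>K$ the list to be sorted is $a_1,\dots,a_{n-K},V_1,\dots,V_K$; the last $K$ items are the pivots, and $p_1<\dots<p_K$ denote the sorted pivots. The spacings are $D_0=p_1$, $D_i=p_{i+1}-p_i$ for $1\le i\le K-1$, $D_K=1-p_K$, and $D=(D_0,\dots,D_K)$. The sublists $S_0,\dots,S_K$ consist of the non-pivot elements of the list lying in $(0,p_1),(p_1,p_2),\dots,(p_K,1)$,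 respectively, and $I_i^{(n)}=|S_i|$. Classification trees. $\mathcal{T}$ is the (finite) set of all binary search trees with internal nodes $p_1,\dots,p_K$ and external nodes (leaves) $S_0,\dots,S_K$ from left to right. For $t\in\mathcal{T}$, $h_t(i)$ is the depth of the leaf $S_i$ in $t$ (the number of comparisons needed to classify an element into $S_i$ using $t$), and $l_t(x_0,\dots,x_K)=\sum_{i=0}^K x_i h_t(i)$. Put $l_{\mathrm{opt}}(D)=\min_{t\in\mathcal{T}} l_t(D)$, $\gamma_K=\mathbb{E}[l_{\mathrm{opt}}(D)]$ and $\alpha_K=\gamma_K/(H_{K+1}-1)$. Optimal partition strategy. The elements $a_1,\dots,a_{n-K}$ are classified one after another. Let $C^{(k)}_i$ be the number of elements among $a_1,\dots,a_{k-1}$ classified into $S_i$. The element $a_k$ is classified using the tree $t\in\mathcal{T}$ minimizing $l_t(C^{(k)}_0+1,\dots,C^{(k)}_K+1)$; ties are resolved by choosing the smallest minimizing tree with respect to an arbitrary but fixed total order on $\mathcal{T}$. With $G_{t,k}$ the event that $a_k$ is classified using $t$, the number of comparisons in the partitioning stage is $$P_n=\sum_{k=1}^{n-K}\sum_{t\in\mathcal{T}}\sum_{i=0}^K \mathbf{1}_{G_{t,k}}\mathbf{1}_{\{a_k\in S_i\}}h_t(i)+R_K,$$ where $R_K\le K^2$ is the number of comparisons used to sort the $K$ pivots by a fixed elementary sorting algorithm. Number of key comparisons. For $0\le n\le K$, $X_n$ is the number of comparisons a fixed elementary sorting algorithm uses on $n$ elements in uniformly random order (at most $K^2$). For $n>K$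 the distribution of $X_n$ is given recursively by $$X_n\stackrel{d}{=}\sum_{i=0}^K X^{(i)}_{I_i^{(n)}}+P_n,$$ where the $X^{(i)}_m$ are distributed as $X_m$, and the sequences $(X^{(i)}_m)_{m\ge0}$, $i=0,\dots,K$, are independent of each other and of $(I_0^{(n)},\dots,I_K^{(n)},P_n)$. Limit. $Z_K$ denotes a random variable whose distribution is the unique centered, square integrable probability measure on $\mathbb{R}$ such that $$Z_K\stackrel{d}{=}\sum_{i=0}^K\left(D_iZ_K^{(i)}+\alpha_KD_i\ln(D_i)\right)+l_{\mathrm{opt}}(D),$$ where $D,Z_K^{(0)},\dots,Z_K^{(K)}$ are independent and each $Z_K^{(i)}$ has the same distribution as $Z_K$. *)

theory Defs
  imports "HOL-Probability.Probability" "HOL-Library.Tree"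
    "HOL-Combinatorics.Multiset_Permutations"
begin

section \<open>Probability metrics\<close>

definition Lp_norm :: "real \<Rightarrow> 'a measure \<Rightarrow> ('a \<Rightarrow> real) \<Rightarrow> ennreal" where
  "Lp_norm p M f =
     (let J = \<integral>\<^sup>+ x. ennreal (\<bar>f x\<bar> powr p) \<partial>M
      in if J = \<infinity> then \<infinity> else ennreal (enn2real J powr (1 / p)))"

text \<open>Couplings are the joint laws of pairs \<open>(X, Y)\<close>, defined on an arbitrary common probability
  space, such that \<open>X\<close> has law \<open>\<mu>\<close> and \<open>Y\<close> has law \<open>\<nu>\<close>.\<close>

definition couplings :: "real measure \<Rightarrow> real measure \<Rightarrow> (real \<times> real) measure set" where
  "couplings \<mu> \<nu> = {\<pi>. prob_space \<pi> \<and> sets \<pi> = sets (borel \<Otimes>\<^sub>M borel) \<and>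
      distr \<pi> borel fst = \<mu> \<and> distr \<pi> borel snd = \<nu>}"

text \<open>The value is extended: a finite distance to a law with finite \<open>p\<close>-th absolute moment entails
  a finite \<open>p\<close>-th absolute moment.\<close>

definition lp_dist :: "real \<Rightarrow> real measure \<Rightarrow> real measure \<Rightarrow> ennreal" where
  "lp_dist p \<mu> \<nu> = (INF \<pi>\<in>couplings \<mu> \<nu>. Lp_norm p \<pi> (\<lambda>(x, y). x - y))"

definition ks_dist :: "real measure \<Rightarrow> real measure \<Rightarrow> real" where
  "ks_dist \<mu> \<nu> = (SUP x. \<bar>cdf \<mu> x - cdf \<nu> x\<bar>)"


section \<open>Comparison-based sorting of a fixed number of items\<close>

text \<open>A deterministic comparison-based algorithm on \<open>n\<close> items is a decision tree: \<open>Compare i j s t\<close>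
  makes one key comparison between items \<open>i\<close> and \<open>j\<close> and continues with \<open>s\<close> if item \<open>i\<close> is the
  smaller one and with \<open>t\<close> otherwise; \<open>Output is\<close> stops and lists the positions of the items in
  increasing order.\<close>

datatype sorter = Output "nat list" | Compare nat nat sorter sorter

primrec sorter_output :: "sorter \<Rightarrow> 'a::linorder list \<Rightarrow> nat list" where
  "sorter_output (Output is) xs = is"
| "sorter_output (Compare i j s t) xs =
     (if xs ! i < xs ! j then sorter_output s xs else sorter_output t xs)"

primrec comparisons :: "sorter \<Rightarrow> 'a::linorder list \<Rightarrow> nat" where
  "comparisons (Output is) xs = 0"
| "comparisons (Compare i j s t) xs =
     Suc (if xs ! i < xs ! j then comparisons s xs else comparisons t xs)"

primrec sorter_wf :: "nat \<Rightarrow> sorter \<Rightarrow> bool" where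
  "sorter_wf n (Output is) \<longleftrightarrow> mset is = mset [0..<n]"
| "sorter_wf n (Compare i j s t) \<longleftrightarrow> i < n \<and> j < n \<and> sorter_wf n s \<and> sorter_wf n t"

text \<open>Only the relative order of the items matters, so correctness is expressed on permutations.\<close>

definition sorts :: "nat \<Rightarrow> sorter \<Rightarrow> bool" where
  "sorts n s \<longleftrightarrow> sorter_wf n s \<and>
     (\<forall>xs\<in>permutations_of_set {..<n}. sorted (map (\<lambda>i. xs ! i) (sorter_output s xs)))"


section \<open>Classification trees\<close>

text \<open>The internal node \<open>p\<^sub>j\<close> is represented by its index \<open>j\<close>.\<close>

definition class_trees :: "nat \<Rightarrow> nat tree set" where
  "class_trees K = {t. bst t \<and> set_tree t = {1..K}}"

text \<open>Searching for the leaf \<open>S\<^sub>i\<close>, which lies between \<open>p\<^sub>i\<close> and \<open>p\<^sub>i\<^sub>+\<^sub>1\<close>, one goes left at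
  \<open>p\<^sub>j\<close> iff \<open>i < j\<close>.\<close>

fun leaf_depth :: "nat tree \<Rightarrow> nat \<Rightarrow> nat" where
  "leaf_depth Leaf i = 0"
| "leaf_depth (Node l j r) i = Suc (if i < j then leaf_depth l i else leaf_depth r i)"

definition tree_cost :: "nat \<Rightarrow> nat tree \<Rightarrow> (nat \<Rightarrow> real) \<Rightarrow> real" where
  "tree_cost K t x = (\<Sum>i\<le>K. x i * real (leaf_depth t i))"

definition opt_cost :: "nat \<Rightarrow> (nat \<Rightarrow> real) \<Rightarrow> real" where
  "opt_cost K x = Min ((\<lambda>t. tree_cost K t x) ` class_trees K)"

definition optimal_trees :: "nat \<Rightarrow> (nat \<Rightarrow> real) \<Rightarrow> nat tree set" where
  "optimal_trees K x = {t \<in> class_trees K. \<forall>s\<in>class_trees K. tree_cost K t x \<le> tree_cost K s x}"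

definition selected_tree ::
    "nat \<Rightarrow> (nat tree \<times> nat tree) set \<Rightarrow> (nat \<Rightarrow> real) \<Rightarrow> nat tree \<Rightarrow> bool" where
  "selected_tree K r x t \<longleftrightarrow> t \<in> optimal_trees K x \<and> (\<forall>s\<in>optimal_trees K x. (t, s) \<in> r)"

lemma class_trees_size: "size t = K" if "t \<in> class_trees K"
proof -
  have "size t = card (set_tree t)" if "bst t" for t :: "nat tree"
    using that
  proof (induction t)
    case (Node l a r)
    have "set_tree l \<inter> set_tree r = {}" "a \<notin> set_tree l \<union> set_tree r"
      using Node.prems by fastforce+
    with Node show ?case
      by (simp add: card_Un_disjoint)
  qed simp
  with that show ?thesis
    by (simp add: class_trees_def)
qed

lemma finite_class_trees: "finite (class_trees K)"
proof -
  have *: "finite {t :: nat tree. set_tree t \<subseteq> {1..K} \<and> size t \<le> n}" for n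
  proof (induction n)
    case (Suc n)
    let ?F = "{t :: nat tree. set_tree t \<subseteq> {1..K} \<and> size t \<le> n}"
    have "{t :: nat tree. set_tree t \<subseteq> {1..K} \<and> size t \<le> Suc n}
            \<subseteq> insert Leaf ((\<lambda>(l, a, r). Node l a r) ` (?F \<times> {1..K} \<times> ?F))"
    proof
      fix t :: "nat tree"
      assume "t \<in> {t. set_tree t \<subseteq> {1..K} \<and> size t \<le> Suc n}"
      then show "t \<in> insert Leaf ((\<lambda>(l, a, r). Node l a r) ` (?F \<times> {1..K} \<times> ?F))"
        by (cases t) (auto simp: image_iff)
    qed
    then show ?case
      by (rule finite_subset) (use Suc.IH in auto)
  qed simp
  have "class_trees K \<subseteq> {t. set_tree t \<subseteq> {1..K} \<and> size t \<le> K}"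
    using class_trees_size by (fastforce simp: class_trees_def)
  then show ?thesis
    by (rule finite_subset) (rule *)
qed

lemma class_trees_nonempty: "class_trees K \<noteq> {}"
proof -
  have "\<exists>t. t \<in> class_trees K"
  proof (induction K)
    case 0
    then show ?case
      by (intro exI[of _ Leaf]) (simp add: class_trees_def)
  next
    case (Suc K)
    then obtain t where "t \<in> class_trees K"
      by blast
    then show ?case
      by (intro exI[of _ "Node t (Suc K) Leaf"]) (auto simp: class_trees_def)
  qed
  then show ?thesis
    by blast
qed


section \<open>Partitioning\<close>

text \<open>The pivots are \<open>v 1, \<dots>, v K\<close> and the remaining items are \<open>a 1, a 2, \<dots>\<close>.
  Conventions: \<open>p\<^sub>0 = 0\<close> and \<open>p\<^sub>K\<^sub>+\<^sub>1 = 1\<close>.\<close>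

definition pivot :: "nat \<Rightarrow> (nat \<Rightarrow> real) \<Rightarrow> nat \<Rightarrow> real" where
  "pivot K v j =
     (if j = 0 then 0 else if j \<le> K then sort (map v [1..<Suc K]) ! (j - 1) else 1)"

definition spacing :: "nat \<Rightarrow> (nat \<Rightarrow> real) \<Rightarrow> nat \<Rightarrow> real" where
  "spacing K v i = pivot K v (Suc i) - pivot K v i"

definition class_interval :: "nat \<Rightarrow> (nat \<Rightarrow> real) \<Rightarrow> nat \<Rightarrow> real set" where
  "class_interval K v i = {pivot K v i <..< pivot K v (Suc i)}"

definition class_count :: "nat \<Rightarrow> (nat \<Rightarrow> real) \<Rightarrow> (nat \<Rightarrow> real) \<Rightarrow> nat \<Rightarrow> nat \<Rightarrow> nat" where
  "class_count K v a m i = card {k \<in> {1..m}. a k \<in> class_interval K v i}"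

definition sublist_size :: "nat \<Rightarrow> nat \<Rightarrow> (nat \<Rightarrow> real) \<Rightarrow> (nat \<Rightarrow> real) \<Rightarrow> nat \<Rightarrow> nat" where
  "sublist_size K n v a i = class_count K v a (n - K) i"

definition partition_cost ::
    "nat \<Rightarrow> (nat tree \<times> nat tree) set \<Rightarrow> sorter \<Rightarrow> nat \<Rightarrow> (nat \<Rightarrow> real) \<Rightarrow> (nat \<Rightarrow> real) \<Rightarrow> real" where
  "partition_cost K r s n v a =
     (\<Sum>k=1..n - K. \<Sum>t\<in>class_trees K. \<Sum>i\<le>K.
        of_bool (selected_tree K r (\<lambda>i. real (class_count K v a (k - 1) i) + 1) t)
        * of_bool (a k \<in> class_interval K v i) * real (leaf_depth t i))
     + real (comparisons s (map v [1..<Suc K]))"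


text \<open>The vector \<open>(I\<^sub>0, \<dots>, I\<^sub>K, P)\<close>, with index \<open>K + 1\<close> (and above) for the last entry.\<close>

definition partition_vector ::
    "nat \<Rightarrow> (nat tree \<times> nat tree) set \<Rightarrow> sorter \<Rightarrow> nat \<Rightarrow> (nat \<Rightarrow> real) \<Rightarrow> (nat \<Rightarrow> real) \<Rightarrow> nat \<Rightarrow> real" where
  "partition_vector K r s n v a i =
     (if i \<le> K then real (sublist_size K n v a i) else partition_cost K r s n v a)"


section \<open>The number of key comparisons\<close>

abbreviation unif01 :: "real measure" where
  "unif01 \<equiv> uniform_measure lborel {0..1}"

text \<open>\<open>r\<close> is the order that resolves ties between trees, \<open>s\<close> sorts the pivots and \<open>b n\<close> sorts the
  short lists of length \<open>n \<le> K\<close>; \<open>Xc i m\<close> is the copy \<open>X\<^sub>m\<^sup>(\<^sup>i\<^sup>)\<close> of \<open>X m\<close>.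
  In \<open>indep\<close> the index \<open>None\<close> stands for \<open>(I\<^sub>0, \<dots>, I\<^sub>K, P\<^sub>n)\<close> and \<open>Some i\<close> for the
  sequence \<open>(X\<^sub>m\<^sup>(\<^sup>i\<^sup>))\<^sub>m\<close>.\<close>

locale optimal_quicksort = prob_space M for M :: "'a measure" +
  fixes K :: nat
    and r :: "(nat tree \<times> nat tree) set"
    and s :: sorter
    and b :: "nat \<Rightarrow> sorter"
    and V a :: "nat \<Rightarrow> 'a \<Rightarrow> real"
    and X :: "nat \<Rightarrow> 'a \<Rightarrow> real"
    and Xc :: "nat \<Rightarrow> nat \<Rightarrow> 'a \<Rightarrow> real"
  assumes tie_order: "linear_order_on (class_trees K) r"
    and pivot_sorter: "sorts K s"
    and pivot_sorter_le: "\<And>xs. xs \<in> permutations_of_set {..<K} \<Longrightarrow> comparisons s xs \<le> K\<^sup>2"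
    and base_sorter: "\<And>n. n \<le> K \<Longrightarrow> sorts n (b n)"
    and base_sorter_le:
      "\<And>n xs. n \<le> K \<Longrightarrow> xs \<in> permutations_of_set {..<n} \<Longrightarrow> comparisons (b n) xs \<le> K\<^sup>2"
    and V_uniform: "\<And>j. j \<in> {1..K} \<Longrightarrow> distr M borel (V j) = unif01"
    and a_uniform: "\<And>k. k \<ge> 1 \<Longrightarrow> distr M borel (a k) = unif01"
    and V_a_indep: "indep_vars (\<lambda>_. borel) (case_sum V a) ({1..K} <+> {1..})"
    and X_measurable: "\<And>n. X n \<in> borel_measurable M"
    and Xc_measurable: "\<And>i m. i \<le> K \<Longrightarrow> Xc i m \<in> borel_measurable M"
    and Xc_law: "\<And>i m. i \<le> K \<Longrightarrow> distr M borel (Xc i m) = distr M borel (X m)"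
    and indep: "\<And>n. n > K \<Longrightarrow>
      indep_vars (\<lambda>_. \<Pi>\<^sub>M m\<in>UNIV. borel)
        (case_option
          (\<lambda>\<omega>. partition_vector K r s n (\<lambda>j. V j \<omega>) (\<lambda>k. a k \<omega>))
          (\<lambda>i \<omega> m. Xc i m \<omega>))
        (insert None (Some ` {..K}))"
    and X_short: "\<And>n. n \<le> K \<Longrightarrow>
      distr M borel (X n) =
        distr (measure_pmf (pmf_of_set (permutations_of_set {..<n}))) borel
          (\<lambda>xs. real (comparisons (b n) xs))"
    and X_rec: "\<And>n. n > K \<Longrightarrow>
      distr M borel (X n) =
        distr M borel (\<lambda>\<omega>.
          (\<Sum>i\<le>K. Xc i (sublist_size K n (\<lambda>j. V j \<omega>) (\<lambda>k. a k \<omega>) i) \<omega>)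
          + partition_cost K r s n (\<lambda>j. V j \<omega>) (\<lambda>k. a k \<omega>))"


section \<open>The limit law\<close>

abbreviation pivot_measure :: "nat \<Rightarrow> (nat \<Rightarrow> real) measure" where
  "pivot_measure K \<equiv> (\<Pi>\<^sub>M j\<in>{1..K}. unif01)"

definition gamma_K :: "nat \<Rightarrow> real" where
  "gamma_K K = (\<integral>v. opt_cost K (spacing K v) \<partial>pivot_measure K)"

definition alpha_K :: "nat \<Rightarrow> real" where
  "alpha_K K = gamma_K K / (harm (K + 1) - 1)"

text \<open>Independence of \<open>D, Z\<^sup>(\<^sup>0\<^sup>), \<dots>, Z\<^sup>(\<^sup>K\<^sup>)\<close> is expressed by the product measure.\<close>

definition is_limit_law :: "nat \<Rightarrow> real measure \<Rightarrow> bool" where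
  "is_limit_law K \<zeta> \<longleftrightarrow>
     prob_space \<zeta> \<and> sets \<zeta> = sets borel \<and>
     integrable \<zeta> (\<lambda>x. x\<^sup>2) \<and> integrable \<zeta> (\<lambda>x. x) \<and> (\<integral>x. x \<partial>\<zeta>) = 0 \<and>
     \<zeta> = distr (pivot_measure K \<Otimes>\<^sub>M (\<Pi>\<^sub>M i\<in>{..K}. \<zeta>)) borel
           (\<lambda>(v, z).
              (\<Sum>i\<le>K. (spacing K v i * z i + alpha_K K * spacing K v i * ln (spacing K v i)))
              + opt_cost K (spacing K v))"

end

theory Submission
 imports Defs "HOL-Real_Asymp.Real_Asymp"
begin

text \<open>The recursion is solved on the level of couplings: \<open>X n\<close> and \<open>Z\<close> are constructed on one space by
feeding the same pivots and the pairs of the recursive calls into both distributional equations, so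
that \<open>X n - E (X n) - n Z\<close> equals the sum of the same quantities for the sublists plus a toll. The
toll is small because the sublist sizes and the cost of partitioning concentrate around \<open>n D\<close> and
\<open>n l_opt(D)\<close> at scale \<open>sqrt n\<close> (Hoeffding's lemma along the steps, with the regret of the selected
tree bounded by the fluctuation of the counters), and because \<open>E (X n) = alpha n ln n + c n + O(n^b)\<close> for
every \<open>b > 1/2\<close>. The last fact is the only place where \<open>K \<le> 4\<close> enters: the characteristic roots of the
linear recurrence for the means are then 1 and numbers with negative real part. Since the conditionally
independent summands are centered and \<open>E (sum D_i^s) < 1\<close> for \<open>s > 1\<close>, second moments, then all
moments, of the coupled difference are \<open>O(n^(1/2 + eps))\<close>; the finiteness of the moments of \<open>Z\<close> is read
off the coupling. For the Kolmogorov distance one needs that \<open>Z\<close> has a bounded density: given all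
but two pivots, the limiting toll is a minimum of finitely many strongly convex functions on convex
pieces, and a strongly convex function of two variables spends area \<open>O(h)\<close> in a window of length \<open>h\<close>.\<close>

section \<open>Pivots and spacings\<close>

text \<open>The recursion holds only in distribution and the sublist sizes are random, so no space
  carrying X_n and Z together is given. The coupling is therefore defined by recursion on n: every
  sublist owns an independent history of pairs for all smaller sizes, and the realised size selects
  one of them. Since the selected pairs are independent given the partitioning data, moments become
  iterated integrals over pairs, items and pivots.

  The loss \<epsilon> has one source. At scale n^\<tau> the recursion for p-th moments contracts
  only if \<tau> p > 1, and the induction over p has to start at p = 2, where centering removes the
  mixed terms; hence \<tau> > 1/2 strictly. The same margin absorbs the factor ln n that x ln x
  contributes to the toll.

  Moments of Z beyond the second are not part of its definition but enter the toll. The deviations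
  therefore carry a parameter c: c = 0 bounds the moments of the centered number of comparisons
  without using Z, c = 1 compares it with n Z, and both together bound the moments of Z.\<close>

lemma sorted_nth_le_iff:
 fixes xs :: "'a::linorder list"
 assumes "sorted xs" "i < length xs"
 shows "xs ! i \<le> c \<longleftrightarrow> i < length (filter (\<lambda>x. x \<le> c) xs)"
 using assms
proof (induction xs arbitrary: i)
 case (Cons x xs)
 show ?case
 proof (cases "x \<le> c")
  case True
  then show ?thesis using Cons by (cases i) auto
 next
  case False
  then have "\<forall>y\<in>set (x # xs). \<not> y \<le> c" using Cons.prems(1) by auto
  moreover have "(x # xs) ! i \<in> set (x # xs)" using Cons.prems(2) by (rule nth_mem)
  ultimately show ?thesis by (auto simp: filter_empty_conv)
 qed
qed simp

text \<open>An order statistic is at most c iff at least j samples are. This replaces sorting by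
  counting, which is how \<open>measurable_pivot\<close> is obtained.\<close>

lemma pivot_le_iff:
 assumes "j \<in> {1..K}"
 shows "pivot K v j \<le> c \<longleftrightarrow> j \<le> card {k \<in> {1..K}. v k \<le> c}"
proof -
 let ?xs = "sort (map v [1..<Suc K])"
 have "length (filter (\<lambda>x. x \<le> c) ?xs) = length (filter (\<lambda>x. x \<le> c) (map v [1..<Suc K]))"
  by (metis mset_filter mset_sort size_mset)
 also have "... = length (filter (\<lambda>k. v k \<le> c) [1..<Suc K])"
  by (simp add: filter_map o_def del: upt_Suc)
 also have "... = card {k \<in> {1..K}. v k \<le> c}"
  by (subst distinct_card[symmetric]) (auto intro!: arg_cong[where f = card])
 finally have "length (filter (\<lambda>x. x \<le> c) ?xs) = ..." .
 moreover have "?xs ! (j - 1) \<le> c \<longleftrightarrow> j - 1 < length (filter (\<lambda>x. x \<le> c) ?xs)"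
  by (rule sorted_nth_le_iff) (use assms in auto)
 ultimately show ?thesis using assms by (auto simp: pivot_def)
qed

lemma pivot_cong: "(\<And>j. j \<in> {1..K} ==> v j = v' j) ==> pivot K v i = pivot K v' i"
proof -
 assume "\<And>j. j \<in> {1..K} ==> v j = v' j"
 then have "map v [1..<Suc K] = map v' [1..<Suc K]" by (intro map_cong) auto
 then show ?thesis unfolding pivot_def by (simp only:)
qed

lemma pivot_0 [simp]: "pivot K v 0 = 0" and pivot_last [simp]: "pivot K v (Suc K) = 1"
 by (simp_all add: pivot_def)

lemma sum_spacing: "(\<Sum>i\<le>K. spacing K v i) = 1"
 unfolding spacing_def using sum_lessThan_telescope[of "pivot K v" "Suc K"]
 by (simp add: lessThan_Suc_atMost)

text \<open>An almost sure event (\<open>AE_generic_pivots\<close>) on which all pointwise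
  statements about intervals, spacings and counts are proved; off it, intervals may be empty and
  spacings may vanish.\<close>

definition generic_pivots :: "nat \<Rightarrow> (nat \<Rightarrow> real) \<Rightarrow> bool" where
 "generic_pivots K v \<longleftrightarrow> inj_on v {1..K} \<and> (\<forall>j\<in>{1..K}. v j \<in> {0<..<1})"

text \<open>Distinctness lets each sorted value be traced back to exactly one index, which gives the
  sorting permutation. It turns sums over order statistics into sums over the independent pivots,
  and it labels the pieces into which the pivot cube is cut for the density bound.\<close>

lemma pivot_order:
 assumes "generic_pivots K v"
 obtains \<sigma> where "bij_betw \<sigma> {1..K} {1..K}" "strict_mono_on {1..K} (v \<circ> \<sigma>)"
  "\<And>j. j \<in> {1..K} ==> pivot K v j = v (\<sigma> j)"
proof -
 note upt_Suc [simp del]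
 let ?xs = "sort (map v [1..<Suc K])"
 have inj: "inj_on v {1..K}" using assms by (simp add: generic_pivots_def)
 have set: "set ?xs = v ` {1..K}" by auto
 have dist: "distinct ?xs" using inj by (simp add: distinct_map atLeastLessThanSuc_atLeastAtMost del: upt_Suc)
 have len: "length ?xs = K" by simp
 define \<sigma> where "\<sigma> j = inv_into {1..K} v (?xs ! (j - 1))" for j
 have mem: "?xs ! (j - 1) \<in> v ` {1..K}" if "j \<in> {1..K}" for j
  unfolding set[symmetric] by (rule nth_mem) (use that len in auto)
 have v\<sigma>: "v (\<sigma> j) = ?xs ! (j - 1)" and \<sigma>_in: "\<sigma> j \<in> {1..K}" if "j \<in> {1..K}" for j
  unfolding \<sigma>_def using f_inv_into_f[OF mem[OF that]] inv_into_into[OF mem[OF that]] by blast+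
 have mono: "strict_mono_on {1..K} (v \<circ> \<sigma>)"
 proof (rule strict_mono_onI)
  fix i j assume ij: "i \<in> {1..K}" "j \<in> {1..K}" "i < j"
  have "?xs ! (i - 1) \<le> ?xs ! (j - 1)"
   by (rule sorted_nth_mono) (use ij len in auto)
  moreover have "?xs ! (i - 1) \<noteq> ?xs ! (j - 1)"
   using dist len ij by (subst nth_eq_iff_index_eq) auto
  ultimately show "(v \<circ> \<sigma>) i < (v \<circ> \<sigma>) j" using ij v\<sigma> by simp
 qed
 have "inj_on \<sigma> {1..K}"
  using strict_mono_on_imp_inj_on[OF mono] by (rule inj_on_imageI2)
 moreover have "\<sigma> ` {1..K} \<subseteq> {1..K}" using \<sigma>_in by auto
 ultimately have "bij_betw \<sigma> {1..K} {1..K}"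
  unfolding bij_betw_def using endo_inj_surj[of "{1..K}" \<sigma>] by blast
 then show ?thesis
  by (rule that[OF _ mono]) (simp add: v\<sigma> pivot_def)
qed

lemma
 assumes "generic_pivots K v"
 shows pivot_in_image: "j \<in> {1..K} ==> pivot K v j \<in> v ` {1..K}"
  and image_in_pivot: "j \<in> {1..K} ==> v j \<in> pivot K v ` {1..K}"
  and pivot_strict_mono: "strict_mono_on {..Suc K} (pivot K v)"
proof -
 obtain \<sigma> where \<sigma>: "bij_betw \<sigma> {1..K} {1..K}" "strict_mono_on {1..K} (v \<circ> \<sigma>)"
   "\<And>j. j \<in> {1..K} ==> pivot K v j = v (\<sigma> j)"
  using pivot_order[OF assms] by blast
 show im: "pivot K v j \<in> v ` {1..K}" if "j \<in> {1..K}" for j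
  using \<sigma>(3)[OF that] bij_betwE[OF \<sigma>(1)] that by (metis imageI)
 show "v j \<in> pivot K v ` {1..K}" if "j \<in> {1..K}"
 proof -
  have "j \<in> \<sigma> ` {1..K}" using that \<sigma>(1) by (simp add: bij_betw_def)
  then obtain i where "i \<in> {1..K}" "j = \<sigma> i" by (rule imageE)
  then show ?thesis using \<sigma>(3)[of i] by (metis imageI)
 qed
 have in01: "pivot K v j \<in> {0<..<1}" if "j \<in> {1..K}" for j
  using im[OF that] assms by (auto simp: generic_pivots_def)
 show "strict_mono_on {..Suc K} (pivot K v)"
 proof (rule strict_mono_onI)
  fix i j assume ij: "i \<in> {..Suc K}" "j \<in> {..Suc K}" "i < j"
  show "pivot K v i < pivot K v j"
  proof (cases "i = 0 \<or> j = Suc K")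
   case True
   then show ?thesis
    using ij in01[of i] in01[of j] by (cases "i = 0"; cases "j = Suc K") auto
  next
   case False
   then have "i \<in> {1..K}" "j \<in> {1..K}" using ij by auto
   then show ?thesis using \<sigma>(3)[of i] \<sigma>(3)[of j] strict_mono_onD[OF \<sigma>(2), of i j] ij(3) by simp
  qed
 qed
qed

lemma pivot_bounds:
 assumes "generic_pivots K v" "j \<le> Suc K"
 shows "0 \<le> pivot K v j" "pivot K v j \<le> 1"
 using strict_mono_onD[OF pivot_strict_mono[OF assms(1)], of 0 j]
  strict_mono_onD[OF pivot_strict_mono[OF assms(1)], of j "Suc K"] assms(2)
 by (cases "j = 0"; cases "j = Suc K"; simp)+

lemma spacing_pos: "generic_pivots K v ==> i \<le> K ==> 0 < spacing K v i"
 unfolding spacing_def using strict_mono_onD[OF pivot_strict_mono, of K v i "Suc i"] by auto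

lemma spacing_le_1: "generic_pivots K v ==> i \<le> K ==> spacing K v i \<le> 1"
 unfolding spacing_def using pivot_bounds(2)[of K v "Suc i"] pivot_bounds(1)[of K v i] by auto

lemma class_interval_disjoint:
 assumes "generic_pivots K v" "i \<le> K" "j \<le> K" "i \<noteq> j"
 shows "class_interval K v i \<inter> class_interval K v j = {}"
proof -
 have *: "class_interval K v i \<inter> class_interval K v j = {}" if "i < j" "j \<le> K" for i j
 proof -
  have "pivot K v (Suc i) \<le> pivot K v j"
   using strict_mono_onD[OF pivot_strict_mono[OF assms(1)], of "Suc i" j] that
   by (cases "Suc i = j") auto
  then show ?thesis by (auto simp: class_interval_def)
 qed
 show ?thesis using *[of i j] *[of j i] assms by (cases "i < j") auto
qed

text \<open>The interval that contains u starts at the last pivot below u; the convention that pivot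
  0 is the point 0 guarantees that one exists.\<close>

lemma class_interval_cover:
 assumes "generic_pivots K v" "u \<in> {0<..<1}" "u \<notin> v ` {1..K}"
 shows "\<exists>i\<le>K. u \<in> class_interval K v i"
proof -
 define i where "i = Max {j\<in>{..K}. pivot K v j < u}"
 have "i \<in> {j\<in>{..K}. pivot K v j < u}" unfolding i_def
  by (rule Max_in) (use assms in \<open>auto intro!: exI[of _ 0]\<close>)
 moreover have "u < pivot K v (Suc i)"
 proof (cases "i = K")
  case True then show ?thesis using assms by simp
 next
  case False
  then have "Suc i \<le> K" using calculation by auto
  then have "\<not> pivot K v (Suc i) < u"
   using Max_ge[of "{j\<in>{..K}. pivot K v j < u}" "Suc i"] unfolding i_def[symmetric] by fastforce
  moreover have "pivot K v (Suc i) \<noteq> u"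
   using pivot_in_image[OF assms(1), of "Suc i"] \<open>Suc i \<le> K\<close> assms(3) by auto
  ultimately show ?thesis by simp
 qed
 ultimately show ?thesis by (auto simp: class_interval_def)
qed

lemma sum_of_bool_class:
 assumes "generic_pivots K v" "u \<in> class_interval K v i" "i \<le> K"
 shows "(\<Sum>j\<le>K. of_bool (u \<in> class_interval K v j) * f j) = (f i :: real)"
proof -
 have "of_bool (u \<in> class_interval K v j) * f j = (if j = i then f j else 0)" if "j \<le> K" for j
  using class_interval_disjoint[OF assms(1) that assms(3)] assms(2) by auto
 then have "(\<Sum>j\<le>K. of_bool (u \<in> class_interval K v j) * f j) = (\<Sum>j\<le>K. if j = i then f j else 0)"
  by (intro sum.cong) auto
 then show ?thesis using assms(3) by simp
qed

section \<open>Measurability of pivots, spacings and counts\<close>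

lemma measurable_pivot [measurable]:
 assumes [measurable]: "\<And>j. j \<in> {1..K} ==> (\<lambda>x. v x j) \<in> borel_measurable M"
 shows "(\<lambda>x. pivot K (v x) j) \<in> borel_measurable M"
proof (cases "j \<in> {1..K}")
 case True
 show ?thesis
 proof (rule borel_measurableI_le)
  fix c
  have "{x \<in> space M. pivot K (v x) j \<le> c}
    = {x \<in> space M. real j \<le> (\<Sum>k\<in>{1..K}. of_bool (v x k \<le> c))}"
   by (simp add: pivot_le_iff[OF True] sum_of_bool_eq Int_def flip: of_nat_sum)
  also have "... \<in> sets M" by measurable
  finally show "{x \<in> space M. pivot K (v x) j \<le> c} \<in> sets M" .
 qed
next
 case False
 then have "(\<lambda>x. pivot K (v x) j) = (\<lambda>_. if j = 0 then 0 else 1)"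
  by (auto simp: pivot_def fun_eq_iff)
 then show ?thesis by simp
qed

lemma measurable_spacing [measurable]:
 assumes [measurable]: "\<And>j. j \<in> {1..K} ==> (\<lambda>x. v x j) \<in> borel_measurable M"
 shows "(\<lambda>x. spacing K (v x) i) \<in> borel_measurable M"
 unfolding spacing_def by measurable

lemma class_count_sum:
 "real (class_count K v a m i) = (\<Sum>k=1..m. of_bool (a k \<in> class_interval K v i))"
 by (simp add: class_count_def sum_of_bool_eq Int_def)

lemma pred_class_interval [measurable]:
 assumes [measurable]: "\<And>j. j \<in> {1..K} ==> (\<lambda>x. v x j) \<in> borel_measurable M"
  "u \<in> borel_measurable M"
 shows "Measurable.pred M (\<lambda>x. u x \<in> class_interval K (v x) i)"
 unfolding class_interval_def by simp

lemma measurable_class_count [measurable]: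
 assumes [measurable]: "\<And>j. j \<in> {1..K} ==> (\<lambda>x. v x j) \<in> borel_measurable M"
  "\<And>k. k \<in> {1..m} ==> (\<lambda>x. a x k) \<in> borel_measurable M"
 shows "(\<lambda>x. class_count K (v x) (a x) m i) \<in> measurable M (count_space UNIV)"
proof -
 have "(\<lambda>x. real (class_count K (v x) (a x) m i)) \<in> borel_measurable M"
  unfolding class_count_sum by measurable
 then have "(\<lambda>x. nat \<lfloor>real (class_count K (v x) (a x) m i)\<rfloor>) \<in> measurable M (count_space UNIV)"
  by measurable
 then show ?thesis by simp
qed

lemma class_count_le: "class_count K v a m i \<le> m"
proof -
 have "class_count K v a m i \<le> card {1..m}" unfolding class_count_def by (rule card_mono) auto
 then show ?thesis by simp
qed

lemma sum_class_count:
 assumes "generic_pivots K v" "\<And>k. k \<in> {1..m} ==> a k \<in> {0<..<1} - v ` {1..K}"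
 shows "(\<Sum>i\<le>K. class_count K v a m i) = m"
proof -
 have "(\<Sum>i\<le>K. real (class_count K v a m i)) = (\<Sum>k=1..m. \<Sum>i\<le>K. of_bool (a k \<in> class_interval K v i))"
  unfolding class_count_sum by (rule sum.swap)
 also have "... = (\<Sum>k=1..m. 1)"
 proof (rule sum.cong)
  fix k assume "k \<in> {1..m}"
  then obtain i where "i \<le> K" "a k \<in> class_interval K v i"
   using class_interval_cover[OF assms(1), of "a k"] assms(2)[of k] by auto
  then show "(\<Sum>i\<le>K. of_bool (a k \<in> class_interval K v i)) = (1::real)"
   using sum_of_bool_class[OF assms(1), of "a k" i "\<lambda>_. 1"] by simp
 qed simp
 also have "... = real m" by simp
 finally show ?thesis by (simp only: of_nat_sum[symmetric] of_nat_eq_iff)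
qed

lemma class_count_cong:
 "(\<And>j. j \<in> {1..K} ==> v j = v' j) ==> (\<And>k. k \<in> {1..m} ==> a k = a' k) ==>
  class_count K v a m i = class_count K v' a' m i"
proof -
 assume *: "\<And>j. j \<in> {1..K} ==> v j = v' j" "\<And>k. k \<in> {1..m} ==> a k = a' k"
 have "pivot K v = pivot K v'" using pivot_cong[of K v v'] *(1) by blast
 then show ?thesis unfolding class_count_def class_interval_def using *(2)
  by (intro arg_cong[where f = card]) auto
qed

section \<open>Classification trees\<close>

lemma leaf_depth_le_size: "leaf_depth t i \<le> size t"
 by (induction t) (auto intro: le_trans)

lemma leaf_depth_le: "t \<in> class_trees K ==> leaf_depth t i \<le> K"
 using leaf_depth_le_size[of t i] class_trees_size by simp

lemma leaf_depth_ge_1: "t \<in> class_trees K ==> K \<ge> 1 ==> 1 \<le> leaf_depth t i"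
 by (cases t) (auto simp: class_trees_def)

lemma opt_cost_le: "t \<in> class_trees K ==> opt_cost K x \<le> tree_cost K t x"
 unfolding opt_cost_def by (intro Min_le) (auto simp: finite_class_trees)

lemma opt_cost_attained: obtains t where "t \<in> class_trees K" "opt_cost K x = tree_cost K t x"
proof -
 have "opt_cost K x \<in> (\<lambda>t. tree_cost K t x) ` class_trees K"
  unfolding opt_cost_def by (intro Min_in) (auto simp: finite_class_trees class_trees_nonempty)
 then show ?thesis using that by auto
qed

lemma measurable_tree_cost [measurable]:
 assumes [measurable]: "\<And>i. i \<le> K ==> (\<lambda>x. f x i) \<in> borel_measurable M"
 shows "(\<lambda>x. tree_cost K t (f x)) \<in> borel_measurable M"
 unfolding tree_cost_def by measurable

lemma measurable_opt_cost [measurable]: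
 assumes [measurable]: "\<And>i. i \<le> K ==> (\<lambda>x. f x i) \<in> borel_measurable M"
 shows "(\<lambda>x. opt_cost K (f x)) \<in> borel_measurable M"
proof -
 have "(\<lambda>x. Min ((\<lambda>t. tree_cost K t (f x)) ` class_trees K)) \<in> borel_measurable M"
  by (rule borel_measurable_Min[OF finite_class_trees]) measurable
 then show ?thesis by (simp add: opt_cost_def)
qed

lemma opt_cost_spacing_bounds:
 assumes "generic_pivots K v" "K \<ge> 1"
 shows "1 \<le> opt_cost K (spacing K v)" "opt_cost K (spacing K v) \<le> real K"
proof -
 obtain t where t: "t \<in> class_trees K" "opt_cost K (spacing K v) = tree_cost K t (spacing K v)"
  by (rule opt_cost_attained)
 have "(\<Sum>i\<le>K. spacing K v i * 1) \<le> tree_cost K t (spacing K v)"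
  unfolding tree_cost_def using leaf_depth_ge_1[OF t(1) assms(2)] spacing_pos[OF assms(1)]
  by (intro sum_mono mult_left_mono) (auto intro: less_imp_le)
 then show "1 \<le> opt_cost K (spacing K v)" using t by (simp add: sum_spacing)
 have "tree_cost K t (spacing K v) \<le> (\<Sum>i\<le>K. spacing K v i * real K)"
  unfolding tree_cost_def using leaf_depth_le[OF t(1)] spacing_pos[OF assms(1)]
  by (intro sum_mono mult_left_mono) (auto intro: less_imp_le)
 then show "opt_cost K (spacing K v) \<le> real K"
  using t by (simp add: sum_spacing flip: sum_distrib_right)
qed

lemma selected_tree_in: "selected_tree K r x t ==> t \<in> class_trees K"
 by (simp add: selected_tree_def optimal_trees_def)

lemma selected_tree_opt: "selected_tree K r x t ==> tree_cost K t x = opt_cost K x"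
proof -
 assume t: "selected_tree K r x t"
 obtain u where "u \<in> class_trees K" "opt_cost K x = tree_cost K u x"
  by (rule opt_cost_attained)
 moreover from t have "t \<in> class_trees K" "\<forall>s\<in>class_trees K. tree_cost K t x \<le> tree_cost K s x"
  by (auto simp: selected_tree_def optimal_trees_def)
 ultimately show ?thesis using opt_cost_le[of t K x] by fastforce
qed

lemma selected_tree_exists:
 assumes "linear_order_on (class_trees K) r"
 shows "\<exists>!t. selected_tree K r x t"
proof -
 have fin: "finite (optimal_trees K x)"
  by (rule finite_subset[OF _ finite_class_trees[of K]]) (auto simp: optimal_trees_def)
 obtain t where "t \<in> class_trees K" "opt_cost K x = tree_cost K t x"
  by (rule opt_cost_attained)
 then have "t \<in> optimal_trees K x"
  using opt_cost_le[of _ K x] by (auto simp: optimal_trees_def)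
 then have ne: "optimal_trees K x \<noteq> {}" by blast
 have sub: "optimal_trees K x \<subseteq> class_trees K" by (auto simp: optimal_trees_def)
 have r: "refl_on (class_trees K) r" "trans r" "antisym r" "total_on (class_trees K) r"
  using assms by (auto simp: order_on_defs)
 have "\<exists>t\<in>S. \<forall>s\<in>S. (t, s) \<in> r" if "finite S" "S \<noteq> {}" "S \<subseteq> class_trees K" for S
  using that
 proof (induction S rule: finite_ne_induct)
  case (singleton y)
  then show ?case using r(1) by (auto simp: refl_on_def)
 next
  case (insert y F)
  then obtain t where t: "t \<in> F" "\<forall>s\<in>F. (t, s) \<in> r" by auto
  have "(t, y) \<in> r \<or> (y, t) \<in> r"
   using r(4) insert.prems t(1) insert.hyps by (auto simp: total_on_def)
  then show ?case
  proof
   assume "(t, y) \<in> r"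
   then show ?thesis using t by (intro bexI[of _ t]) auto
  next
   assume "(y, t) \<in> r"
   then have "\<forall>s\<in>F. (y, s) \<in> r" using t r(2) by (meson transD)
   moreover have "(y, y) \<in> r" using r(1) insert.prems by (auto simp: refl_on_def)
   ultimately show ?thesis by (intro bexI[of _ y]) auto
  qed
 qed
 from this[OF fin ne sub] obtain t where "t \<in> optimal_trees K x" "\<forall>s\<in>optimal_trees K x. (t, s) \<in> r"
  by blast
 then show ?thesis
  using r(3) by (intro ex1I[of _ t]) (auto simp: selected_tree_def antisym_def)
qed

section \<open>A linear recurrence\<close>

text \<open>The mean of e(min A) over a uniformly random k-subset A of {0..<n}: the weight of j
  counts the subsets with minimum j. For k = K this is the mean of e at the size of one sublist. The
  value \<open>e n\<close> at k = 0 is what makes the recurrence in k start correctly.\<close>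

definition window_avg :: "(nat \<Rightarrow> real) \<Rightarrow> nat \<Rightarrow> nat \<Rightarrow> real" where
 "window_avg e k n = (if k = 0 then e n
   else (\<Sum>j<n. real ((n - 1 - j) choose (k - 1)) * e j) / real (n choose k))"

lemma window_sum_Suc:
 assumes "k \<ge> 1"
 shows "(\<Sum>j<Suc n. real ((n - j) choose k) * e j)
  = (\<Sum>j<n. real ((n - 1 - j) choose k) * e j) + (\<Sum>j<n. real ((n - 1 - j) choose (k - 1)) * (e j :: real))"
proof -
 obtain k' where k: "k = Suc k'" using assms by (cases k) auto
 have "(n - j) choose k = ((n - 1 - j) choose k) + ((n - 1 - j) choose (k - 1))" if "j < n" for j
 proof -
  have "n - j = Suc (n - 1 - j)" using that by simp
  then show ?thesis by (metis k add.commute binomial_Suc_Suc diff_Suc_1)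
 qed
 then have "(\<Sum>j<n. real ((n - j) choose k) * e j)
  = (\<Sum>j<n. real ((n - 1 - j) choose k) * e j + real ((n - 1 - j) choose (k - 1)) * e j)"
  by (intro sum.cong) (simp_all add: algebra_simps)
 then show ?thesis using k by (simp add: sum.distrib)
qed

text \<open>Pascal's rule for the weights together with k C(n+1, k) = (n+1) C(n, k-1). The averages
  for k = 1..K thus form a first-order linear system, fed at k = 1 by e itself; the recursion for
  the means expresses e through the K-th average and so closes the system.\<close>

lemma window_avg_Suc:
 assumes "1 \<le> k" "k \<le> n"
 shows "real (n + 1) * window_avg e k (n + 1) = (real (n + 1) - real k) * window_avg e k n + real k * window_avg e (k - 1) n"
proof -
 define S where "S k n = (\<Sum>j<n. real ((n - 1 - j) choose (k - 1)) * e j)" for k n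
 have S_avg: "S k n = real (n choose k) * window_avg e k n" if "1 \<le> k" "k \<le> n" for k n
  using that by (simp add: window_avg_def S_def)
 have rec: "S k (n + 1) = S k n + (if k = 1 then e n else S (k - 1) n)"
 proof (cases "k = 1")
  case False
  then show ?thesis using window_sum_Suc[of "k - 1" n e] assms by (simp add: S_def)
 qed (simp add: S_def)
 also have "(if k = 1 then e n else S (k - 1) n) = real (n choose (k - 1)) * window_avg e (k - 1) n"
  using S_avg[of "k - 1" n] assms by (auto simp: window_avg_def)
 finally have 1: "real ((n + 1) choose k) * window_avg e k (n + 1)
  = real (n choose k) * window_avg e k n + real (n choose (k - 1)) * window_avg e (k - 1) n"
  using S_avg[of k n] S_avg[of k "n + 1"] assms by simp
 obtain k' where k: "k = Suc k'" using assms by (cases k) auto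
 have "Suc k' * (Suc n choose Suc k') = Suc n * (n choose k')"
  by (rule Suc_times_binomial)
 then have a: "real k * real ((n + 1) choose k) = real (n + 1) * real (n choose (k - 1))"
  unfolding k by (metis Suc_eq_plus1 diff_Suc_1 of_nat_mult)
 have b: "real ((n + 1) choose k) = real (n choose k) + real (n choose (k - 1))"
  unfolding k by simp
 have c: "real k * real (n choose k) = (real (n + 1) - real k) * real (n choose (k - 1))"
  using a b by (simp add: algebra_simps)
 define B where "B = real (n choose (k - 1))"
 have B: "B > 0" unfolding B_def using assms by simp
 have k0: "real k > 0" using assms by simp
 have "real k * (real ((n + 1) choose k) * window_avg e k (n + 1))
  = real k * (real (n choose k) * window_avg e k n) + real k * (B * window_avg e (k - 1) n)"
  using 1 by (simp add: B_def algebra_simps)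
 then have "(real k * real ((n + 1) choose k)) * window_avg e k (n + 1)
  = (real k * real (n choose k)) * window_avg e k n + real k * B * window_avg e (k - 1) n"
  by (simp only: mult.assoc)
 then have "B * (real (n + 1) * window_avg e k (n + 1))
  = B * ((real (n + 1) - real k) * window_avg e k n + real k * window_avg e (k - 1) n)"
  unfolding a c B_def[symmetric] by (simp only: distrib_left mult.assoc mult.commute mult.left_commute)
 then show ?thesis using B by simp
qed

text \<open>The coefficient of n ln n is explicit, that of n is only asserted to exist: it depends
  on all values of the sequence, and in the toll it cancels up to a bounded term because the sublist
  sizes add up to n - K.\<close>

definition log_linear :: "real \<Rightarrow> real \<Rightarrow> (nat \<Rightarrow> real) \<Rightarrow> bool" where
 "log_linear \<beta> \<alpha> f \<longleftrightarrow> (\<exists>c C. \<forall>n\<ge>1. \<bar>f n - \<alpha> * real n * ln (real n) - c * real n\<bar> \<le> C * real n powr \<beta>)"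

lemma log_linear_eventuallyI:
 assumes "\<And>n. n \<ge> m ==> \<bar>f n - \<alpha> * real n * ln (real n) - c * real n\<bar> \<le> C * real n powr \<beta>"
  and "\<beta> \<ge> 0"
 shows "log_linear \<beta> \<alpha> f"
proof -
 define g where "g n = \<bar>f n - \<alpha> * real n * ln (real n) - c * real n\<bar>" for n
 define C' where "C' = \<bar>C\<bar> + (\<Sum>n<m. g n)"
 have g: "g n \<ge> 0" for n by (simp add: g_def)
 have "g n \<le> C' * real n powr \<beta>" if "n \<ge> 1" for n
 proof (cases "n \<ge> m")
  case True
  have "g n \<le> C * real n powr \<beta>" using assms(1)[OF True] by (simp add: g_def)
  also have "... \<le> C' * real n powr \<beta>"
   unfolding C'_def using sum_nonneg[of "{..<m}" g] g by (intro mult_right_mono) auto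
  finally show ?thesis .
 next
  case False
  then have "g n \<le> (\<Sum>n<m. g n)" by (intro member_le_sum) (auto simp: g)
  also have "... \<le> C'" by (simp add: C'_def)
  also have "C' * 1 \<le> C' * real n powr \<beta>"
   using that assms(2) g by (intro mult_left_mono ge_one_powr_ge_zero) (auto simp: C'_def intro!: add_nonneg_nonneg sum_nonneg)
  finally show ?thesis by simp
 qed
 then show ?thesis unfolding log_linear_def g_def by blast
qed

lemma log_linear_add: "log_linear \<beta> \<alpha> f ==> log_linear \<beta> \<alpha>' g ==> log_linear \<beta> (\<alpha> + \<alpha>') (\<lambda>n. f n + g n)"
 unfolding log_linear_def
proof safe
 fix c C c' C'
 assume 1: "\<forall>n\<ge>1. \<bar>f n - \<alpha> * real n * ln (real n) - c * real n\<bar> \<le> C * real n powr \<beta>"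
  and 2: "\<forall>n\<ge>1. \<bar>g n - \<alpha>' * real n * ln (real n) - c' * real n\<bar> \<le> C' * real n powr \<beta>"
 have "\<bar>f n + g n - (\<alpha> + \<alpha>') * real n * ln (real n) - (c + c') * real n\<bar> \<le> (C + C') * real n powr \<beta>" if "n \<ge> 1" for n
  using 1[rule_format, OF that] 2[rule_format, OF that] by (simp add: algebra_simps)
 then show "\<exists>c C. \<forall>n\<ge>1. \<bar>f n + g n - (\<alpha> + \<alpha>') * real n * ln (real n) - c * real n\<bar> \<le> C * real n powr \<beta>"
  by blast
qed

lemma log_linear_cmult: "log_linear \<beta> \<alpha> f ==> log_linear \<beta> (k * \<alpha>) (\<lambda>n. k * f n)"
 unfolding log_linear_def
proof safe
 fix c C
 assume 1: "\<forall>n\<ge>1. \<bar>f n - \<alpha> * real n * ln (real n) - c * real n\<bar> \<le> C * real n powr \<beta>"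
 have "\<bar>k * f n - k * \<alpha> * real n * ln (real n) - (k * c) * real n\<bar> \<le> (\<bar>k\<bar> * C) * real n powr \<beta>" if "n \<ge> 1" for n
 proof -
  have "\<bar>k * f n - k * \<alpha> * real n * ln (real n) - (k * c) * real n\<bar> = \<bar>k\<bar> * \<bar>f n - \<alpha> * real n * ln (real n) - c * real n\<bar>"
   by (simp flip: abs_mult add: algebra_simps)
  also have "... \<le> \<bar>k\<bar> * (C * real n powr \<beta>)" using 1 that by (intro mult_left_mono) auto
  finally show ?thesis by (simp add: mult.assoc)
 qed
 then show "\<exists>c C. \<forall>n\<ge>1. \<bar>k * f n - k * \<alpha> * real n * ln (real n) - c * real n\<bar> \<le> C * real n powr \<beta>"
  by blast
qed

lemma sum_powr_le:
 assumes "0 < \<beta>" "\<beta> \<le> 1"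
 shows "(\<Sum>j=1..n. real j powr (\<beta> - 1)) \<le> real n powr \<beta> / \<beta>"
proof (induction n)
 case (Suc n)
 have "real (Suc n) powr (\<beta> - 1) * \<beta> \<le> real (Suc n) powr \<beta> - real n powr \<beta>"
 proof (cases "n = 0")
  case False
  then have n: "real n > 0" by simp
  have "\<exists>z. real n < z \<and> z < real n + 1 \<and> (real n + 1) powr \<beta> - real n powr \<beta> = (real n + 1 - real n) * (\<beta> * z powr (\<beta> - 1))"
   by (rule MVT2) (use n in \<open>auto intro!: derivative_eq_intros\<close>)
  then obtain z where z: "real n < z" "z < real n + 1" "(real n + 1) powr \<beta> - real n powr \<beta> = \<beta> * z powr (\<beta> - 1)" by auto
  have "(real n + 1) powr (\<beta> - 1) \<le> z powr (\<beta> - 1)"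
   using z n assms by (intro powr_mono2') auto
  then have "\<beta> * (real n + 1) powr (\<beta> - 1) \<le> \<beta> * z powr (\<beta> - 1)" using assms by simp
  then show ?thesis using z(3) by (simp add: mult.commute add.commute)
 qed (use assms in simp)
 then show ?case using Suc assms by (simp add: field_simps)
qed simp

text \<open>The hypothesis says that z + g decreases and z - g increases. Their difference 2 g tends
  to 0, so they have a common limit c, and z n lies within g n of it.\<close>

lemma convergence_rate:
 fixes z g :: "nat \<Rightarrow> real"
 assumes step: "\<And>n. n \<ge> n0 ==> \<bar>z (Suc n) - z n\<bar> \<le> g n - g (Suc n)"
  and g: "g \<longlonglongrightarrow> 0"
 shows "\<exists>c. \<forall>n\<ge>n0. \<bar>z n - c\<bar> \<le> g n"
proof -
 define a where "a n = z (n + n0) + g (n + n0)" for n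
 define b where "b n = z (n + n0) - g (n + n0)" for n
 have dec: "decseq a" unfolding decseq_Suc_iff a_def
 proof
  show "z (Suc n + n0) + g (Suc n + n0) \<le> z (n + n0) + g (n + n0)" for n
   using step[of "n + n0"] by simp
 qed
 have inc: "incseq b" unfolding incseq_Suc_iff b_def
 proof
  show "z (n + n0) - g (n + n0) \<le> z (Suc n + n0) - g (Suc n + n0)" for n
   using step[of "n + n0"] by simp
 qed
 have "decseq (\<lambda>n. g (n + n0))" unfolding decseq_Suc_iff
 proof
  show "g (Suc n + n0) \<le> g (n + n0)" for n using step[of "n + n0"] by simp
 qed
 moreover have "(\<lambda>n. g (n + n0)) \<longlonglongrightarrow> 0" using g by (rule LIMSEQ_ignore_initial_segment)
 ultimately have g0: "g (n + n0) \<ge> 0" for n by (rule decseq_ge)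
 have "b 0 \<le> a n" for n
  using incseqD[OF inc, of 0 n] g0[of n] by (simp add: a_def b_def)
 then obtain c where c: "a \<longlonglongrightarrow> c" "\<forall>n. c \<le> a n" using decseq_convergent[OF dec] by blast
 have "(\<lambda>n. a n - 2 * g (n + n0)) \<longlonglongrightarrow> c - 2 * 0"
  by (intro tendsto_intros c LIMSEQ_ignore_initial_segment g)
 moreover have "(\<lambda>n. a n - 2 * g (n + n0)) = b" by (simp add: fun_eq_iff a_def b_def)
 ultimately have "b \<longlonglongrightarrow> c" by simp
 then have b: "b n \<le> c" for n using incseq_le[OF inc] by blast
 have "\<bar>z (n + n0) - c\<bar> \<le> g (n + n0)" for n
  using c(2)[rule_format, of n] b[of n] unfolding a_def b_def abs_le_iff by simp
 then have "\<bar>z n - c\<bar> \<le> g n" if "n \<ge> n0" for n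
  using that by (metis le_add_diff_inverse2)
 then show ?thesis by blast
qed

text \<open>Makes an error n^(\<beta>-2) summable by telescoping. The factor 4 bounds 2^(2-\<beta>),
  the price of replacing n by a point below n + 1 <= 2 n.\<close>

lemma powr_diff_ge:
 assumes "0 < \<beta>" "\<beta> < 1" "n \<ge> 1"
 shows "real n powr (\<beta> - 2) \<le> 4 / (1 - \<beta>) * (real n powr (\<beta> - 1) - real (Suc n) powr (\<beta> - 1))"
proof -
 have n: "real n > 0" using assms by simp
 have "\<exists>z. real n < z \<and> z < real n + 1 \<and> (real n + 1) powr (\<beta> - 1) - real n powr (\<beta> - 1) = (real n + 1 - real n) * ((\<beta> - 1) * z powr (\<beta> - 1 - 1))"
  by (rule MVT2) (use n in \<open>auto intro!: derivative_eq_intros\<close>)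
 then obtain z where z: "real n < z" "z < real n + 1"
  "(real n + 1) powr (\<beta> - 1) - real n powr (\<beta> - 1) = (\<beta> - 1) * z powr (\<beta> - 2)" by auto
 have "real n powr (\<beta> - 2) = 2 powr (2 - \<beta>) * (2 * real n) powr (\<beta> - 2)"
  using n by (simp add: powr_mult mult.assoc[symmetric] flip: powr_add)
 also have "... \<le> 2 powr 2 * z powr (\<beta> - 2)"
  using z n assms by (intro mult_mono powr_mono powr_mono2') auto
 finally have "real n powr (\<beta> - 2) \<le> 4 * z powr (\<beta> - 2)" by simp
 then have "(1 - \<beta>) * real n powr (\<beta> - 2) \<le> (1 - \<beta>) * (4 * z powr (\<beta> - 2))"
  using assms by (intro mult_left_mono) auto
 also have "... = 4 * (real n powr (\<beta> - 1) - (real n + 1) powr (\<beta> - 1))"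
  using z(3) by (simp add: algebra_simps)
 finally show ?thesis using assms by (simp add: field_simps)
qed

text \<open>The characteristic root 1 produces the leading term \<open>n ln n\<close>.\<close>

lemma resonant_recurrence:
 fixes u t :: "nat \<Rightarrow> real"
 assumes rec: "\<And>n. n \<ge> n0 ==> u (n + 1) = (1 + 1 / real (n + 1)) * u n + t n / real (n + 1)"
  and t: "\<And>n. n \<ge> n0 ==> \<bar>t n - \<gamma> * real n\<bar> \<le> C * real n powr \<beta>"
  and \<beta>: "0 < \<beta>" "\<beta> < 1"
 shows "log_linear \<beta> \<gamma> u"
proof -
 \<comment> \<open>Division by n + 1 removes the homogeneous solution: u n / (n+1) has increments t
   n / ((n+1)(n+2)), which are about \<gamma> / n and sum to \<gamma> ln n.\<close>
 define z where "z n = u n / real (n + 1) - \<gamma> * ln (real n)" for n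
 have "(\<lambda>n. real n / (real (n + 1) * real (n + 2)) - ln (real n + 1) + ln (real n)) \<in> O(\<lambda>n. real n powr (\<beta> - 2))"
 proof -
  have "(\<lambda>n. real n / (real (n + 1) * real (n + 2)) - ln (real n + 1) + ln (real n)) \<in> O(\<lambda>n. real n powr (- 2))"
   by real_asymp
  also have "(\<lambda>n. real n powr (- 2)) \<in> O(\<lambda>n. real n powr (\<beta> - 2))"
   using \<beta> by real_asymp
  finally show ?thesis .
 qed
 then obtain B where B: "\<forall>\<^sub>F n in sequentially. \<bar>real n / (real (n + 1) * real (n + 2)) - ln (real n + 1) + ln (real n)\<bar> \<le> B * real n powr (\<beta> - 2)"
  by (auto elim!: landau_o.bigE)
 then obtain n1 where n1: "\<And>n. n \<ge> n1 ==> \<bar>real n / (real (n + 1) * real (n + 2)) - ln (real n + 1) + ln (real n)\<bar> \<le> B * real n powr (\<beta> - 2)"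
  by (auto simp: eventually_sequentially)
 define N where "N = Max {n0, n1, 1}"
 have N: "n \<ge> n0" "n \<ge> n1" "n \<ge> 1" if "n \<ge> N" for n using that by (auto simp: N_def)
 define D where "D = \<bar>\<gamma>\<bar> * \<bar>B\<bar> + \<bar>C\<bar>"
 define g where "g n = D * (4 / (1 - \<beta>)) * real n powr (\<beta> - 1)" for n
 have "\<bar>z (Suc n) - z n\<bar> \<le> g n - g (Suc n)" if n: "n \<ge> N" for n
 proof -
  note N = N[OF n]
  have "u (n + 1) / real (n + 2) = u n / real (n + 1) + t n / (real (n + 1) * real (n + 2))"
   using rec[OF N(1)] by (simp add: divide_simps)
  then have "z (Suc n) - z n = t n / (real (n + 1) * real (n + 2)) - \<gamma> * ln (real n + 1) + \<gamma> * ln (real n)"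
   by (simp add: z_def add.commute)
  also have "... = \<gamma> * (real n / (real (n + 1) * real (n + 2)) - ln (real n + 1) + ln (real n))
    + (t n - \<gamma> * real n) / (real (n + 1) * real (n + 2))"
   by (simp add: algebra_simps diff_divide_distrib)
  also have "\<bar>...\<bar> \<le> \<bar>\<gamma>\<bar> * (B * real n powr (\<beta> - 2)) + C * real n powr \<beta> / (real (n + 1) * real (n + 2))"
   by (rule order_trans[OF abs_triangle_ineq], rule add_mono)
    (use n1[OF N(2)] t[OF N(1)] in \<open>auto simp: abs_mult abs_divide intro!: mult_left_mono divide_right_mono\<close>)
  also have "C * real n powr \<beta> / (real (n + 1) * real (n + 2)) \<le> \<bar>C\<bar> * real n powr (\<beta> - 2)"
  proof -
   have "C * real n powr \<beta> / (real (n + 1) * real (n + 2)) \<le> \<bar>C\<bar> * real n powr \<beta> / (real n * real n)"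
    using N(3) by (intro frac_le mult_right_mono mult_mono) auto
   then show ?thesis using N(3) by (simp add: powr_diff power2_eq_square)
  qed
  also have "\<bar>\<gamma>\<bar> * (B * real n powr (\<beta> - 2)) \<le> \<bar>\<gamma>\<bar> * (\<bar>B\<bar> * real n powr (\<beta> - 2))"
   by (intro mult_left_mono mult_right_mono) auto
  finally have "\<bar>z (Suc n) - z n\<bar> \<le> D * real n powr (\<beta> - 2)" by (simp add: D_def algebra_simps)
  also have "... \<le> D * (4 / (1 - \<beta>) * (real n powr (\<beta> - 1) - real (Suc n) powr (\<beta> - 1)))"
   by (rule mult_left_mono[OF powr_diff_ge[OF \<beta> N(3)]]) (simp add: D_def)
  also have "... = g n - g (Suc n)" by (simp add: g_def algebra_simps)
  finally show ?thesis .
 qed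
 moreover have "g \<longlonglongrightarrow> 0" unfolding g_def using \<beta> by real_asymp
 ultimately obtain c where c: "\<And>n. n \<ge> N ==> \<bar>z n - c\<bar> \<le> g n"
  using convergence_rate[of N z g] by blast
 define G where "G = D * (4 / (1 - \<beta>))"
 have G: "G \<ge> 0" unfolding G_def D_def using \<beta> by simp
 show ?thesis
 proof (rule log_linear_eventuallyI[where m = N and c = c and C = "\<bar>\<gamma>\<bar> / \<beta> + \<bar>c\<bar> + 2 * G"])
  fix n assume n: "n \<ge> N"
  note N = N[OF n]
  have "u n = real (n + 1) * (z n + \<gamma> * ln (real n))" by (simp add: z_def)
  then have "u n - \<gamma> * real n * ln (real n) - c * real n = \<gamma> * ln (real n) + c + real (n + 1) * (z n - c)"
   by (simp add: algebra_simps)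
  also have "\<bar>...\<bar> \<le> \<bar>\<gamma>\<bar> * \<bar>ln (real n)\<bar> + \<bar>c\<bar> + real (n + 1) * \<bar>z n - c\<bar>"
   by (intro order_trans[OF abs_triangle_ineq] add_mono) (simp_all add: abs_mult)
  also have "... \<le> \<bar>\<gamma>\<bar> * (real n powr \<beta> / \<beta>) + \<bar>c\<bar> * real n powr \<beta> + 2 * G * real n powr \<beta>"
  proof (intro add_mono mult_left_mono)
   show "\<bar>ln (real n)\<bar> \<le> real n powr \<beta> / \<beta>"
    using ln_powr_bound[of "real n" \<beta>] N \<beta> by (simp add: ln_ge_zero)
   show "\<bar>c\<bar> \<le> \<bar>c\<bar> * real n powr \<beta>"
    using ge_one_powr_ge_zero[of "real n" \<beta>] N \<beta> by (simp add: mult_le_cancel_left1)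
   have "real (n + 1) * \<bar>z n - c\<bar> \<le> (2 * real n) * (G * real n powr (\<beta> - 1))"
    using c[OF n] N by (intro mult_mono) (auto simp: g_def G_def)
   also have "... = 2 * G * real n powr \<beta>" using N by (simp add: powr_diff)
   finally show "real (n + 1) * \<bar>z n - c\<bar> \<le> ..." .
  qed simp
  finally show "\<bar>u n - \<gamma> * real n * ln (real n) - c * real n\<bar> \<le> (\<bar>\<gamma>\<bar> / \<beta> + \<bar>c\<bar> + 2 * G) * real n powr \<beta>"
   by (simp add: algebra_simps)
 qed (use \<beta> in simp)
qed

text \<open>After subtraction of the particular solution d n the homogeneous factor has modulus at
  most 1 for large n, since Re \<sigma> < 0. The errors, of order j^(\<beta>-1), therefore only add
  up, to O(n^\<beta>). The sequence is complex because the roots are.\<close>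

lemma stable_recurrence:
 fixes w :: "nat \<Rightarrow> complex" and t :: "nat \<Rightarrow> real"
 assumes rec: "\<And>n. n \<ge> n0 ==> w (n + 1) = (1 + \<sigma> / of_nat (n + 1)) * w n + of_real (t n / real (n + 1))"
  and t: "\<And>n. n \<ge> n0 ==> \<bar>t n - \<gamma> * real n\<bar> \<le> C * real n powr \<beta>"
  and \<beta>: "0 < \<beta>" "\<beta> < 1" and \<sigma>: "Re \<sigma> < 0"
 shows "log_linear \<beta> 0 (\<lambda>n. Re (w n))" "log_linear \<beta> 0 (\<lambda>n. Im (w n))"
proof -
 \<comment> \<open>Chosen so that d n solves the recurrence for the toll \<gamma> n up to an error d
   / (n+1).\<close>
 define d where "d = of_real \<gamma> / (1 - \<sigma>)"
 have \<sigma>1: "1 - \<sigma> \<noteq> 0" using \<sigma> by auto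
 define v where "v n = w n - d * of_nat n" for n
 have v_rec: "v (Suc n) = (1 + \<sigma> / of_nat (n + 1)) * v n + (of_real (t n - \<gamma> * real n) - d) / of_nat (n + 1)"
  if "n \<ge> n0" for n
 proof -
  have m: "(of_nat (n + 1) :: complex) \<noteq> 0" by (metis add_is_0 of_nat_eq_0_iff one_neq_zero)
  have \<gamma>: "of_real \<gamma> = d * (1 - \<sigma>)" using \<sigma>1 by (simp add: d_def)
  have "of_nat (n + 1) * v (Suc n) = of_nat (n + 1) * w (n + 1) - d * of_nat (n + 1) * of_nat (n + 1)"
   by (simp add: v_def algebra_simps)
  also have "of_nat (n + 1) * w (n + 1) = (of_nat (n + 1) + \<sigma>) * w n + of_real (t n)"
   unfolding rec[OF that] using m by (simp add: field_simps del: of_nat_Suc of_nat_add)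
  also have "... - d * of_nat (n + 1) * of_nat (n + 1)
    = (of_nat (n + 1) + \<sigma>) * v n + (of_real (t n) - d * (1 - \<sigma>) * of_nat n - d)"
   by (simp add: v_def algebra_simps)
  finally have "of_nat (n + 1) * v (Suc n) = (of_nat (n + 1) + \<sigma>) * v n + (of_real (t n - \<gamma> * real n) - d)"
   by (simp add: \<gamma>)
  moreover have "a = (1 + \<sigma> / x) * y + r / x" if "x \<noteq> 0" "x * a = (x + \<sigma>) * y + r" for a x y r
   using that by (simp add: field_simps)
  ultimately show ?thesis using m by blast
 qed
 \<comment> \<open>From this m on |x + \<sigma>|^2 = x^2 + 2 x Re \<sigma> + |\<sigma>|^2 is at most
   x^2 for x = n + 1.\<close>
 obtain m :: nat where m: "(cmod \<sigma>)\<^sup>2 / (- 2 * Re \<sigma>) \<le> real m" using real_arch_simple by blast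
 have contr: "cmod (1 + \<sigma> / of_nat (n + 1)) \<le> 1" if "n \<ge> m" for n
 proof -
  define x where "x = real (n + 1)"
  have x: "x > 0" "(cmod \<sigma>)\<^sup>2 \<le> - 2 * Re \<sigma> * x"
  proof -
   have "(cmod \<sigma>)\<^sup>2 \<le> - 2 * Re \<sigma> * real m" using m \<sigma> by (simp add: field_simps)
   also have "... \<le> - 2 * Re \<sigma> * x" using \<sigma> that by (intro mult_left_mono) (auto simp: x_def)
   finally show "(cmod \<sigma>)\<^sup>2 \<le> ..." .
  qed (simp add: x_def)
  have "(cmod (1 + \<sigma> / of_real x))\<^sup>2 = (1 + Re \<sigma> / x)\<^sup>2 + (Im \<sigma> / x)\<^sup>2"
   by (simp add: cmod_power2)
  also have "... = 1 + (2 * Re \<sigma> * x + (cmod \<sigma>)\<^sup>2) / x\<^sup>2"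
   using x(1) unfolding cmod_power2 by (simp add: field_simps power2_eq_square)
  also have "... \<le> 1" using x by (simp add: divide_le_0_iff)
  finally show ?thesis by (simp add: x_def abs_square_le_1)
 qed
 define N where "N = Max {n0, m, 1}"
 have N: "n \<ge> n0" "n \<ge> m" "n \<ge> 1" if "n \<ge> N" for n using that by (auto simp: N_def)
 define D where "D = \<bar>C\<bar> + cmod d"
 have step: "cmod (v (Suc n)) \<le> cmod (v n) + D * real n powr (\<beta> - 1)" if n: "n \<ge> N" for n
 proof -
  note N = N[OF n]
  have p1: "1 \<le> real n powr \<beta>" using ge_one_powr_ge_zero[of "real n" \<beta>] N \<beta> by simp
  have "cmod (v (Suc n)) \<le> cmod (1 + \<sigma> / of_nat (n + 1)) * cmod (v n)
    + cmod (of_real (t n - \<gamma> * real n) - d) / real (n + 1)"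
   unfolding v_rec[OF N(1)]
   by (rule order_trans[OF norm_triangle_ineq]) (simp only: norm_mult norm_divide norm_of_nat order_refl)
  also have "... \<le> 1 * cmod (v n) + (D * real n powr \<beta>) / real n"
  proof (intro add_mono mult_right_mono frac_le contr N)
   have "cmod (of_real (t n - \<gamma> * real n) - d) \<le> \<bar>t n - \<gamma> * real n\<bar> + cmod d"
    by (rule order_trans[OF norm_triangle_ineq4]) (simp only: norm_of_real order_refl)
   also have "... \<le> \<bar>C\<bar> * real n powr \<beta> + cmod d * real n powr \<beta>"
    using t[OF N(1)] p1 by (intro add_mono order_trans[OF t[OF N(1)]] mult_right_mono) (auto simp: mult_le_cancel_left1)
   finally show "cmod (of_real (t n - \<gamma> * real n) - d) \<le> D * real n powr \<beta>"
    by (simp add: D_def algebra_simps)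
  qed (use N in \<open>auto simp: D_def\<close>)
  finally show ?thesis using N by (simp add: powr_diff)
 qed
 have D: "D \<ge> 0" by (simp add: D_def)
 have bound: "cmod (v n) \<le> cmod (v N) + D * (\<Sum>j=1..<n. real j powr (\<beta> - 1))" if "n \<ge> N" for n
  using that
 proof (induction n rule: dec_induct)
  case base
  show ?case using D by (simp add: sum_nonneg)
 next
  case (step n)
  then show ?case using \<open>\<And>n. n \<ge> N ==> cmod (v (Suc n)) \<le> _\<close>[of n] N(3)[of n] by (simp add: algebra_simps)
 qed
 define c where "c = cmod (v N) + D / \<beta>"
 have est: "cmod (w n - d * of_nat n) \<le> c * real n powr \<beta>" if "n \<ge> N" for n
 proof -
  note N = N[OF that]
  have p1: "1 \<le> real n powr \<beta>" using ge_one_powr_ge_zero[of "real n" \<beta>] N \<beta> by simp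
  have "(\<Sum>j=1..<n. real j powr (\<beta> - 1)) \<le> (\<Sum>j=1..n. real j powr (\<beta> - 1))"
   by (intro sum_mono2) auto
  also have "... \<le> real n powr \<beta> / \<beta>" using \<beta> by (intro sum_powr_le) auto
  finally have "cmod (v n) \<le> cmod (v N) * real n powr \<beta> + D * (real n powr \<beta> / \<beta>)"
   using p1 D by (intro order_trans[OF bound[OF that]] add_mono mult_left_mono) (auto simp: mult_le_cancel_left1)
  then show ?thesis by (simp add: v_def c_def algebra_simps)
 qed
 show "log_linear \<beta> 0 (\<lambda>n. Re (w n))"
  by (rule log_linear_eventuallyI[where m = N and c = "Re d" and C = c])
   (use est \<beta> in \<open>auto intro!: order_trans[OF _ est] order_trans[OF _ abs_Re_le_cmod]\<close>)
 show "log_linear \<beta> 0 (\<lambda>n. Im (w n))"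
  by (rule log_linear_eventuallyI[where m = N and c = "Im d" and C = c])
   (use est \<beta> in \<open>auto intro!: order_trans[OF _ est] order_trans[OF _ abs_Im_le_cmod]\<close>)
qed

lemma log_linear_linear:
 assumes "\<And>n. n \<ge> n0 ==> \<bar>t n - \<gamma> * real n\<bar> \<le> C * real n powr \<beta>" "\<beta> \<ge> 0"
 shows "log_linear \<beta> 0 t"
 by (rule log_linear_eventuallyI[where m = n0 and c = \<gamma> and C = C]) (use assms in auto)

text \<open>L is a left eigenvector of the linear system for the averages, so the combination w
  decouples into a scalar recurrence. Eliminating L from the conditions leaves the characteristic
  equation (\<sigma>+1)...(\<sigma>+K) = (K+1)!, of which 1 is always a root.\<close>

lemma window_eigenvector:
 fixes L :: "nat \<Rightarrow> complex"
 assumes e: "\<And>n. n > K ==> e n = real (K + 1) * window_avg e K n + t n"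
  and L1: "L 1 = 1" and L: "\<And>k. k \<in> {1..<K} ==> of_nat (k + 1) * L (k + 1) = (\<sigma> + of_nat k) * L k"
  and LK: "(\<sigma> + of_nat K) * L K = of_nat (K + 1)" and K: "K \<ge> 1"
  and w: "\<And>n. w n = (\<Sum>k=1..K. L k * of_real (window_avg e k n))" and n: "n > K"
 shows "w (n + 1) = (1 + \<sigma> / of_nat (n + 1)) * w n + of_real (t n / real (n + 1))"
proof -
 define a where "a k = complex_of_real (window_avg e k n)" for k
 have m: "(of_nat (n + 1) :: complex) \<noteq> 0" by (metis add_is_0 of_nat_eq_0_iff one_neq_zero)
 have step: "of_nat (n + 1) * complex_of_real (window_avg e k (n + 1)) = (of_nat (n + 1) - of_nat k) * a k + of_nat k * a (k - 1)"
  if "k \<in> {1..K}" for k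
 proof -
  have "complex_of_real (real (n + 1) * window_avg e k (n + 1))
    = complex_of_real ((real (n + 1) - real k) * window_avg e k n + real k * window_avg e (k - 1) n)"
   by (subst window_avg_Suc) (use that n in auto)
  then show ?thesis by (simp add: a_def)
 qed
 have "of_nat (n + 1) * w (n + 1) = (\<Sum>k=1..K. L k * (of_nat (n + 1) * complex_of_real (window_avg e k (n + 1))))"
  unfolding w by (simp add: sum_distrib_left mult_ac)
 also have "... = (\<Sum>k=1..K. L k * ((of_nat (n + 1) - of_nat k) * a k + of_nat k * a (k - 1)))"
  by (intro sum.cong refl arg_cong2[where f = "(*)"] step)
 also have "... = of_nat (n + 1) * (\<Sum>k=1..K. L k * a k)
   - (\<Sum>k=1..K. of_nat k * L k * a k) + (\<Sum>k=1..K. of_nat k * L k * a (k - 1))"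
  unfolding sum_distrib_left sum_subtractf[symmetric] sum.distrib[symmetric]
  by (intro sum.cong) (simp_all add: algebra_simps)
 also have "(\<Sum>k=1..K. of_nat k * L k * a (k - 1)) = (\<Sum>k<K. of_nat (Suc k) * L (Suc k) * a k)"
  by (simp add: sum.shift_bounds_cl_Suc_ivl[symmetric] sum.atLeast1_atMost_eq)
 also have "... = a 0 + (\<Sum>k=1..<K. of_nat (k + 1) * L (k + 1) * a k)"
  using K L1 by (simp add: lessThan_atLeast0 sum.atLeast_Suc_lessThan)
 also have "... = a 0 + (\<Sum>k=1..<K. (\<sigma> + of_nat k) * L k * a k)"
  using L by (intro arg_cong2[where f = "(+)"] sum.cong) auto
 also have "a 0 = of_nat (K + 1) * a K + of_real (t n)"
  using e[OF n] by (simp add: a_def window_avg_def[of _ 0])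
 also have "of_nat (K + 1) * a K = (\<sigma> + of_nat K) * L K * a K" using LK by simp
 also have "(\<sigma> + of_nat K) * L K * a K + of_real (t n) + (\<Sum>k=1..<K. (\<sigma> + of_nat k) * L k * a k)
   = (\<Sum>k=1..K. (\<sigma> + of_nat k) * L k * a k) + of_real (t n)"
 proof -
  have "{1..K} = insert K {1..<K}" using K by auto
  then show ?thesis by simp
 qed
 also have "(\<Sum>k=1..K. (\<sigma> + of_nat k) * L k * a k) = \<sigma> * (\<Sum>k=1..K. L k * a k) + (\<Sum>k=1..K. of_nat k * L k * a k)"
  unfolding sum_distrib_left sum.distrib[symmetric] by (intro sum.cong) (simp_all add: algebra_simps)
 finally have "of_nat (n + 1) * w (n + 1) = (of_nat (n + 1) + \<sigma>) * w n + of_real (t n)"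
  by (simp add: w a_def algebra_simps)
 moreover have "x = (1 + \<sigma> / y) * z + r / y" if "y \<noteq> 0" "y * x = (y + \<sigma>) * z + r" for x y z r
  using that by (simp add: field_simps)
 ultimately show ?thesis using m by (metis of_real_divide of_real_of_nat_eq)
qed

text \<open>The root 1 has eigenvector L = 1 and yields \<open>resonant_recurrence\<close>; all
  other roots have negative real part for K <= 4 and yield \<open>stable_recurrence\<close>. Solving
  for the K-th average recovers e, and the coefficient of the resonant combination is 1 / (harm
  (K+1) - 1).\<close>

lemma mean_log_linear:
 assumes K: "K \<in> {2, 3, 4}"
  and e: "\<And>n. n > K ==> e n = real (K + 1) * window_avg e K n + t n"
  and t: "\<And>n. n > K ==> \<bar>t n - \<gamma> * real n\<bar> \<le> C * real n powr \<beta>"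
  and \<beta>: "0 < \<beta>" "\<beta> < 1"
 shows "log_linear \<beta> (\<gamma> / (harm (K + 1) - 1)) e"
proof -
 define A where "A k n = window_avg e k n" for k n
 have t': "\<bar>t n - \<gamma> * real n\<bar> \<le> C * real n powr \<beta>" if "n \<ge> Suc K" for n using t that by auto
 have t0: "log_linear \<beta> 0 t" using log_linear_linear[OF t'] \<beta> by simp
 \<comment> \<open>The recursion for e holds only beyond K; the finitely many remaining values are
   absorbed into the constant.\<close>
 have log_linear_cong: "log_linear \<beta> \<alpha> e" if ll: "log_linear \<beta> \<alpha> (\<lambda>n. real (K + 1) * A K n + t n)" for \<alpha>
 proof -
  obtain c D where D: "\<forall>n\<ge>1. \<bar>real (K + 1) * A K n + t n - \<alpha> * real n * ln (real n) - c * real n\<bar> \<le> D * real n powr \<beta>"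
   using ll unfolding log_linear_def by blast
  show ?thesis
   by (rule log_linear_eventuallyI[where m = "Suc K" and c = c and C = D]) (use D e \<beta> in \<open>auto simp: A_def\<close>)
 qed
 have eig: "(\<Sum>k=1..K. L k * of_real (A k (n + 1)))
   = (1 + \<sigma> / of_nat (n + 1)) * (\<Sum>k=1..K. L k * of_real (A k n)) + of_real (t n / real (n + 1))"
  if "L 1 = 1" "\<And>k. k \<in> {1..<K} ==> of_nat (k + 1) * L (k + 1) = (\<sigma> + of_nat k) * L k"
   "(\<sigma> + of_nat K) * L K = of_nat (K + 1)" "n \<ge> Suc K" for L :: "nat \<Rightarrow> complex" and \<sigma> n
  using window_eigenvector[OF e that(1) that(2) that(3), where n = n and w = "\<lambda>n. \<Sum>k=1..K. L k * of_real (A k n)"] K that(4)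
  by (auto simp: A_def)
 have u: "log_linear \<beta> \<gamma> (\<lambda>n. \<Sum>k=1..K. A k n)"
 proof (rule resonant_recurrence[OF _ t' \<beta>])
  fix n assume n: "n \<ge> Suc K"
  have "complex_of_real (\<Sum>k=1..K. A k (n + 1)) = of_real ((1 + 1 / real (n + 1)) * (\<Sum>k=1..K. A k n) + t n / real (n + 1))"
   using eig[where L = "\<lambda>_. 1" and \<sigma> = 1 and n = n] n by simp
  then show "(\<Sum>k=1..K. A k (n + 1)) = (1 + 1 / real (n + 1)) * (\<Sum>k=1..K. A k n) + t n / real (n + 1)"
   by (simp only: of_real_eq_iff)
 qed
 have stable: "log_linear \<beta> 0 (\<lambda>n. Re (\<Sum>k=1..K. L k * of_real (A k n)))"
  "log_linear \<beta> 0 (\<lambda>n. Im (\<Sum>k=1..K. L k * of_real (A k n)))"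
  if "L 1 = 1" "\<And>k. k \<in> {1..<K} ==> of_nat (k + 1) * L (k + 1) = (\<sigma> + of_nat k) * L k"
   "(\<sigma> + of_nat K) * L K = of_nat (K + 1)" "Re \<sigma> < 0" for L :: "nat \<Rightarrow> complex" and \<sigma>
  by (rule stable_recurrence[OF eig[OF that(1-3)] t' \<beta> that(4)]; assumption)+
 note lin = log_linear_add[OF log_linear_add[OF log_linear_cmult log_linear_cmult] log_linear_add[OF log_linear_cmult t0]]
 have harm: "harm (Suc n) = harm n + 1 / (real n + 1)" for n
  by (simp add: harm_Suc inverse_eq_divide add.commute)
 consider "K = 2" | "K = 3" | "K = 4" using K by auto
 then show ?thesis
 proof cases
  case 1
  define L :: "nat \<Rightarrow> complex" where "L k = (if k = 1 then 1 else - 3 / 2)" for k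
  have w: "log_linear \<beta> 0 (\<lambda>n. Re (\<Sum>k=1..K. L k * of_real (A k n)))"
   by (rule stable(1)[where \<sigma> = "-4"]) (use 1 in \<open>auto simp: L_def le_less_Suc_eq numeral_2_eq_2\<close>)
  \<comment> \<open>The roots of (\<sigma>+1)(\<sigma>+2) = 6 are 1 and -4, and 3 A_2 = 6/5 (u - w).
    The third combination has coefficient 0; it only pads the sum to the shape of
    \<open>lin\<close>.\<close>
  have "log_linear \<beta> (6 / 5 * \<gamma> + (- 6 / 5) * 0 + (0 * 0 + 0)) (\<lambda>n. real (K + 1) * A K n + t n)"
  proof (rule arg_cong[where f = "log_linear \<beta> _", THEN iffD1, OF _ lin[OF u w w]])
  qed (simp add: fun_eq_iff 1 L_def numeral_eq_Suc field_simps)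
  then have "log_linear \<beta> (6 / 5 * \<gamma>) e" using log_linear_cong by simp
  then show ?thesis by (simp add: 1 numeral_eq_Suc harm harm_expand(1) mult.commute)
 next
  case 2
  \<comment> \<open>The roots besides 1 are -7/2 + i q and its conjugate, from \<sigma>^2 + 7
    \<sigma> + 18 = 0. As the averages are real, one of the two provides both a real and an
    imaginary combination.\<close>
  define q where "q = sqrt 23 / 2"
  have q: "q * q = 23 / 4" "q \<noteq> 0" by (simp_all add: q_def)
  define L where "L k = (if k = 1 then 1 else if k = 2 then Complex (- 5 / 4) (q / 2)
   else Complex (- 1 / 3) (- 2 / 3 * q))" for k :: nat
  have qx: "q * (x * q) = 23 / 4 * x" for x
  proof -
   have "q * (x * q) = (q * q) * x" by (simp only: ac_simps)
   then show ?thesis by (simp only: q(1))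
  qed
  have k: "of_nat (k + 1) * L (k + 1) = (Complex (- 7 / 2) q + of_nat k) * L k" if "k \<in> {1..<K}" for k
  proof -
   have "k = 1 \<or> k = 2" using that 2 by auto
   then show ?thesis by (elim disjE) (simp_all add: L_def complex_eq_iff q qx)
  qed
  have kK: "(Complex (- 7 / 2) q + of_nat K) * L K = of_nat (K + 1)"
   by (simp add: 2 L_def complex_eq_iff q qx)
  have w: "log_linear \<beta> 0 (\<lambda>n. Re (\<Sum>k=1..K. L k * of_real (A k n)))"
   "log_linear \<beta> 0 (\<lambda>n. Im (\<Sum>k=1..K. L k * of_real (A k n)))"
   using stable[OF _ k kK] by (simp_all add: L_def)
  have "log_linear \<beta> (12 / 13 * \<gamma> + (- 12 / 13) * 0 + ((- 54 / 13 / q) * 0 + 0)) (\<lambda>n. real (K + 1) * A K n + t n)"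
  proof (rule arg_cong[where f = "log_linear \<beta> _", THEN iffD1, OF _ lin[OF u w]])
  qed (use q in \<open>simp add: fun_eq_iff 2 L_def numeral_eq_Suc field_simps\<close>)
  then have "log_linear \<beta> (12 / 13 * \<gamma>) e" using log_linear_cong by simp
  then show ?thesis by (simp add: 2 numeral_eq_Suc harm harm_expand(1) mult.commute)
 next
  case 3
  \<comment> \<open>The roots besides 1 are -6, with eigenvector \<open>L'\<close>, and -5/2 + i q
    with its conjugate, from \<sigma>^2 + 5 \<sigma> + 16 = 0. The resonant combination, that of -6
    and the imaginary part for the complex root suffice to isolate A_4.\<close>
  define q where "q = sqrt 39 / 2"
  have q: "q * q = 39 / 4" "q \<noteq> 0" by (simp_all add: q_def)
  define L where "L k = (if k = 1 then 1 else if k = 2 then Complex (- 3 / 4) (q / 2)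
   else if k = 3 then Complex (- 3 / 2) (- q / 3) else Complex (5 / 8) (- 5 / 12 * q))" for k :: nat
  define L' :: "nat \<Rightarrow> complex" where "L' k = (if k = 1 then 1 else if k = 2 then - 5 / 2
   else if k = 3 then 10 / 3 else - 5 / 2)" for k
  have qx: "q * (x * q) = 39 / 4 * x" for x
  proof -
   have "q * (x * q) = (q * q) * x" by (simp only: ac_simps)
   then show ?thesis by (simp only: q(1))
  qed
  have k: "of_nat (k + 1) * L (k + 1) = (Complex (- 5 / 2) q + of_nat k) * L k"
   and k': "of_nat (k + 1) * L' (k + 1) = (- 6 + of_nat k) * L' k" if "k \<in> {1..<K}" for k
  proof -
   have *: "k = 1 \<or> k = 2 \<or> k = 3" using that 3 by auto
   then show "of_nat (k + 1) * L (k + 1) = (Complex (- 5 / 2) q + of_nat k) * L k"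
    by (elim disjE) (simp_all add: L_def complex_eq_iff q qx)
   show "of_nat (k + 1) * L' (k + 1) = (- 6 + of_nat k) * L' k"
    using * by (auto simp: L'_def)
  qed
  have kK: "(Complex (- 5 / 2) q + of_nat K) * L K = of_nat (K + 1)"
   by (simp add: 3 L_def complex_eq_iff q qx)
  have kK': "(- 6 + of_nat K) * L' K = of_nat (K + 1)" by (simp add: 3 L'_def)
  have w: "log_linear \<beta> 0 (\<lambda>n. Im (\<Sum>k=1..K. L k * of_real (A k n)))"
   using stable(2)[OF _ k kK] by (simp add: L_def)
  have w': "log_linear \<beta> 0 (\<lambda>n. Re (\<Sum>k=1..K. L' k * of_real (A k n)))"
   using stable(1)[OF _ k' kK'] by (simp add: L'_def)
  have "log_linear \<beta> (60 / 77 * \<gamma> + (- 60 / 77) * 0 + ((- 60 / 11 / q) * 0 + 0)) (\<lambda>n. real (K + 1) * A K n + t n)"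
  proof (rule arg_cong[where f = "log_linear \<beta> _", THEN iffD1, OF _ lin[OF u w' w]])
  qed (use q in \<open>simp add: fun_eq_iff 3 L_def L'_def numeral_eq_Suc field_simps\<close>)
  then have "log_linear \<beta> (60 / 77 * \<gamma>) e" using log_linear_cong by simp
  then show ?thesis by (simp add: 3 numeral_eq_Suc harm harm_expand(1) mult.commute)
 qed
qed

section \<open>Power inequalities and the contraction argument\<close>

text \<open>With m the largest term and T the rest, (m+T)^p <= m^p + p T (m+T)^(p-1), and m + T is
  at most card I times m. Two features matter for the moment recursion: the pure powers have
  coefficient 1, as contraction requires, and the mixed terms have the form u^(p-1) v, which
  independence turns into lower moments.\<close>

lemma power_sum_le:
 fixes u :: "'i \<Rightarrow> real"
 assumes I: "finite I" and u: "\<And>i. i \<in> I ==> u i \<ge> 0" and p: "p \<ge> 1"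
 shows "(\<Sum>i\<in>I. u i) ^ p \<le> (\<Sum>i\<in>I. u i ^ p)
  + real p * real (card I) ^ (p - 1) * (\<Sum>i\<in>I. \<Sum>j\<in>I - {i}. u i ^ (p - 1) * u j)"
proof (cases "I = {}")
 case False
 obtain p' where p': "p = Suc p'" using p by (cases p) auto
 have "finite (u ` I)" "u ` I \<noteq> {}" using I False by auto
 from Max_in[OF this] obtain k where k: "k \<in> I" "u k = Max (u ` I)" by auto
 then have umax: "u i \<le> u k" if "i \<in> I" for i using I that by simp
 define m where "m = u k"
 define T where "T = (\<Sum>j\<in>I - {k}. u j)"
 have mT: "(\<Sum>i\<in>I. u i) = m + T" "m \<ge> 0" "T \<ge> 0"
  using I k(1) u by (auto simp only: m_def T_def sum.remove[of I k] Diff_iff intro!: sum_nonneg)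
 have card: "m + T \<le> real (card I) * m"
  unfolding mT(1)[symmetric] using sum_bounded_above[of I u m] umax by (simp add: m_def)
 have step: "(m + T) ^ n \<le> m ^ n + real n * T * (m + T) ^ (n - 1)" for n
 proof (induction n)
  case (Suc n)
  have "(m + T) ^ Suc n = m * (m + T) ^ n + T * (m + T) ^ n" by (simp add: algebra_simps)
  also have "m * (m + T) ^ n \<le> m * (m ^ n + real n * T * (m + T) ^ (n - 1))"
   using Suc mT by (intro mult_left_mono)
  also have "m * (m ^ n + real n * T * (m + T) ^ (n - 1)) \<le> m ^ Suc n + real n * T * (m + T) ^ n"
  proof (cases n)
   case (Suc n')
   have "m * (real n * T * (m + T) ^ (n - 1)) \<le> (m + T) * (real n * T * (m + T) ^ (n - 1))"
    using mT by (intro mult_right_mono) auto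
   then show ?thesis using Suc by (simp add: algebra_simps)
  qed simp
  finally show ?case by (simp add: algebra_simps)
 qed simp
 have "(\<Sum>i\<in>I. u i) ^ p \<le> m ^ p + real p * T * (m + T) ^ (p - 1)"
  unfolding mT(1) by (rule step)
 also have "(m + T) ^ (p - 1) \<le> (real (card I) * m) ^ (p - 1)"
  using card mT by (intro power_mono) auto
 then have "m ^ p + real p * T * (m + T) ^ (p - 1) \<le> m ^ p + real p * T * (real (card I) * m) ^ (p - 1)"
  using mT by (intro add_left_mono mult_left_mono) auto
 also have "... = m ^ p + real p * real (card I) ^ (p - 1) * (\<Sum>j\<in>I - {k}. u k ^ (p - 1) * u j)"
  by (simp add: T_def m_def power_mult_distrib sum_distrib_left mult_ac)
 also have "... \<le> (\<Sum>i\<in>I. u i ^ p) + real p * real (card I) ^ (p - 1) * (\<Sum>i\<in>I. \<Sum>j\<in>I - {i}. u i ^ (p - 1) * u j)"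
  using I k u unfolding m_def
  by (intro add_mono mult_left_mono member_le_sum[of k I "\<lambda>i. u i ^ p"]
    member_le_sum[of k I "\<lambda>i. \<Sum>j\<in>I - {i}. u i ^ (p - 1) * u j"])
   (auto intro!: sum_nonneg mult_nonneg_nonneg)
 finally show ?thesis .
qed (use p in \<open>simp add: power_0_left\<close>)

text \<open>Either y <= \<theta> x or x < y / \<theta>. For small \<theta> the coefficient of x^p is
  close to 1, so that adding the toll does not destroy the contraction.\<close>

lemma power_add_le:
 fixes x y \<theta> :: real
 assumes "x \<ge> 0" "y \<ge> 0" "\<theta> > 0"
 shows "(x + y) ^ p \<le> (1 + \<theta>) ^ p * x ^ p + (1 + 1 / \<theta>) ^ p * y ^ p"
proof (cases "y \<le> \<theta> * x")
 case True
 have "(x + y) ^ p \<le> ((1 + \<theta>) * x) ^ p" using True assms by (intro power_mono) (auto simp: algebra_simps)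
 also have "... \<le> (1 + \<theta>) ^ p * x ^ p + (1 + 1 / \<theta>) ^ p * y ^ p"
  using assms by (simp add: power_mult_distrib)
 finally show ?thesis .
next
 case False
 have "(x + y) ^ p \<le> ((1 + 1 / \<theta>) * y) ^ p" using False assms by (intro power_mono) (auto simp: field_simps)
 also have "... \<le> (1 + \<theta>) ^ p * x ^ p + (1 + 1 / \<theta>) ^ p * y ^ p"
  using assms by (simp add: power_mult_distrib)
 finally show ?thesis .
qed

lemma power_sum_le_card:
 fixes u :: "'i \<Rightarrow> real"
 assumes "finite I" "\<And>i. i \<in> I ==> u i \<ge> 0" "p \<ge> 1"
 shows "(\<Sum>i\<in>I. u i) ^ p \<le> real (card I) ^ p * (\<Sum>i\<in>I. u i ^ p)"
proof (cases "I = {}")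
 case False
 have "finite (u ` I)" "u ` I \<noteq> {}" using assms False by auto
 from Max_in[OF this] obtain k where k: "k \<in> I" "u k = Max (u ` I)" by auto
 then have "(\<Sum>i\<in>I. u i) \<le> real (card I) * u k"
  using assms by (intro sum_bounded_above) simp
 then have "(\<Sum>i\<in>I. u i) ^ p \<le> (real (card I) * u k) ^ p"
  using assms by (intro power_mono sum_nonneg) auto
 also have "... = real (card I) ^ p * u k ^ p" by (simp add: power_mult_distrib)
 also have "... \<le> real (card I) ^ p * (\<Sum>i\<in>I. u i ^ p)"
  using assms k by (intro mult_left_mono member_le_sum) auto
 finally show ?thesis .
qed (use assms(3) in \<open>simp add: power_0_left\<close>)

text \<open>A discrete Gronwall argument for extended real moments. Finiteness for every n comes
  from a separate strong induction, as the sizes are below n; only then can the initial values be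
  summed into a real constant.\<close>

lemma contraction_bound:
 fixes h :: "nat \<Rightarrow> ennreal" and J :: "nat \<Rightarrow> nat \<Rightarrow> 'q \<Rightarrow> nat" and Q :: "nat \<Rightarrow> 'q measure"
 assumes Q: "\<And>n. prob_space (Q n)"
  and J: "\<And>n i q. n > K ==> i \<le> K ==> J n i q < n"
  and J_meas: "\<And>n i. n > K ==> i \<le> K ==> J n i \<in> measurable (Q n) (count_space UNIV)"
  and h0: "h 0 = 0" and h_fin: "\<And>n. n \<le> K ==> h n < \<infinity>"
  and h_rec: "\<And>n. n > K ==> h n \<le> ennreal a * (\<integral>\<^sup>+q. (\<Sum>i\<le>K. h (J n i q)) \<partial>Q n) + ennreal (C * real n powr \<sigma>)"
  and contr: "\<And>n. n \<ge> n0 ==> (\<integral>\<^sup>+q. (\<Sum>i\<le>K. ennreal (real (J n i q) powr \<sigma>)) \<partial>Q n) \<le> ennreal (\<kappa> * real n powr \<sigma>)"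
  and a: "0 \<le> a" "0 \<le> \<kappa>" "a * \<kappa> < 1" and \<sigma>: "\<sigma> \<ge> 0" and C: "C \<ge> 0"
 shows "\<exists>D\<ge>0. \<forall>n. h n \<le> ennreal (D * real n powr \<sigma>)"
proof -
 let ?H = "\<lambda>n. \<integral>\<^sup>+q. (\<Sum>i\<le>K. h (J n i q)) \<partial>Q n"
 have fin: "h n < \<infinity>" for n
 proof (induction n rule: less_induct)
  case (less n)
  show ?case
  proof (cases "n \<le> K")
   case False
   interpret prob_space "Q n" by (rule Q)
   have "?H n \<le> (\<integral>\<^sup>+q. (\<Sum>i\<le>K. \<Sum>m<n. h m) \<partial>Q n)"
    using J False by (intro nn_integral_mono sum_mono member_le_sum) auto
   also have "... = (\<Sum>i\<le>K. \<Sum>m<n. h m)" by (simp add: emeasure_space_1)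
   also have "... < \<infinity>" using less by (auto simp: ennreal_mult_less_top less_top of_nat_less_top)
   finally have "ennreal a * ?H n + ennreal (C * real n powr \<sigma>) < \<infinity>"
    by (simp add: ennreal_mult_less_top)
   then show ?thesis using h_rec[of n] False by (auto intro: le_less_trans)
  qed (use h_fin in simp)
 qed
 define g where "g n = enn2real (h n)" for n
 have g: "h n = ennreal (g n)" "g n \<ge> 0" for n
  unfolding g_def using fin[of n] by auto
 define N where "N = max n0 (Suc K)"
 define D where "D = C / (1 - a * \<kappa>) + (\<Sum>m<N. g m)"
 have D: "D \<ge> 0" unfolding D_def using C a g by (auto intro!: add_nonneg_nonneg sum_nonneg divide_nonneg_nonneg)
 have "C + a * \<kappa> * D \<le> D"
 proof -
  have "C = (1 - a * \<kappa>) * (C / (1 - a * \<kappa>))" using a by simp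
  also have "... \<le> (1 - a * \<kappa>) * D"
   unfolding D_def using a g by (intro mult_left_mono) (auto intro!: sum_nonneg)
  finally show ?thesis by (simp add: algebra_simps)
 qed
 have "h n \<le> ennreal (D * real n powr \<sigma>)" for n
 proof (induction n rule: less_induct)
  case (less n)
  consider "n = 0" | "n \<ge> 1" "n < N" | "n \<ge> N" by linarith
  then show ?case
  proof cases
   case 2
   have "g n \<le> (\<Sum>m<N. g m)" using 2 g by (intro member_le_sum) auto
   also have "... \<le> D" unfolding D_def using C a by (auto intro!: divide_nonneg_nonneg)
   also have "D * 1 \<le> D * real n powr \<sigma>"
    using 2 \<sigma> D by (intro mult_left_mono ge_one_powr_ge_zero) auto
   finally show ?thesis by (simp add: g ennreal_leI)
  next
   case 3
   then have n: "n > K" "n \<ge> n0" by (auto simp: N_def)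
   have "h n \<le> ennreal a * ?H n + ennreal (C * real n powr \<sigma>)"
    by (rule h_rec[OF n(1)])
   also have "?H n
     \<le> (\<integral>\<^sup>+q. (\<Sum>i\<le>K. ennreal D * ennreal (real (J n i q) powr \<sigma>)) \<partial>Q n)"
    using less J[OF n(1)] D by (intro nn_integral_mono sum_mono) (simp add: ennreal_mult)
   also have "... = ennreal D * (\<integral>\<^sup>+q. (\<Sum>i\<le>K. ennreal (real (J n i q) powr \<sigma>)) \<partial>Q n)"
    unfolding sum_distrib_left[symmetric]
    by (rule nn_integral_cmult) (use J_meas[OF n(1)] in measurable)
   also have "... \<le> ennreal D * ennreal (\<kappa> * real n powr \<sigma>)"
    by (intro mult_left_mono contr n) simp
   also have "ennreal a * (ennreal D * ennreal (\<kappa> * real n powr \<sigma>)) + ennreal (C * real n powr \<sigma>)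
     = ennreal ((C + a * \<kappa> * D) * real n powr \<sigma>)"
    using a D C by (simp add: ennreal_mult[symmetric] ennreal_plus[symmetric] algebra_simps del: ennreal_plus)
   also have "... \<le> ennreal (D * real n powr \<sigma>)"
    using \<open>C + a * \<kappa> * D \<le> D\<close> by (intro ennreal_leI mult_right_mono) auto
   finally show ?thesis by (simp add: mult_left_mono add_right_mono)
  qed (simp add: h0)
 qed
 then show ?thesis using D by blast
qed

section \<open>Level sets of strongly convex functions in the plane\<close>

text \<open>Contracting the sublevel set of height \<open>x + h\<close> towards a point of height less than \<open>x\<close> moves it
 into the sublevel set of height \<open>x\<close>; in dimension two the area of a sublevel set is at most linear
 in its height above the infimum.\<close>

lemma strongly_convex_level_area:
 fixes G :: "real \<times> real \<Rightarrow> real"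
 assumes S: "convex S"
  and meas: "\<And>y. {u \<in> S. G u \<le> y} \<in> sets borel"
  and strong: "\<And>u v t. u \<in> S ==> v \<in> S ==> 0 < t ==> t < 1 ==>
   G ((1 - t) *\<^sub>R u + t *\<^sub>R v) \<le> (1 - t) * G u + t * G v - c * t * (1 - t) * (norm (u - v))\<^sup>2"
  and below: "\<And>u. u \<in> S ==> m0 \<le> G u"
  and c: "c > 0" and h: "h \<ge> 0"
 shows "emeasure lborel {u \<in> S. x < G u \<and> G u \<le> x + h} \<le> ennreal (64 / c * h)"
proof (cases "S = {}")
 case False
 define L where "L y = {u \<in> S. G u \<le> y}" for y
 define m where "m = (INF u\<in>S. G u)"
 have bdd: "bdd_below (G ` S)" using below by (auto intro!: bdd_belowI)
 have m_le: "m \<le> G u" if "u \<in> S" for u unfolding m_def using bdd that by (rule cINF_lower)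
 have L_sets: "L y \<in> sets lborel" for y unfolding L_def sets_lborel by (rule meas)
 \<comment> \<open>Two points of height at most w lie within sqrt (4 (w - m) / c) of each other
   because their midpoint has height at least m; so L w fits into a square of area 16 (w - m) /
   c.\<close>
 have area: "emeasure lborel (L w) \<le> ennreal (16 / c * (w - m))" for w
 proof (cases "L w = {}")
  case ne: False
  then obtain u where u: "u \<in> S" "G u \<le> w" by (auto simp: L_def)
  have wm: "w - m \<ge> 0" using m_le[OF u(1)] u(2) by simp
  define R where "R = sqrt (4 / c * (w - m))"
  have R: "R \<ge> 0" "R\<^sup>2 = 4 / c * (w - m)" unfolding R_def using wm c by auto
  have "norm (v - u) \<le> R" if v: "v \<in> S" "G v \<le> w" for v
  proof -
   have "(1 - 1 / 2) *\<^sub>R u + (1 / 2) *\<^sub>R v \<in> S"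
    using S u v by (intro convexD_alt) auto
   then have "m \<le> G ((1 - 1 / 2) *\<^sub>R u + (1 / 2) *\<^sub>R v)" by (rule m_le)
   also have "... \<le> (1 - 1 / 2) * G u + (1 / 2) * G v - c * (1 / 2) * (1 - 1 / 2) * (norm (u - v))\<^sup>2"
    by (rule strong) (use u v in auto)
   also have "... \<le> w - c / 4 * (norm (u - v))\<^sup>2" using u v by simp
   finally have "(norm (u - v))\<^sup>2 \<le> 4 / c * (w - m)" using c by (simp add: field_simps)
   then have "(norm (u - v))\<^sup>2 \<le> R\<^sup>2" by (simp only: R(2))
   then show ?thesis using R(1) by (metis norm_minus_commute power2_le_imp_le)
  qed
  then have "L w \<subseteq> cbox (u - (R, R)) (u + (R, R))"
  proof (intro subsetI)
   fix v assume "v \<in> L w"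
   then have "norm (v - u) \<le> R" using \<open>\<And>v. v \<in> S ==> G v \<le> w ==> norm (v - u) \<le> R\<close> by (simp add: L_def)
   then have "\<bar>fst v - fst u\<bar> \<le> R" "\<bar>snd v - snd u\<bar> \<le> R"
    using prod.collapse[of "v - u"] norm_fst_le[of "fst (v - u)" "snd (v - u)"] norm_snd_le[of "snd (v - u)" "fst (v - u)"]
    by (simp_all only: prod.collapse real_norm_def flip: fst_diff snd_diff)
   note * = this
   show "v \<in> cbox (u - (R, R)) (u + (R, R))"
    using * by (cases u; cases v) (auto simp: cbox_Pair_eq abs_le_iff)
  qed
  then have "emeasure lborel (L w) \<le> emeasure lborel (cbox (u - (R, R)) (u + (R, R)))"
   by (intro emeasure_mono) auto
  also have "... = ennreal ((2 * R) * (2 * R))"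
   using R(1) by (cases u) (simp add: emeasure_lborel_cbox_eq Basis_prod_def prod.union_disjoint)
  also have "(2 * R) * (2 * R) = 16 / c * (w - m)" using R(2) by (simp add: power2_eq_square)
  finally show ?thesis .
 qed simp
 have eq: "{u \<in> S. x < G u \<and> G u \<le> x + h} = L (x + h) - L x" by (auto simp: L_def)
 show ?thesis
 proof (cases "x \<le> m")
  case True
  have "emeasure lborel (L (x + h) - L x) \<le> emeasure lborel (L (x + h))"
   by (intro emeasure_mono L_sets) auto
  also have "... \<le> ennreal (16 / c * (x + h - m))" by (rule area)
  also have "... \<le> ennreal (64 / c * h)"
  proof (rule ennreal_leI)
   have "16 / c * (x + h - m) \<le> 16 / c * h" using True c by (intro mult_left_mono) auto
   also have "... \<le> 64 / c * h" using c h by (intro mult_right_mono divide_right_mono) auto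
   finally show "16 / c * (x + h - m) \<le> 64 / c * h" .
  qed
  finally show ?thesis by (simp add: eq)
 next
  case False
  \<comment> \<open>The infimum need not be attained. A centre of height below (x + m) / 2 is good
    enough, as then x + h - m <= 2 (x + h - G u).\<close>
  then have "m < (x + m) / 2" by simp
  then have "(INF u\<in>S. G u) < (x + m) / 2" unfolding m_def[symmetric] .
  then obtain u where u: "u \<in> S" "G u < (x + m) / 2"
   using cINF_less_iff[OF \<open>S \<noteq> {}\<close> bdd, of "(x + m) / 2"] by blast
  then have ux: "G u < x" using False by simp
  show ?thesis
  proof (cases "h = 0")
   case False
   then have h0: "h > 0" using h by simp
   \<comment> \<open>Convexity bounds the height of (1-t) u + t v by (1-t) G u + t (x+h); this t
     makes the bound equal to x.\<close>
   define t where "t = (x - G u) / (x + h - G u)"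
   have t: "0 < t" "t < 1" using ux h0 by (auto simp: t_def)
   have sub: "L (x + h) \<subseteq> (\<lambda>v. (1 - t) *\<^sub>R u + t *\<^sub>R v) -` L x"
   proof
    fix v assume v: "v \<in> L (x + h)"
    have "G ((1 - t) *\<^sub>R u + t *\<^sub>R v) \<le> (1 - t) * G u + t * G v - c * t * (1 - t) * (norm (u - v))\<^sup>2"
     by (rule strong) (use u v t in \<open>auto simp: L_def\<close>)
    also have "... \<le> (1 - t) * G u + t * (x + h)"
    proof -
     have "t * G v \<le> t * (x + h)" using v t by (intro mult_left_mono) (auto simp: L_def)
     moreover have "0 \<le> c * t * (1 - t) * (norm (u - v))\<^sup>2" using t c by simp
     ultimately show ?thesis by linarith
    qed
    also have "... = G u + t * (x + h - G u)" by (simp add: algebra_simps)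
    also have "... = x" using ux h0 by (simp add: t_def)
    finally show "v \<in> (\<lambda>v. (1 - t) *\<^sub>R u + t *\<^sub>R v) -` L x"
     using v u t S by (auto simp: L_def intro!: convexD_alt)
   qed
   \<comment> \<open>The contraction with ratio t scales areas by t^2, so t^2 area(L (x+h)) <=
     area(L x).\<close>
   have "emeasure lborel (L x)
     = emeasure (density (distr lborel borel (\<lambda>v. (1 - t) *\<^sub>R u + t *\<^sub>R v)) (\<lambda>_. \<bar>t\<bar> ^ DIM(real \<times> real))) (L x)"
    using t by (subst lborel_affine[of t "(1 - t) *\<^sub>R u"]) auto
   also have "... = ennreal (t\<^sup>2) * emeasure lborel ((\<lambda>v. (1 - t) *\<^sub>R u + t *\<^sub>R v) -` L x)"
    using L_sets[of x] t
    by (simp add: emeasure_density nn_integral_cmult emeasure_distr power2_eq_square numeral_2_eq_2)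
   also have "... \<ge> ennreal (t\<^sup>2) * emeasure lborel (L (x + h))"
   proof (intro mult_left_mono emeasure_mono sub)
    have "(\<lambda>v. (1 - t) *\<^sub>R u + t *\<^sub>R v) \<in> borel_measurable borel" by simp
    from measurable_sets[OF this, of "L x"] L_sets[of x]
    show "(\<lambda>v. (1 - t) *\<^sub>R u + t *\<^sub>R v) -` L x \<in> sets lborel" by simp
   qed simp
   finally have low: "ennreal (t\<^sup>2) * emeasure lborel (L (x + h)) \<le> emeasure lborel (L x)" .
   have "emeasure lborel (L (x + h)) \<noteq> \<infinity>" using area[of "x + h"] by (auto simp: top_unique)
   then obtain a where a: "emeasure lborel (L (x + h)) = ennreal a" "a \<ge> 0"
    by (cases "emeasure lborel (L (x + h))") auto
   have "emeasure lborel (L x) \<le> emeasure lborel (L (x + h))"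
    using h by (intro emeasure_mono L_sets) (auto simp: L_def)
   then obtain b where b: "emeasure lborel (L x) = ennreal b" "b \<ge> 0"
    using a by (cases "emeasure lborel (L x)") (auto simp: top_unique)
   have wm: "0 \<le> x + h - m" using False \<open>\<not> x \<le> m\<close> h by simp
   have a_le: "a \<le> 16 / c * (x + h - m)"
    using area[of "x + h"] a wm c by (simp add: ennreal_le_iff)
   have "t\<^sup>2 * a \<le> b" using low a b by (simp add: ennreal_mult[symmetric])
   \<comment> \<open>The loss factor 1 - t^2 <= 2 (1 - t) is of order h / (x + h - G u), while a is
     at most of order x + h - G u: the heights cancel and only h remains.\<close>
   then have "a - b \<le> (1 - t\<^sup>2) * a" by (simp add: algebra_simps)
   also have "... = (1 - t) * (1 + t) * a" by (simp add: power2_eq_square algebra_simps)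
   also have "... \<le> (1 - t) * 2 * (16 / c * (x + h - m))"
    using t a a_le wm c by (intro mult_mono) auto
   also have "x + h - m \<le> 2 * (x + h - G u)" using u h by simp
   then have "(1 - t) * 2 * (16 / c * (x + h - m)) \<le> (1 - t) * 2 * (16 / c * (2 * (x + h - G u)))"
    using t c by (intro mult_left_mono) auto
   also have "1 - t = h / (x + h - G u)" using ux h0 by (simp add: t_def field_simps)
   also have "h / (x + h - G u) * 2 * (16 / c * (2 * (x + h - G u))) = 64 / c * h"
   proof -
    have key: "y \<noteq> 0 ==> h / y * 2 * (16 / c * (2 * y)) = 64 / c * h" for y
     using c by (simp add: field_simps)
    show ?thesis by (rule key) (use ux h0 in simp)
   qed
   finally have ab: "a - b \<le> 64 / c * h" .
   have "emeasure lborel (L (x + h) - L x) = ennreal a - ennreal b"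
    unfolding a(1)[symmetric] b(1)[symmetric]
    by (intro emeasure_Diff L_sets) (use b h in \<open>auto simp: L_def\<close>)
   also have "... = ennreal (a - b)" using b by (simp add: ennreal_minus)
   also have "... \<le> ennreal (64 / c * h)" using ab by (rule ennreal_leI)
   finally show ?thesis by (simp add: eq)
  next
   case True
   then have empty: "{u \<in> S. x < G u \<and> G u \<le> x + h} = {}" by auto
   show ?thesis unfolding empty by simp
  qed
 qed
qed simp

section \<open>Concentration of the partitioning stage\<close>

abbreviation item_measure :: "nat \<Rightarrow> (nat \<Rightarrow> real) measure" where
 "item_measure N \<equiv> (\<Pi>\<^sub>M k\<in>{1..N}. unif01)"

lemma prob_space_unif01: "prob_space unif01"
 by (rule prob_space_uniform_measure) auto

lemma (in prob_space) nn_integral_prob_const: "(\<integral>\<^sup>+x. c \<partial>M) = c"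
 by (simp add: emeasure_space_1)

lemma prob_space_item_measure: "prob_space (item_measure N)"
 by (intro prob_space_PiM prob_space_unif01)

text \<open>The k-th increment depends on the past only through a 1, ..., a (k-1), so integrating
  out the last item costs a factor B. The number N of items is kept apart from the number m of
  summands, so that items not yet used are integrated away in the same induction.\<close>

lemma mgf_martingale:
 fixes g :: "nat \<Rightarrow> (nat \<Rightarrow> real) \<Rightarrow> real \<Rightarrow> real"
 assumes meas: "\<And>k n. 1 \<le> k ==> k \<le> n ==> (\<lambda>a. g k a (a k)) \<in> borel_measurable (item_measure n)"
  and dep: "\<And>k a a'. (\<And>j. j \<in> {1..<k} ==> a j = a' j) ==> g k a = g k a'"
  and meas': "\<And>k a. 1 \<le> k ==> g k a \<in> borel_measurable unif01"
  and mgf: "\<And>k a. 1 \<le> k ==> (\<integral>\<^sup>+y. ennreal (exp (g k a y)) \<partial>unif01) \<le> ennreal B"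
  and B: "B \<ge> 0" and m: "m \<le> N"
 shows "(\<integral>\<^sup>+a. ennreal (exp (\<Sum>k=1..m. g k a (a k))) \<partial>item_measure N) \<le> ennreal (B ^ m)"
 using m
proof (induction N arbitrary: m)
 case 0
 interpret prob_space "item_measure 0" by (rule prob_space_item_measure)
 show ?case using 0 emeasure_space_1 by simp
next
 case (Suc N)
 interpret U: prob_space unif01 by (rule prob_space_unif01)
 interpret P: product_prob_space "\<lambda>_::nat. unif01" "{1..N}" by unfold_locales
 have ins: "{1..Suc N} = insert (Suc N) {1..N}" by auto
 have [measurable]: "(\<lambda>a. g k a (a k)) \<in> borel_measurable (item_measure (Suc N))" if "k \<in> {1..m}" for k
  using meas that Suc.prems by auto
 have "(\<integral>\<^sup>+a. ennreal (exp (\<Sum>k=1..m. g k a (a k))) \<partial>item_measure (Suc N))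
   = (\<integral>\<^sup>+a. \<integral>\<^sup>+y. ennreal (exp (\<Sum>k=1..m. g k (a(Suc N := y)) ((a(Suc N := y)) k))) \<partial>unif01 \<partial>item_measure N)"
  unfolding ins
 proof (rule P.product_nn_integral_insert)
  show "(\<lambda>a. ennreal (exp (\<Sum>k=1..m. g k a (a k)))) \<in> borel_measurable (\<Pi>\<^sub>M i\<in>insert (Suc N) {1..N}. unif01)"
   unfolding ins[symmetric] by measurable
 qed auto
 also have "... \<le> ennreal (B ^ m)"
 proof (cases "m = Suc N")
  case False
  then have "m \<le> N" using Suc.prems by simp
  moreover have "g k (a(Suc N := y)) = g k a" if "k \<in> {1..m}" for k a y
   by (rule dep) (use that \<open>m \<le> N\<close> in auto)
  ultimately have "(\<Sum>k=1..m. g k (a(Suc N := y)) ((a(Suc N := y)) k)) = (\<Sum>k=1..m. g k a (a k))" for a y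
   by (intro sum.cong) auto
  then show ?thesis using Suc.IH[OF \<open>m \<le> N\<close>] U.emeasure_space_1 by simp
 next
  case True
  have *: "g k (a(Suc N := y)) = g k a" if "k \<in> {1..Suc N}" for k a y
   by (rule dep) (use that in auto)
  have **: "(\<Sum>k=1..N. g k (a(Suc N := y)) ((a(Suc N := y)) k)) = (\<Sum>k=1..N. g k a (a k))" for a y
   using * by (intro sum.cong) auto
  have [measurable]: "(\<lambda>a. g k a (a k)) \<in> borel_measurable (item_measure N)" if "k \<in> {1..N}" for k
   using meas that by auto
  have "(\<integral>\<^sup>+a. \<integral>\<^sup>+y. ennreal (exp (\<Sum>k=1..m. g k (a(Suc N := y)) ((a(Suc N := y)) k))) \<partial>unif01 \<partial>item_measure N)
    = (\<integral>\<^sup>+a. \<integral>\<^sup>+y. ennreal (exp (\<Sum>k=1..N. g k a (a k))) * ennreal (exp (g (Suc N) a y)) \<partial>unif01 \<partial>item_measure N)"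
   unfolding True by (simp add: ** * exp_add ennreal_mult del: fun_upd_apply) (simp add: ** *)
  also have "... \<le> (\<integral>\<^sup>+a. ennreal (exp (\<Sum>k=1..N. g k a (a k))) * ennreal B \<partial>item_measure N)"
  proof (rule nn_integral_mono)
   fix a
   have "(\<integral>\<^sup>+y. ennreal (exp (\<Sum>k=1..N. g k a (a k))) * ennreal (exp (g (Suc N) a y)) \<partial>unif01)
     \<le> ennreal (exp (\<Sum>k=1..N. g k a (a k))) * (\<integral>\<^sup>+y. ennreal (exp (g (Suc N) a y)) \<partial>unif01)"
    using meas'[of "Suc N" a] by (subst nn_integral_cmult) auto
   also have "... \<le> ennreal (exp (\<Sum>k=1..N. g k a (a k))) * ennreal B"
    by (intro mult_left_mono mgf) auto
   finally show "(\<integral>\<^sup>+y. ennreal (exp (\<Sum>k=1..N. g k a (a k))) * ennreal (exp (g (Suc N) a y)) \<partial>unif01)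
     \<le> ..." .
  qed
  also have "... = (\<integral>\<^sup>+a. ennreal (exp (\<Sum>k=1..N. g k a (a k))) \<partial>item_measure N) * ennreal B"
   by (rule nn_integral_multc) measurable
  also have "... \<le> ennreal (B ^ N) * ennreal B"
   by (intro mult_right_mono Suc.IH) auto
  also have "... = ennreal (B ^ m)" using True B by (simp add: ennreal_mult[symmetric] mult.commute)
  finally show ?thesis .
 qed
 finally show ?case .
qed

lemma power_le_fact_exp: "x ^ p \<le> fact p * exp x" if "x \<ge> 0" for x :: real
proof -
 have "(\<Sum>n\<in>{p}. inverse (fact n) * x ^ n) \<le> (\<Sum>n. inverse (fact n) * x ^ n)"
  using summable_exp[of x] that by (intro sum_le_suminf) auto
 also have "... = exp x" by (simp add: exp_def scaleR_conv_of_real)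
 finally show ?thesis by (simp add: field_simps)
qed

text \<open>Exponential moments at scale 1/r on both sides control every moment, through |S|^p <= p!
  r^p exp(|S|/r).\<close>

lemma moment_le_exp:
 fixes S :: "'a \<Rightarrow> real"
 assumes [measurable]: "S \<in> borel_measurable M" and r: "r > 0" "B \<ge> 0"
  and B: "(\<integral>\<^sup>+x. ennreal (exp (S x / r)) \<partial>M) \<le> ennreal B" "(\<integral>\<^sup>+x. ennreal (exp (- (S x / r))) \<partial>M) \<le> ennreal B"
 shows "(\<integral>\<^sup>+x. ennreal (\<bar>S x\<bar> ^ p) \<partial>M) \<le> ennreal (2 * fact p * B * r ^ p)"
proof -
 have pt: "\<bar>S x\<bar> ^ p \<le> fact p * r ^ p * (exp (S x / r) + exp (- (S x / r)))" for x
 proof -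
  have "(\<bar>S x\<bar> / r) ^ p \<le> fact p * exp (\<bar>S x\<bar> / r)" using r by (intro power_le_fact_exp) auto
  also have "exp (\<bar>S x\<bar> / r) \<le> exp (S x / r) + exp (- (S x / r))"
   by (cases "S x \<ge> 0") auto
  finally show ?thesis using r by (simp add: field_simps power_divide)
 qed
 have "(\<integral>\<^sup>+x. ennreal (\<bar>S x\<bar> ^ p) \<partial>M)
   \<le> (\<integral>\<^sup>+x. ennreal (fact p * r ^ p) * (ennreal (exp (S x / r)) + ennreal (exp (- (S x / r)))) \<partial>M)"
  using pt r by (intro nn_integral_mono) (simp add: ennreal_mult[symmetric] ennreal_plus[symmetric] del: ennreal_plus)
 also have "... = ennreal (fact p * r ^ p) * ((\<integral>\<^sup>+x. ennreal (exp (S x / r)) \<partial>M) + (\<integral>\<^sup>+x. ennreal (exp (- (S x / r))) \<partial>M))"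
  by (subst nn_integral_cmult) (simp_all add: nn_integral_add)
 also have "... \<le> ennreal (fact p * r ^ p) * (ennreal B + ennreal B)"
  by (intro mult_left_mono add_mono B) auto
 also have "... = ennreal (2 * fact p * B * r ^ p)"
  using r by (simp add: ennreal_mult[symmetric] ennreal_plus[symmetric] mult_ac del: ennreal_plus)
 finally show ?thesis .
qed

lemma measure_class_interval:
 assumes "generic_pivots K v" "i \<le> K"
 shows "measure unif01 (class_interval K v i) = spacing K v i"
proof -
 have "class_interval K v i \<subseteq> {0..1}"
  using pivot_bounds[OF assms(1), of i] pivot_bounds[OF assms(1), of "Suc i"] assms(2)
  by (auto simp: class_interval_def)
 then have "{0..1} \<inter> class_interval K v i = class_interval K v i" by auto
 moreover have "class_interval K v i \<in> sets lborel" by (simp add: class_interval_def)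
 ultimately have "emeasure unif01 (class_interval K v i) = emeasure lborel (class_interval K v i)"
  by (subst emeasure_uniform_measure) (auto simp: divide_ennreal_def)
 then show ?thesis using spacing_pos[OF assms]
  by (simp add: measure_def class_interval_def spacing_def)
qed

lemma integral_class_sum:
 assumes "generic_pivots K v"
 shows "(\<integral>u. (\<Sum>i\<le>K. of_bool (u \<in> class_interval K v i) * f i) \<partial>unif01) = (\<Sum>i\<le>K. spacing K v i * f i)"
proof -
 interpret U: prob_space unif01 by (rule prob_space_unif01)
 have S: "class_interval K v i \<in> sets unif01" for i by (simp add: class_interval_def)
 have "integrable unif01 (\<lambda>u. of_bool (u \<in> class_interval K v i) * f i)
   \<and> (\<integral>u. of_bool (u \<in> class_interval K v i) * f i \<partial>unif01) = spacing K v i * f i" if "i \<le> K" for i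
 proof -
  have eq: "(\<lambda>u. of_bool (u \<in> class_interval K v i) * f i) = (\<lambda>u. f i * indicator (class_interval K v i) u)"
   by (auto simp: indicator_def)
  have "integrable unif01 (indicator (class_interval K v i) :: real \<Rightarrow> real)"
   by (intro integrable_real_indicator S) (simp add: U.emeasure_eq_measure)
  moreover have "(\<integral>u. indicator (class_interval K v i) u \<partial>unif01) = spacing K v i"
   using S measure_class_interval[OF assms that]
   by (simp only: Bochner_Integration.integral_indicator space_uniform_measure space_lborel space_borel Int_UNIV_right)
  ultimately show ?thesis unfolding eq by simp
 qed
 note * = this
 have "(\<integral>u. (\<Sum>i\<le>K. of_bool (u \<in> class_interval K v i) * f i) \<partial>unif01)
   = (\<Sum>i\<le>K. \<integral>u. of_bool (u \<in> class_interval K v i) * f i \<partial>unif01)"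
  by (rule Bochner_Integration.integral_sum) (use * in blast)
 also have "... = (\<Sum>i\<le>K. spacing K v i * f i)"
  by (rule sum.cong) (use * in auto)
 finally show ?thesis .
qed

lemma class_sum_range:
 assumes "generic_pivots K v" "\<And>i. i \<le> K ==> 0 \<le> f i \<and> f i \<le> c" "0 \<le> c"
 shows "(\<Sum>i\<le>K. of_bool (u \<in> class_interval K v i) * f i) \<in> {0..c::real}"
proof (cases "\<exists>i\<le>K. u \<in> class_interval K v i")
 case True
 then show ?thesis using sum_of_bool_class[OF assms(1)] assms(2) by fastforce
next
 case False
 then have "(\<Sum>i\<le>K. of_bool (u \<in> class_interval K v i) * f i) = 0" by (intro sum.neutral) auto
 then show ?thesis using assms(3) by simp
qed

lemma class_step_mgf:
 assumes "generic_pivots K v" "\<And>i. i \<le> K ==> 0 \<le> f i \<and> f i \<le> c" "0 \<le> c" "l > 0"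
 defines "F \<equiv> (\<lambda>u. (\<Sum>i\<le>K. of_bool (u \<in> class_interval K v i) * f i) - (\<Sum>i\<le>K. spacing K v i * f i))"
 shows "(\<integral>\<^sup>+u. ennreal (exp (l * F u)) \<partial>unif01) \<le> ennreal (exp (l\<^sup>2 * c\<^sup>2 / 8))"
  and "(\<integral>\<^sup>+u. ennreal (exp (- (l * F u))) \<partial>unif01) \<le> ennreal (exp (l\<^sup>2 * c\<^sup>2 / 8))"
proof -
 interpret U: prob_space unif01 by (rule prob_space_unif01)
 have [measurable]: "class_interval K v i \<in> sets borel" for i by (simp add: class_interval_def)
 let ?G = "\<lambda>u. \<Sum>i\<le>K. of_bool (u \<in> class_interval K v i) * f i"
 have meas: "?G \<in> borel_measurable unif01" by measurable
 interpret G: interval_bounded_random_variable unif01 ?G 0 c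
  by unfold_locales (rule meas, intro AE_I2 class_sum_range[OF assms(1-3)])
 interpret G': interval_bounded_random_variable unif01 "\<lambda>u. - ?G u" "- c" 0
  by unfold_locales (use meas in measurable, use class_sum_range[OF assms(1-3)] in \<open>simp only: atLeastAtMost_iff neg_le_iff_le neg_le_0_iff_le AE_I2\<close>)
 show "(\<integral>\<^sup>+u. ennreal (exp (l * F u)) \<partial>unif01) \<le> ennreal (exp (l\<^sup>2 * c\<^sup>2 / 8))"
  using G.Hoeffdings_lemma_nn_integral[OF assms(4)] unfolding F_def integral_class_sum[OF assms(1)] by simp
 show "(\<integral>\<^sup>+u. ennreal (exp (- (l * F u))) \<partial>unif01) \<le> ennreal (exp (l\<^sup>2 * c\<^sup>2 / 8))"
  using G'.Hoeffdings_lemma_nn_integral[OF assms(4)]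
  unfolding F_def Bochner_Integration.integral_minus integral_class_sum[OF assms(1)] by (simp add: algebra_simps)
qed

text \<open>Weights w may be chosen from the past before the next item is classified; the centered
  weighted class indicators are then martingale increments in an interval of length c. At scale r =
  sqrt m each factor from Hoeffding's lemma is exp(c^2 / (8 m)), and the product of m of them does
  not depend on m. The bound is uniform in the pivots.\<close>

lemma class_martingale_moment:
 fixes w :: "nat \<Rightarrow> (nat \<Rightarrow> real) \<Rightarrow> nat \<Rightarrow> real"
 assumes v: "generic_pivots K v"
  and range: "\<And>k a i. i \<le> K ==> 0 \<le> w k a i \<and> w k a i \<le> c" and c: "0 \<le> c"
  and dep: "\<And>k a a'. (\<And>j. j \<in> {1..<k} ==> a j = a' j) ==> w k a = w k a'"
  and meas: "\<And>k n i. 1 \<le> k ==> k \<le> n ==> i \<le> K ==> (\<lambda>a. w k a i) \<in> borel_measurable (item_measure n)"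
  and m: "m \<le> N" and p: "p \<ge> 1"
 shows "(\<integral>\<^sup>+a. ennreal (\<bar>\<Sum>k=1..m. (\<Sum>i\<le>K. of_bool (a k \<in> class_interval K v i) * w k a i)
   - (\<Sum>i\<le>K. spacing K v i * w k a i)\<bar> ^ p) \<partial>item_measure N) \<le> ennreal (2 * fact p * exp (c\<^sup>2 / 8) * sqrt (real m) ^ p)"
proof (cases "m = 0")
 case False
 define F where "F k a u = (\<Sum>i\<le>K. of_bool (u \<in> class_interval K v i) * w k a i) - (\<Sum>i\<le>K. spacing K v i * w k a i)" for k a u
 define r where "r = sqrt (real m)"
 have r: "r > 0" "r\<^sup>2 = real m" using False by (auto simp: r_def)
 define B where "B = exp ((1 / r)\<^sup>2 * c\<^sup>2 / 8)"
 have Bm: "B ^ m = exp (c\<^sup>2 / 8)"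
  using False r(2) by (simp add: B_def power_divide flip: exp_of_nat_mult)
 have [measurable]: "class_interval K v i \<in> sets borel" for i by (simp add: class_interval_def)
 have F_meas: "(\<lambda>a. F k a (a k)) \<in> borel_measurable (item_measure n)" if "1 \<le> k" "k \<le> n" for k n
 proof -
  have [measurable]: "(\<lambda>a. a k) \<in> borel_measurable (item_measure n)"
   using measurable_component_singleton[of k "{1..n}" "\<lambda>_. unif01"] that by simp
  have [measurable]: "(\<lambda>a. w k a i) \<in> borel_measurable (item_measure n)" if "i \<in> {..K}" for i
   using meas \<open>1 \<le> k\<close> \<open>k \<le> n\<close> that by auto
  show ?thesis unfolding F_def by measurable
 qed
 have F_meas': "F k a \<in> borel_measurable unif01" for k a
  unfolding F_def by measurable
 have F_dep: "F k a = F k a'" if "\<And>j. j \<in> {1..<k} ==> a j = a' j" for k a a'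
 proof -
  have "w k a = w k a'" by (rule dep) (rule that)
  then show ?thesis unfolding F_def by simp
 qed
 have "(\<integral>\<^sup>+a. ennreal (\<bar>\<Sum>k=1..m. F k a (a k)\<bar> ^ p) \<partial>item_measure N) \<le> ennreal (2 * fact p * B ^ m * r ^ p)"
 proof (rule moment_le_exp)
  show "(\<lambda>a. \<Sum>k=1..m. F k a (a k)) \<in> borel_measurable (item_measure N)"
   using m F_meas by (intro borel_measurable_sum) auto
  show "(\<integral>\<^sup>+a. ennreal (exp ((\<Sum>k=1..m. F k a (a k)) / r)) \<partial>item_measure N) \<le> ennreal (B ^ m)"
  proof -
   have "(\<integral>\<^sup>+a. ennreal (exp (\<Sum>k=1..m. 1 / r * F k a (a k))) \<partial>item_measure N) \<le> ennreal (B ^ m)"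
   proof (rule mgf_martingale[OF _ _ _ _ _ m])
    show "(\<integral>\<^sup>+u. ennreal (exp (1 / r * F k a u)) \<partial>unif01) \<le> ennreal B" for k a
     unfolding F_def B_def by (rule class_step_mgf(1)[OF v range c]) (use r in auto)
    show "(\<lambda>u. 1 / r * F k a u) = (\<lambda>u. 1 / r * F k a' u)" if "\<And>j. j \<in> {1..<k} ==> a j = a' j" for k a a'
     using F_dep[OF that] by simp
   qed (use F_meas F_meas' in \<open>auto simp: B_def\<close>)
   then show ?thesis by (simp add: sum_divide_distrib)
  qed
  show "(\<integral>\<^sup>+a. ennreal (exp (- ((\<Sum>k=1..m. F k a (a k)) / r))) \<partial>item_measure N) \<le> ennreal (B ^ m)"
  proof -
   have "(\<integral>\<^sup>+a. ennreal (exp (\<Sum>k=1..m. - (1 / r * F k a (a k)))) \<partial>item_measure N) \<le> ennreal (B ^ m)"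
   proof (rule mgf_martingale[OF _ _ _ _ _ m])
    show "(\<integral>\<^sup>+u. ennreal (exp (- (1 / r * F k a u))) \<partial>unif01) \<le> ennreal B" for k a
     unfolding F_def B_def by (rule class_step_mgf(2)[OF v range c]) (use r in auto)
    show "(\<lambda>u. - (1 / r * F k a u)) = (\<lambda>u. - (1 / r * F k a' u))" if "\<And>j. j \<in> {1..<k} ==> a j = a' j" for k a a'
     using F_dep[OF that] by simp
   qed (use F_meas F_meas' in \<open>auto simp: B_def\<close>)
   then show ?thesis by (simp add: sum_divide_distrib sum_negf)
  qed
 qed (use r in \<open>auto simp: B_def\<close>)
 then show ?thesis unfolding Bm by (simp add: F_def r_def)
qed (use p in \<open>simp add: power_0_left\<close>)

lemma class_count_moment:
 assumes v: "generic_pivots K v" and m: "m \<le> N" and p: "p \<ge> 1" and i: "i \<le> K"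
 shows "(\<integral>\<^sup>+a. ennreal (\<bar>real (class_count K v a m i) - real m * spacing K v i\<bar> ^ p) \<partial>item_measure N)
  \<le> ennreal (2 * fact p * exp (1 / 8) * sqrt (real m) ^ p)"
proof -
 have eq: "(\<Sum>j\<le>K. x j * of_bool (j = i)) = (x i :: real)" for x
  using i by (simp add: of_bool_def if_distrib cong: if_cong)
 show ?thesis
  using class_martingale_moment[of K v "\<lambda>_ _ j. of_bool (j = i)" 1, OF v _ _ _ _ m p]
  by (simp add: eq class_count_sum sum_subtractf)
qed

section \<open>Cost of classification with the selected trees\<close>

text \<open>Only one summand is nonzero, the one for the selected tree. The sum over all trees is
  kept because it matches \<open>partition_cost\<close> and makes measurability immediate.\<close>

definition selected_depth :: "nat \<Rightarrow> (nat tree \<times> nat tree) set \<Rightarrow> (nat \<Rightarrow> real) \<Rightarrow> nat \<Rightarrow> real" where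
 "selected_depth K r x i = (\<Sum>t\<in>class_trees K. of_bool (selected_tree K r x t) * real (leaf_depth t i))"

lemma selected_depth_eq:
 assumes "linear_order_on (class_trees K) r"
 obtains t where "selected_tree K r x t" "selected_depth K r x = (\<lambda>i. real (leaf_depth t i))"
proof -
 obtain t where t: "selected_tree K r x t" and uniq: "\<And>u. selected_tree K r x u ==> u = t"
  using selected_tree_exists[OF assms, of x] by blast
 have "selected_depth K r x i = real (leaf_depth t i)" for i
 proof -
  have "selected_depth K r x i = (\<Sum>u\<in>class_trees K. if u = t then real (leaf_depth t i) else 0)"
  proof -
   have "selected_tree K r x u \<longleftrightarrow> u = t" for u using t uniq by blast
   then show ?thesis unfolding selected_depth_def by (intro sum.cong) auto
  qed
  then show ?thesis using selected_tree_in[OF t] by (simp only: sum.delta[OF finite_class_trees] if_True)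
 qed
 then show ?thesis using that[OF t] by blast
qed

lemma measurable_selected_depth [measurable]:
 assumes [measurable]: "\<And>i. i \<le> K ==> (\<lambda>x. f x i) \<in> borel_measurable M"
 shows "(\<lambda>x. selected_depth K r (f x) j) \<in> borel_measurable M"
proof -
 have [measurable]: "Measurable.pred M (\<lambda>x. selected_tree K r (f x) t)" if "t \<in> class_trees K" for t
 proof -
  have eq: "selected_tree K r (f x) t \<longleftrightarrow> (\<forall>s\<in>class_trees K. tree_cost K t (f x) \<le> tree_cost K s (f x)) \<and>
    (\<forall>s\<in>class_trees K. (\<forall>u\<in>class_trees K. tree_cost K s (f x) \<le> tree_cost K u (f x)) \<longrightarrow> (t, s) \<in> r)" for x
   using that by (auto simp: selected_tree_def optimal_trees_def)
  show ?thesis unfolding eq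
   by (intro pred_intros_logic pred_intros_finite finite_class_trees) measurable
 qed
 show ?thesis unfolding selected_depth_def by measurable
qed

text \<open>If t is optimal for x and u is optimal for d, linearity of the cost gives q (l_t(d) -
  l_u(d)) <= l_u(x - q d) - l_t(x - q d). How ties are resolved is irrelevant here: only optimality
  of t for x enters.\<close>

lemma tree_regret:
 assumes "selected_tree K r x t" and "q \<ge> 0"
 shows "\<bar>q * (tree_cost K t d - opt_cost K d)\<bar> \<le> 2 * real K * (\<Sum>i\<le>K. \<bar>x i - q * d i\<bar>)"
proof -
 obtain u where u: "u \<in> class_trees K" "opt_cost K d = tree_cost K u d" by (rule opt_cost_attained)
 have t: "t \<in> class_trees K" by (rule selected_tree_in[OF assms(1)])
 have cost: "\<bar>tree_cost K s (\<lambda>i. x i - q * d i)\<bar> \<le> real K * (\<Sum>i\<le>K. \<bar>x i - q * d i\<bar>)"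
  if "s \<in> class_trees K" for s
 proof -
  have "\<bar>tree_cost K s (\<lambda>i. x i - q * d i)\<bar> \<le> (\<Sum>i\<le>K. \<bar>(x i - q * d i) * real (leaf_depth s i)\<bar>)"
   unfolding tree_cost_def by (rule sum_abs)
  also have "... \<le> (\<Sum>i\<le>K. \<bar>x i - q * d i\<bar> * real K)"
   using leaf_depth_le[OF that] by (intro sum_mono) (simp add: abs_mult mult_left_mono)
  finally show ?thesis by (simp add: sum_distrib_left mult.commute)
 qed
 have lin: "tree_cost K s (\<lambda>i. x i - q * d i) = tree_cost K s x - q * tree_cost K s d" for s
  by (simp add: tree_cost_def sum_subtractf sum_distrib_left algebra_simps)
 have "tree_cost K t x \<le> tree_cost K u x"
  using opt_cost_le[OF u(1)] selected_tree_opt[OF assms(1)] by simp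
 moreover have "opt_cost K d \<le> tree_cost K t d" by (rule opt_cost_le[OF t])
 then have "0 \<le> q * (tree_cost K t d - opt_cost K d)" using assms(2) by simp
 ultimately show ?thesis
  using cost[OF t] cost[OF u(1)] unfolding lin u(2) by (simp add: algebra_simps)
qed

lemma weighted_power_sum_le:
 fixes w y :: "'i \<Rightarrow> real"
 assumes "finite S" "\<And>i. i \<in> S ==> w i \<ge> 0" "\<And>i. i \<in> S ==> y i \<ge> 0" "p \<ge> 1" "(\<Sum>i\<in>S. w i) > 0"
 shows "(\<Sum>i\<in>S. w i * y i) ^ p \<le> (\<Sum>i\<in>S. w i) ^ (p - 1) * (\<Sum>i\<in>S. w i * y i ^ p)"
proof -
 define W where "W = (\<Sum>i\<in>S. w i)"
 have W: "W > 0" using assms by (simp add: W_def)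
 have S: "S \<noteq> {}" using assms(5) by auto
 have conv: "convex_on {0::real..} (\<lambda>x. x ^ p)"
  using convex_power_even[of p] convex_power_odd[of p] convex_on_subset[of UNIV "\<lambda>x::real. x ^ p" "{0..}"]
  by (cases "even p") auto
 have "(\<Sum>i\<in>S. (w i / W) *\<^sub>R y i) ^ p \<le> (\<Sum>i\<in>S. (w i / W) * y i ^ p)"
  by (rule convex_on_sum[OF assms(1) S conv]) (use assms W in \<open>auto simp: W_def simp flip: sum_divide_distrib\<close>)
 then have "((\<Sum>i\<in>S. w i * y i) / W) ^ p \<le> (\<Sum>i\<in>S. w i * y i ^ p) / W"
  by (simp add: sum_divide_distrib)
 then have "(\<Sum>i\<in>S. w i * y i) ^ p \<le> (\<Sum>i\<in>S. w i * y i ^ p) / W * W ^ p"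
  using W by (simp add: power_divide field_simps)
 also have "... = W ^ (p - 1) * (\<Sum>i\<in>S. w i * y i ^ p)"
  using W assms(4) by (simp add: power_diff field_simps)
 finally show ?thesis by (simp add: W_def)
qed

definition partition_steps ::
  "nat \<Rightarrow> (nat tree \<times> nat tree) set \<Rightarrow> nat \<Rightarrow> (nat \<Rightarrow> real) \<Rightarrow> (nat \<Rightarrow> real) \<Rightarrow> real" where
 "partition_steps K r N v a = (\<Sum>k=1..N. \<Sum>i\<le>K. of_bool (a k \<in> class_interval K v i)
   * selected_depth K r (\<lambda>i. real (class_count K v a (k - 1) i) + 1) i)"

lemma partition_cost_eq:
 "partition_cost K r s n v a = partition_steps K r (n - K) v a + real (comparisons s (map v [1..<Suc K]))"
proof -
 have "(\<Sum>t\<in>class_trees K. \<Sum>i\<le>K. of_bool (selected_tree K r x t) * of_bool (y \<in> class_interval K v i) * real (leaf_depth t i))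
   = (\<Sum>i\<le>K. of_bool (y \<in> class_interval K v i) * selected_depth K r x i)" for x y
  unfolding selected_depth_def sum_distrib_left by (subst sum.swap) (simp only: mult_ac)
 then show ?thesis unfolding partition_cost_def partition_steps_def by (simp only:)
qed

lemma selected_depth_bounds:
 assumes "linear_order_on (class_trees K) r"
 shows "0 \<le> selected_depth K r x i \<and> selected_depth K r x i \<le> real K"
proof -
 obtain t where "selected_tree K r x t" "selected_depth K r x = (\<lambda>i. real (leaf_depth t i))"
  by (rule selected_depth_eq[OF assms])
 then show ?thesis using leaf_depth_le[OF selected_tree_in] by auto
qed

abbreviation steps_dev :: "nat \<Rightarrow> (nat tree \<times> nat tree) set \<Rightarrow> nat \<Rightarrow> (nat \<Rightarrow> real) \<Rightarrow> (nat \<Rightarrow> real) \<Rightarrow> real" where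
 "steps_dev K r N v a \<equiv> \<bar>partition_steps K r N v a - real N * opt_cost K (spacing K v)\<bar>"

text \<open>A step costs the depth in the tree chosen from the past. Centering at the conditional
  means leaves a martingale. The conditional mean in step k exceeds l_opt(D) by the regret, at most
  1/k times the deviation of the counters, that is k^(-1/2) times a variable with bounded moments.
  As the sum of k^(-1/2) is at most 2 sqrt N, both parts have order sqrt N. The constant depends
  neither on N nor on the pivots.\<close>

lemma partition_steps_moment:
 assumes lin: "linear_order_on (class_trees K) r" and p: "p \<ge> 1"
 shows "\<exists>C\<ge>0. \<forall>N v. generic_pivots K v \<longrightarrow>
  (\<integral>\<^sup>+a. ennreal (steps_dev K r N v a ^ p) \<partial>item_measure N)
   \<le> ennreal (C * sqrt (real N) ^ p)"
proof -
 define c where "c = 2 * fact p * exp (1 / 8) + (1::real)"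
 define B where "B = (2 * real K) ^ p * real (K + 1) ^ p * real (K + 1) * 2 ^ p * c"
 define A where "A = 2 * fact p * exp ((real K)\<^sup>2 / 8)"
 have c0: "c \<ge> 0" and B0: "B \<ge> 0" and A0: "A \<ge> 0" by (simp_all add: c_def B_def A_def)
 show ?thesis
 proof (intro exI[of _ "2 ^ p * (A + 2 ^ p * B)"] conjI allI impI)
  show "0 \<le> 2 ^ p * (A + 2 ^ p * B)" using A0 B0 by simp
  fix N v assume v: "generic_pivots K v"
 let ?I = "\<lambda>f. \<integral>\<^sup>+a. ennreal (f a ^ p) \<partial>item_measure N"
  define D where "D = spacing K v"
  define w where "w k a = selected_depth K r (\<lambda>i. real (class_count K v a (k - 1) i) + 1)" for k a
  define mart where "mart a = (\<Sum>k=1..N. (\<Sum>i\<le>K. of_bool (a k \<in> class_interval K v i) * w k a i) - (\<Sum>i\<le>K. D i * w k a i))" for a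
  \<comment> \<open>The counters' deviation before step k on the scale sqrt k, with the factor of
    \<open>tree_regret\<close>. The added 1 pays for the counters being increased by one and for
    comparing with k D_i in place of (k-1) D_i.\<close>
  define y where "y k a = 2 * real K / sqrt (real k) * (\<Sum>i\<le>K. \<bar>real (class_count K v a (k - 1) i) - real (k - 1) * D i\<bar> + 1)" for k a
  define T where "T a = (\<Sum>k=1..N. real k powr (- 1 / 2) * y k a)" for a
 let ?s = "\<lambda>a. \<Sum>k=1..N. ennreal (real k powr (- 1 / 2)) * ennreal (y k a ^ p)"
  have a_meas: "(\<lambda>a. a k) \<in> borel_measurable (item_measure n)" if "k \<in> {1..n}" for k n
   using measurable_component_singleton[of k "{1..n}" "\<lambda>_. unif01"] that by simp
  have count_meas[measurable]: "(\<lambda>a. class_count K v a m i) \<in> measurable (item_measure n) (count_space UNIV)" if "m \<le> n" for m n i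
   using that by (intro measurable_class_count a_meas) auto
  have w_meas: "(\<lambda>a. w k a i) \<in> borel_measurable (item_measure n)" if "1 \<le> k" "k \<le> n" for k n i
  proof -
   have [measurable]: "(\<lambda>a. class_count K v a (k - 1) i) \<in> measurable (item_measure n) (count_space UNIV)" for i
    by (rule count_meas) (use that in auto)
   show ?thesis unfolding w_def by measurable
  qed
  have decomp: "\<bar>partition_steps K r N v a - real N * opt_cost K D\<bar> \<le> \<bar>mart a\<bar> + T a" for a
  proof -
   have step: "\<bar>(\<Sum>i\<le>K. D i * w k a i) - opt_cost K D\<bar> \<le> real k powr (- 1 / 2) * y k a" if k: "k \<in> {1..N}" for k
   proof -
    obtain t where t: "selected_tree K r (\<lambda>i. real (class_count K v a (k - 1) i) + 1) t" "w k a = (\<lambda>i. real (leaf_depth t i))"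
     unfolding w_def by (rule selected_depth_eq[OF lin])
    have k0: "real k > 0" using k by simp
    have "\<bar>real k * (tree_cost K t D - opt_cost K D)\<bar>
      \<le> 2 * real K * (\<Sum>i\<le>K. \<bar>real (class_count K v a (k - 1) i) + 1 - real k * D i\<bar>)"
     by (rule tree_regret[OF t(1)]) simp
    also have "... \<le> 2 * real K * (\<Sum>i\<le>K. \<bar>real (class_count K v a (k - 1) i) - real (k - 1) * D i\<bar> + 1)"
    proof (intro mult_left_mono sum_mono)
     fix i assume "i \<in> {..K}"
     then have "0 < D i" "D i \<le> 1" using spacing_pos[OF v] spacing_le_1[OF v] by (auto simp: D_def)
     moreover have "real k * D i = real (k - 1) * D i + D i" using k by (cases k) (auto simp: algebra_simps)
     ultimately show "\<bar>real (class_count K v a (k - 1) i) + 1 - real k * D i\<bar>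
       \<le> \<bar>real (class_count K v a (k - 1) i) - real (k - 1) * D i\<bar> + 1" by linarith
    qed simp
    also have "... = sqrt (real k) * y k a" using k0 by (simp add: y_def)
    finally have "real k * \<bar>tree_cost K t D - opt_cost K D\<bar> \<le> ..." by (simp add: abs_mult)
    then have "\<bar>tree_cost K t D - opt_cost K D\<bar> \<le> sqrt (real k) / real k * y k a" using k0 by (simp add: field_simps)
    also have "sqrt (real k) / real k = real k powr (- 1 / 2)"
    proof -
     have "real k powr (- (1 / 2)) = inverse (sqrt (real k))"
      using k0 by (simp only: powr_minus powr_half_sqrt[OF less_imp_le])
     moreover have "sqrt (real k) / real k = inverse (sqrt (real k))"
      using k0 real_sqrt_mult_self[of "real k"] by (simp add: field_simps)
     ultimately show ?thesis by simp
    qed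
    finally show ?thesis by (simp add: t(2) tree_cost_def)
   qed
   have "partition_steps K r N v a - real N * opt_cost K D
     = mart a + (\<Sum>k=1..N. (\<Sum>i\<le>K. D i * w k a i) - opt_cost K D)"
    by (simp add: partition_steps_def mart_def w_def sum_subtractf)
   also have "\<bar>...\<bar> \<le> \<bar>mart a\<bar> + (\<Sum>k=1..N. \<bar>(\<Sum>i\<le>K. D i * w k a i) - opt_cost K D\<bar>)"
    by (rule order_trans[OF abs_triangle_ineq add_left_mono[OF sum_abs]])
   also have "... \<le> \<bar>mart a\<bar> + T a" unfolding T_def by (intro add_left_mono sum_mono step)
   finally show ?thesis .
  qed
  have mart: "(\<integral>\<^sup>+a. ennreal (\<bar>mart a\<bar> ^ p) \<partial>item_measure N) \<le> ennreal (A * sqrt (real N) ^ p)"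
   unfolding mart_def A_def D_def
  proof (rule class_martingale_moment[OF v _ _ _ _ _ p])
   show "w k a = w k a'" if *: "\<And>j. j \<in> {1..<k} ==> a j = a' j" for k a a'
   proof -
    have "class_count K v a (k - 1) i = class_count K v a' (k - 1) i" for i
     by (rule class_count_cong) (use * in auto)
    then show ?thesis by (simp add: w_def)
   qed
  qed (use w_meas selected_depth_bounds[OF lin] in \<open>auto simp: w_def\<close>)
  have y_meas: "y k \<in> borel_measurable (item_measure N)" if "k \<in> {1..N}" for k
  proof -
   have [measurable]: "(\<lambda>a. class_count K v a (k - 1) i) \<in> measurable (item_measure N) (count_space UNIV)" for i
    by (rule count_meas) (use that in auto)
   show ?thesis unfolding y_def by measurable
  qed
  have y0: "y k a \<ge> 0" for k a by (auto simp: y_def intro!: mult_nonneg_nonneg sum_nonneg divide_nonneg_nonneg)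
  have y: "?I (y k) \<le> ennreal B" if k: "k \<in> {1..N}" for k
  proof -
   interpret P: prob_space "item_measure N" by (rule prob_space_item_measure)
   define x where "x i a = \<bar>real (class_count K v a (k - 1) i) - real (k - 1) * D i\<bar>" for i a
   have [measurable]: "x i \<in> borel_measurable (item_measure N)" for i
   proof -
    have [measurable]: "(\<lambda>a. class_count K v a (k - 1) i) \<in> measurable (item_measure N) (count_space UNIV)" for i
     by (rule count_meas) (use k in auto)
    show ?thesis unfolding x_def by measurable
   qed
   have k0: "real k > 0" using k by simp
   define b where "b = (2 * real K / sqrt (real k)) ^ p * (real (K + 1) ^ p * 2 ^ p)"
   have b0: "b \<ge> 0" by (simp add: b_def)
   have pt: "y k a ^ p \<le> b * (\<Sum>i\<le>K. x i a ^ p + 1)" for a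
   proof -
    have "(\<Sum>i\<le>K. x i a + 1) ^ p \<le> real (K + 1) ^ p * (\<Sum>i\<le>K. (x i a + 1) ^ p)"
     using power_sum_le_card[of "{..K}" "\<lambda>i. x i a + 1" p] p by (simp add: x_def)
    also have "(\<Sum>i\<le>K. (x i a + 1) ^ p) \<le> (\<Sum>i\<le>K. 2 ^ p * (x i a ^ p + 1))"
     using power_add_le[of "x _ a" 1 1 p] by (intro sum_mono) (simp add: x_def algebra_simps)
    finally have "(\<Sum>i\<le>K. x i a + 1) ^ p \<le> real (K + 1) ^ p * (2 ^ p * (\<Sum>i\<le>K. x i a ^ p + 1))"
     by (simp add: sum_distrib_left mult_left_mono)
    then have "(2 * real K / sqrt (real k)) ^ p * (\<Sum>i\<le>K. x i a + 1) ^ p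
      \<le> (2 * real K / sqrt (real k)) ^ p * (real (K + 1) ^ p * (2 ^ p * (\<Sum>i\<le>K. x i a ^ p + 1)))"
     by (intro mult_left_mono) auto
    moreover have "y k a ^ p = (2 * real K / sqrt (real k)) ^ p * (\<Sum>i\<le>K. x i a + 1) ^ p"
     by (simp only: y_def x_def power_mult_distrib)
    ultimately show ?thesis by (simp only: b_def mult.assoc)
   qed
   have xm: "?I (x i) + 1 \<le> ennreal (c * sqrt (real k) ^ p)" if "i \<le> K" for i
   proof -
    have "?I (x i) \<le> ennreal (2 * fact p * exp (1 / 8) * sqrt (real (k - 1)) ^ p)"
     unfolding x_def D_def by (rule class_count_moment[OF v _ p that]) (use k in auto)
    also have "... \<le> ennreal (2 * fact p * exp (1 / 8) * sqrt (real k) ^ p)"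
     by (intro ennreal_leI mult_left_mono power_mono) auto
    finally have "?I (x i) + ennreal 1
      \<le> ennreal (2 * fact p * exp (1 / 8) * sqrt (real k) ^ p) + ennreal (sqrt (real k) ^ p)"
     using k by (intro add_mono ennreal_leI) auto
    then show ?thesis by (simp add: c_def algebra_simps flip: ennreal_plus)
   qed
   have "?I (y k)
     \<le> (\<integral>\<^sup>+a. ennreal b * (\<Sum>i\<le>K. ennreal (x i a ^ p) + 1) \<partial>item_measure N)"
   proof (rule nn_integral_mono)
    fix a
    have "ennreal (y k a ^ p) \<le> ennreal (b * (\<Sum>i\<le>K. x i a ^ p + 1))" by (intro ennreal_leI pt)
    also have "... = ennreal b * (\<Sum>i\<le>K. ennreal (x i a ^ p) + 1)"
     using b0 by (subst ennreal_mult) (auto simp: x_def sum_nonneg simp flip: sum_ennreal ennreal_1)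
    finally show "ennreal (y k a ^ p) \<le> ..." .
   qed
   also have "... = ennreal b * (\<Sum>i\<le>K. ?I (x i) + 1)"
   proof -
    have "(\<integral>\<^sup>+a. ennreal b * (\<Sum>i\<le>K. ennreal (x i a ^ p) + 1) \<partial>item_measure N)
      = ennreal b * (\<integral>\<^sup>+a. (\<Sum>i\<le>K. ennreal (x i a ^ p) + 1) \<partial>item_measure N)"
     by (rule nn_integral_cmult) measurable
    also have "(\<integral>\<^sup>+a. (\<Sum>i\<le>K. ennreal (x i a ^ p) + 1) \<partial>item_measure N)
      = (\<Sum>i\<le>K. \<integral>\<^sup>+a. ennreal (x i a ^ p) + 1 \<partial>item_measure N)"
     by (rule nn_integral_sum) measurable
    also have "... = (\<Sum>i\<le>K. ?I (x i) + 1)"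
     by (intro sum.cong refl, subst nn_integral_add) (simp_all only: P.nn_integral_prob_const, measurable)
    finally show ?thesis .
   qed
   also have "... \<le> ennreal b * (\<Sum>i\<le>K. ennreal (c * sqrt (real k) ^ p))"
    by (intro mult_left_mono sum_mono xm) auto
   also have "... = ennreal (b * (real (K + 1) * (c * sqrt (real k) ^ p)))"
    using b0 c0 by (simp add: ennreal_mult ennreal_of_nat_eq_real_of_nat)
   also have "b * (real (K + 1) * (c * sqrt (real k) ^ p)) = B"
    using k0 by (simp add: b_def B_def power_divide field_simps)
   finally show ?thesis .
  qed
  define W where "W = (\<Sum>k=1..N. real k powr (- 1 / 2))"
  have W0: "W \<ge> 0" by (simp add: W_def sum_nonneg)
  have W: "W \<le> 2 * sqrt (real N)"
   using sum_powr_le[of "1 / 2" N] by (simp add: W_def powr_half_sqrt)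
  have T0: "T a \<ge> 0" for a unfolding T_def using y0 by (intro sum_nonneg mult_nonneg_nonneg) auto
  have T: "?I T \<le> ennreal (2 ^ p * B * sqrt (real N) ^ p)"
  proof (cases "N = 0")
   case False
   then have W1: "W > 0" unfolding W_def by (intro sum_pos) auto
   have "?I T
     \<le> (\<integral>\<^sup>+a. ennreal (W ^ (p - 1)) * ?s a \<partial>item_measure N)"
   proof (rule nn_integral_mono)
    fix a
    \<comment> \<open>Jensen with the weights k^(-1/2): only the p-th moments of the single
      \<open>y k\<close> are needed, although these are dependent.\<close>
    have "T a ^ p \<le> W ^ (p - 1) * (\<Sum>k=1..N. real k powr (- 1 / 2) * y k a ^ p)"
     unfolding T_def W_def by (rule weighted_power_sum_le) (use y0 p W1 in \<open>auto simp: W_def\<close>)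
    then have "ennreal (T a ^ p) \<le> ennreal (W ^ (p - 1) * (\<Sum>k=1..N. real k powr (- 1 / 2) * y k a ^ p))"
     by (rule ennreal_leI)
    also have "... = ennreal (W ^ (p - 1)) * ?s a"
     using W0 y0 by (simp add: ennreal_mult sum_nonneg flip: sum_ennreal)
    finally show "ennreal (T a ^ p) \<le> ..." .
   qed
   also have "... = ennreal (W ^ (p - 1)) * (\<Sum>k=1..N. ennreal (real k powr (- 1 / 2)) * ?I (y k))"
   proof -
    have *: "(\<lambda>a. ennreal (real k powr (- 1 / 2)) * ennreal (y k a ^ p)) \<in> borel_measurable (item_measure N)" if "k \<in> {1..N}" for k
     using y_meas[OF that] by measurable
    have "(\<integral>\<^sup>+a. ennreal (W ^ (p - 1)) * ?s a \<partial>item_measure N)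
      = ennreal (W ^ (p - 1)) * (\<integral>\<^sup>+a. ?s a \<partial>item_measure N)"
     by (rule nn_integral_cmult) (rule borel_measurable_sum, rule *)
    also have "(\<integral>\<^sup>+a. ?s a \<partial>item_measure N)
      = (\<Sum>k=1..N. \<integral>\<^sup>+a. ennreal (real k powr (- 1 / 2)) * ennreal (y k a ^ p) \<partial>item_measure N)"
     by (rule nn_integral_sum) (rule *)
    also have "... = (\<Sum>k=1..N. ennreal (real k powr (- 1 / 2)) * ?I (y k))"
    proof (rule sum.cong[OF refl], rule nn_integral_cmult)
     fix k assume "k \<in> {1..N}"
     from y_meas[OF this] show "(\<lambda>a. ennreal (y k a ^ p)) \<in> borel_measurable (item_measure N)" by measurable
    qed
    finally show ?thesis .
   qed
   also have "... \<le> ennreal (W ^ (p - 1)) * (\<Sum>k=1..N. ennreal (real k powr (- 1 / 2)) * ennreal B)"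
    by (intro mult_left_mono sum_mono y) auto
   also have "... = ennreal (W ^ (p - 1) * (W * B))"
   proof -
    have "(\<Sum>k=1..N. ennreal (real k powr (- 1 / 2)) * ennreal B) = (\<Sum>k=1..N. ennreal (real k powr (- 1 / 2) * B))"
     using B0 by (intro sum.cong refl ennreal_mult[symmetric]) auto
    also have "... = ennreal (W * B)"
     unfolding W_def sum_distrib_right using B0 by (intro sum_ennreal) auto
    finally show ?thesis using W0 B0 by (simp only: ennreal_mult zero_le_power mult_nonneg_nonneg)
   qed
   also have "... \<le> ennreal (2 ^ p * B * sqrt (real N) ^ p)"
   proof (rule ennreal_leI)
    have "W ^ (p - 1) * (W * B) = W ^ p * B" using p by (cases p) auto
    also have "... \<le> (2 * sqrt (real N)) ^ p * B" using W W0 B0 by (intro mult_right_mono power_mono) auto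
    finally show "W ^ (p - 1) * (W * B) \<le> 2 ^ p * B * sqrt (real N) ^ p" by (simp add: power_mult_distrib mult_ac)
   qed
   finally show ?thesis .
  qed (use p in \<open>simp add: T_def power_0_left\<close>)
  have mart_meas: "mart \<in> borel_measurable (item_measure N)"
  proof -
   have [measurable]: "(\<lambda>a. w k a i) \<in> borel_measurable (item_measure N)" if "k \<in> {1..N}" for k i using w_meas that by auto
   have [measurable]: "(\<lambda>a. a k) \<in> borel_measurable (item_measure N)" if "k \<in> {1..N}" for k using a_meas that .
   have [measurable]: "class_interval K v i \<in> sets borel" for i by (simp add: class_interval_def)
   show ?thesis unfolding mart_def by measurable
  qed
  have T_meas: "T \<in> borel_measurable (item_measure N)"
   unfolding T_def by (intro borel_measurable_sum borel_measurable_times borel_measurable_const y_meas)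
  have "(\<integral>\<^sup>+a. ennreal (steps_dev K r N v a ^ p) \<partial>item_measure N)
    \<le> (\<integral>\<^sup>+a. ennreal (2 ^ p) * (ennreal (\<bar>mart a\<bar> ^ p) + ennreal (T a ^ p)) \<partial>item_measure N)"
  proof (rule nn_integral_mono)
   fix a
   have "steps_dev K r N v a ^ p \<le> (\<bar>mart a\<bar> + T a) ^ p"
    using decomp[of a] by (intro power_mono) (auto simp: D_def)
   also have "... \<le> 2 ^ p * (\<bar>mart a\<bar> ^ p + T a ^ p)"
    using power_add_le[of "\<bar>mart a\<bar>" "T a" 1 p] T0 by (simp add: algebra_simps)
   finally have "ennreal (steps_dev K r N v a ^ p)
     \<le> ennreal (2 ^ p * (\<bar>mart a\<bar> ^ p + T a ^ p))" by (rule ennreal_leI)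
   then show "ennreal (steps_dev K r N v a ^ p)
     \<le> ennreal (2 ^ p) * (ennreal (\<bar>mart a\<bar> ^ p) + ennreal (T a ^ p))"
    using T0 by (simp add: ennreal_mult)
  qed
  also have "... = ennreal (2 ^ p) * ((\<integral>\<^sup>+a. ennreal (\<bar>mart a\<bar> ^ p) \<partial>item_measure N) + ?I T)"
   using mart_meas T_meas by (subst nn_integral_cmult) (auto simp: nn_integral_add)
  also have "... \<le> ennreal (2 ^ p) * (ennreal (A * sqrt (real N) ^ p) + ennreal (2 ^ p * B * sqrt (real N) ^ p))"
   by (intro mult_left_mono add_mono mart T) auto
  also have "... = ennreal (2 ^ p * (A + 2 ^ p * B) * sqrt (real N) ^ p)"
   using A0 B0 by (simp add: algebra_simps flip: ennreal_mult ennreal_plus)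
  finally show "(\<integral>\<^sup>+a. ennreal (steps_dev K r N v a ^ p) \<partial>item_measure N)
    \<le> ..." .
 qed
qed

text \<open>The height of the decision tree bounds the count on every input, in particular on lists
  of real pivots.\<close>

lemma comparisons_bounded: "\<exists>B. \<forall>xs :: 'a::linorder list. comparisons s xs \<le> B"
proof (induction s)
 case (Compare i j s t)
 then obtain B B' where "\<forall>xs :: 'a list. comparisons s xs \<le> B" "\<forall>xs :: 'a list. comparisons t xs \<le> B'" by blast
 then show ?case by (intro exI[of _ "Suc (max B B')"]) (auto simp: le_max_iff_disj)
qed simp

section \<open>The law of the spacings and of the sublist sizes\<close>

lemma prob_space_pivot_measure: "prob_space (pivot_measure K)"
 by (intro prob_space_PiM prob_space_unif01)

lemma measurable_coord [measurable]:
 "i \<in> I ==> (\<lambda>v. v i) \<in> borel_measurable (\<Pi>\<^sub>M i\<in>I. unif01)"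
 using measurable_component_singleton[of i I "\<lambda>_. unif01"] by simp

lemma pivot_spacing_measurable: "(\<lambda>v. spacing K v i) \<in> borel_measurable (pivot_measure K)"
 by (rule measurable_spacing[of K "\<lambda>v. v"]) (rule measurable_coord)

lemma AE_unif01_neq: "AE y in unif01. y \<noteq> c"
proof (rule AE_I[where N = "{c}"])
 show "emeasure unif01 {c} = 0"
 proof -
  have "emeasure lborel ({0..1} \<inter> {c}) = 0"
   by (rule countable_imp_null_set_lborel[THEN null_setsD1]) simp
  then show ?thesis by (subst emeasure_uniform_measure) simp_all
 qed
qed auto

lemma AE_unif01_interior: "AE y in unif01. y \<in> {0<..<1}"
proof -
 have "AE y in unif01. y \<in> {0..1}" by (rule AE_uniform_measureI) auto
 with AE_unif01_neq[of 0] AE_unif01_neq[of 1] show ?thesis by eventually_elim auto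
qed

text \<open>Integrating out coordinate i alone turns the event into a single point of the uniform
  law.\<close>

lemma AE_PiM_neq:
 assumes "finite I" "i \<in> I" "j \<in> I" "i \<noteq> j"
 shows "AE v in (\<Pi>\<^sub>M k\<in>I. unif01). v i \<noteq> (v j :: real)"
proof -
 interpret U: prob_space unif01 by (rule prob_space_unif01)
 interpret P: product_prob_space "\<lambda>_. unif01" "I - {i}" by unfold_locales
 have I: "I = insert i (I - {i})" using assms by auto
 have m: "(\<lambda>v. v i) \<in> borel_measurable (\<Pi>\<^sub>M k\<in>I. unif01)" "(\<lambda>v. v j) \<in> borel_measurable (\<Pi>\<^sub>M k\<in>I. unif01)"
  using measurable_coord[OF assms(2)] measurable_coord[OF assms(3)] by blast+
 have meas: "{v \<in> space (\<Pi>\<^sub>M k\<in>I. unif01). v i = v j} \<in> sets (\<Pi>\<^sub>M k\<in>I. unif01)"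
  by (rule borel_measurable_eq[OF m])
 have "emeasure (\<Pi>\<^sub>M k\<in>I. unif01) {v \<in> space (\<Pi>\<^sub>M k\<in>I. unif01). v i = v j}
   = (\<integral>\<^sup>+v. indicator {v \<in> space (\<Pi>\<^sub>M k\<in>I. unif01). v i = v j} v \<partial>(\<Pi>\<^sub>M k\<in>I. unif01))"
  by (rule nn_integral_indicator[OF meas, symmetric])
 also have "... = (\<integral>\<^sup>+v. of_bool (v i = v j) \<partial>(\<Pi>\<^sub>M k\<in>I. unif01))"
  by (intro nn_integral_cong) (simp add: indicator_def)
 also have "... = (\<integral>\<^sup>+x. \<integral>\<^sup>+y. of_bool ((x(i := y)) i = (x(i := y)) j) \<partial>unif01 \<partial>(\<Pi>\<^sub>M k\<in>I - {i}. unif01))"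
 proof (rule P.product_nn_integral_insert[of "I - {i}" i, unfolded I[symmetric]])
  show "(\<lambda>v. of_bool (v i = v j) :: ennreal) \<in> borel_measurable (\<Pi>\<^sub>M k\<in>I. unif01)"
  proof -
   show ?thesis unfolding of_bool_def by (rule measurable_If[OF _ _ meas]) simp_all
  qed
 qed (use assms in auto)
 also have "... = (\<integral>\<^sup>+x. 0 \<partial>(\<Pi>\<^sub>M k\<in>I - {i}. unif01))"
 proof (intro nn_integral_cong)
  fix x :: "'a \<Rightarrow> real"
  have "(\<integral>\<^sup>+y. of_bool ((x(i := y)) i = (x(i := y)) j) \<partial>unif01) = (\<integral>\<^sup>+y. 0 \<partial>unif01)"
  proof (rule nn_integral_cong_AE)
   show "AE y in unif01. of_bool ((x(i := y)) i = (x(i := y)) j) = (0::ennreal)"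
    using AE_unif01_neq[of "x j"] by eventually_elim (use assms in auto)
  qed
  then show "(\<integral>\<^sup>+y. of_bool ((x(i := y)) i = (x(i := y)) j) \<partial>unif01) = 0" by simp
 qed
 finally have "emeasure (\<Pi>\<^sub>M k\<in>I. unif01) {v \<in> space (\<Pi>\<^sub>M k\<in>I. unif01). v i = v j} = 0" by simp
 then show ?thesis by (intro AE_I[OF _ _ meas]) auto
qed

lemma AE_generic_pivots: "AE v in pivot_measure K. generic_pivots K v"
proof -
 have "AE v in pivot_measure K. v j \<in> {0<..<1}" if "j \<in> {1..K}" for j
  by (rule AE_PiM_component[OF prob_space_unif01 that AE_unif01_interior])
 note * = this
 have 1: "AE v in pivot_measure K. \<forall>j\<in>{1..K}. v j \<in> {0<..<1}"
  by (rule AE_finite_allI[OF finite_atLeastAtMost]) (rule *)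
 have "AE v in pivot_measure K. \<forall>i\<in>{1..K}. \<forall>j\<in>{1..K}. i \<noteq> j \<longrightarrow> v i \<noteq> v j"
  by (rule AE_finite_allI[OF finite_atLeastAtMost], rule AE_finite_allI[OF finite_atLeastAtMost], rule AE_impI)
   (rule AE_PiM_neq; simp)
 with 1 show ?thesis by eventually_elim (auto simp: generic_pivots_def inj_on_def)
qed

lemma AE_items_generic:
 fixes K :: nat
 shows "AE a in item_measure N. \<forall>k\<in>{1..N}. a k \<in> {0<..<1} - v ` {1..K}"
proof -
 have "AE y in unif01. y \<in> {0<..<1} - v ` {1..K}"
 proof -
  have "AE y in unif01. \<forall>j\<in>{1..K}. y \<noteq> v j" by (intro AE_finite_allI AE_unif01_neq) auto
  with AE_unif01_interior show ?thesis by eventually_elim auto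
 qed
 then have "AE a in item_measure N. a k \<in> {0<..<1} - v ` {1..K}" if "k \<in> {1..N}" for k
  by (rule AE_PiM_component[OF prob_space_unif01 that])
 note * = this
 show ?thesis by (rule AE_finite_allI[OF finite_atLeastAtMost]) (rule *)
qed

text \<open>For y = 0 or y a pivot: the spacing that begins at y exceeds x. In this form the pivots
  appear in their original order, so that their independence can be used; see
  \<open>sum_spacing_greater\<close>.\<close>

definition long_gap :: "nat \<Rightarrow> (nat \<Rightarrow> real) \<Rightarrow> real \<Rightarrow> real \<Rightarrow> bool" where
 "long_gap K v x y \<longleftrightarrow> y + x < 1 \<and> (\<forall>j\<in>{1..K}. v j \<notin> {y<..y + x})"

lemma spacing_greater_iff:
 assumes v: "generic_pivots K v" and i: "i \<le> K" and x: "x \<ge> 0"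
 shows "x < spacing K v i \<longleftrightarrow> long_gap K v x (pivot K v i)"
proof
 assume *: "x < spacing K v i"
 have "v j \<notin> {pivot K v i<..pivot K v i + x}" if j: "j \<in> {1..K}" for j
 proof
  assume "v j \<in> {pivot K v i<..pivot K v i + x}"
  then have u: "pivot K v i < v j" "v j < pivot K v (Suc i)" using * by (auto simp: spacing_def)
  obtain l where l: "l \<in> {1..K}" "v j = pivot K v l" using image_in_pivot[OF v j] by auto
  have "i < l" using u(1) l i strict_mono_onD[OF pivot_strict_mono[OF v], of l i] by (cases "l = i") force+
  moreover have "l < Suc i" using u(2) l i strict_mono_onD[OF pivot_strict_mono[OF v], of "Suc i" l] by (cases "l = Suc i") force+
  ultimately show False by simp
 qed
 moreover have "pivot K v i + x < 1"
  using * pivot_bounds(2)[OF v, of "Suc i"] i by (simp add: spacing_def)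
 ultimately show "long_gap K v x (pivot K v i)" by (simp add: long_gap_def)
next
 assume *: "long_gap K v x (pivot K v i)"
 show "x < spacing K v i"
 proof (cases "i = K")
  case True
  then show ?thesis using * by (simp add: long_gap_def spacing_def)
 next
  case False
  then have "Suc i \<in> {1..K}" using i by auto
  then obtain j where "j \<in> {1..K}" "pivot K v (Suc i) = v j"
   using pivot_in_image[OF v, of "Suc i"] by (metis imageE)
  then have "pivot K v (Suc i) \<notin> {pivot K v i<..pivot K v i + x}" using * by (auto simp: long_gap_def)
  then show ?thesis using spacing_pos[OF v i] by (simp add: spacing_def)
 qed
qed

lemma sum_spacing_greater:
 assumes v: "generic_pivots K v" and x: "x \<ge> 0"
 shows "(\<Sum>i\<le>K. of_bool (x < spacing K v i)) = of_bool (long_gap K v x 0) + (\<Sum>l\<in>{1..K}. of_bool (long_gap K v x (v l)) :: ennreal)"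
proof -
 obtain \<sigma> where \<sigma>: "bij_betw \<sigma> {1..K} {1..K}" "\<And>j. j \<in> {1..K} ==> pivot K v j = v (\<sigma> j)"
  using pivot_order[OF v] by metis
 have "(\<Sum>i\<le>K. of_bool (x < spacing K v i)) = (\<Sum>i\<le>K. of_bool (long_gap K v x (pivot K v i)) :: ennreal)"
  using spacing_greater_iff[OF v _ x] by (intro sum.cong) auto
 also have "... = of_bool (long_gap K v x 0) + (\<Sum>i\<in>{1..K}. of_bool (long_gap K v x (pivot K v i)))"
 proof -
  have "{..K} = insert 0 {1..K}" by auto
  then show ?thesis by simp
 qed
 also have "(\<Sum>i\<in>{1..K}. of_bool (long_gap K v x (pivot K v i))) = (\<Sum>i\<in>{1..K}. of_bool (long_gap K v x (v (\<sigma> i))) :: ennreal)"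
  using \<sigma>(2) by (intro sum.cong) auto
 also have "... = (\<Sum>l\<in>{1..K}. of_bool (long_gap K v x (v l)))"
  by (rule sum.reindex_bij_betw[OF \<sigma>(1)])
 finally show ?thesis .
qed

lemma nn_integral_avoid:
 assumes "0 \<le> x" "0 \<le> y" "y + x \<le> 1" and I: "finite I"
 shows "(\<integral>\<^sup>+v. of_bool (\<forall>j\<in>I. v j \<notin> {y<..y + x}) \<partial>(\<Pi>\<^sub>M j\<in>I. unif01)) = ennreal ((1 - x) ^ card I)"
proof -
 interpret U: prob_space unif01 by (rule prob_space_unif01)
 interpret P: product_prob_space "\<lambda>_. unif01" I by unfold_locales
 have m: "emeasure unif01 (- {y<..y + x}) = ennreal (1 - x)"
 proof -
  have "emeasure unif01 {y<..y + x} = ennreal x"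
  proof -
   have "{0..1} \<inter> {y<..y + x} = {y<..y + x}" using assms by auto
   then show ?thesis using assms by (subst emeasure_uniform_measure) (auto simp: divide_ennreal_def)
  qed
  then have "U.prob {y<..y + x} = x" using assms by (simp add: measure_def)
  then have "U.prob (- {y<..y + x}) = 1 - x" using U.prob_compl[of "{y<..y + x}"] by (simp add: Compl_eq_Diff_UNIV)
  then show ?thesis by (simp add: U.emeasure_eq_measure del: measure_uniform_measure)
 qed
 have "(\<integral>\<^sup>+v. of_bool (\<forall>j\<in>I. v j \<notin> {y<..y + x}) \<partial>(\<Pi>\<^sub>M j\<in>I. unif01))
   = (\<integral>\<^sup>+v. (\<Prod>j\<in>I. indicator (- {y<..y + x}) (v j)) \<partial>(\<Pi>\<^sub>M j\<in>I. unif01))"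
 proof (intro nn_integral_cong)
  fix v
  show "of_bool (\<forall>j\<in>I. v j \<notin> {y<..y + x}) = (\<Prod>j\<in>I. indicator (- {y<..y + x}) (v j) :: ennreal)"
  proof (cases "\<forall>j\<in>I. v j \<notin> {y<..y + x}")
   case True
   then show ?thesis by (simp add: indicator_def)
  next
   case False
   then obtain j where "j \<in> I" "v j \<in> {y<..y + x}" by blast
   then have "(\<Prod>j\<in>I. indicator (- {y<..y + x}) (v j) :: ennreal) = 0"
    using I by (intro prod_zero) (auto simp: indicator_def intro!: bexI[of _ j])
   then show ?thesis using False by simp
  qed
 qed
 also have "... = (\<Prod>j\<in>I. \<integral>\<^sup>+u. indicator (- {y<..y + x}) u \<partial>unif01)"
  by (rule P.product_nn_integral_prod[OF I]) (simp add: borel_measurable_indicator)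
 also have "... = ennreal (1 - x) ^ card I" using m by simp
 also have "... = ennreal ((1 - x) ^ card I)" using assms by (simp add: ennreal_power)
 finally show ?thesis .
qed

lemma measurable_long_gap:
 shows "i \<in> {1..K} ==> Measurable.pred (pivot_measure K) (\<lambda>v. long_gap K v x (v i))"
  and "Measurable.pred (pivot_measure K) (\<lambda>v. long_gap K v x 0)"
proof -
 let ?M = "pivot_measure K"
 have coord: "(\<lambda>v. v j) \<in> borel_measurable ?M" if "j \<in> {1..K}" for j
  using that by (rule measurable_coord)
 have "Measurable.pred ?M (\<lambda>v. long_gap K v x (f v))" if f: "f \<in> borel_measurable ?M" for f
 proof -
  have fx: "(\<lambda>v. f v + x) \<in> borel_measurable ?M" by (intro borel_measurable_add f borel_measurable_const)
  have "Measurable.pred ?M (\<lambda>v. \<not> (f v < v j \<and> \<not> f v + x < v j))" if "j \<in> {1..K}" for j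
   by (intro pred_intros_logic borel_measurable_pred_less f fx coord that)
  then have "Measurable.pred ?M (\<lambda>v. \<forall>j\<in>{1..K}. \<not> (f v < v j \<and> \<not> f v + x < v j))"
   by (rule pred_intros_finite(3)[OF finite_atLeastAtMost])
  moreover have "Measurable.pred ?M (\<lambda>v. f v + x < 1)"
   by (intro borel_measurable_pred_less fx borel_measurable_const)
  ultimately have "Measurable.pred ?M (\<lambda>v. f v + x < 1 \<and> (\<forall>j\<in>{1..K}. \<not> (f v < v j \<and> \<not> f v + x < v j)))"
   by (intro pred_intros_logic)
  then show ?thesis by (simp only: long_gap_def greaterThanAtMost_iff not_less)
 qed
 note * = this
 show "Measurable.pred ?M (\<lambda>v. long_gap K v x (v i))" if "i \<in> {1..K}"
  by (rule *[OF coord[OF that]])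
 show "Measurable.pred ?M (\<lambda>v. long_gap K v x 0)"
  by (rule *[OF borel_measurable_const])
qed

text \<open>The spacing at 0 exceeds x iff all K pivots avoid (0, x]. The spacing beginning at pivot
  l exceeds x iff that pivot is below 1 - x and the other K - 1 avoid an interval of length x. Each
  of the K + 1 events has probability (1-x)^K.\<close>

lemma spacing_tail:
 assumes K: "K \<ge> 1" and x: "0 \<le> x" "x < 1"
 shows "(\<integral>\<^sup>+v. (\<Sum>i\<le>K. of_bool (x < spacing K v i)) \<partial>pivot_measure K) = ennreal (real (K + 1) * (1 - x) ^ K)"
proof -
 let ?L = "\<lambda>l. \<integral>\<^sup>+v. of_bool (long_gap K v x (v l)) \<partial>pivot_measure K"
 interpret U: prob_space unif01 by (rule prob_space_unif01)
 have "(\<integral>\<^sup>+v. (\<Sum>i\<le>K. of_bool (x < spacing K v i)) \<partial>pivot_measure K)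
   = (\<integral>\<^sup>+v. of_bool (long_gap K v x 0) + (\<Sum>l\<in>{1..K}. of_bool (long_gap K v x (v l))) \<partial>pivot_measure K)"
  by (rule nn_integral_cong_AE, rule eventually_mono[OF AE_generic_pivots], rule sum_spacing_greater[OF _ x(1)])
 also have "... = (\<integral>\<^sup>+v. of_bool (long_gap K v x 0) \<partial>pivot_measure K)
   + (\<Sum>l\<in>{1..K}. ?L l)"
 proof -
  have m: "(\<lambda>v. of_bool (long_gap K v x (v l)) :: ennreal) \<in> borel_measurable (pivot_measure K)" if "l \<in> {1..K}" for l
   using measurable_long_gap(1)[OF that] by measurable
  have m0: "(\<lambda>v. of_bool (long_gap K v x 0) :: ennreal) \<in> borel_measurable (pivot_measure K)"
   using measurable_long_gap(2) by measurable
  have "(\<integral>\<^sup>+v. (\<Sum>l\<in>{1..K}. of_bool (long_gap K v x (v l)) :: ennreal) \<partial>pivot_measure K)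
    = (\<Sum>l\<in>{1..K}. ?L l)"
   by (rule nn_integral_sum) (rule m)
  moreover have "(\<lambda>v. \<Sum>l\<in>{1..K}. of_bool (long_gap K v x (v l)) :: ennreal) \<in> borel_measurable (pivot_measure K)"
   by (rule borel_measurable_sum) (rule m)
  ultimately show ?thesis using nn_integral_add[OF m0] by (simp only:)
 qed
 also have "(\<integral>\<^sup>+v. of_bool (long_gap K v x 0) \<partial>pivot_measure K) = ennreal ((1 - x) ^ K)"
 proof -
  have "long_gap K v x 0 \<longleftrightarrow> (\<forall>j\<in>{1..K}. v j \<notin> {0<..0 + x})" for v using x by (simp add: long_gap_def)
  then show ?thesis using nn_integral_avoid[of x 0 "{1..K}"] x by (simp only:) simp
 qed
 also have "(\<Sum>l\<in>{1..K}. ?L l) = (\<Sum>l\<in>{1..K}. ennreal ((1 - x) ^ K))"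
 proof (rule sum.cong[OF refl])
  fix l assume l: "l \<in> {1..K}"
  interpret P: product_prob_space "\<lambda>_. unif01" "{1..K} - {l}" by unfold_locales
  have I: "{1..K} = insert l ({1..K} - {l})" using l by auto
  define f where "f v = (of_bool (long_gap K v x (v l)) :: ennreal)" for v
  have f: "f \<in> borel_measurable (\<Pi>\<^sub>M k\<in>insert l ({1..K} - {l}). unif01)"
   unfolding f_def I[symmetric] using measurable_long_gap(1)[OF l] by measurable
  have inner: "(\<integral>\<^sup>+w. f (w(l := y)) \<partial>(\<Pi>\<^sub>M k\<in>{1..K} - {l}. unif01))
    = ennreal ((1 - x) ^ (K - 1)) * indicator {..<1 - x} y" if y: "y \<in> {0<..<1}" for y
  proof (cases "y + x < 1")
   case True
   have "f (w(l := y)) = of_bool (\<forall>j\<in>{1..K} - {l}. w j \<notin> {y<..y + x})" for w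
    unfolding f_def long_gap_def using True by (intro arg_cong[where f = of_bool]) auto
   then have "(\<integral>\<^sup>+w. f (w(l := y)) \<partial>(\<Pi>\<^sub>M k\<in>{1..K} - {l}. unif01)) = ennreal ((1 - x) ^ card ({1..K} - {l}))"
    using nn_integral_avoid[of x y "{1..K} - {l}"] True x y by (simp del: of_bool_eq_iff greaterThanAtMost_iff)
   moreover have "card ({1..K} - {l}) = K - 1" using l by simp
   ultimately show ?thesis using True by simp
  next
   case False
   then have "f (w(l := y)) = 0" for w by (simp add: f_def long_gap_def)
   then show ?thesis using False by simp
  qed
  have "(\<integral>\<^sup>+v. of_bool (long_gap K v x (v l)) \<partial>pivot_measure K) = (\<integral>\<^sup>+v. f v \<partial>(\<Pi>\<^sub>M k\<in>insert l ({1..K} - {l}). unif01))"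
   unfolding f_def I[symmetric] by (rule refl)
  also have "... = (\<integral>\<^sup>+y. (\<integral>\<^sup>+w. f (w(l := y)) \<partial>(\<Pi>\<^sub>M k\<in>{1..K} - {l}. unif01)) \<partial>unif01)"
   by (rule P.product_nn_integral_insert_rev[OF _ _ f]) auto
  also have "... = (\<integral>\<^sup>+y. ennreal ((1 - x) ^ (K - 1)) * indicator {..<1 - x} y \<partial>unif01)"
   by (rule nn_integral_cong_AE, rule eventually_mono[OF AE_unif01_interior]) (rule inner)
  also have "... = ennreal ((1 - x) ^ (K - 1)) * emeasure unif01 {..<1 - x}"
   by (subst nn_integral_cmult_indicator) auto
  also have "emeasure unif01 {..<1 - x} = ennreal (1 - x)"
  proof -
   have "{0..1} \<inter> {..<1 - x} = {0..<1 - x}" using x by auto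
   then show ?thesis using x by (subst emeasure_uniform_measure) (auto simp: divide_ennreal_def)
  qed
  also have "ennreal ((1 - x) ^ (K - 1)) * ennreal (1 - x) = ennreal ((1 - x) ^ K)"
  proof -
   have "(1 - x) ^ (K - 1) * (1 - x) = (1 - x) ^ K" using K by (cases K) simp_all
   then show ?thesis using x by (subst ennreal_mult[symmetric]) auto
  qed
  finally show "(\<integral>\<^sup>+v. of_bool (long_gap K v x (v l)) \<partial>pivot_measure K) = ..." .
 qed
 also have "ennreal ((1 - x) ^ K) + (\<Sum>l\<in>{1..K}. ennreal ((1 - x) ^ K)) = ennreal (real (K + 1) * (1 - x) ^ K)"
  using x by (simp add: ennreal_of_nat_eq_real_of_nat ennreal_mult[symmetric] algebra_simps flip: ennreal_plus)
 finally show ?thesis .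
qed

text \<open>The sum of the laws of all spacings is one finite measure with tails (K+1)(1-x)^K, and
  tails determine it. Only this sum is ever needed, so the law of a single spacing is not
  computed.\<close>

lemma spacing_law:
 fixes g :: "real \<Rightarrow> ennreal"
 assumes K: "K \<ge> 1" and g[measurable]: "g \<in> borel_measurable borel"
 shows "(\<integral>\<^sup>+v. (\<Sum>i\<le>K. g (spacing K v i)) \<partial>pivot_measure K)
  = (\<integral>\<^sup>+t. g t * ennreal (real (K + 1) * real K * (1 - t) ^ (K - 1) * indicator {0..1} t) \<partial>lborel)"
proof -
 let ?PC = "pivot_measure K \<Otimes>\<^sub>M count_space {..K}"
 interpret P: prob_space "pivot_measure K" by (rule prob_space_pivot_measure)
 interpret C: sigma_finite_measure "count_space {..K}" by (rule sigma_finite_measure_count_space_finite[OF finite_atMost])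
 define S where "S = (\<lambda>z. spacing K (fst z) (snd z))"
 have m: "S \<in> borel_measurable ?PC"
  unfolding S_def
 proof (rule measurable_compose_countable'[where I = "{..K}" and f = "\<lambda>i vi. spacing K (fst vi) i" and g = snd])
  show "(\<lambda>vi. spacing K (fst vi) i) \<in> borel_measurable ?PC" for i
   by (rule measurable_compose[OF measurable_fst pivot_spacing_measurable])
 qed simp_all
 \<comment> \<open>The sum of the K + 1 laws, realised as an image of the pivot measure times the
   counting measure on the indices.\<close>
 define \<nu> where "\<nu> = distr ?PC borel S"
 define \<rho> where "\<rho> = density lborel (\<lambda>t. ennreal (real (K + 1) * real K * (1 - t) ^ (K - 1) * indicator {0..1} t))"
 have \<nu>: "(\<integral>\<^sup>+t. h t \<partial>\<nu>) = (\<integral>\<^sup>+v. (\<Sum>i\<le>K. h (spacing K v i)) \<partial>pivot_measure K)"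
  if [measurable]: "h \<in> borel_measurable borel" for h :: "real \<Rightarrow> ennreal"
 proof -
  have hS: "(\<lambda>z. h (S z)) \<in> borel_measurable ?PC"
   by (rule measurable_compose[OF m that])
  have "(\<integral>\<^sup>+t. h t \<partial>\<nu>) = (\<integral>\<^sup>+z. h (S z) \<partial>?PC)"
   unfolding \<nu>_def by (rule nn_integral_distr[OF m]) (use that in simp)
  also have "... = (\<integral>\<^sup>+v. \<integral>\<^sup>+i. h (S (v, i)) \<partial>count_space {..K} \<partial>pivot_measure K)"
   by (rule C.nn_integral_fst[OF hS, symmetric])
  also have "... = (\<integral>\<^sup>+v. (\<Sum>i\<le>K. h (spacing K v i)) \<partial>pivot_measure K)"
   unfolding nn_integral_count_space_finite[OF finite_atMost] S_def fst_conv snd_conv by (rule refl)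
  finally show ?thesis .
 qed
 have tail\<nu>: "emeasure \<nu> {x<..} = (\<integral>\<^sup>+v. (\<Sum>i\<le>K. of_bool (x < spacing K v i)) \<partial>pivot_measure K)" for x
 proof -
  have "emeasure \<nu> {x<..} = (\<integral>\<^sup>+t. indicator {x<..} t \<partial>\<nu>)"
   by (rule nn_integral_indicator[symmetric]) (simp add: \<nu>_def)
  also have "... = (\<integral>\<^sup>+v. (\<Sum>i\<le>K. indicator {x<..} (spacing K v i)) \<partial>pivot_measure K)"
   by (rule \<nu>) (rule borel_measurable_indicator, rule borel_open, rule open_greaterThan)
  also have "... = (\<integral>\<^sup>+v. (\<Sum>i\<le>K. of_bool (x < spacing K v i)) \<partial>pivot_measure K)"
   by (intro nn_integral_cong sum.cong) (simp_all only: indicator_def greaterThan_iff)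
  finally show ?thesis .
 qed
 have tail\<rho>: "emeasure \<rho> {x<..} = ennreal (real (K + 1) * (1 - max 0 x) ^ K)" if "x < 1" for x
 proof -
  have "((\<lambda>t. real (K + 1) * real K * (1 - t) ^ (K - 1)) has_integral
    (- real (K + 1) * (1 - 1) ^ K) - (- real (K + 1) * (1 - max 0 x) ^ K)) {max 0 x..1}"
   by (rule fundamental_theorem_of_calculus)
    (use that in \<open>auto intro!: derivative_eq_intros simp: has_real_derivative_iff_has_vector_derivative[symmetric] algebra_simps\<close>)
  moreover have "(- real (K + 1) * (1 - 1) ^ K) - (- real (K + 1) * (1 - max 0 x) ^ K) = real (K + 1) * (1 - max 0 x) ^ K"
   using K by (simp add: power_0_left algebra_simps)
  ultimately have I: "((\<lambda>t. real (K + 1) * real K * (1 - t) ^ (K - 1)) has_integral (real (K + 1) * (1 - max 0 x) ^ K)) {max 0 x..1}"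
   by (simp only:)
  have "emeasure \<rho> {x<..} = (\<integral>\<^sup>+t. ennreal (real (K + 1) * real K * (1 - t) ^ (K - 1) * indicator {0..1} t) * indicator {x<..} t \<partial>lborel)"
   by (simp add: \<rho>_def emeasure_density)
  also have "... = (\<integral>\<^sup>+t. ennreal (indicator {max 0 x..1} t * (real (K + 1) * real K * (1 - t) ^ (K - 1))) \<partial>lborel)"
   by (rule nn_integral_cong_AE, rule eventually_mono[OF AE_lborel_singleton[of x]]) (auto simp: indicator_def)
  also have "... = ennreal (real (K + 1) * (1 - max 0 x) ^ K)"
   by (rule nn_integral_has_integral_lebesgue[OF _ I]) auto
  finally show ?thesis .
 qed
 have eq: "emeasure \<nu> {x<..} = emeasure \<rho> {x<..}" for x
 proof -
  consider "x < 0" | "0 \<le> x" "x < 1" | "x \<ge> 1" by linarith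
  then show ?thesis
  proof cases
   case 1
   have "emeasure \<nu> {x<..} = (\<integral>\<^sup>+v. of_nat (K + 1) \<partial>pivot_measure K)"
    unfolding tail\<nu>
   proof (rule nn_integral_cong_AE, rule eventually_mono[OF AE_generic_pivots])
    fix v assume v: "generic_pivots K v"
    have "(\<Sum>i\<le>K. of_bool (x < spacing K v i)) = (\<Sum>i\<le>K. 1 :: ennreal)"
     using spacing_pos[OF v] 1 by (intro sum.cong refl) (simp add: order.strict_trans[of x 0])
    then show "(\<Sum>i\<le>K. of_bool (x < spacing K v i)) = (of_nat (K + 1) :: ennreal)" by simp
   qed
   also have "... = ennreal (real (K + 1))"
    by (simp only: P.nn_integral_prob_const ennreal_of_nat_eq_real_of_nat)
   finally show ?thesis using 1 tail\<rho>[of x] by simp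
  next
   case 2
   then show ?thesis using spacing_tail[OF K 2] tail\<nu> tail\<rho>[of x] by simp
  next
   case 3
   have "emeasure \<nu> {x<..} = (\<integral>\<^sup>+v. 0 \<partial>pivot_measure K)"
    unfolding tail\<nu>
   proof (rule nn_integral_cong_AE, rule eventually_mono[OF AE_generic_pivots])
    fix v assume v: "generic_pivots K v"
    show "(\<Sum>i\<le>K. of_bool (x < spacing K v i)) = (0 :: ennreal)"
     using spacing_le_1[OF v] 3 by (intro sum.neutral) force
   qed
   moreover have "emeasure \<rho> {x<..} = (\<integral>\<^sup>+t. ennreal (real (K + 1) * real K * (1 - t) ^ (K - 1) * indicator {0..1} t) * indicator {x<..} t \<partial>lborel)"
    by (simp add: \<rho>_def emeasure_density)
   moreover have "... = (\<integral>\<^sup>+t. 0 \<partial>(lborel :: real measure))" by (rule nn_integral_cong) (use 3 in \<open>auto simp: indicator_def\<close>)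
   ultimately show ?thesis by simp
  qed
 qed
 have "\<nu> = \<rho>"
 proof (rule measure_eqI_lessThan)
  show "emeasure \<nu> {x<..} < \<infinity>" for x
  proof -
   have "emeasure \<nu> {x<..} \<le> (\<integral>\<^sup>+v. (\<Sum>i\<le>K. 1) \<partial>pivot_measure K)"
    unfolding tail\<nu> by (intro nn_integral_mono sum_mono) auto
   also have "... = (\<Sum>i\<le>K. 1)" by (simp only: P.nn_integral_prob_const)
   also have "... < \<infinity>" by (simp add: of_nat_less_top del: of_nat_Suc)
   finally show ?thesis .
  qed
 qed (simp_all add: eq, simp_all add: \<nu>_def \<rho>_def)
 have "(\<integral>\<^sup>+v. (\<Sum>i\<le>K. g (spacing K v i)) \<partial>pivot_measure K) = (\<integral>\<^sup>+t. g t \<partial>\<rho>)"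
  using \<nu>[OF g] \<open>\<nu> = \<rho>\<close> by (simp only:)
 also have "... = (\<integral>\<^sup>+t. ennreal (real (K + 1) * real K * (1 - t) ^ (K - 1) * indicator {0..1} t) * g t \<partial>lborel)"
  unfolding \<rho>_def by (rule nn_integral_density) (use g in simp_all)
 finally show ?thesis by (simp only: mult.commute[of "g _"])
qed

section \<open>Binomial and beta-binomial sublist sizes\<close>

text \<open>The expectation of f at a binomial variable with N trials and success probability
  x.\<close>

definition bernstein_sum :: "nat \<Rightarrow> (nat \<Rightarrow> real) \<Rightarrow> real \<Rightarrow> real" where
 "bernstein_sum N f x = (\<Sum>j\<le>N. real (N choose j) * x ^ j * (1 - x) ^ (N - j) * f j)"

lemma bernstein_sum_Suc:
 "bernstein_sum (Suc N) f x = x * bernstein_sum N (\<lambda>j. f (Suc j)) x + (1 - x) * bernstein_sum N f x"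
proof -
 define T where "T j = x ^ j * (1 - x) ^ (Suc N - j) * f j" for j
 have "bernstein_sum (Suc N) f x = (\<Sum>j\<le>Suc N. real (Suc N choose j) * T j)"
  by (simp add: bernstein_sum_def T_def mult.assoc)
 also have "... = T 0 + (\<Sum>j\<le>N. real (Suc N choose Suc j) * T (Suc j))"
  by (subst sum.atMost_Suc_shift) simp
 also have "(\<Sum>j\<le>N. real (Suc N choose Suc j) * T (Suc j)) = (\<Sum>j\<le>N. real (N choose j) * T (Suc j)) + (\<Sum>j\<le>N. real (N choose Suc j) * T (Suc j))"
  by (simp add: sum.distrib[symmetric] algebra_simps)
 also have "T 0 + ((\<Sum>j\<le>N. real (N choose j) * T (Suc j)) + (\<Sum>j\<le>N. real (N choose Suc j) * T (Suc j)))
   = (\<Sum>j\<le>N. real (N choose j) * T (Suc j)) + (\<Sum>j\<le>Suc N. real (N choose j) * T j)"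
 proof -
  have "(\<Sum>j\<le>Suc N. real (N choose j) * T j) = T 0 + (\<Sum>j\<le>N. real (N choose Suc j) * T (Suc j))"
   by (subst sum.atMost_Suc_shift) simp
  then show ?thesis by simp
 qed
 also have "(\<Sum>j\<le>Suc N. real (N choose j) * T j) = (1 - x) * bernstein_sum N f x"
  unfolding bernstein_sum_def sum_distrib_left
  by (simp add: binomial_eq_0) (rule sum.cong, simp_all add: T_def Suc_diff_le)
 also have "(\<Sum>j\<le>N. real (N choose j) * T (Suc j)) = x * bernstein_sum N (\<lambda>j. f (Suc j)) x"
  unfolding bernstein_sum_def sum_distrib_left by (rule sum.cong) (simp_all add: T_def)
 finally show ?thesis .
qed

lemma bernstein_sum_nonneg: "(\<And>j. f j \<ge> 0) ==> 0 \<le> x ==> x \<le> 1 ==> bernstein_sum N f x \<ge> 0"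
 unfolding bernstein_sum_def by (intro sum_nonneg mult_nonneg_nonneg) auto

lemma class_count_Suc:
 "class_count K v (a(Suc N := y)) (Suc N) i = class_count K v a N i + of_bool (y \<in> class_interval K v i)"
proof -
 have "real (class_count K v (a(Suc N := y)) (Suc N) i) = real (class_count K v a N i + of_bool (y \<in> class_interval K v i))"
  unfolding of_nat_add class_count_sum by simp
 then show ?thesis by (simp only: of_nat_eq_iff)
qed

lemma measurable_class_count_items:
 "m \<le> N ==> (\<lambda>a. class_count K v a m i) \<in> measurable (item_measure N) (count_space UNIV)"
 by (intro measurable_class_count measurable_coord) auto

text \<open>Given the pivots, each item falls into the i-th interval independently with probability
  D_i. Conditioning on the last item reproduces \<open>bernstein_sum_Suc\<close>.\<close>

lemma class_count_law:
 assumes v: "generic_pivots K v" and i: "i \<le> K" and f: "\<And>j. f j \<ge> 0"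
 shows "(\<integral>\<^sup>+a. ennreal (f (class_count K v a N i)) \<partial>item_measure N) = ennreal (bernstein_sum N f (spacing K v i))"
 using f
proof (induction N arbitrary: f)
 case 0
 interpret prob_space "item_measure 0" by (rule prob_space_item_measure)
 have "class_count K v a 0 i = 0" for a using class_count_le[of K v a 0 i] by simp
 then have "(\<integral>\<^sup>+a. ennreal (f (class_count K v a 0 i)) \<partial>item_measure 0) = ennreal (f 0) * emeasure (item_measure 0) (space (item_measure 0))"
  by simp
 also have "... = ennreal (f 0)" by (simp only: emeasure_space_1 mult_1_right)
 finally show ?case by (simp only: bernstein_sum_def) simp
next
 case (Suc N)
 define D where "D = spacing K v i"
 have D: "0 \<le> D" "D \<le> 1" using spacing_pos[OF v i] spacing_le_1[OF v i] by (auto simp: D_def)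
 interpret U: prob_space unif01 by (rule prob_space_unif01)
 interpret P: product_prob_space "\<lambda>_::nat. unif01" "{1..N}" by unfold_locales
 have ins: "{1..Suc N} = insert (Suc N) {1..N}" by auto
 define h where "h a = ennreal (f (class_count K v a (Suc N) i))" for a
 have h: "h \<in> borel_measurable (\<Pi>\<^sub>M i\<in>insert (Suc N) {1..N}. unif01)"
  unfolding h_def ins[symmetric]
  by (rule measurable_compose[OF measurable_class_count_items]) simp_all
 have inner: "(\<integral>\<^sup>+y. h (a(Suc N := y)) \<partial>unif01)
   = ennreal (D * f (Suc (class_count K v a N i)) + (1 - D) * f (class_count K v a N i))" for a
 proof -
  let ?c = "class_count K v a N i" and ?S = "class_interval K v i"
  have S: "?S \<in> sets unif01" "- ?S \<in> sets unif01" by (simp_all add: class_interval_def)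
  have m: "U.prob ?S = D" unfolding D_def by (rule measure_class_interval[OF v i])
  have m': "U.prob (- ?S) = 1 - D"
   using U.prob_compl[OF S(1)] m by (simp only: Compl_eq_Diff_UNIV space_uniform_measure space_lborel space_borel)
  have "(\<integral>\<^sup>+y. h (a(Suc N := y)) \<partial>unif01)
    = (\<integral>\<^sup>+y. ennreal (f (Suc ?c)) * indicator ?S y + ennreal (f ?c) * indicator (- ?S) y \<partial>unif01)"
   by (intro nn_integral_cong) (simp add: h_def class_count_Suc indicator_def)
  also have "... = ennreal (f (Suc ?c)) * emeasure unif01 ?S + ennreal (f ?c) * emeasure unif01 (- ?S)"
  proof -
   have m: "(\<lambda>y. ennreal c * indicator A y) \<in> borel_measurable unif01" if "A \<in> sets unif01" for c A
    by (intro borel_measurable_times_ennreal borel_measurable_const borel_measurable_indicator that)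
   show ?thesis
    by (simp only: nn_integral_add[OF m[OF S(1)] m[OF S(2)]] nn_integral_cmult_indicator[OF S(1)] nn_integral_cmult_indicator[OF S(2)])
  qed
  also have "... = ennreal (f (Suc ?c)) * ennreal D + ennreal (f ?c) * ennreal (1 - D)"
   by (simp only: U.emeasure_eq_measure m m')
  also have "... = ennreal (D * f (Suc ?c) + (1 - D) * f ?c)"
   using Suc.prems D by (simp add: ennreal_mult[symmetric] ennreal_plus[symmetric] mult.commute del: ennreal_plus)
  finally show ?thesis .
 qed
 have "(\<integral>\<^sup>+a. ennreal (f (class_count K v a (Suc N) i)) \<partial>item_measure (Suc N))
   = (\<integral>\<^sup>+a. h a \<partial>(\<Pi>\<^sub>M i\<in>insert (Suc N) {1..N}. unif01))"
  unfolding h_def ins by (rule refl)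
 also have "... = (\<integral>\<^sup>+a. (\<integral>\<^sup>+y. h (a(Suc N := y)) \<partial>unif01) \<partial>item_measure N)"
  by (rule P.product_nn_integral_insert[OF _ _ h]) auto
 also have "... = (\<integral>\<^sup>+a. ennreal D * ennreal (f (Suc (class_count K v a N i))) + ennreal (1 - D) * ennreal (f (class_count K v a N i)) \<partial>item_measure N)"
  unfolding inner using Suc.prems D by (simp add: ennreal_mult)
 also have "... = ennreal D * (\<integral>\<^sup>+a. ennreal (f (Suc (class_count K v a N i))) \<partial>item_measure N)
   + ennreal (1 - D) * (\<integral>\<^sup>+a. ennreal (f (class_count K v a N i)) \<partial>item_measure N)"
 proof -
  have m: "(\<lambda>a. ennreal (g (class_count K v a N i))) \<in> borel_measurable (item_measure N)" for g
   by (rule measurable_compose[OF measurable_class_count_items]) simp_all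
  note m1 = m[of "\<lambda>j. f (Suc j)"] and m2 = m[of f]
  show ?thesis
   unfolding nn_integral_cmult[OF m1, symmetric] nn_integral_cmult[OF m2, symmetric]
   by (rule nn_integral_add) (intro borel_measurable_times_ennreal m1 m2 borel_measurable_const)+
 qed
 also have "... = ennreal D * ennreal (bernstein_sum N (\<lambda>j. f (Suc j)) D) + ennreal (1 - D) * ennreal (bernstein_sum N f D)"
  unfolding D_def using Suc.IH[of "\<lambda>j. f (Suc j)"] Suc.IH[of f] Suc.prems by simp
 also have "... = ennreal (bernstein_sum (Suc N) f D)"
  unfolding bernstein_sum_Suc using D Suc.prems
  by (simp add: ennreal_mult[symmetric] bernstein_sum_nonneg ennreal_plus[symmetric] del: ennreal_plus)
 finally show ?case by (simp add: D_def)
qed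

lemma beta_integral:
 "(\<integral>\<^sup>+t. ennreal (t ^ j * (1 - t) ^ k * indicator {0..1} t) \<partial>lborel) = ennreal (fact j * fact k / fact (j + k + 1))"
proof -
 define b where "b = (fact j * fact k / fact (j + k + 1) :: real)"
 have "((\<lambda>t. t powr (real (j + 1) - 1) * (1 - t) powr (real (k + 1) - 1)) has_integral Beta (real (j + 1)) (real (k + 1))) {0..1}"
  by (rule has_integral_Beta_real) auto
 then have "((\<lambda>t. t ^ j * (1 - t) ^ k) has_integral Beta (real (j + 1)) (real (k + 1))) {0..1}"
  by (rule has_integral_spike_finite[where S = "{0, 1}", rotated 2]) (auto simp: powr_realpow)
 moreover have "Beta (real (j + 1)) (real (k + 1)) = b"
  using Gamma_fact[of j, where 'a = real] Gamma_fact[of k, where 'a = real] Gamma_fact[of "j + k + 1", where 'a = real]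
  by (simp add: Beta_def b_def algebra_simps)
 ultimately have I: "((\<lambda>t. t ^ j * (1 - t) ^ k) has_integral b) {0..1}" by (simp only:)
 have "(\<integral>\<^sup>+t. ennreal (t ^ j * (1 - t) ^ k * indicator {0..1} t) \<partial>lborel)
   = (\<integral>\<^sup>+t. ennreal (indicator {0..1} t * (t ^ j * (1 - t) ^ k)) \<partial>lborel)"
  by (simp only: mult.commute)
 also have "... = ennreal b"
  by (rule nn_integral_has_integral_lebesgue[OF _ I]) auto
 finally show ?thesis by (simp only: b_def)
qed

lemma beta_binomial:
 assumes "K \<ge> 1" "j \<le> N"
 shows "real K * real (N choose j) * (fact j * fact (N - j + (K - 1)) / fact (N + K))
  = real ((N + K - 1 - j) choose (K - 1)) / real ((N + K) choose K)"
proof -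
 obtain k where k: "K = Suc k" using assms(1) by (cases K) auto
 obtain i where i: "N = j + i" using assms(2) le_Suc_ex by blast
 have 1: "real (N choose j) = fact N / (fact j * fact i)"
  by (subst binomial_fact) (use i in auto)
 have 2: "real ((N + K - 1 - j) choose (K - 1)) = fact (i + k) / (fact k * fact i)"
  by (subst binomial_fact) (use i k in auto)
 have 3: "real ((N + K) choose K) = fact (N + K) / (fact K * fact N)"
  by (subst binomial_fact) auto
 have 4: "(fact K :: real) = real K * fact k" by (simp add: k)
 have 5: "N - j + (K - 1) = i + k" using i k by simp
 show ?thesis unfolding 1 2 3 4 5 by (simp add: field_simps)
qed

text \<open>A binomial size averaged over the beta density of the spacings is beta-binomial: the
  expected number of sublists of size j is (K+1) C(n-1-j, K-1) / C(n, K) for n = N + K. This is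
  where the model meets \<open>window_avg\<close>.\<close>

lemma sublist_sizes_law:
 assumes K: "K \<ge> 1" and f: "\<And>j. f j \<ge> 0"
 shows "(\<integral>\<^sup>+v. (\<Sum>i\<le>K. \<integral>\<^sup>+a. ennreal (f (class_count K v a N i)) \<partial>item_measure N) \<partial>pivot_measure K)
  = ennreal (real (K + 1) * window_avg f K (N + K))"
proof -
 let ?b = "\<lambda>j. fact j * fact (N - j + (K - 1)) / fact (N + K) :: real"
 let ?w = "\<lambda>j t. t ^ j * (1 - t) ^ (N - j + (K - 1)) * indicator {0..1} t :: real"
 define W where "W t = real (K + 1) * real K * (1 - t) ^ (K - 1) * (indicator {0..1} t :: real)" for t :: real
 define c where "c j = real (K + 1) * real K * (real (N choose j) * f j)" for j
 have c: "c j \<ge> 0" for j using f by (simp add: c_def)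
 have "(\<integral>\<^sup>+v. (\<Sum>i\<le>K. \<integral>\<^sup>+a. ennreal (f (class_count K v a N i)) \<partial>item_measure N) \<partial>pivot_measure K)
   = (\<integral>\<^sup>+v. (\<Sum>i\<le>K. ennreal (bernstein_sum N f (spacing K v i))) \<partial>pivot_measure K)"
  by (rule nn_integral_cong_AE, rule eventually_mono[OF AE_generic_pivots])
   (intro sum.cong refl class_count_law f; simp)
 also have "... = (\<integral>\<^sup>+t. ennreal (bernstein_sum N f t) * ennreal (W t) \<partial>lborel)"
  unfolding W_def
 proof (rule spacing_law[OF K])
  have "bernstein_sum N f \<in> borel_measurable borel"
   unfolding bernstein_sum_def by (intro borel_measurable_continuous_onI continuous_intros)
  then show "(\<lambda>t. ennreal (bernstein_sum N f t)) \<in> borel_measurable borel"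
   by (rule measurable_compose) (rule measurable_ennreal)
 qed
 also have "... = (\<integral>\<^sup>+t. (\<Sum>j\<le>N. ennreal (c j) * ennreal (?w j t)) \<partial>lborel)"
 proof (intro nn_integral_cong)
  fix t :: real
  show "ennreal (bernstein_sum N f t) * ennreal (W t)
    = (\<Sum>j\<le>N. ennreal (c j) * ennreal (?w j t))"
  proof (cases "t \<in> {0..1}")
   case True
   have "bernstein_sum N f t * W t = (\<Sum>j\<le>N. c j * (t ^ j * (1 - t) ^ (N - j + (K - 1))))"
    unfolding bernstein_sum_def sum_distrib_right W_def c_def power_add using True
    by (intro sum.cong refl) (simp add: mult_ac)
   then have "ennreal (bernstein_sum N f t) * ennreal (W t) = ennreal (\<Sum>j\<le>N. c j * (t ^ j * (1 - t) ^ (N - j + (K - 1))))"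
    using True f by (subst ennreal_mult[symmetric]) (auto simp: bernstein_sum_nonneg W_def)
   also have "... = (\<Sum>j\<le>N. ennreal (c j * (t ^ j * (1 - t) ^ (N - j + (K - 1)))))"
    using True c by (intro sum_ennreal[symmetric]) auto
   finally show ?thesis using True c by (simp add: ennreal_mult)
  qed (simp add: W_def)
 qed
 also have "... = (\<Sum>j\<le>N. ennreal (c j) * (\<integral>\<^sup>+t. ennreal (?w j t) \<partial>lborel))"
  by (subst nn_integral_sum) (simp_all add: nn_integral_cmult)
 also have "... = (\<Sum>j\<le>N. ennreal (c j * ?b j))"
 proof (intro sum.cong refl)
  fix j assume "j \<in> {..N}"
  then have "j + (N - j + (K - 1)) + 1 = N + K" using K by auto
  then show "ennreal (c j) * (\<integral>\<^sup>+t. ennreal (?w j t) \<partial>lborel)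
    = ennreal (c j * ?b j)"
   unfolding beta_integral using c[of j] by (simp only: ennreal_mult')
 qed
 also have "... = ennreal (\<Sum>j\<le>N. c j * ?b j)"
  using c by (intro sum_ennreal) auto
 also have "(\<Sum>j\<le>N. c j * ?b j)
   = (\<Sum>j\<le>N. real (K + 1) * (real ((N + K - 1 - j) choose (K - 1)) * f j / real ((N + K) choose K)))"
 proof (intro sum.cong refl)
  fix j assume "j \<in> {..N}"
  then have *: "real K * real (N choose j) * ?b j
    = real ((N + K - 1 - j) choose (K - 1)) / real ((N + K) choose K)"
   by (intro beta_binomial[OF K]) simp
  have "c j * ?b j
    = real (K + 1) * f j * (real K * real (N choose j) * ?b j)"
   by (simp add: c_def)
  also have "... = real (K + 1) * (real ((N + K - 1 - j) choose (K - 1)) * f j / real ((N + K) choose K))"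
   unfolding * by simp
  finally show "c j * ?b j = ..." .
 qed
 also have "... = real (K + 1) * window_avg f K (N + K)"
 proof -
  \<comment> \<open>Sizes above N = n - K carry weight 0, because then n - 1 - j < K - 1.\<close>
  have "(\<Sum>j<N + K. real ((N + K - 1 - j) choose (K - 1)) * f j) = (\<Sum>j\<le>N. real ((N + K - 1 - j) choose (K - 1)) * f j)"
   using K by (intro sum.mono_neutral_right) (auto simp: binomial_eq_0)
  then show ?thesis using K by (simp add: window_avg_def sum_distrib_left sum_divide_distrib)
 qed
 finally show ?thesis .
qed

section \<open>Product measures and the partitioning data\<close>

lemmas borel_rules = measurable_compose[OF _ measurable_ennreal] borel_measurable_power borel_measurable_abs borel_measurable_add
 borel_measurable_diff borel_measurable_times_ennreal borel_measurable_times borel_measurable_sum borel_measurable_const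

abbreviation pcost :: "nat \<Rightarrow> (nat tree \<times> nat tree) set \<Rightarrow> sorter \<Rightarrow> nat \<Rightarrow> (nat \<Rightarrow> real) \<times> (nat \<Rightarrow> real) \<Rightarrow> real" where
 "pcost K r s n q \<equiv> partition_cost K r s n (fst q) (snd q)"

abbreviation psize :: "nat \<Rightarrow> nat \<Rightarrow> (nat \<Rightarrow> real) \<times> (nat \<Rightarrow> real) \<Rightarrow> nat \<Rightarrow> nat" where
 "psize K n q \<equiv> sublist_size K n (fst q) (snd q)"

text \<open>Selecting coordinates along an injection and mapping each of them again yields a product
  measure. This is used to pick the pair of the realised size out of every history, to pass to
  marginals of the coupling, and to re-index independent families.\<close>

lemma distr_PiM_select:
 assumes I: "finite I" and h: "inj_on h I"
  and \<rho>: "\<And>j. j \<in> h ` I ==> prob_space (\<rho> j)"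
  and g: "\<And>i. i \<in> I ==> g i \<in> measurable (\<rho> (h i)) (B i)"
 shows "distr (PiM (h ` I) \<rho>) (PiM I B) (\<lambda>z. \<lambda>i\<in>I. g i (z (h i))) = PiM I (\<lambda>i. distr (\<rho> (h i)) (B i) (g i))"
  (is "?D = ?P")
proof -
 \<comment> \<open>Point masses off the index set make every factor a probability measure, as the
   theory of product measures expects.\<close>
 define \<rho>' where "\<rho>' j = (if j \<in> h ` I then \<rho> j else return (count_space UNIV) undefined)" for j
 define \<nu> where "\<nu> i = (if i \<in> I then distr (\<rho> (h i)) (B i) (g i) else return (count_space UNIV) undefined)" for i
 have p': "prob_space (\<rho>' j)" for j unfolding \<rho>'_def using \<rho> by (simp add: prob_space_return)
 have p\<nu>: "prob_space (\<nu> i)" for i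
  unfolding \<nu>_def using \<rho> g by (simp add: prob_space_return prob_space.prob_space_distr)
 interpret R: product_sigma_finite \<rho>' unfolding product_sigma_finite_def
  using prob_space_imp_sigma_finite[OF p'] by blast
 interpret N: product_sigma_finite \<nu> unfolding product_sigma_finite_def
  using prob_space_imp_sigma_finite[OF p\<nu>] by blast
 have eq\<rho>: "PiM (h ` I) \<rho> = PiM (h ` I) \<rho>'" by (rule PiM_cong) (simp_all add: \<rho>'_def)
 have eq\<nu>: "?P = PiM I \<nu>" by (rule PiM_cong) (simp_all add: \<nu>_def)
 have sets: "sets ?D = sets (PiM I \<nu>)" by (simp add: \<nu>_def cong: sets_PiM_cong)
 have meas: "(\<lambda>z. \<lambda>i\<in>I. g i (z (h i))) \<in> measurable (PiM (h ` I) \<rho>) (PiM I B)"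
 proof (rule measurable_restrict)
  fix i assume i: "i \<in> I"
  have "(\<lambda>z. z (h i)) \<in> measurable (PiM (h ` I) \<rho>) (\<rho> (h i))"
   using i by (intro measurable_component_singleton) auto
  from measurable_compose[OF this g[OF i]]
  show "(\<lambda>z. g i (z (h i))) \<in> measurable (PiM (h ` I) \<rho>) (B i)" .
 qed
 show ?thesis unfolding eq\<nu>
 proof (rule N.PiM_eqI[OF I sets])
  fix A assume A: "\<And>i. i \<in> I ==> A i \<in> sets (\<nu> i)"
  then have A': "A i \<in> sets (B i)" if "i \<in> I" for i using that by (simp add: \<nu>_def)
  define E where "E j = g (inv_into I h j) -` A (inv_into I h j) \<inter> space (\<rho> j)" for j
  have Eh: "E (h i) = g i -` A i \<inter> space (\<rho> (h i))" if "i \<in> I" for i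
   using that h by (simp add: E_def)
  have E_sets: "E j \<in> sets (\<rho>' j)" if "j \<in> h ` I" for j
   using that Eh g A' by (auto simp: \<rho>'_def intro!: measurable_sets)
  have "emeasure ?D (PiE I A) = emeasure (PiM (h ` I) \<rho>) ((\<lambda>z. \<lambda>i\<in>I. g i (z (h i))) -` PiE I A \<inter> space (PiM (h ` I) \<rho>))"
   by (rule emeasure_distr[OF meas]) (use A' I in \<open>auto intro!: sets_PiM_I_finite\<close>)
  also have "(\<lambda>z. \<lambda>i\<in>I. g i (z (h i))) -` PiE I A \<inter> space (PiM (h ` I) \<rho>) = PiE (h ` I) E"
  proof (intro set_eqI iffI)
   fix z assume z: "z \<in> (\<lambda>z. \<lambda>i\<in>I. g i (z (h i))) -` PiE I A \<inter> space (PiM (h ` I) \<rho>)"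
   then show "z \<in> PiE (h ` I) E" by (auto simp: space_PiM Eh PiE_iff)
  next
   fix z assume "z \<in> PiE (h ` I) E"
   then show "z \<in> (\<lambda>z. \<lambda>i\<in>I. g i (z (h i))) -` PiE I A \<inter> space (PiM (h ` I) \<rho>)"
    by (auto simp: space_PiM Eh PiE_iff)
  qed
  also have "emeasure (PiM (h ` I) \<rho>) (PiE (h ` I) E) = (\<Prod>j\<in>h ` I. emeasure (\<rho>' j) (E j))"
   unfolding eq\<rho> by (rule R.emeasure_PiM) (use I E_sets in auto)
  also have "... = (\<Prod>i\<in>I. emeasure (\<rho>' (h i)) (E (h i)))"
   by (rule prod.reindex_cong[OF h]) auto
  also have "... = (\<Prod>i\<in>I. emeasure (\<nu> i) (A i))"
   by (intro prod.cong refl) (simp add: \<rho>'_def \<nu>_def Eh emeasure_distr[OF g A'])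
  finally show "emeasure ?D (PiE I A) = ..." .
 qed
qed

lemma nn_integral_PiM_select:
 assumes I: "finite I" and h: "inj_on h I"
  and \<rho>: "\<And>j. j \<in> h ` I ==> prob_space (\<rho> j)"
  and g: "\<And>i. i \<in> I ==> g i \<in> measurable (\<rho> (h i)) (B i)"
  and \<nu>: "\<And>i. i \<in> I ==> distr (\<rho> (h i)) (B i) (g i) = \<nu> i"
  and f: "f \<in> borel_measurable (PiM I B)"
  and f': "\<And>z. z \<in> space (PiM (h ` I) \<rho>) ==> f' z = f (\<lambda>i\<in>I. g i (z (h i)))"
 shows "(\<integral>\<^sup>+z. f' z \<partial>PiM (h ` I) \<rho>) = (\<integral>\<^sup>+x. f x \<partial>PiM I \<nu>)"
proof -
 have meas: "(\<lambda>z. \<lambda>i\<in>I. g i (z (h i))) \<in> measurable (PiM (h ` I) \<rho>) (PiM I B)"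
 proof (rule measurable_restrict)
  fix i assume i: "i \<in> I"
  have "(\<lambda>z. z (h i)) \<in> measurable (PiM (h ` I) \<rho>) (\<rho> (h i))"
   using i by (intro measurable_component_singleton) auto
  from measurable_compose[OF this g[OF i]]
  show "(\<lambda>z. g i (z (h i))) \<in> measurable (PiM (h ` I) \<rho>) (B i)" .
 qed
 define T where "T z = (\<lambda>i\<in>I. g i (z (h i)))" for z
 have T: "T \<in> measurable (PiM (h ` I) \<rho>) (PiM I B)" using meas unfolding T_def .
 have "PiM I \<nu> = PiM I (\<lambda>i. distr (\<rho> (h i)) (B i) (g i))" by (rule PiM_cong) (simp_all add: \<nu>)
 also have "... = distr (PiM (h ` I) \<rho>) (PiM I B) T"
  unfolding T_def using distr_PiM_select[of I h \<rho> g B] I h \<rho> g by simp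
 finally have eq: "PiM I \<nu> = ..." .
 have "(\<integral>\<^sup>+x. f x \<partial>PiM I \<nu>) = (\<integral>\<^sup>+z. f (T z) \<partial>PiM (h ` I) \<rho>)"
  unfolding eq by (rule nn_integral_distr[OF T]) (use f in simp)
 also have "... = (\<integral>\<^sup>+z. f' z \<partial>PiM (h ` I) \<rho>)" by (intro nn_integral_cong) (simp add: T_def f')
 finally show ?thesis ..
qed

lemma measure_eqI_nn_integral:
 assumes "sets M = sets N" "\<And>f. f \<in> borel_measurable N ==> (\<integral>\<^sup>+x. f x \<partial>M) = (\<integral>\<^sup>+x. f x \<partial>N)"
 shows "M = N"
proof (rule measure_eqI[OF assms(1)])
 fix A assume A: "A \<in> sets M"
 then have "(\<integral>\<^sup>+x. indicator A x \<partial>M) = (\<integral>\<^sup>+x. indicator A x \<partial>N)"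
  using assms(1) by (intro assms(2)) auto
 then show "emeasure M A = emeasure N A" using A assms(1) by simp
qed

section \<open>Joint law of pivots and items, and measurability of the partitioning data\<close>

abbreviation partition_measure :: "nat \<Rightarrow> nat \<Rightarrow> ((nat \<Rightarrow> real) \<times> (nat \<Rightarrow> real)) measure" where
 "partition_measure K n \<equiv> pivot_measure K \<Otimes>\<^sub>M item_measure (n - K)"

lemma prob_space_partition_measure: "prob_space (partition_measure K n)"
proof -
 interpret V: prob_space "pivot_measure K" by (rule prob_space_pivot_measure)
 interpret A: prob_space "item_measure (n - K)" by (rule prob_space_item_measure)
 interpret pair_prob_space "pivot_measure K" "item_measure (n - K)" ..
 show ?thesis by unfold_locales
qed

lemma nn_integral_partition_measure:
 assumes "f \<in> borel_measurable (partition_measure K n)"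
 shows "(\<integral>\<^sup>+q. f q \<partial>partition_measure K n) = (\<integral>\<^sup>+v. \<integral>\<^sup>+a. f (v, a) \<partial>item_measure (n - K) \<partial>pivot_measure K)"
 using sigma_finite_measure.nn_integral_fst[OF prob_space_imp_sigma_finite[OF prob_space_item_measure] assms] by simp

lemma measurable_pivot_part:
 "j \<in> {1..K} ==> (\<lambda>q. fst q j) \<in> borel_measurable (partition_measure K n)"
 by (rule measurable_compose[OF measurable_fst measurable_coord])

lemma measurable_item_part:
 "k \<in> {1..n - K} ==> (\<lambda>q. snd q k) \<in> borel_measurable (partition_measure K n)"
 by (rule measurable_compose[OF measurable_snd measurable_coord])

lemma measurable_spacing_part:
 "(\<lambda>q. spacing K (fst q) i) \<in> borel_measurable (partition_measure K n)"
 by (rule measurable_spacing, rule measurable_pivot_part)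

lemma measurable_count_part:
 "m \<le> n - K ==> (\<lambda>q. class_count K (fst q) (snd q) m i) \<in> measurable (partition_measure K n) (count_space UNIV)"
 by (rule measurable_class_count, rule measurable_pivot_part, assumption, rule measurable_item_part) auto

lemma measurable_sublist_size_part:
 "(\<lambda>q. psize K n q i) \<in> measurable (partition_measure K n) (count_space UNIV)"
 unfolding sublist_size_def by (rule measurable_count_part) simp

lemma measurable_comparisons:
 fixes v :: "'a \<Rightarrow> nat \<Rightarrow> real"
 assumes m: "\<And>j. j \<in> {1..K} ==> (\<lambda>x. v x j) \<in> borel_measurable M" and wf: "sorter_wf K t"
 shows "(\<lambda>x. real (comparisons t (map (v x) [1..<Suc K]))) \<in> borel_measurable M"
 using wf
proof (induction t)
 case (Compare i j s t)
 have "map (v x) [1..<Suc K] ! l = v x (Suc l)" if "l < K" for l x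
  using that by (subst nth_map) (auto simp del: upt_Suc)
 then have nth: "map (v x) [1..<Suc K] ! i = v x (Suc i)" "map (v x) [1..<Suc K] ! j = v x (Suc j)" for x
  using Compare.prems by auto
 have v: "(\<lambda>x. v x (Suc i)) \<in> borel_measurable M" "(\<lambda>x. v x (Suc j)) \<in> borel_measurable M"
  by (rule m; use Compare.prems in simp)+
 have [measurable]: "(\<lambda>x. real (comparisons s (map (v x) [1..<Suc K]))) \<in> borel_measurable M"
  "(\<lambda>x. real (comparisons t (map (v x) [1..<Suc K]))) \<in> borel_measurable M"
  by (rule Compare.IH; use Compare.prems in simp)+
 have "(\<lambda>x. real (comparisons (Compare i j s t) (map (v x) [1..<Suc K])))
   = (\<lambda>x. 1 + (if v x (Suc i) < v x (Suc j) then real (comparisons s (map (v x) [1..<Suc K]))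
     else real (comparisons t (map (v x) [1..<Suc K]))))"
  unfolding comparisons.simps nth by (auto simp del: upt_Suc)
 also have "... \<in> borel_measurable M"
  by (intro borel_rules measurable_If borel_measurable_less[OF v(1) v(2)]) fact+
 finally show ?case .
qed simp

lemma measurable_partition_steps:
 "(\<lambda>q. partition_steps K r (n - K) (fst q) (snd q)) \<in> borel_measurable (partition_measure K n)"
proof -
 have c: "(\<lambda>q. real (class_count K (fst q) (snd q) (k - 1) i) + 1) \<in> borel_measurable (partition_measure K n)"
  if "k \<in> {1..n - K}" for k i
  by (intro borel_rules measurable_compose[OF measurable_count_part]) (use that in auto)
 have d: "(\<lambda>q. selected_depth K r (\<lambda>i. real (class_count K (fst q) (snd q) (k - 1) i) + 1) j) \<in> borel_measurable (partition_measure K n)"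
  if "k \<in> {1..n - K}" for k j
  by (rule measurable_selected_depth) (rule c[OF that])
 have p: "(\<lambda>q. of_bool (snd q k \<in> class_interval K (fst q) i) :: real) \<in> borel_measurable (partition_measure K n)"
  if "k \<in> {1..n - K}" for k i
 proof -
  have "Measurable.pred (partition_measure K n) (\<lambda>q. snd q k \<in> class_interval K (fst q) i)"
   by (rule pred_class_interval, rule measurable_pivot_part, assumption, rule measurable_item_part[OF that])
  then have "{q \<in> space (partition_measure K n). snd q k \<in> class_interval K (fst q) i} \<in> sets (partition_measure K n)"
   by (simp only: pred_def)
  then show ?thesis unfolding of_bool_def by (intro measurable_If borel_measurable_const)
 qed
 show ?thesis unfolding partition_steps_def
  by (intro borel_rules p d)
qed

lemma measurable_partition_cost_part:
 assumes "sorter_wf K s"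
 shows "(\<lambda>q. pcost K r s n q) \<in> borel_measurable (partition_measure K n)"
 unfolding partition_cost_eq
 by (intro borel_measurable_add measurable_partition_steps measurable_comparisons[OF measurable_pivot_part assms])

text \<open>Only K pivots and n - K items are read. The random variables of the model are indexed by
  all naturals while the product measure lives on extensional functions; this lemma mediates between
  the two.\<close>

lemma partition_vector_restrict:
 "partition_vector K r s n v a = partition_vector K r s n (\<lambda>j\<in>{1..K}. v j) (\<lambda>k\<in>{1..n - K}. a k)"
proof -
 let ?v = "\<lambda>j\<in>{1..K}. v j" and ?a = "\<lambda>k\<in>{1..n - K}. a k"
 have c: "class_count K v a m i = class_count K ?v ?a m i" if "m \<le> n - K" for m i
  by (rule class_count_cong) (use that in auto)
 have p: "pivot K v = pivot K ?v" using pivot_cong[of K v ?v] by fastforce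
 have "partition_steps K r (n - K) v a = partition_steps K r (n - K) ?v ?a"
  unfolding partition_steps_def
 proof (rule sum.cong[OF refl])
  fix k assume k: "k \<in> {1..n - K}"
  have "class_count K v a (k - 1) = class_count K ?v ?a (k - 1)" using c[of "k - 1"] k by auto
  then show "(\<Sum>i\<le>K. of_bool (a k \<in> class_interval K v i) * selected_depth K r (\<lambda>i. real (class_count K v a (k - 1) i) + 1) i)
    = (\<Sum>i\<le>K. of_bool (?a k \<in> class_interval K ?v i) * selected_depth K r (\<lambda>i. real (class_count K ?v ?a (k - 1) i) + 1) i)"
   using k by (simp only: class_interval_def p restrict_apply if_True)
 qed
 moreover have "map v [1..<Suc K] = map ?v [1..<Suc K]" by (intro map_cong) auto
 ultimately have "partition_cost K r s n v a = partition_cost K r s n ?v ?a"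
  unfolding partition_cost_eq by (simp only:)
 moreover have "sublist_size K n v a i = sublist_size K n ?v ?a i" for i
  unfolding sublist_size_def by (rule c) simp
 ultimately show ?thesis unfolding partition_vector_def fun_eq_iff by simp
qed

lemma measurable_partition_vector:
 assumes "sorter_wf K s"
 shows "(\<lambda>q. partition_vector K r s n (fst q) (snd q)) \<in> measurable (partition_measure K n) (\<Pi>\<^sub>M m\<in>UNIV. borel)"
proof (rule measurable_PiM_single')
 fix i :: nat
 have "(\<lambda>q. real (psize K n q i)) \<in> borel_measurable (partition_measure K n)"
  by (rule measurable_compose[OF measurable_sublist_size_part]) simp
 then show "(\<lambda>q. partition_vector K r s n (fst q) (snd q) i) \<in> borel_measurable (partition_measure K n)"
  using measurable_partition_cost_part[OF assms] by (cases "i \<le> K") (simp_all only: partition_vector_def if_True if_False simp_thms)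
qed simp

lemma partition_cost_bounds:
 assumes "linear_order_on (class_trees K) r"
 shows "\<exists>B. \<forall>n v a. generic_pivots K v \<longrightarrow> 0 \<le> partition_cost K r s n v a \<and> partition_cost K r s n v a \<le> real K * real (n - K) + B"
proof -
 obtain B where B: "\<And>xs :: real list. comparisons s xs \<le> B" using comparisons_bounded by blast
 have step: "(\<Sum>i\<le>K. of_bool (a k \<in> class_interval K v i) * selected_depth K r x i) \<in> {0..real K}"
  if "generic_pivots K v" for v a k x
  by (rule class_sum_range[OF that selected_depth_bounds[OF assms]]) simp
 have "0 \<le> partition_steps K r N v a \<and> partition_steps K r N v a \<le> real K * real N" if "generic_pivots K v" for N v a
 proof
  show "0 \<le> partition_steps K r N v a"
   unfolding partition_steps_def by (rule sum_nonneg) (metis step[OF that] atLeastAtMost_iff)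
  have "partition_steps K r N v a \<le> (\<Sum>k=1..N. real K)"
   unfolding partition_steps_def by (rule sum_mono) (metis step[OF that] atLeastAtMost_iff)
  then show "partition_steps K r N v a \<le> real K * real N" by (simp add: mult.commute)
 qed
 then show ?thesis using B unfolding partition_cost_eq
  by (intro exI[of _ "real B"] allI impI conjI add_nonneg_nonneg add_mono) (auto simp del: upt_Suc)
qed

section \<open>The recursion on the level of laws\<close>

lemma (in prob_space) indep_vars_distr_eq_PiM_reindexed:
 assumes ind: "indep_vars (\<lambda>_. B) X (h ` I)" and I: "finite I" "I \<noteq> {}" and h: "inj_on h I"
  and law: "\<And>i. i \<in> I ==> distr M B (X (h i)) = \<rho>"
 shows "distr M (\<Pi>\<^sub>M i\<in>I. B) (\<lambda>\<omega>. \<lambda>i\<in>I. X (h i) \<omega>) = (\<Pi>\<^sub>M i\<in>I. \<rho>)"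
proof -
 have rv: "X j \<in> measurable M B" if "j \<in> h ` I" for j using ind that by (auto simp: indep_vars_def)
 have law': "distr M B (X j) = \<rho>" if "j \<in> h ` I" for j using law that by auto
 obtain i0 where i0: "i0 \<in> I" using I by auto
 have \<rho>: "prob_space \<rho>" using prob_space_distr[of "X (h i0)" B] rv law i0 by auto
 have sets\<rho>: "sets \<rho> = sets B" using law[OF i0] by (metis sets_distr)
 have J: "distr M (\<Pi>\<^sub>M j\<in>h ` I. B) (\<lambda>\<omega>. \<lambda>j\<in>h ` I. X j \<omega>) = (\<Pi>\<^sub>M j\<in>h ` I. \<rho>)"
 proof -
  have "distr M (\<Pi>\<^sub>M j\<in>h ` I. B) (\<lambda>\<omega>. \<lambda>j\<in>h ` I. X j \<omega>) = (\<Pi>\<^sub>M j\<in>h ` I. distr M B (X j))"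
   using ind I rv by (subst indep_vars_iff_distr_eq_PiM'[symmetric]) auto
  also have "... = (\<Pi>\<^sub>M j\<in>h ` I. \<rho>)" by (rule PiM_cong) (simp_all add: law')
  finally show ?thesis .
 qed
 have XJ: "(\<lambda>\<omega>. \<lambda>j\<in>h ` I. X j \<omega>) \<in> measurable M (\<Pi>\<^sub>M j\<in>h ` I. B)"
  by (intro measurable_restrict rv)
 have sel: "(\<lambda>z. \<lambda>i\<in>I. z (h i)) \<in> measurable (\<Pi>\<^sub>M j\<in>h ` I. B) (\<Pi>\<^sub>M i\<in>I. B)"
  by (intro measurable_restrict measurable_component_singleton) auto
 have id: "distr \<rho> B (\<lambda>x. x) = \<rho>" using sets\<rho> by (intro distr_id2) simp
 have "(\<Pi>\<^sub>M i\<in>I. \<rho>) = (\<Pi>\<^sub>M i\<in>I. distr \<rho> B (\<lambda>x. x))" by (simp only: id)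
 also have "... = distr (\<Pi>\<^sub>M j\<in>h ` I. \<rho>) (\<Pi>\<^sub>M i\<in>I. B) (\<lambda>z. \<lambda>i\<in>I. z (h i))"
  using distr_PiM_select[of I h "\<lambda>_. \<rho>" "\<lambda>_ x. x" "\<lambda>_. B"] I h \<rho> sets\<rho>
  by (simp add: measurable_ident_sets)
 also have "... = distr (distr M (\<Pi>\<^sub>M j\<in>h ` I. B) (\<lambda>\<omega>. \<lambda>j\<in>h ` I. X j \<omega>)) (\<Pi>\<^sub>M i\<in>I. B) (\<lambda>z. \<lambda>i\<in>I. z (h i))"
  by (simp only: J)
 also have "... = distr M (\<Pi>\<^sub>M i\<in>I. B) (\<lambda>\<omega>. \<lambda>i\<in>I. X (h i) \<omega>)"
  by (subst distr_distr[OF sel XJ]) (auto intro!: distr_cong simp: restrict_def)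
 finally show ?thesis ..
qed

text \<open>The model with its probability space forgotten: only the laws of X_n remain, and the
  recursion says that given the partitioning data q the summands are independent with the laws of
  the realised sizes. \<open>zero\<close> says that an empty list has a deterministic cost, so that
  the deviation at size 0 vanishes, where the bounds of order n^\<tau> vanish as well.\<close>

locale quicksort_laws =
 fixes K :: nat and r :: "(nat tree \<times> nat tree) set" and s :: sorter and \<mu> :: "nat \<Rightarrow> real measure"
 assumes K: "K \<ge> 1"
  and tie: "linear_order_on (class_trees K) r"
  and wf: "sorter_wf K s"
  and prob_\<mu>: "\<And>n. prob_space (\<mu> n)" and sets_\<mu>: "\<And>n. sets (\<mu> n) = sets borel"
  and short: "\<And>n. n \<le> K ==> \<exists>b. AE x in \<mu> n. 0 \<le> x \<and> x \<le> b"
  and zero: "\<exists>c. AE x in \<mu> 0. x = c"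
  and rec: "\<And>n f. n > K ==> f \<in> borel_measurable borel ==>
   (\<integral>\<^sup>+x. f x \<partial>\<mu> n) = (\<integral>\<^sup>+q. (\<integral>\<^sup>+x. f ((\<Sum>i\<le>K. x i) + pcost K r s n q)
    \<partial>(\<Pi>\<^sub>M i\<in>{..K}. \<mu> (psize K n q i))) \<partial>partition_measure K n)"

context optimal_quicksort
begin

lemma partition_data_law:
 assumes K: "K \<ge> 1" and n: "n > K"
 shows "distr M (partition_measure K n) (\<lambda>\<omega>. (\<lambda>j\<in>{1..K}. V j \<omega>, \<lambda>k\<in>{1..n - K}. a k \<omega>)) = partition_measure K n"
proof -
 let ?pd = "\<lambda>\<omega>. (\<lambda>j\<in>{1..K}. V j \<omega>, \<lambda>k\<in>{1..n - K}. a k \<omega>)"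
 let ?bv = "\<Pi>\<^sub>M j\<in>{1..K}. borel :: real measure" and ?ba = "\<Pi>\<^sub>M k\<in>{1..n - K}. borel :: real measure"
 let ?Z = "case_sum V a" and ?A = "Inl ` {1..K} :: (nat + nat) set" and ?B = "Inr ` {1..n - K} :: (nat + nat) set"
 have sub: "?A \<subseteq> {1..K} <+> {1..}" "?B \<subseteq> {1..K} <+> {1..}" by auto
 have ne: "{1..K} \<noteq> {}" "{1..n - K} \<noteq> {}" using K n by auto
 have indAB: "indep_var (\<Pi>\<^sub>M l\<in>?A. borel) (\<lambda>\<omega>. \<lambda>l\<in>?A. ?Z l \<omega>) (\<Pi>\<^sub>M l\<in>?B. borel) (\<lambda>\<omega>. \<lambda>l\<in>?B. ?Z l \<omega>)"
  by (rule indep_var_restrict[OF V_a_indep]) auto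
 let ?f = "\<lambda>z. \<lambda>j\<in>{1..K}. z (Inl j)" and ?g = "\<lambda>z. \<lambda>k\<in>{1..n - K}. z (Inr k)"
 have f: "?f \<in> measurable (\<Pi>\<^sub>M l\<in>?A. borel) ?bv"
  by (intro measurable_restrict measurable_component_singleton) auto
 have g: "?g \<in> measurable (\<Pi>\<^sub>M l\<in>?B. borel) ?ba"
  by (intro measurable_restrict measurable_component_singleton) auto
 have "indep_var ?bv (?f \<circ> (\<lambda>\<omega>. \<lambda>l\<in>?A. ?Z l \<omega>)) ?ba (?g \<circ> (\<lambda>\<omega>. \<lambda>l\<in>?B. ?Z l \<omega>))"
  by (rule indep_var_compose[OF indAB f g])
 moreover have "?f \<circ> (\<lambda>\<omega>. \<lambda>l\<in>?A. ?Z l \<omega>) = (\<lambda>\<omega>. \<lambda>j\<in>{1..K}. V j \<omega>)"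
  by (auto simp: fun_eq_iff restrict_def)
 moreover have "?g \<circ> (\<lambda>\<omega>. \<lambda>l\<in>?B. ?Z l \<omega>) = (\<lambda>\<omega>. \<lambda>k\<in>{1..n - K}. a k \<omega>)"
  by (auto simp: fun_eq_iff restrict_def)
 ultimately have ind: "indep_var ?bv (\<lambda>\<omega>. \<lambda>j\<in>{1..K}. V j \<omega>) ?ba (\<lambda>\<omega>. \<lambda>k\<in>{1..n - K}. a k \<omega>)"
  by (simp only:)
 have V: "distr M ?bv (\<lambda>\<omega>. \<lambda>j\<in>{1..K}. V j \<omega>) = pivot_measure K"
  using indep_vars_distr_eq_PiM_reindexed[of borel ?Z Inl "{1..K}" unif01] indep_vars_subset[OF V_a_indep sub(1)] ne V_uniform
  by simp
 have A: "distr M ?ba (\<lambda>\<omega>. \<lambda>k\<in>{1..n - K}. a k \<omega>) = item_measure (n - K)"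
  using indep_vars_distr_eq_PiM_reindexed[of borel ?Z Inr "{1..n - K}" unif01] indep_vars_subset[OF V_a_indep sub(2)] ne a_uniform
  by simp
 have "distr M (?bv \<Otimes>\<^sub>M ?ba) ?pd = partition_measure K n"
  using ind unfolding indep_var_distribution_eq V A by (elim conjE) (erule sym)
 moreover have "sets (?bv \<Otimes>\<^sub>M ?ba) = sets (partition_measure K n)"
  by (intro sets_pair_measure_cong sets_PiM_cong) auto
 then have "distr M (partition_measure K n) ?pd
   = distr M (?bv \<Otimes>\<^sub>M ?ba) ?pd"
  by (intro distr_cong refl) (rule sym)
 ultimately show ?thesis by (simp only:)
qed

text \<open>The partitioning vector and the K + 1 sequences of copies are independent, so their
  joint law is a product over \<open>J\<close>. With the \<open>None\<close> coordinate fixed, the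
  sizes are constants and each sequence contributes just the coordinate of its size; the law of the
  \<open>None\<close> coordinate is then transported back to pivots and items.\<close>

lemma law_rec:
 assumes K: "K \<ge> 1" and n: "n > K" and f: "f \<in> borel_measurable borel"
 shows "(\<integral>\<^sup>+x. f x \<partial>distr M borel (X n)) = (\<integral>\<^sup>+q. (\<integral>\<^sup>+x. f ((\<Sum>i\<le>K. x i) + pcost K r s n q)
    \<partial>(\<Pi>\<^sub>M i\<in>{..K}. distr M borel (X (psize K n q i)))) \<partial>partition_measure K n)"
proof -
 let ?B = "\<Pi>\<^sub>M m\<in>(UNIV :: nat set). (borel :: real measure)"
 define T where "T \<omega> = partition_vector K r s n (\<lambda>j. V j \<omega>) (\<lambda>k. a k \<omega>)" for \<omega>
 define Z where "Z = case_option T (\<lambda>i \<omega> m. Xc i m \<omega>)"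
 define J where "J = insert None (Some ` {..K})"
 \<comment> \<open>The value off \<open>J\<close> is arbitrary; it makes every factor a probability
   measure.\<close>
 define \<rho> where "\<rho> j = (if j \<in> J then distr M ?B (Z j) else return ?B undefined)" for j
 have wf: "sorter_wf K s" using pivot_sorter by (simp add: sorts_def)
 have ind: "indep_vars (\<lambda>_. ?B) Z J" unfolding Z_def T_def J_def by (rule indep[OF n])
 have Z: "Z j \<in> measurable M ?B" if "j \<in> J" for j using ind that by (auto simp: indep_vars_def)
 have prob_\<rho>: "prob_space (\<rho> j)" for j
  unfolding \<rho>_def using Z by (auto intro!: prob_space_distr prob_space_return simp: space_PiM)
 have sets_\<rho>: "sets (\<rho> j) = sets ?B" for j by (simp add: \<rho>_def)
 interpret R: product_sigma_finite \<rho> unfolding product_sigma_finite_def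
  using prob_space_imp_sigma_finite[OF prob_\<rho>] by blast
 have joint: "distr M (\<Pi>\<^sub>M j\<in>J. ?B) (\<lambda>\<omega>. \<lambda>j\<in>J. Z j \<omega>) = PiM J \<rho>"
 proof -
  have "distr M (\<Pi>\<^sub>M j\<in>J. ?B) (\<lambda>\<omega>. \<lambda>j\<in>J. Z j \<omega>) = (\<Pi>\<^sub>M j\<in>J. distr M ?B (Z j))"
   using ind Z by (subst indep_vars_iff_distr_eq_PiM'[symmetric]) (auto simp: J_def)
  also have "... = PiM J \<rho>" by (rule PiM_cong) (simp_all add: \<rho>_def)
  finally show ?thesis .
 qed
 have ZJ: "(\<lambda>\<omega>. \<lambda>j\<in>J. Z j \<omega>) \<in> measurable M (\<Pi>\<^sub>M j\<in>J. ?B)" by (intro measurable_restrict Z)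
 \<comment> \<open>The sizes travel as reals inside the partitioning vector and are recovered by the
   floor; the index \<open>Suc K\<close> reads the cost.\<close>
 define \<Psi> where "\<Psi> z = (\<Sum>i\<le>K. z (Some i) (nat \<lfloor>z None i\<rfloor>)) + z None (Suc K)" for z :: "nat option \<Rightarrow> nat \<Rightarrow> real"
 have coord: "(\<lambda>z. z j m) \<in> borel_measurable (PiM J \<rho>)" if "j \<in> J" for j m
 proof -
  have "(\<lambda>x. x m) \<in> borel_measurable (\<rho> j)"
   unfolding measurable_cong_sets[OF sets_\<rho> refl] by (rule measurable_component_singleton) simp
  with measurable_component_singleton[OF that] show ?thesis
   by (rule measurable_compose[where f = "\<lambda>z. z j" and g = "\<lambda>x. x m" and N = "\<rho> j"])
 qed
 have \<Psi>: "\<Psi> \<in> borel_measurable (PiM J \<rho>)"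
  unfolding \<Psi>_def
 proof (intro borel_rules)
  fix i assume i: "i \<in> {..K}"
  have nm: "(\<lambda>z. nat \<lfloor>z None i\<rfloor>) \<in> measurable (PiM J \<rho>) (count_space UNIV)"
  proof -
   have fl: "(\<lambda>x::real. nat \<lfloor>x\<rfloor>) \<in> measurable borel (count_space UNIV)" by measurable
   show ?thesis by (rule measurable_compose[where f = "\<lambda>z. z None i" and g = "\<lambda>x. nat \<lfloor>x\<rfloor>", OF _ fl]) (rule coord, simp add: J_def)
  qed
  show "(\<lambda>z. z (Some i) (nat \<lfloor>z None i\<rfloor>)) \<in> borel_measurable (PiM J \<rho>)"
   by (rule measurable_compose_countable'[where f = "\<lambda>m z. z (Some i) m" and g = "\<lambda>z. nat \<lfloor>z None i\<rfloor>" and I = UNIV, OF coord nm])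
    (use i in \<open>auto simp: J_def\<close>)
 next
  show "(\<lambda>z. z None (Suc K)) \<in> borel_measurable (PiM J \<rho>)" by (rule coord) (simp add: J_def)
 qed
 have f\<Psi>: "(\<lambda>z. f (\<Psi> z)) \<in> borel_measurable (PiM J \<rho>)" by (rule measurable_compose[where f = \<Psi> and g = f, OF \<Psi> f])
 have setsJ: "sets (\<Pi>\<^sub>M j\<in>J. ?B) = sets (PiM J \<rho>)" by (intro sets_PiM_cong refl sets_\<rho>[symmetric])
 have XZ: "(\<Sum>i\<le>K. Xc i (sublist_size K n (\<lambda>j. V j \<omega>) (\<lambda>k. a k \<omega>) i) \<omega>)
     + partition_cost K r s n (\<lambda>j. V j \<omega>) (\<lambda>k. a k \<omega>) = \<Psi> (\<lambda>j\<in>J. Z j \<omega>)" for \<omega>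
  by (auto simp: \<Psi>_def Z_def T_def J_def partition_vector_def intro!: sum.cong)
 define F where "F t = (\<integral>\<^sup>+x. f ((\<Sum>i\<le>K. x i) + t (Suc K)) \<partial>(\<Pi>\<^sub>M i\<in>{..K}. distr M borel (X (nat \<lfloor>t i\<rfloor>))))" for t :: "nat \<Rightarrow> real"
 have inner: "(\<integral>\<^sup>+z. f (\<Psi> (z(None := t))) \<partial>PiM (Some ` {..K}) \<rho>) = F t" for t
  unfolding F_def
 proof (rule nn_integral_PiM_select[where g = "\<lambda>i x. x (nat \<lfloor>t i\<rfloor>)" and B = "\<lambda>_. borel"])
  fix i assume i: "i \<in> {..K}"
  show m: "(\<lambda>x. x (nat \<lfloor>t i\<rfloor>)) \<in> borel_measurable (\<rho> (Some i))"
   unfolding measurable_cong_sets[OF sets_\<rho> refl] by (rule measurable_component_singleton) simp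
  have ZS: "Z (Some i) \<in> measurable M ?B" by (rule Z) (use i in \<open>simp add: J_def\<close>)
  have "distr (\<rho> (Some i)) borel (\<lambda>x. x (nat \<lfloor>t i\<rfloor>)) = distr (distr M ?B (Z (Some i))) borel (\<lambda>x. x (nat \<lfloor>t i\<rfloor>))"
   using i by (simp add: \<rho>_def J_def)
  also have "... = distr M borel (\<lambda>\<omega>. Z (Some i) \<omega> (nat \<lfloor>t i\<rfloor>))"
   by (subst distr_distr[OF _ ZS]) (simp_all add: comp_def)
  also have "... = distr M borel (X (nat \<lfloor>t i\<rfloor>))" using Xc_law[of i] i by (simp add: Z_def)
  finally show "distr (\<rho> (Some i)) borel (\<lambda>x. x (nat \<lfloor>t i\<rfloor>)) = ..." .
 next
  have "(\<lambda>x. (\<Sum>i\<le>K. x i) + t (Suc K)) \<in> borel_measurable (\<Pi>\<^sub>M i\<in>{..K}. borel)"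
   by (intro borel_rules measurable_component_singleton)
  from measurable_compose[OF this f]
  show "(\<lambda>x. f ((\<Sum>i\<le>K. x i) + t (Suc K))) \<in> borel_measurable (\<Pi>\<^sub>M i\<in>{..K}. borel)" .
  show "f (\<Psi> (z(None := t))) = f ((\<Sum>i\<le>K. (\<lambda>i\<in>{..K}. z (Some i) (nat \<lfloor>t i\<rfloor>)) i) + t (Suc K))" for z
   by (simp add: \<Psi>_def)
 qed (simp_all add: prob_\<rho>)
 have F_meas: "F \<in> borel_measurable (\<rho> None)"
 proof -
  interpret S: finite_product_sigma_finite \<rho> "Some ` {..K}" by unfold_locales simp
  have "(\<lambda>(t, z). f (\<Psi> (z(None := t)))) \<in> borel_measurable (\<rho> None \<Otimes>\<^sub>M PiM (Some ` {..K}) \<rho>)"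
  proof -
   have "(\<lambda>(z, t). z(None := t)) \<in> measurable (PiM (Some ` {..K}) \<rho> \<Otimes>\<^sub>M \<rho> None) (PiM J \<rho>)"
    unfolding J_def by (rule measurable_add_dim)
   from measurable_compose[OF measurable_pair_swap' measurable_compose[OF this f\<Psi>]]
   show ?thesis by (simp add: case_prod_beta)
  qed
  from S.borel_measurable_nn_integral[OF this] show ?thesis by (simp add: inner)
 qed
 have T_dist: "\<rho> None = distr (partition_measure K n) ?B (\<lambda>q. partition_vector K r s n (fst q) (snd q))"
 proof -
  let ?D = "\<lambda>\<omega>. (\<lambda>j\<in>{1..K}. V j \<omega>, \<lambda>k\<in>{1..n - K}. a k \<omega>)"
  have D: "?D \<in> measurable M (partition_measure K n)"
  proof (rule measurable_Pair)
   have rv: "case_sum V a l \<in> borel_measurable M" if "l \<in> {1..K} <+> {1..}" for l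
    using V_a_indep that unfolding indep_vars_def by blast
   have eq: "measurable M unif01 = borel_measurable M" by (rule measurable_cong_sets) simp_all
   show "(\<lambda>\<omega>. \<lambda>j\<in>{1..K}. V j \<omega>) \<in> measurable M (pivot_measure K)"
   proof (rule measurable_restrict)
    fix j assume "j \<in> {1..K}"
    then have "Inl j \<in> {1..K} <+> {1..}" by (rule InlI)
    from rv[OF this] show "V j \<in> measurable M unif01" by (simp only: eq sum.case)
   qed
   show "(\<lambda>\<omega>. \<lambda>k\<in>{1..n - K}. a k \<omega>) \<in> measurable M (item_measure (n - K))"
   proof (rule measurable_restrict)
    fix k assume "k \<in> {1..n - K}"
    then have "Inr k \<in> {1..K} <+> {1..}" by (intro InrI) simp
    from rv[OF this] show "a k \<in> measurable M unif01" by (simp only: eq sum.case)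
   qed
  qed
  have "\<rho> None = distr M ?B T" by (simp add: \<rho>_def J_def Z_def)
  also have "T = (\<lambda>q. partition_vector K r s n (fst q) (snd q)) \<circ> ?D"
   using partition_vector_restrict[of K r s n] by (simp add: T_def fun_eq_iff)
  also have "distr M ?B ... = distr (distr M (partition_measure K n) ?D) ?B (\<lambda>q. partition_vector K r s n (fst q) (snd q))"
   by (rule distr_distr[OF measurable_partition_vector[OF wf] D, symmetric])
  also have "... = distr (partition_measure K n) ?B (\<lambda>q. partition_vector K r s n (fst q) (snd q))"
   by (simp only: partition_data_law[OF K n])
  finally show ?thesis .
 qed
 have "(\<integral>\<^sup>+x. f x \<partial>distr M borel (X n)) = (\<integral>\<^sup>+x. f x \<partial>distr M borel (\<lambda>\<omega>. \<Psi> (\<lambda>j\<in>J. Z j \<omega>)))"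
  unfolding X_rec[OF n] XZ by (rule refl)
 also have "distr M borel (\<lambda>\<omega>. \<Psi> (\<lambda>j\<in>J. Z j \<omega>)) = distr (PiM J \<rho>) borel \<Psi>"
 proof -
  have "distr (distr M (\<Pi>\<^sub>M j\<in>J. ?B) (\<lambda>\<omega>. \<lambda>j\<in>J. Z j \<omega>)) borel \<Psi> = distr M borel (\<Psi> \<circ> (\<lambda>\<omega>. \<lambda>j\<in>J. Z j \<omega>))"
   by (rule distr_distr[OF _ ZJ]) (use \<Psi> in \<open>simp only: measurable_cong_sets[OF setsJ refl]\<close>)
  then show ?thesis unfolding joint by (simp only: comp_def)
 qed
 also have "(\<integral>\<^sup>+x. f x \<partial>distr (PiM J \<rho>) borel \<Psi>) = (\<integral>\<^sup>+z. f (\<Psi> z) \<partial>PiM J \<rho>)"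
  by (rule nn_integral_distr[OF \<Psi>]) (use f in simp)
 also have "... = (\<integral>\<^sup>+t. (\<integral>\<^sup>+z. f (\<Psi> (z(None := t))) \<partial>PiM (Some ` {..K}) \<rho>) \<partial>\<rho> None)"
  using f\<Psi> unfolding J_def by (intro R.product_nn_integral_insert_rev) auto
 also have "... = (\<integral>\<^sup>+t. F t \<partial>\<rho> None)" by (simp only: inner)
 also have "... = (\<integral>\<^sup>+q. F (partition_vector K r s n (fst q) (snd q)) \<partial>partition_measure K n)"
  unfolding T_dist
 proof (rule nn_integral_distr[OF measurable_partition_vector[OF wf]])
  show "F \<in> borel_measurable (distr (partition_measure K n) ?B (\<lambda>q. partition_vector K r s n (fst q) (snd q)))"
   using F_meas unfolding T_dist .
 qed
 also have "... = (\<integral>\<^sup>+q. (\<integral>\<^sup>+x. f ((\<Sum>i\<le>K. x i) + pcost K r s n q)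
    \<partial>(\<Pi>\<^sub>M i\<in>{..K}. distr M borel (X (psize K n q i)))) \<partial>partition_measure K n)"
 proof (intro nn_integral_cong)
  fix q
  have P: "(\<Pi>\<^sub>M i\<in>{..K}. distr M borel (X (nat \<lfloor>partition_vector K r s n (fst q) (snd q) i\<rfloor>)))
    = (\<Pi>\<^sub>M i\<in>{..K}. distr M borel (X (psize K n q i)))"
   by (rule PiM_cong) (simp_all add: partition_vector_def)
  have C: "partition_vector K r s n (fst q) (snd q) (Suc K) = pcost K r s n q"
   by (simp add: partition_vector_def)
  show "F (partition_vector K r s n (fst q) (snd q)) = (\<integral>\<^sup>+x. f ((\<Sum>i\<le>K. x i) + pcost K r s n q)
    \<partial>(\<Pi>\<^sub>M i\<in>{..K}. distr M borel (X (psize K n q i))))"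
   unfolding F_def P C by (rule refl)
 qed
 finally show ?thesis .
qed

lemma laws:
 assumes "K \<ge> 1"
 shows "quicksort_laws K r s (\<lambda>n. distr M borel (X n))"
proof (rule quicksort_laws.intro)
 show "prob_space (distr M borel (X n))" for n by (rule prob_space_distr[OF X_measurable])
 show "sorter_wf K s" using pivot_sorter by (simp add: sorts_def)
 have fin: "finite (permutations_of_set {..<n})" "permutations_of_set {..<n} \<noteq> {}" for n :: nat
  by (simp_all add: permutations_of_set_empty_iff)
 show "\<exists>b. AE x in distr M borel (X n). 0 \<le> x \<and> x \<le> b" if "n \<le> K" for n
 proof (rule exI[of _ "real (K\<^sup>2)"])
  have "AE xs in measure_pmf (pmf_of_set (permutations_of_set {..<n})). 0 \<le> real (comparisons (b n) xs) \<and> real (comparisons (b n) xs) \<le> real (K\<^sup>2)"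
   using fin[of n] base_sorter_le[OF that] by (auto simp: AE_measure_pmf_iff simp del: of_nat_power)
  then show "AE x in distr M borel (X n). 0 \<le> x \<and> x \<le> real (K\<^sup>2)"
   unfolding X_short[OF that] by (subst AE_distr_iff) auto
 qed
 show "\<exists>c. AE x in distr M borel (X 0). x = c"
 proof (rule exI[of _ "real (comparisons (b 0) ([] :: nat list))"])
  have "AE xs in measure_pmf (pmf_of_set (permutations_of_set {..<0::nat})). real (comparisons (b 0) xs) = real (comparisons (b 0) ([] :: nat list))"
   by (simp add: AE_measure_pmf_iff)
  then show "AE x in distr M borel (X 0). x = real (comparisons (b 0) ([] :: nat list))"
   unfolding X_short[OF le0] by (subst AE_distr_iff) auto
 qed
 show "(\<integral>\<^sup>+x. f x \<partial>distr M borel (X n)) = (\<integral>\<^sup>+q. (\<integral>\<^sup>+x. f ((\<Sum>i\<le>K. x i) + pcost K r s n q)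
    \<partial>(\<Pi>\<^sub>M i\<in>{..K}. distr M borel (X (psize K n q i)))) \<partial>partition_measure K n)"
  if "n > K" "f \<in> borel_measurable borel" for n and f :: "real \<Rightarrow> ennreal"
  by (rule law_rec[OF assms that])
qed (use assms tie_order in simp_all)

end

section \<open>The coupling\<close>

abbreviation pair_borel :: "(real \<times> real) measure" where
 "pair_borel \<equiv> borel \<Otimes>\<^sub>M borel"

definition limit_toll :: "nat \<Rightarrow> (nat \<Rightarrow> real) \<Rightarrow> real" where
 "limit_toll K v = (\<Sum>i\<le>K. alpha_K K * spacing K v i * ln (spacing K v i)) + opt_cost K (spacing K v)"

lemma measurable_limit_toll: "limit_toll K \<in> borel_measurable (pivot_measure K)"
proof -
 have "(\<lambda>v. opt_cost K (spacing K v)) \<in> borel_measurable (pivot_measure K)"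
  by (rule measurable_opt_cost) (rule pivot_spacing_measurable)
 then show ?thesis unfolding limit_toll_def
  by (intro borel_rules borel_measurable_ln pivot_spacing_measurable)
qed

locale limit_coupling = quicksort_laws K r s \<mu>
 for K :: nat and r :: "(nat tree \<times> nat tree) set" and s :: sorter and \<mu> :: "nat \<Rightarrow> real measure" +
 fixes \<zeta> :: "real measure"
 assumes limit: "is_limit_law K \<zeta>"
begin

lemma prob_\<zeta>: "prob_space \<zeta>" and sets_\<zeta>: "sets \<zeta> = sets borel"
 using limit by (auto simp: is_limit_law_def)

text \<open>One step of both distributional equations at once, driven by the same pivots: the first
  components obey the recursion of the comparisons, the second ones the fixed-point equation of the
  limit.\<close>

definition combine :: "nat \<Rightarrow> (nat \<Rightarrow> real) \<times> (nat \<Rightarrow> real) \<Rightarrow> (nat \<Rightarrow> real \<times> real) \<Rightarrow> real \<times> real" where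
 "combine n q x = ((\<Sum>i\<le>K. fst (x i)) + pcost K r s n q,
   (\<Sum>i\<le>K. spacing K (fst q) i * snd (x i)) + limit_toll K (fst q))"

abbreviation sz :: "nat \<Rightarrow> (nat \<Rightarrow> real) \<times> (nat \<Rightarrow> real) \<Rightarrow> nat \<Rightarrow> nat" where
 "sz n q i \<equiv> psize K n q i"

text \<open>For short lists the two laws are coupled independently. Otherwise each sublist gets its
  own independent history, one pair for every size below n, from which the realised size selects;
  this avoids a random choice of measure. The test \<open>m < n\<close> always succeeds on the index
  set and only makes the decrease visible to the termination proof.\<close>

function \<pi> :: "nat \<Rightarrow> (real \<times> real) measure" where
 "\<pi> n = (if n \<le> K then \<mu> n \<Otimes>\<^sub>M \<zeta>
   else distr (partition_measure K n \<Otimes>\<^sub>M (\<Pi>\<^sub>M i\<in>{..K}. \<Pi>\<^sub>M m\<in>{..<n}. if m < n then \<pi> m else \<mu> m \<Otimes>\<^sub>M \<zeta>)) pair_borel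
    (\<lambda>(q, w). combine n q (\<lambda>i. w i (sz n q i))))"
 by pat_completeness auto
termination by (relation less_than) auto

declare \<pi>.simps [simp del]

lemma sz_less: "n > K ==> sz n q i < n"
 using class_count_le[of K "fst q" "snd q" "n - K" i] K by (simp add: sublist_size_def)

lemma combine_measurable:
 assumes X: "\<And>i. i \<le> K ==> (\<lambda>z. X z i) \<in> measurable M pair_borel"
  and Q: "Q \<in> measurable M (partition_measure K n)"
 shows "(\<lambda>z. combine n (Q z) (X z)) \<in> measurable M pair_borel"
proof -
 have f: "(\<lambda>z. fst (X z i)) \<in> borel_measurable M" and g: "(\<lambda>z. snd (X z i)) \<in> borel_measurable M" if "i \<le> K" for i
  by (rule measurable_compose[OF X[OF that] measurable_fst], rule measurable_compose[OF X[OF that] measurable_snd])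
 have P: "(\<lambda>z. partition_cost K r s n (fst (Q z)) (snd (Q z))) \<in> borel_measurable M"
  by (rule measurable_compose[OF Q measurable_partition_cost_part[OF wf]])
 have S: "(\<lambda>z. spacing K (fst (Q z)) i) \<in> borel_measurable M" for i
  by (rule measurable_compose[OF Q measurable_spacing_part])
 have T: "(\<lambda>z. limit_toll K (fst (Q z))) \<in> borel_measurable M"
  by (rule measurable_compose[OF Q measurable_compose[OF measurable_fst measurable_limit_toll]])
 show ?thesis unfolding combine_def
  by (intro borel_rules measurable_Pair f g P S T) simp_all
qed

lemma sets_\<pi>: "sets (\<pi> n) = sets pair_borel"
 using sets_pair_measure_cong[OF sets_\<mu> sets_\<zeta>] by (simp add: \<pi>.simps[of n])

lemma space_\<pi>: "space (\<pi> n) = UNIV"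
 using sets_eq_imp_space_eq[OF sets_\<pi>] by (simp add: space_pair_measure)

abbreviation history :: "nat \<Rightarrow> (nat \<Rightarrow> real \<times> real) measure" where
 "history n \<equiv> (\<Pi>\<^sub>M m\<in>{..<n}. \<pi> m)"

lemma \<pi>_rec:
 assumes "n > K"
 shows "\<pi> n = distr (partition_measure K n \<Otimes>\<^sub>M (\<Pi>\<^sub>M i\<in>{..K}. history n)) pair_borel
  (\<lambda>z. combine n (fst z) (\<lambda>i. snd z i (sz n (fst z) i)))"
proof -
 have eq: "(\<Pi>\<^sub>M m\<in>{..<n}. if m < n then \<pi> m else \<mu> m \<Otimes>\<^sub>M \<zeta>) = history n"
  by (rule PiM_cong) auto
 show ?thesis using assms unfolding \<pi>.simps[of n] eq case_prod_beta by simp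
qed

lemma history_coord: "m < n ==> (\<lambda>x. x m) \<in> measurable (history n) pair_borel"
proof -
 assume "m < n"
 then have "(\<lambda>x. x m) \<in> measurable (history n) (\<pi> m)" by (intro measurable_component_singleton) simp
 then show ?thesis by (simp only: measurable_cong_sets[OF refl sets_\<pi>[of m]])
qed

lemma measurable_sz: "n > K ==> (\<lambda>q. sz n q i) \<in> measurable (partition_measure K n) (count_space {..<n})"
 using measurable_sets[OF measurable_sublist_size_part, of "{_}"] sz_less
 by (simp add: measurable_count_space_eq2_countable)

lemma select_measurable:
 assumes n: "n > K" and i: "i \<le> K"
 shows "(\<lambda>z. snd z i (sz n (fst z) i)) \<in> measurable (partition_measure K n \<Otimes>\<^sub>M (\<Pi>\<^sub>M i\<in>{..K}. history n)) pair_borel"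
proof -
 let ?M = "partition_measure K n \<Otimes>\<^sub>M (\<Pi>\<^sub>M i\<in>{..K}. history n)"
 have c: "(\<lambda>z. snd z i m) \<in> measurable ?M pair_borel" if "m \<in> {..<n}" for m
 proof -
  have 2: "(\<lambda>z. snd z i) \<in> measurable ?M (history n)"
   by (rule measurable_compose[OF measurable_snd measurable_component_singleton]) (use i in simp)
  show ?thesis
   by (rule measurable_compose[where f = "\<lambda>z. snd z i" and g = "\<lambda>x. x m", OF 2 history_coord]) (use that in simp)
 qed
 have s: "(\<lambda>z. sz n (fst z) i) \<in> measurable ?M (count_space {..<n})"
  by (rule measurable_compose[OF measurable_fst measurable_sz[OF n]])
 show ?thesis
  by (rule measurable_compose_countable'[where f = "\<lambda>m z. snd z i m" and g = "\<lambda>z. sz n (fst z) i" and I = "{..<n}", OF c s]) simp_all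
qed

lemma combine_select_measurable:
 assumes n: "n > K"
 shows "(\<lambda>z. combine n (fst z) (\<lambda>i. snd z i (sz n (fst z) i)))
  \<in> measurable (partition_measure K n \<Otimes>\<^sub>M (\<Pi>\<^sub>M i\<in>{..K}. history n)) pair_borel"
 by (rule combine_measurable) (rule select_measurable[OF n], assumption, rule measurable_fst)

lemma prob_\<pi>: "prob_space (\<pi> n)"
proof (induction n rule: less_induct)
 case (less n)
 show ?case
 proof (cases "n \<le> K")
  case True
  interpret A: prob_space "\<mu> n" by (rule prob_\<mu>)
  interpret B: prob_space \<zeta> by (rule prob_\<zeta>)
  interpret AB: pair_prob_space "\<mu> n" \<zeta> ..
  have "prob_space (\<mu> n \<Otimes>\<^sub>M \<zeta>)" by (rule AB.prob_space_axioms)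
  then show ?thesis using True by (simp add: \<pi>.simps[of n])
 next
  case False
  then have n: "n > K" by simp
  have S: "prob_space (history n)" using less by (intro prob_space_PiM) auto
  interpret A: prob_space "partition_measure K n" by (rule prob_space_partition_measure)
  interpret B: prob_space "\<Pi>\<^sub>M i\<in>{..K}. history n" by (rule prob_space_PiM) (rule S)
  interpret AB: pair_prob_space "partition_measure K n" "\<Pi>\<^sub>M i\<in>{..K}. history n" ..
  show ?thesis unfolding \<pi>_rec[OF n] by (rule AB.prob_space_distr[OF combine_select_measurable[OF n]])
 qed
qed

lemma prob_history: "prob_space (history n)"
 by (rule prob_space_PiM) (rule prob_\<pi>)

lemma distr_history: "m < n ==> distr (history n) pair_borel (\<lambda>x. x m) = \<pi> m"
proof -
 assume m: "m < n"
 have "distr (history n) pair_borel (\<lambda>x. x m) = distr (history n) (\<pi> m) (\<lambda>x. x m)"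
  by (intro distr_cong refl) (simp only: sets_\<pi>)
 also have "... = \<pi> m" by (rule distr_PiM_component) (use m prob_\<pi> in auto)
 finally show ?thesis .
qed

abbreviation inputs :: "nat \<Rightarrow> (nat \<Rightarrow> real) \<times> (nat \<Rightarrow> real) \<Rightarrow> (nat \<Rightarrow> real \<times> real) measure" where
 "inputs n q \<equiv> \<Pi>\<^sub>M i\<in>{..K}. \<pi> (sz n q i)"

text \<open>Conditionally on the partitioning data, the recursive calls are independent.\<close>

lemma
 assumes n: "n > K" and G: "G \<in> borel_measurable (partition_measure K n \<Otimes>\<^sub>M (\<Pi>\<^sub>M i\<in>{..K}. pair_borel))"
 shows mixture_measurable: "(\<lambda>q. \<integral>\<^sup>+x. G (q, x) \<partial>(inputs n q)) \<in> borel_measurable (partition_measure K n)"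
  and mixture_eq: "(\<integral>\<^sup>+z. G (fst z, \<lambda>i\<in>{..K}. snd z i (sz n (fst z) i)) \<partial>(partition_measure K n \<Otimes>\<^sub>M (\<Pi>\<^sub>M i\<in>{..K}. history n)))
   = (\<integral>\<^sup>+q. (\<integral>\<^sup>+x. G (q, x) \<partial>(inputs n q)) \<partial>partition_measure K n)"
proof -
 let ?W = "\<Pi>\<^sub>M i\<in>{..K}. history n"
 interpret W: prob_space ?W by (rule prob_space_PiM) (rule prob_history)
 define g where "g z = G (fst z, \<lambda>i\<in>{..K}. snd z i (sz n (fst z) i))" for z
 have "(\<lambda>z. (fst z, \<lambda>i\<in>{..K}. snd z i (sz n (fst z) i))) \<in> measurable (partition_measure K n \<Otimes>\<^sub>M ?W) (partition_measure K n \<Otimes>\<^sub>M (\<Pi>\<^sub>M i\<in>{..K}. pair_borel))"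
  by (intro measurable_Pair measurable_fst measurable_restrict select_measurable[OF n]) simp
 then have g: "g \<in> borel_measurable (partition_measure K n \<Otimes>\<^sub>M ?W)"
  unfolding g_def by (rule measurable_compose[OF _ G])
 have inner: "(\<integral>\<^sup>+w. g (q, w) \<partial>?W) = (\<integral>\<^sup>+x. G (q, x) \<partial>(inputs n q))" if q: "q \<in> space (partition_measure K n)" for q
 proof -
  have "(\<integral>\<^sup>+w. g (q, w) \<partial>PiM ((\<lambda>i. i) ` {..K}) (\<lambda>_. history n)) = (\<integral>\<^sup>+x. G (q, x) \<partial>(inputs n q))"
  proof (rule nn_integral_PiM_select[where g = "\<lambda>i x. x (sz n q i)" and B = "\<lambda>_. pair_borel"])
   show "(\<lambda>x. G (q, x)) \<in> borel_measurable (\<Pi>\<^sub>M i\<in>{..K}. pair_borel)"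
    by (rule measurable_compose[OF measurable_Pair1'[OF q] G])
  qed (simp_all add: g_def prob_history history_coord distr_history sz_less[OF n])
  then show ?thesis by simp
 qed
 show "(\<lambda>q. \<integral>\<^sup>+x. G (q, x) \<partial>(inputs n q)) \<in> borel_measurable (partition_measure K n)"
  using W.borel_measurable_nn_integral_fst[OF g] by (rule measurable_cong[THEN iffD1, rotated]) (rule inner)
 have "(\<integral>\<^sup>+z. g z \<partial>(partition_measure K n \<Otimes>\<^sub>M ?W)) = (\<integral>\<^sup>+q. \<integral>\<^sup>+w. g (q, w) \<partial>?W \<partial>partition_measure K n)"
  by (rule W.nn_integral_fst[OF g, symmetric])
 also have "... = (\<integral>\<^sup>+q. (\<integral>\<^sup>+x. G (q, x) \<partial>(inputs n q)) \<partial>partition_measure K n)"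
  by (rule nn_integral_cong) (rule inner)
 finally show "(\<integral>\<^sup>+z. G (fst z, \<lambda>i\<in>{..K}. snd z i (sz n (fst z) i)) \<partial>(partition_measure K n \<Otimes>\<^sub>M ?W))
   = ..."
  by (simp only: g_def)
qed

section \<open>Marginals of the coupling\<close>

lemma combine_pair_measurable:
 "(\<lambda>z. combine n (fst z) (snd z)) \<in> measurable (partition_measure K n \<Otimes>\<^sub>M (\<Pi>\<^sub>M i\<in>{..K}. pair_borel)) pair_borel"
 by (rule combine_measurable, rule measurable_compose[OF measurable_snd measurable_component_singleton], simp, rule measurable_fst)

lemma nn_integral_\<pi>:
 assumes n: "n > K" and f: "f \<in> borel_measurable pair_borel"
 shows "(\<integral>\<^sup>+y. f y \<partial>\<pi> n) = (\<integral>\<^sup>+q. (\<integral>\<^sup>+x. f (combine n q x) \<partial>(inputs n q)) \<partial>partition_measure K n)"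
proof -
 have "(\<integral>\<^sup>+y. f y \<partial>\<pi> n) = (\<integral>\<^sup>+z. f (combine n (fst z) (\<lambda>i. snd z i (sz n (fst z) i))) \<partial>(partition_measure K n \<Otimes>\<^sub>M (\<Pi>\<^sub>M i\<in>{..K}. history n)))"
  unfolding \<pi>_rec[OF n] by (rule nn_integral_distr[OF combine_select_measurable[OF n]]) (use f in simp)
 also have "... = (\<integral>\<^sup>+z. f (combine n (fst (fst z, \<lambda>i\<in>{..K}. snd z i (sz n (fst z) i))) (snd (fst z, \<lambda>i\<in>{..K}. snd z i (sz n (fst z) i)))) \<partial>(partition_measure K n \<Otimes>\<^sub>M (\<Pi>\<^sub>M i\<in>{..K}. history n)))"
  by (simp add: combine_def)
 also have "... = (\<integral>\<^sup>+q. (\<integral>\<^sup>+x. f (combine n (fst (q, x)) (snd (q, x))) \<partial>(inputs n q)) \<partial>partition_measure K n)"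
  by (rule mixture_eq[OF n, where G = "\<lambda>z. f (combine n (fst z) (snd z))"]) (rule measurable_compose[OF combine_pair_measurable f])
 finally show ?thesis by (simp only: fst_conv snd_conv)
qed

lemma measurable_\<pi>: "measurable (\<pi> n) N = measurable pair_borel N"
 by (rule measurable_cong_sets[OF sets_\<pi> refl])

text \<open>Induction on n: the first components of the selected pairs are independent with the laws
  of the sublist costs, and the first component of \<open>combine\<close> is the right-hand side of
  the recursion.\<close>

lemma fst_\<pi>: "distr (\<pi> n) borel fst = \<mu> n"
proof (induction n rule: less_induct)
 case (less n)
 show ?case
 proof (cases "n \<le> K")
  case True
  interpret B: prob_space \<zeta> by (rule prob_\<zeta>)
  have "distr (\<pi> n) borel fst = distr (\<mu> n \<Otimes>\<^sub>M \<zeta>) (\<mu> n) fst"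
   using True by (intro distr_cong) (simp_all add: \<pi>.simps[of n] sets_\<mu>)
  also have "... = \<mu> n" by (rule B.distr_pair_fst)
  finally show ?thesis .
 next
  case False
  then have n: "n > K" by simp
  show ?thesis
  proof (rule measure_eqI_nn_integral)
   fix f :: "real \<Rightarrow> ennreal" assume "f \<in> borel_measurable (\<mu> n)"
   then have f: "f \<in> borel_measurable borel" by (simp only: measurable_cong_sets[OF sets_\<mu> refl])
   have "(\<integral>\<^sup>+x. f x \<partial>distr (\<pi> n) borel fst) = (\<integral>\<^sup>+y. f (fst y) \<partial>\<pi> n)"
    by (rule nn_integral_distr) (use f in \<open>simp_all add: measurable_\<pi>\<close>)
   also have "... = (\<integral>\<^sup>+q. (\<integral>\<^sup>+x. f (fst (combine n q x)) \<partial>(inputs n q)) \<partial>partition_measure K n)"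
    by (rule nn_integral_\<pi>[OF n measurable_compose[OF measurable_fst f]])
   also have "... = (\<integral>\<^sup>+q. (\<integral>\<^sup>+x. f ((\<Sum>i\<le>K. x i) + pcost K r s n q)
     \<partial>(\<Pi>\<^sub>M i\<in>{..K}. \<mu> (sz n q i))) \<partial>partition_measure K n)"
   proof (rule nn_integral_cong)
    fix q
    have "(\<integral>\<^sup>+x. f (fst (combine n q x)) \<partial>PiM ((\<lambda>i. i) ` {..K}) (\<lambda>i. \<pi> (sz n q i)))
      = (\<integral>\<^sup>+x. f ((\<Sum>i\<le>K. x i) + pcost K r s n q) \<partial>(\<Pi>\<^sub>M i\<in>{..K}. \<mu> (sz n q i)))"
    proof (rule nn_integral_PiM_select[where g = "\<lambda>_. fst" and B = "\<lambda>_. borel"])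
     have "(\<lambda>x. (\<Sum>i\<le>K. x i) + pcost K r s n q) \<in> borel_measurable (\<Pi>\<^sub>M i\<in>{..K}. borel)"
      by (intro borel_rules measurable_component_singleton)
     from measurable_compose[OF this f]
     show "(\<lambda>x. f ((\<Sum>i\<le>K. x i) + pcost K r s n q)) \<in> borel_measurable (\<Pi>\<^sub>M i\<in>{..K}. borel)" .
     show "f (fst (combine n q z)) = f ((\<Sum>i\<le>K. (\<lambda>i\<in>{..K}. fst (z i)) i) + pcost K r s n q)" for z
      by (simp add: combine_def)
    qed (simp_all add: prob_\<pi> measurable_\<pi> less sz_less[OF n])
    then show "(\<integral>\<^sup>+x. f (fst (combine n q x)) \<partial>(inputs n q))
      = (\<integral>\<^sup>+x. f ((\<Sum>i\<le>K. x i) + pcost K r s n q) \<partial>(\<Pi>\<^sub>M i\<in>{..K}. \<mu> (sz n q i)))" by simp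
   qed
   also have "... = (\<integral>\<^sup>+x. f x \<partial>\<mu> n)" by (rule rec[OF n f, symmetric])
   finally show "(\<integral>\<^sup>+x. f x \<partial>distr (\<pi> n) borel fst) = ..." .
  qed (simp add: sets_\<mu>)
 qed
qed

lemma \<zeta>_fixed_point:
 assumes f: "f \<in> borel_measurable borel"
 shows "(\<integral>\<^sup>+x. f x \<partial>\<zeta>) = (\<integral>\<^sup>+v. (\<integral>\<^sup>+z. f ((\<Sum>i\<le>K. spacing K v i * z i) + limit_toll K v) \<partial>(\<Pi>\<^sub>M i\<in>{..K}. \<zeta>)) \<partial>pivot_measure K)"
  and "(\<lambda>v. \<integral>\<^sup>+z. f ((\<Sum>i\<le>K. spacing K v i * z i) + limit_toll K v) \<partial>(\<Pi>\<^sub>M i\<in>{..K}. \<zeta>)) \<in> borel_measurable (pivot_measure K)"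
proof -
 let ?Z = "\<Pi>\<^sub>M i\<in>{..K}. \<zeta>"
 define h where "h y = (\<Sum>i\<le>K. spacing K (fst y) i * snd y i) + limit_toll K (fst y)" for y
 interpret Z: prob_space ?Z by (rule prob_space_PiM) (rule prob_\<zeta>)
 have co: "(\<lambda>z. z i) \<in> borel_measurable ?Z" if "i \<in> {..K}" for i
  using measurable_component_singleton[OF that, of "\<lambda>_. \<zeta>"] measurable_cong_sets[OF refl sets_\<zeta>] by auto
 have h: "h \<in> borel_measurable (pivot_measure K \<Otimes>\<^sub>M ?Z)"
  unfolding h_def
  by (intro borel_rules measurable_compose[OF measurable_fst pivot_spacing_measurable] measurable_compose[OF measurable_snd co] measurable_compose[OF measurable_fst measurable_limit_toll]) simp_all
 have fh: "(\<lambda>y. f (h y)) \<in> borel_measurable (pivot_measure K \<Otimes>\<^sub>M ?Z)" by (rule measurable_compose[OF h f])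
 have "\<zeta> = distr (pivot_measure K \<Otimes>\<^sub>M ?Z) borel h"
 proof -
  have "(\<lambda>(v, z). (\<Sum>i\<le>K. (spacing K v i * z i + alpha_K K * spacing K v i * ln (spacing K v i))) + opt_cost K (spacing K v)) = h"
   by (auto simp: fun_eq_iff h_def limit_toll_def sum.distrib)
  then show ?thesis using limit unfolding is_limit_law_def by metis
 qed
 then have "(\<integral>\<^sup>+x. f x \<partial>\<zeta>) = (\<integral>\<^sup>+x. f x \<partial>distr (pivot_measure K \<Otimes>\<^sub>M ?Z) borel h)" by (rule arg_cong)
 also have "... = (\<integral>\<^sup>+y. f (h y) \<partial>(pivot_measure K \<Otimes>\<^sub>M ?Z))"
  by (rule nn_integral_distr[OF h]) (use f in simp)
 also have "... = (\<integral>\<^sup>+v. \<integral>\<^sup>+z. f (h (v, z)) \<partial>?Z \<partial>pivot_measure K)"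
  by (rule Z.nn_integral_fst[OF fh, symmetric])
 finally show "(\<integral>\<^sup>+x. f x \<partial>\<zeta>) = (\<integral>\<^sup>+v. (\<integral>\<^sup>+z. f ((\<Sum>i\<le>K. spacing K v i * z i) + limit_toll K v) \<partial>?Z) \<partial>pivot_measure K)"
  by (simp add: h_def)
 show "(\<lambda>v. \<integral>\<^sup>+z. f ((\<Sum>i\<le>K. spacing K v i * z i) + limit_toll K v) \<partial>?Z) \<in> borel_measurable (pivot_measure K)"
  using Z.borel_measurable_nn_integral_fst[OF fh] by (simp add: h_def)
qed

text \<open>The sizes decide which pairs are selected, but all pairs share the second marginal
  \<zeta>, so the selection leaves no trace in it. What remains depends on the pivots only and is
  the fixed-point equation.\<close>

lemma snd_\<pi>: "distr (\<pi> n) borel snd = \<zeta>"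
proof (induction n rule: less_induct)
 case (less n)
 show ?case
 proof (cases "n \<le> K")
  case True
  interpret A: prob_space "\<mu> n" by (rule prob_\<mu>)
  interpret B: prob_space \<zeta> by (rule prob_\<zeta>)
  interpret AB: pair_prob_space "\<mu> n" \<zeta> ..
  interpret BA: pair_prob_space \<zeta> "\<mu> n" ..
  have "distr (\<pi> n) borel snd = distr (\<mu> n \<Otimes>\<^sub>M \<zeta>) \<zeta> snd"
   using True by (intro distr_cong) (simp_all add: \<pi>.simps[of n] sets_\<zeta>)
  also have "... = distr (distr (\<zeta> \<Otimes>\<^sub>M \<mu> n) (\<mu> n \<Otimes>\<^sub>M \<zeta>) (\<lambda>(x, y). (y, x))) \<zeta> snd"
   by (subst AB.distr_pair_swap) (rule refl)
  also have "... = distr (\<zeta> \<Otimes>\<^sub>M \<mu> n) \<zeta> fst"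
   by (subst distr_distr) (auto intro!: distr_cong measurable_pair_swap')
  also have "... = \<zeta>" by (rule A.distr_pair_fst)
  finally show ?thesis .
 next
  case False
  then have n: "n > K" by simp
  show ?thesis
  proof (rule measure_eqI_nn_integral)
   fix f :: "real \<Rightarrow> ennreal" assume "f \<in> borel_measurable \<zeta>"
   then have f: "f \<in> borel_measurable borel" by (simp only: measurable_cong_sets[OF sets_\<zeta> refl])
   define H where "H v = (\<integral>\<^sup>+z. f ((\<Sum>i\<le>K. spacing K v i * z i) + limit_toll K v) \<partial>(\<Pi>\<^sub>M i\<in>{..K}. \<zeta>))" for v
   have H: "H \<in> borel_measurable (pivot_measure K)" unfolding H_def by (rule \<zeta>_fixed_point(2)[OF f])
   interpret A: prob_space "item_measure (n - K)" by (rule prob_space_item_measure)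
   have "(\<integral>\<^sup>+x. f x \<partial>distr (\<pi> n) borel snd) = (\<integral>\<^sup>+y. f (snd y) \<partial>\<pi> n)"
    by (rule nn_integral_distr) (use f in \<open>simp_all add: measurable_\<pi>\<close>)
   also have "... = (\<integral>\<^sup>+q. (\<integral>\<^sup>+x. f (snd (combine n q x)) \<partial>(inputs n q)) \<partial>partition_measure K n)"
    by (rule nn_integral_\<pi>[OF n measurable_compose[OF measurable_snd f]])
   also have "... = (\<integral>\<^sup>+q. H (fst q) \<partial>partition_measure K n)"
   proof (rule nn_integral_cong)
    fix q
    have "(\<integral>\<^sup>+x. f (snd (combine n q x)) \<partial>PiM ((\<lambda>i. i) ` {..K}) (\<lambda>i. \<pi> (sz n q i))) = H (fst q)"
     unfolding H_def
    proof (rule nn_integral_PiM_select[where g = "\<lambda>_. snd" and B = "\<lambda>_. borel"])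
     have "(\<lambda>z. (\<Sum>i\<le>K. spacing K (fst q) i * z i) + limit_toll K (fst q)) \<in> borel_measurable (\<Pi>\<^sub>M i\<in>{..K}. borel)"
      by (intro borel_rules measurable_component_singleton)
     from measurable_compose[OF this f]
     show "(\<lambda>z. f ((\<Sum>i\<le>K. spacing K (fst q) i * z i) + limit_toll K (fst q))) \<in> borel_measurable (\<Pi>\<^sub>M i\<in>{..K}. borel)" .
     show "f (snd (combine n q z)) = f ((\<Sum>i\<le>K. spacing K (fst q) i * (\<lambda>i\<in>{..K}. snd (z i)) i) + limit_toll K (fst q))" for z
      by (simp add: combine_def)
    qed (simp_all add: prob_\<pi> measurable_\<pi> less sz_less[OF n])
    then show "(\<integral>\<^sup>+x. f (snd (combine n q x)) \<partial>(inputs n q)) = H (fst q)" by simp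
   qed
   also have "... = (\<integral>\<^sup>+v. \<integral>\<^sup>+a. H v \<partial>item_measure (n - K) \<partial>pivot_measure K)"
    using nn_integral_partition_measure[OF measurable_compose[OF measurable_fst H]] by simp
   also have "... = (\<integral>\<^sup>+v. H v \<partial>pivot_measure K)"
    by (simp only: A.nn_integral_prob_const)
   also have "... = (\<integral>\<^sup>+x. f x \<partial>\<zeta>)" unfolding H_def by (rule \<zeta>_fixed_point(1)[OF f, symmetric])
   finally show "(\<integral>\<^sup>+x. f x \<partial>distr (\<pi> n) borel snd) = ..." .
  qed (simp add: sets_\<zeta>)
 qed
qed

end

section \<open>Moments under product measures\<close>

lemma product_sigma_finite_prob: "(\<And>i. prob_space (\<nu> i)) ==> product_sigma_finite \<nu>"
 unfolding product_sigma_finite_def using prob_space_imp_sigma_finite by blast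

lemma measurable_PiM_coordinate:
 "i \<in> I ==> f \<in> measurable (\<nu> i) N ==> (\<lambda>x. f (x i)) \<in> measurable (PiM I \<nu>) N"
 by (rule measurable_compose[OF measurable_component_singleton])

lemma nn_integral_PiM_component:
 assumes \<nu>: "\<And>i. prob_space (\<nu> i)" and i: "i \<in> I" and f: "f \<in> borel_measurable (\<nu> i)"
 shows "(\<integral>\<^sup>+x. f (x i) \<partial>PiM I \<nu>) = (\<integral>\<^sup>+x. f x \<partial>\<nu> i)"
proof -
 have d: "distr (PiM I \<nu>) (\<nu> i) (\<lambda>x. x i) = \<nu> i" by (rule distr_PiM_component) (use \<nu> i in auto)
 have "(\<integral>\<^sup>+x. f x \<partial>\<nu> i) = (\<integral>\<^sup>+x. f x \<partial>distr (PiM I \<nu>) (\<nu> i) (\<lambda>x. x i))"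
  by (simp only: d)
 also have "... = (\<integral>\<^sup>+x. f (x i) \<partial>PiM I \<nu>)"
  by (rule nn_integral_distr[OF measurable_component_singleton[OF i]]) (simp only: d f)
 finally show ?thesis by simp
qed

lemma prod_two:
 fixes f g :: "'a \<Rightarrow> 'b::comm_monoid_mult"
 assumes "finite I" "i \<in> I" "j \<in> I" "i \<noteq> j"
 shows "(\<Prod>k\<in>I. (if k = i then f else if k = j then g else (\<lambda>_. 1)) (x k)) = f (x i) * g (x j)"
proof -
 have "(\<Prod>k\<in>I - {i} - {j}. (if k = i then f else if k = j then g else (\<lambda>_. 1)) (x k)) = 1"
  by (rule prod.neutral) simp
 then show ?thesis
  using prod.remove[of I i "\<lambda>k. (if k = i then f else if k = j then g else (\<lambda>_. 1)) (x k)"]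
   prod.remove[of "I - {i}" j "\<lambda>k. (if k = i then f else if k = j then g else (\<lambda>_. 1)) (x k)"] assms by simp
qed

lemma nn_integral_PiM_pair:
 assumes \<nu>: "\<And>i. prob_space (\<nu> i)" and I: "finite I" "i \<in> I" "j \<in> I" "i \<noteq> j"
  and f: "f \<in> borel_measurable (\<nu> i)" and g: "g \<in> borel_measurable (\<nu> j)"
 shows "(\<integral>\<^sup>+x. f (x i) * g (x j) \<partial>PiM I \<nu>) = (\<integral>\<^sup>+x. f x \<partial>\<nu> i) * (\<integral>\<^sup>+x. g x \<partial>\<nu> j)"
proof -
 interpret product_sigma_finite \<nu> by (rule product_sigma_finite_prob[OF \<nu>])
 let ?F = "\<lambda>k. if k = i then f else if k = j then g else (\<lambda>_. 1)"
 have "(\<integral>\<^sup>+x. (\<Prod>k\<in>I. ?F k (x k)) \<partial>PiM I \<nu>) = (\<Prod>k\<in>I. integral\<^sup>N (\<nu> k) (?F k))"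
  by (rule product_nn_integral_prod) (use I f g in auto)
 also have "... = (\<Prod>k\<in>I. (if k = i then (\<lambda>_. integral\<^sup>N (\<nu> i) f) else if k = j then (\<lambda>_. integral\<^sup>N (\<nu> j) g) else (\<lambda>_. 1)) ())"
  by (intro prod.cong refl) (simp add: prob_space.emeasure_space_1[OF \<nu>])
 also have "... = integral\<^sup>N (\<nu> i) f * integral\<^sup>N (\<nu> j) g" by (rule prod_two[OF I])
 finally show ?thesis by (simp only: prod_two[OF I])
qed

lemma integral_PiM_pair:
 fixes f g :: "'a \<Rightarrow> real"
 assumes \<nu>: "\<And>i. prob_space (\<nu> i)" and I: "finite I" "i \<in> I" "j \<in> I" "i \<noteq> j"
  and f: "integrable (\<nu> i) f" and g: "integrable (\<nu> j) g"
 shows "integrable (PiM I \<nu>) (\<lambda>x. f (x i) * g (x j))"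
  and "(\<integral>x. f (x i) * g (x j) \<partial>PiM I \<nu>) = (\<integral>x. f x \<partial>\<nu> i) * (\<integral>x. g x \<partial>\<nu> j)"
proof -
 interpret product_sigma_finite \<nu> by (rule product_sigma_finite_prob[OF \<nu>])
 let ?F = "\<lambda>k. if k = i then f else if k = j then g else (\<lambda>_. 1)"
 have fin: "finite_measure (\<nu> k)" for k using \<nu>[of k] by (simp add: prob_space.finite_measure)
 have F: "integrable (\<nu> k) (?F k)" for k using f g finite_measure.integrable_const[OF fin[of k]] by auto
 show "integrable (PiM I \<nu>) (\<lambda>x. f (x i) * g (x j))"
  using product_integrable_prod[of I ?F, OF I(1) F] by (simp only: prod_two[OF I])
 have "(\<integral>x. (\<Prod>k\<in>I. ?F k (x k)) \<partial>PiM I \<nu>) = (\<Prod>k\<in>I. integral\<^sup>L (\<nu> k) (?F k))"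
  by (rule product_integral_prod[OF I(1) F])
 also have "... = (\<Prod>k\<in>I. (if k = i then (\<lambda>_. integral\<^sup>L (\<nu> i) f) else if k = j then (\<lambda>_. integral\<^sup>L (\<nu> j) g) else (\<lambda>_. 1)) ())"
  by (intro prod.cong refl) (simp add: prob_space.prob_space[OF \<nu>])
 also have "... = integral\<^sup>L (\<nu> i) f * integral\<^sup>L (\<nu> j) g" by (rule prod_two[OF I])
 finally show "(\<integral>x. f (x i) * g (x j) \<partial>PiM I \<nu>) = (\<integral>x. f x \<partial>\<nu> i) * (\<integral>x. g x \<partial>\<nu> j)" by (simp only: prod_two[OF I])
qed

text \<open>Centering and independence cancel the mixed terms. The conclusion is stated with the
  non-negative integral, in which the moment recursion is formulated.\<close>

lemma second_moment_PiM:
 fixes u :: "'i \<Rightarrow> 'a \<Rightarrow> real"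
 assumes \<nu>: "\<And>i. prob_space (\<nu> i)" and I: "finite I"
  and u: "\<And>i. i \<in> I ==> u i \<in> borel_measurable (\<nu> i)" and sq: "\<And>i. i \<in> I ==> integrable (\<nu> i) (\<lambda>x. (u i x)\<^sup>2)"
  and zero: "\<And>i. i \<in> I ==> (\<integral>x. u i x \<partial>\<nu> i) = 0"
 shows "(\<integral>\<^sup>+x. ennreal ((\<Sum>i\<in>I. u i (x i))\<^sup>2) \<partial>PiM I \<nu>) = (\<Sum>i\<in>I. \<integral>\<^sup>+x. ennreal ((u i x)\<^sup>2) \<partial>\<nu> i)"
proof -
 have u1: "integrable (\<nu> i) (u i)" if "i \<in> I" for i
  using finite_measure.square_integrable_imp_integrable[OF _ u[OF that] sq[OF that]] \<nu>[of i]
  by (simp add: prob_space.finite_measure)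
 have diag: "integrable (PiM I \<nu>) (\<lambda>x. u i (x i) * u i (x i))" "(\<integral>x. u i (x i) * u i (x i) \<partial>PiM I \<nu>) = (\<integral>x. (u i x)\<^sup>2 \<partial>\<nu> i)"
  if i: "i \<in> I" for i
 proof -
  have m: "(\<lambda>x. u i x * u i x) \<in> borel_measurable (\<nu> i)" by (intro borel_measurable_times u i)
  have d: "distr (PiM I \<nu>) (\<nu> i) (\<lambda>x. x i) = \<nu> i" by (rule distr_PiM_component) (use \<nu> i in auto)
  have c: "(\<lambda>x. x i) \<in> measurable (PiM I \<nu>) (\<nu> i)" by (rule measurable_component_singleton[OF i])
  have s: "integrable (distr (PiM I \<nu>) (\<nu> i) (\<lambda>x. x i)) (\<lambda>x. u i x * u i x)"
   using sq[OF i] by (simp only: d power2_eq_square)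
  show "integrable (PiM I \<nu>) (\<lambda>x. u i (x i) * u i (x i))"
   by (rule integrable_distr[OF c s])
  have "(\<integral>x. u i x * u i x \<partial>distr (PiM I \<nu>) (\<nu> i) (\<lambda>x. x i)) = (\<integral>x. u i (x i) * u i (x i) \<partial>PiM I \<nu>)"
   by (rule integral_distr[OF c m])
  then show "(\<integral>x. u i (x i) * u i (x i) \<partial>PiM I \<nu>) = (\<integral>x. (u i x)\<^sup>2 \<partial>\<nu> i)"
   by (simp only: d power2_eq_square)
 qed
 have int: "integrable (PiM I \<nu>) (\<lambda>x. u i (x i) * u j (x j))" if "i \<in> I" "j \<in> I" for i j
  using that diag(1)[of i] integral_PiM_pair(1)[OF \<nu> I that(1,2) _ u1 u1] by (cases "i = j") auto
 have val: "(\<integral>x. u i (x i) * u j (x j) \<partial>PiM I \<nu>) = (if i = j then (\<integral>x. (u i x)\<^sup>2 \<partial>\<nu> i) else 0)" if "i \<in> I" "j \<in> I" for i j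
  using that diag(2)[of i] integral_PiM_pair(2)[OF \<nu> I that(1,2) _ u1 u1] zero by (cases "i = j") auto
 have sq2: "(\<Sum>i\<in>I. u i (x i))\<^sup>2 = (\<Sum>i\<in>I. \<Sum>j\<in>I. u i (x i) * u j (x j))" for x
  by (simp add: power2_eq_square sum_product)
 have sqi: "integrable (PiM I \<nu>) (\<lambda>x. (\<Sum>i\<in>I. u i (x i))\<^sup>2)"
  unfolding sq2 by (intro Bochner_Integration.integrable_sum int)
 have "(\<integral>\<^sup>+x. ennreal ((\<Sum>i\<in>I. u i (x i))\<^sup>2) \<partial>PiM I \<nu>) = ennreal (\<integral>x. (\<Sum>i\<in>I. u i (x i))\<^sup>2 \<partial>PiM I \<nu>)"
  by (rule nn_integral_eq_integral[OF sqi]) simp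
 also have "(\<integral>x. (\<Sum>i\<in>I. u i (x i))\<^sup>2 \<partial>PiM I \<nu>) = (\<Sum>i\<in>I. \<Sum>j\<in>I. \<integral>x. u i (x i) * u j (x j) \<partial>PiM I \<nu>)"
  unfolding sq2 by (simp add: Bochner_Integration.integral_sum Bochner_Integration.integrable_sum int)
 also have "... = (\<Sum>i\<in>I. \<integral>x. (u i x)\<^sup>2 \<partial>\<nu> i)" using I by (simp add: val)
 also have "ennreal ... = (\<Sum>i\<in>I. ennreal (\<integral>x. (u i x)\<^sup>2 \<partial>\<nu> i))"
  by (rule sum_ennreal[symmetric]) simp
 also have "... = (\<Sum>i\<in>I. \<integral>\<^sup>+x. ennreal ((u i x)\<^sup>2) \<partial>\<nu> i)"
  by (intro sum.cong refl nn_integral_eq_integral[symmetric] sq) simp_all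
 finally show ?thesis .
qed

section \<open>Partition sizes and the contraction\<close>

lemma AE_partition_generic: "AE q in partition_measure K n. generic_pivots K (fst q)"
proof -
 interpret B: prob_space "item_measure (n - K)" by (rule prob_space_item_measure)
 have "AE v in distr (partition_measure K n) (pivot_measure K) fst. generic_pivots K v"
  by (simp only: B.distr_pair_fst AE_generic_pivots)
 then show ?thesis by (rule AE_distrD[OF measurable_fst])
qed

lemma partition_integral_le:
 assumes f: "f \<in> borel_measurable (partition_measure K n)"
  and le: "\<And>v. generic_pivots K v ==> (\<integral>\<^sup>+a. f (v, a) \<partial>item_measure (n - K)) \<le> B"
 shows "(\<integral>\<^sup>+q. f q \<partial>partition_measure K n) \<le> B"
proof -
 interpret P: prob_space "pivot_measure K" by (rule prob_space_pivot_measure)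
 have "(\<integral>\<^sup>+v. \<integral>\<^sup>+a. f (v, a) \<partial>item_measure (n - K) \<partial>pivot_measure K) \<le> (\<integral>\<^sup>+v. B \<partial>pivot_measure K)"
  by (rule nn_integral_mono_AE) (use AE_generic_pivots[of K] le in \<open>auto elim: eventually_mono\<close>)
 then show ?thesis by (simp only: nn_integral_partition_measure[OF f] P.nn_integral_prob_const)
qed

lemma sizes_sum: "AE q in partition_measure K n. (\<Sum>i\<le>K. psize K n q i) = n - K"
proof -
 interpret A: prob_space "pivot_measure K" by (rule prob_space_pivot_measure)
 interpret B: prob_space "item_measure (n - K)" by (rule prob_space_item_measure)
 interpret AB: pair_sigma_finite "pivot_measure K" "item_measure (n - K)" ..
 have m: "(\<lambda>q. real (psize K n q i)) \<in> borel_measurable (partition_measure K n)" for i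
  by (rule measurable_compose[OF measurable_sublist_size_part]) simp
 have "(\<lambda>q. \<Sum>i\<le>K. real (psize K n q i)) \<in> borel_measurable (partition_measure K n)"
  by (intro borel_measurable_sum m)
 from measurable_sets[OF this, of "{real (n - K)}"]
 have "{q \<in> space (partition_measure K n). (\<Sum>i\<le>K. psize K n q i) = n - K} \<in> sets (partition_measure K n)"
  by (simp add: vimage_def Int_def conj_commute flip: of_nat_sum)
 moreover have "AE v in pivot_measure K. AE a in item_measure (n - K).
   (\<Sum>i\<le>K. sublist_size K n (fst (v, a)) (snd (v, a)) i) = n - K"
  using AE_generic_pivots
 proof (rule eventually_mono)
  fix v assume v: "generic_pivots K v"
  show "AE a in item_measure (n - K). (\<Sum>i\<le>K. sublist_size K n (fst (v, a)) (snd (v, a)) i) = n - K"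
   using AE_items_generic[of "n - K" v K]
   by (rule eventually_mono) (use sum_class_count[OF v] in \<open>simp add: sublist_size_def\<close>)
 qed
 ultimately show ?thesis by (rule AB.AE_pair_measure)
qed

lemma size_moment:
 assumes p: "p \<ge> 1" and i: "i \<le> K"
 shows "(\<integral>\<^sup>+q. ennreal (\<bar>real (psize K n q i) - real (n - K) * spacing K (fst q) i\<bar> ^ p) \<partial>partition_measure K n)
  \<le> ennreal (2 * fact p * exp (1 / 8) * sqrt (real n) ^ p)"
proof (rule partition_integral_le)
 have m: "(\<lambda>q. real (psize K n q i)) \<in> borel_measurable (partition_measure K n)"
  by (rule measurable_compose[OF measurable_sublist_size_part]) simp
 show "(\<lambda>q. ennreal (\<bar>real (psize K n q i) - real (n - K) * spacing K (fst q) i\<bar> ^ p)) \<in> borel_measurable (partition_measure K n)"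
  by (intro borel_rules m measurable_spacing_part)
 fix v assume v: "generic_pivots K v"
 have "(\<integral>\<^sup>+a. ennreal (\<bar>real (class_count K v a (n - K) i) - real (n - K) * spacing K v i\<bar> ^ p) \<partial>item_measure (n - K))
   \<le> ennreal (2 * fact p * exp (1 / 8) * sqrt (real (n - K)) ^ p)"
  by (rule class_count_moment[OF v order_refl p i])
 also have "... \<le> ennreal (2 * fact p * exp (1 / 8) * sqrt (real n) ^ p)"
  by (intro ennreal_leI mult_left_mono power_mono) auto
 finally show "(\<integral>\<^sup>+a. ennreal (\<bar>real (sublist_size K n (fst (v, a)) (snd (v, a)) i) - real (n - K) * spacing K (fst (v, a)) i\<bar> ^ p) \<partial>item_measure (n - K))
   \<le> ..."
  by (simp only: sublist_size_def fst_conv snd_conv)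
qed

text \<open>The power has derivative at most \<sigma> on (0, 1]; y > 0 keeps the mean value theorem
  away from 0.\<close>

lemma powr_le_add_lipschitz:
 fixes x y \<sigma> :: real
 assumes x: "0 \<le> x" "x \<le> 1" and y: "0 < y" and \<sigma>: "\<sigma> \<ge> 1"
 shows "x powr \<sigma> \<le> y powr \<sigma> + \<sigma> * \<bar>x - y\<bar>"
proof (cases "x \<le> y")
 case True
 have "x powr \<sigma> \<le> y powr \<sigma>" by (rule powr_mono2) (use True x \<sigma> in auto)
 moreover have "0 \<le> \<sigma> * \<bar>x - y\<bar>" using \<sigma> by simp
 ultimately show ?thesis by linarith
next
 case False
 then have yx: "y < x" by simp
 have "\<exists>z>y. z < x \<and> x powr \<sigma> - y powr \<sigma> = (x - y) * (\<sigma> * z powr (\<sigma> - 1))"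
  by (rule MVT2[OF yx]) (use y in \<open>auto intro!: derivative_eq_intros\<close>)
 then obtain z where z: "y < z" "z < x" "x powr \<sigma> - y powr \<sigma> = (x - y) * (\<sigma> * z powr (\<sigma> - 1))" by blast
 have "z powr (\<sigma> - 1) \<le> 1 powr (\<sigma> - 1)" by (rule powr_mono2) (use z x y \<sigma> in auto)
 then have "z powr (\<sigma> - 1) \<le> 1" by simp
 then have "\<sigma> * z powr (\<sigma> - 1) \<le> \<sigma> * 1" by (rule mult_left_mono) (use \<sigma> in simp)
 then have "(x - y) * (\<sigma> * z powr (\<sigma> - 1)) \<le> (x - y) * (\<sigma> * 1)" by (rule mult_left_mono) (use yx in simp)
 then have "x powr \<sigma> - y powr \<sigma> \<le> \<sigma> * (x - y)" unfolding z(3) mult_1_right by (simp only: mult.commute[of \<sigma> "x - y"])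
 with yx show ?thesis by simp
qed

text \<open>Each spacing is strictly between 0 and 1, the upper bound because K >= 1 leaves a second
  positive one. Hence D_i^\<sigma> < D_i, and the spacings sum to 1.\<close>

lemma spacing_power_mass_less_1:
 assumes K: "K \<ge> 1" and \<sigma>: "\<sigma> > 1"
 shows "(\<integral>\<^sup>+v. (\<Sum>i\<le>K. ennreal (spacing K v i powr \<sigma>)) \<partial>pivot_measure K) < 1"
proof -
 let ?f = "\<lambda>v. \<Sum>i\<le>K. ennreal (spacing K v i powr \<sigma>)"
 interpret P: prob_space "pivot_measure K" by (rule prob_space_pivot_measure)
 have lt: "?f v < 1" if v: "generic_pivots K v" for v
 proof -
  have s: "spacing K v i powr \<sigma> < spacing K v i" if i: "i \<le> K" for i
  proof -
   have D: "0 < spacing K v i" by (rule spacing_pos[OF v i])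
   obtain j where j: "j \<le> K" "j \<noteq> i" using K i by (metis le0 le_antisym not_one_le_zero)
   have "spacing K v i + spacing K v j = (\<Sum>k\<in>{i, j}. spacing K v k)" using j by simp
   also have "... \<le> (\<Sum>k\<le>K. spacing K v k)" by (rule sum_mono2) (use i j spacing_pos[OF v] in \<open>auto intro: less_imp_le\<close>)
   finally have "spacing K v i < 1" using sum_spacing[of K v] spacing_pos[OF v j(1)] by linarith
   then have "spacing K v i powr \<sigma> < spacing K v i powr 1" using D \<sigma> by (intro powr_less_mono') auto
   then show ?thesis using D by simp
  qed
  have "(\<Sum>i\<le>K. spacing K v i powr \<sigma>) < (\<Sum>i\<le>K. spacing K v i)" by (rule sum_strict_mono) (use s in auto)
  then have "ennreal (\<Sum>i\<le>K. spacing K v i powr \<sigma>) < ennreal 1" unfolding sum_spacing by (intro ennreal_lessI) auto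
  then show ?thesis by (simp add: sum_ennreal)
 qed
 have "(\<integral>\<^sup>+v. ?f v \<partial>pivot_measure K) < (\<integral>\<^sup>+v. 1 \<partial>pivot_measure K)"
 proof (rule nn_integral_less)
  show "(\<lambda>v. \<Sum>i\<le>K. ennreal (spacing K v i powr \<sigma>)) \<in> borel_measurable (pivot_measure K)"
   by (intro borel_rules powr_real_measurable pivot_spacing_measurable)
  show le: "AE v in pivot_measure K. ?f v \<le> 1"
   using AE_generic_pivots by (rule eventually_mono) (use lt in \<open>simp add: less_imp_le\<close>)
  show "\<not> (AE v in pivot_measure K. 1 \<le> ?f v)"
  proof
   assume "AE v in pivot_measure K. 1 \<le> ?f v"
   then have "AE v in pivot_measure K. False"
    using AE_generic_pivots[of K] by eventually_elim (use lt in \<open>simp add: not_less[symmetric]\<close>)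
   then show False by (simp add: P.AE_False)
  qed
  have "(\<integral>\<^sup>+v. ?f v \<partial>pivot_measure K) \<le> (\<integral>\<^sup>+v. 1 \<partial>pivot_measure K)"
   by (rule nn_integral_mono_AE[OF le])
  then show "(\<integral>\<^sup>+v. ?f v \<partial>pivot_measure K) \<noteq> \<infinity>"
   by (simp only: P.nn_integral_prob_const) (auto simp: top_unique)
 qed simp
 then show ?thesis by (simp only: P.nn_integral_prob_const)
qed

text \<open>I_i / n differs from D_i by O(n^(-1/2)) in mean and the power is Lipschitz, so the sum
  of (I_i / n)^\<sigma> exceeds that of D_i^\<sigma> by O(n^(-1/2)) in mean. The factor (1 + k0) /
  2, half way between the limit k0 < 1 and 1, absorbs this error for large n.\<close>

lemma sizes_contraction:
 assumes K: "K \<ge> 1" and \<sigma>: "\<sigma> > 1"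
 shows "\<exists>\<kappa>\<ge>0. \<kappa> < 1 \<and> (\<exists>n0. \<forall>n\<ge>n0.
  (\<integral>\<^sup>+q. (\<Sum>i\<le>K. ennreal (real (psize K n q i) powr \<sigma>)) \<partial>partition_measure K n) \<le> ennreal (\<kappa> * real n powr \<sigma>))"
proof -
 let ?f = "\<lambda>n q. \<Sum>i\<le>K. ennreal (real (psize K n q i) powr \<sigma>)"
 let ?I = "\<integral>\<^sup>+v. (\<Sum>i\<le>K. ennreal (spacing K v i powr \<sigma>)) \<partial>pivot_measure K"
 define k0 where "k0 = enn2real ?I"
 have k0: "?I = ennreal k0" "0 \<le> k0" "k0 < 1"
 proof -
  have lt: "?I < 1" by (rule spacing_power_mass_less_1[OF K \<sigma>])
  then show e: "?I = ennreal k0" unfolding k0_def by (auto simp: less_top[symmetric] dest: order.strict_trans2[OF _ top_greatest])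
  show "0 \<le> k0" by (simp add: k0_def)
  then show "k0 < 1" using lt unfolding e by (simp add: ennreal_less_one_iff)
 qed
 define c where "c = (2 * fact 1 * exp (1 / 8) :: real)"
 have c: "c \<ge> 0" by (simp add: c_def)
 define E where "E = \<sigma> * real (K + 1) * (c + real K)"
 have "(\<lambda>n. E * (1 / sqrt (real n))) \<longlonglongrightarrow> 0" by (rule tendsto_mult_right_zero) real_asymp
 then have "eventually (\<lambda>n. E * (1 / sqrt (real n)) < (1 - k0) / 2) sequentially"
  using k0 by (intro order_tendstoD(2)) auto
 then obtain n1 where n1: "\<And>n. n \<ge> n1 ==> E * (1 / sqrt (real n)) < (1 - k0) / 2" by (auto simp: eventually_sequentially)
 have main: "(\<integral>\<^sup>+q. ?f n q \<partial>partition_measure K n) \<le> ennreal ((1 + k0) / 2 * real n powr \<sigma>)"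
  if n: "n \<ge> max (K + 1) n1" for n
 proof -
  have nK: "n > K" and n0: "real n > 0" "real n \<ge> 1" using n K by auto
  let ?Q = "partition_measure K n"
  interpret Q: prob_space ?Q by (rule prob_space_partition_measure)
  interpret P: prob_space "pivot_measure K" by (rule prob_space_pivot_measure)
  interpret B: prob_space "item_measure (n - K)" by (rule prob_space_item_measure)
  define \<delta> where "\<delta> q i = \<bar>real (psize K n q i) - real (n - K) * spacing K (fst q) i\<bar>" for q i
  have ms: "(\<lambda>q. real (psize K n q i)) \<in> borel_measurable ?Q" for i
   by (rule measurable_compose[OF measurable_sublist_size_part]) simp
  have m\<delta>: "(\<lambda>q. \<delta> q i) \<in> borel_measurable ?Q" for i unfolding \<delta>_def
   by (intro borel_rules ms measurable_spacing_part)
  have pw: "real (psize K n q i) powr \<sigma> \<le> real n powr \<sigma> * (spacing K (fst q) i powr \<sigma> + \<sigma> / real n * (\<delta> q i + real K))"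
   if q: "generic_pivots K (fst q)" and i: "i \<le> K" for q i
  proof -
   let ?I = "real (psize K n q i)" and ?D = "spacing K (fst q) i"
   have D: "0 < ?D" "?D \<le> 1" using spacing_pos[OF q i] spacing_le_1[OF q i] by auto
   have I: "?I \<le> real n" using class_count_le[of K "fst q" "snd q" "n - K" i] by (simp add: sublist_size_def)
   have "?I - real n * ?D = (?I - real (n - K) * ?D) - real K * ?D" using nK by (simp add: of_nat_diff algebra_simps)
   moreover have "0 \<le> real K * ?D" using D by simp
   ultimately have "\<bar>?I - real n * ?D\<bar> \<le> \<delta> q i + real K * ?D" unfolding \<delta>_def by linarith
   also have "... \<le> \<delta> q i + real K" using D mult_left_mono[of ?D 1 "real K"] by simp
   finally have d: "\<bar>?I - real n * ?D\<bar> \<le> ..." .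
   have "\<bar>?I / real n - ?D\<bar> = \<bar>?I - real n * ?D\<bar> / real n" using n0 by (simp add: field_simps abs_divide flip: abs_mult)
   also have "... \<le> (\<delta> q i + real K) / real n" using d n0 by (intro divide_right_mono) auto
   finally have d2: "\<bar>?I / real n - ?D\<bar> \<le> ..." .
   have "(?I / real n) powr \<sigma> \<le> ?D powr \<sigma> + \<sigma> * \<bar>?I / real n - ?D\<bar>"
    by (rule powr_le_add_lipschitz) (use I n0 D \<sigma> in auto)
   also have "... \<le> ?D powr \<sigma> + \<sigma> * ((\<delta> q i + real K) / real n)"
    using d2 \<sigma> by (intro add_left_mono mult_left_mono) auto
   finally have "real n powr \<sigma> * (?I / real n) powr \<sigma> \<le> real n powr \<sigma> * (?D powr \<sigma> + \<sigma> / real n * (\<delta> q i + real K))"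
    by (intro mult_left_mono) (simp_all add: field_simps)
   then show ?thesis using n0 by (simp add: powr_divide)
  qed
  let ?A = "\<lambda>q. \<Sum>i\<le>K. ennreal (spacing K (fst q) i powr \<sigma>)"
  let ?F = "\<lambda>q. \<Sum>i\<le>K. (ennreal (\<delta> q i ^ 1) + ennreal (real K))"
  have "(\<integral>\<^sup>+q. ?f n q \<partial>?Q)
    \<le> (\<integral>\<^sup>+q. ennreal (real n powr \<sigma>) * (?A q + ennreal (\<sigma> / real n) * ?F q) \<partial>?Q)"
  proof (rule nn_integral_mono_AE, rule eventually_mono[OF AE_partition_generic])
   fix q :: "(nat \<Rightarrow> real) \<times> (nat \<Rightarrow> real)" assume q: "generic_pivots K (fst q)"
   have "?f n q
    \<le> (\<Sum>i\<le>K. ennreal (real n powr \<sigma> * (spacing K (fst q) i powr \<sigma> + \<sigma> / real n * (\<delta> q i + real K))))"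
    by (intro sum_mono ennreal_leI pw q) simp
   also have "... = (\<Sum>i\<le>K. ennreal (real n powr \<sigma>) * (ennreal (spacing K (fst q) i powr \<sigma>) + ennreal (\<sigma> / real n) * (ennreal (\<delta> q i ^ 1) + ennreal (real K))))"
   proof (intro sum.cong refl)
    fix i
    have nn: "0 \<le> \<delta> q i" "0 \<le> \<sigma> / real n" using \<sigma> by (simp_all add: \<delta>_def)
    have "ennreal (\<sigma> / real n) * (ennreal (\<delta> q i ^ 1) + ennreal (real K)) = ennreal (\<sigma> / real n * (\<delta> q i + real K))"
     using nn by (simp only: power_one_right ennreal_plus[symmetric] ennreal_mult[symmetric] of_nat_0_le_iff add_nonneg_nonneg)
    then show "ennreal (real n powr \<sigma> * (spacing K (fst q) i powr \<sigma> + \<sigma> / real n * (\<delta> q i + real K)))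
     = ennreal (real n powr \<sigma>) * (ennreal (spacing K (fst q) i powr \<sigma>) + ennreal (\<sigma> / real n) * (ennreal (\<delta> q i ^ 1) + ennreal (real K)))"
     using nn by (simp only: ennreal_plus[symmetric] ennreal_mult[symmetric] powr_ge_zero add_nonneg_nonneg mult_nonneg_nonneg of_nat_0_le_iff)
   qed
   also have "... = ennreal (real n powr \<sigma>) * (?A q + ennreal (\<sigma> / real n) * ?F q)"
    by (simp only: sum_distrib_left sum.distrib distrib_left)
   finally show "?f n q \<le> ..." .
  qed
  also have "... = ennreal (real n powr \<sigma>) * ((\<integral>\<^sup>+q. ?A q \<partial>?Q) + ennreal (\<sigma> / real n) * (\<integral>\<^sup>+q. ?F q \<partial>?Q))"
  proof -
   have A: "?A \<in> borel_measurable ?Q"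
    by (intro borel_rules powr_real_measurable measurable_spacing_part)
   have F: "?F \<in> borel_measurable ?Q"
    by (intro borel_rules m\<delta>)
   have F': "(\<lambda>q. ennreal (\<sigma> / real n) * ?F q) \<in> borel_measurable ?Q" by (intro borel_rules F)
   show ?thesis
    by (subst nn_integral_cmult, intro borel_measurable_add A F', subst nn_integral_add[OF A F'], subst nn_integral_cmult[OF F]) (rule refl)
  qed
  also have "(\<integral>\<^sup>+q. ?A q \<partial>?Q) = ennreal k0"
  proof -
   have "(\<lambda>v. \<Sum>i\<le>K. ennreal (spacing K v i powr \<sigma>)) \<in> borel_measurable (pivot_measure K)"
    by (intro borel_rules powr_real_measurable pivot_spacing_measurable)
   then have "(\<integral>\<^sup>+q. ?A q \<partial>?Q) = (\<integral>\<^sup>+v. \<integral>\<^sup>+a. (\<Sum>i\<le>K. ennreal (spacing K v i powr \<sigma>)) \<partial>item_measure (n - K) \<partial>pivot_measure K)"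
    using nn_integral_partition_measure[OF measurable_compose[OF measurable_fst, of "\<lambda>v. \<Sum>i\<le>K. ennreal (spacing K v i powr \<sigma>)" "pivot_measure K" borel]] by simp
   then show ?thesis by (simp only: B.nn_integral_prob_const k0(1))
  qed
  also have "(\<integral>\<^sup>+q. ?F q \<partial>?Q) \<le> ennreal (real (K + 1) * (c + real K) * sqrt (real n))"
  proof -
   have m1: "(\<lambda>q. ennreal (\<delta> q i ^ 1)) \<in> borel_measurable ?Q" for i
    by (intro borel_rules m\<delta>)
   have "(\<integral>\<^sup>+q. ?F q \<partial>?Q) = (\<Sum>i\<le>K. (\<integral>\<^sup>+q. ennreal (\<delta> q i ^ 1) \<partial>?Q) + ennreal (real K))"
    by (subst nn_integral_sum, intro borel_measurable_add m1 borel_measurable_const, subst nn_integral_add)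
     (auto simp only: m1 Q.nn_integral_prob_const borel_measurable_const)
   also have "... \<le> (\<Sum>i\<le>K. ennreal (c * sqrt (real n) ^ 1) + ennreal (real K))"
    unfolding \<delta>_def c_def by (intro sum_mono add_right_mono size_moment) auto
   also have "... = ennreal (real (K + 1) * (c * sqrt (real n) + real K))"
    using c by (simp add: ennreal_mult[symmetric] ennreal_plus[symmetric] ennreal_of_nat_eq_real_of_nat add.commute del: ennreal_plus)
   also have "... \<le> ennreal (real (K + 1) * ((c + real K) * sqrt (real n)))"
    using n0 mult_left_mono[of 1 "sqrt (real n)" "real K"] by (intro ennreal_leI mult_left_mono) (auto simp: algebra_simps)
   finally show ?thesis by (simp add: mult.assoc)
  qed
  also have "ennreal (real n powr \<sigma>) * (ennreal k0 + ennreal (\<sigma> / real n) * ennreal (real (K + 1) * (c + real K) * sqrt (real n)))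
    = ennreal (real n powr \<sigma> * (k0 + \<sigma> / real n * (real (K + 1) * (c + real K) * sqrt (real n))))"
   using k0 \<sigma> c by (simp add: ennreal_mult[symmetric] ennreal_plus[symmetric] del: ennreal_plus)
  also have "\<sigma> / real n * (real (K + 1) * (c + real K) * sqrt (real n)) = E * (1 / sqrt (real n))"
   unfolding E_def using n0 by (simp add: field_simps)
  also have "ennreal (real n powr \<sigma> * (k0 + E * (1 / sqrt (real n)))) \<le> ennreal ((1 + k0) / 2 * real n powr \<sigma>)"
  proof (rule ennreal_leI)
   have "k0 + E * (1 / sqrt (real n)) \<le> (1 + k0) / 2" using n1[of n] n by (simp add: field_simps)
   then have "real n powr \<sigma> * (k0 + E * (1 / sqrt (real n))) \<le> real n powr \<sigma> * ((1 + k0) / 2)" by (rule mult_left_mono) simp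
   then show "real n powr \<sigma> * (k0 + E * (1 / sqrt (real n))) \<le> (1 + k0) / 2 * real n powr \<sigma>" by (simp only: mult.commute)
  qed
  finally show ?thesis by (simp add: add_left_mono mult_left_mono)
 qed
 show ?thesis
  by (rule exI[of _ "(1 + k0) / 2"], intro conjI exI[of _ "max (K + 1) n1"] allI impI main) (use k0 in auto)
qed

section \<open>Moments of the number of comparisons\<close>

context quicksort_laws
begin

abbreviation sdev :: "nat \<Rightarrow> (nat \<Rightarrow> real) \<times> (nat \<Rightarrow> real) \<Rightarrow> real" where
 "sdev n q \<equiv> steps_dev K r (n - K) (fst q) (snd q)"

lemma AE_partition_cost:
 "\<exists>B. \<forall>n. AE q in partition_measure K n. 0 \<le> pcost K r s n q \<and> pcost K r s n q \<le> real K * real n + B"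
proof -
 obtain B where B: "\<And>n v a. generic_pivots K v ==> 0 \<le> partition_cost K r s n v a \<and> partition_cost K r s n v a \<le> real K * real (n - K) + B"
  using partition_cost_bounds[OF tie] by blast
 have "real K * real (n - K) \<le> real K * real n" for n by (intro mult_left_mono) auto
 then have "0 \<le> partition_cost K r s n v a \<and> partition_cost K r s n v a \<le> real K * real n + B" if "generic_pivots K v" for n v a
  using B[OF that] by (meson add_right_mono order_trans)
 then show ?thesis by (intro exI[of _ B] allI eventually_mono[OF AE_partition_generic])
qed

text \<open>For each single n the number of comparisons is almost surely bounded, by induction along
  the recursion. No rate is claimed; this settles all questions of integrability.\<close>

lemma AE_bounded: "\<exists>B. AE x in \<mu> n. 0 \<le> x \<and> x \<le> B"
proof (induction n rule: less_induct)
 case (less n)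
 show ?case
 proof (cases "n \<le> K")
  case True
  then show ?thesis by (rule short)
 next
  case False
  then have n: "n > K" by simp
  from less have "\<forall>m. \<exists>B. m < n \<longrightarrow> (AE x in \<mu> m. 0 \<le> x \<and> x \<le> B)" by blast
  then obtain b where b: "\<And>m. m < n ==> AE x in \<mu> m. 0 \<le> x \<and> x \<le> b m" by metis
  define B' where "B' = (\<Sum>m<n. \<bar>b m\<bar>)"
  have bB: "b m \<le> B'" if "m < n" for m
   using member_le_sum[of m "{..<n}" "\<lambda>m. \<bar>b m\<bar>"] that unfolding B'_def by force
  obtain B0 where B0: "AE q in partition_measure K n. 0 \<le> pcost K r s n q \<and> pcost K r s n q \<le> real K * real n + B0"
   using AE_partition_cost by blast
  define B where "B = real (K + 1) * B' + (real K * real n + B0)"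
  have J: "psize K n q i < n" for q i
   using class_count_le[of K "fst q" "snd q" "n - K" i] K n by (simp add: sublist_size_def)
  have "(\<integral>\<^sup>+x. indicator (- {0..B}) x \<partial>\<mu> n) = (\<integral>\<^sup>+q. (\<integral>\<^sup>+x. indicator (- {0..B}) ((\<Sum>i\<le>K. x i) + pcost K r s n q)
    \<partial>(\<Pi>\<^sub>M i\<in>{..K}. \<mu> (psize K n q i))) \<partial>partition_measure K n)"
   by (rule rec[OF n]) simp
  also have "... = (\<integral>\<^sup>+q. 0 \<partial>partition_measure K n)"
  proof (rule nn_integral_cong_AE, rule eventually_mono[OF B0])
   fix q assume q: "0 \<le> pcost K r s n q \<and> pcost K r s n q \<le> real K * real n + B0"
   let ?N = "\<Pi>\<^sub>M i\<in>{..K}. \<mu> (psize K n q i)"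
   have "AE x in ?N. \<forall>i\<in>{..K}. 0 \<le> x i \<and> x i \<le> B'"
   proof (rule AE_finite_allI)
    fix i assume i: "i \<in> {..K}"
    show "AE x in ?N. 0 \<le> x i \<and> x i \<le> B'"
    proof (rule AE_PiM_component[where P = "\<lambda>x. 0 \<le> x \<and> x \<le> B'"])
     show "AE x in \<mu> (psize K n q i). 0 \<le> x \<and> x \<le> B'"
      using b[OF J] by (rule eventually_mono) (use bB[OF J] in \<open>blast intro: order_trans\<close>)
    qed (use prob_\<mu> i in auto)
   qed simp
   then have "(\<integral>\<^sup>+x. indicator (- {0..B}) ((\<Sum>i\<le>K. x i) + pcost K r s n q) \<partial>?N) = (\<integral>\<^sup>+x. 0 \<partial>?N)"
   proof (intro nn_integral_cong_AE, elim eventually_mono)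
    fix x :: "nat \<Rightarrow> real" assume x: "\<forall>i\<in>{..K}. 0 \<le> x i \<and> x i \<le> B'"
    have "(\<Sum>i\<le>K. x i) \<le> (\<Sum>i\<le>K. B')" by (rule sum_mono) (use x in blast)
    moreover have "0 \<le> (\<Sum>i\<le>K. x i)" by (rule sum_nonneg) (use x in blast)
    ultimately have "(\<Sum>i\<le>K. x i) + pcost K r s n q \<in> {0..B}" using q by (simp add: B_def)
    then show "indicator (- {0..B}) ((\<Sum>i\<le>K. x i) + pcost K r s n q) = (0::ennreal)" by simp
   qed
   then show "(\<integral>\<^sup>+x. indicator (- {0..B}) ((\<Sum>i\<le>K. x i) + pcost K r s n q) \<partial>?N) = 0" by simp
  qed
  finally have "emeasure (\<mu> n) (- {0..B}) = 0" by (simp add: sets_\<mu>)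
  then have "AE x in \<mu> n. 0 \<le> x \<and> x \<le> B"
   by (intro AE_I[of _ _ "- {0..B}"]) (auto simp: sets_\<mu>)
  then show ?thesis by blast
 qed
qed

lemma AE_nonneg: "AE x in \<mu> n. 0 \<le> x"
 using AE_bounded[of n] by (auto elim: eventually_mono)

lemma integrable_power: "integrable (\<mu> n) (\<lambda>x. \<bar>x - c\<bar> ^ p)" and integrable_id: "integrable (\<mu> n) (\<lambda>x. x)"
proof -
 interpret prob_space "\<mu> n" by (rule prob_\<mu>)
 have m: "(\<lambda>x. x) \<in> borel_measurable (\<mu> n)" by (rule measurable_ident_sets[OF sets_\<mu>])
 obtain B where B: "AE x in \<mu> n. 0 \<le> x \<and> x \<le> B" using AE_bounded by blast
 show "integrable (\<mu> n) (\<lambda>x. x)"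
  by (rule integrable_const_bound[of _ B], rule eventually_mono[OF B]) (simp, rule m)
 have "norm (\<bar>x - c\<bar> ^ p) \<le> (\<bar>B\<bar> + \<bar>c\<bar>) ^ p" if "0 \<le> x \<and> x \<le> B" for x
 proof -
  have "\<bar>x - c\<bar> \<le> \<bar>B\<bar> + \<bar>c\<bar>" using that by linarith
  then have "\<bar>x - c\<bar> ^ p \<le> (\<bar>B\<bar> + \<bar>c\<bar>) ^ p" by (rule power_mono) simp
  then show ?thesis by (simp only: real_norm_def power_abs abs_abs)
 qed
 then have "AE x in \<mu> n. norm (\<bar>x - c\<bar> ^ p) \<le> (\<bar>B\<bar> + \<bar>c\<bar>) ^ p" using B by (rule eventually_mono[rotated])
 then show "integrable (\<mu> n) (\<lambda>x. \<bar>x - c\<bar> ^ p)"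
  by (rule integrable_const_bound) (intro borel_rules m)
qed

definition mean :: "nat \<Rightarrow> real" where "mean n = (\<integral>x. x \<partial>\<mu> n)"

definition mean_cost :: "nat \<Rightarrow> real" where
 "mean_cost n = (\<integral>q. pcost K r s n q \<partial>partition_measure K n)"

lemma mean_nonneg: "mean n \<ge> 0"
 unfolding mean_def by (rule integral_nonneg_AE[OF AE_nonneg])

lemma nn_integral_mean: "(\<integral>\<^sup>+x. ennreal x \<partial>\<mu> n) = ennreal (mean n)"
 unfolding mean_def by (rule nn_integral_eq_integral[OF integrable_id AE_nonneg])

lemma integrable_partition_cost: "integrable (partition_measure K n) (\<lambda>q. pcost K r s n q)"
proof -
 interpret prob_space "partition_measure K n" by (rule prob_space_partition_measure)
 obtain B where B: "AE q in partition_measure K n. 0 \<le> pcost K r s n q \<and> pcost K r s n q \<le> real K * real n + B"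
  using AE_partition_cost by blast
 show ?thesis
  by (rule integrable_const_bound[of _ "real K * real n + B"], rule eventually_mono[OF B]) (simp, rule measurable_partition_cost_part[OF wf])
qed

text \<open>Expectations in the recursion, computed with non-negative integrals;
  \<open>sublist_sizes_law\<close> evaluates the sum over the sublists with N = n - K items.\<close>

lemma mean_rec:
 assumes n: "n > K"
 shows "mean n = real (K + 1) * window_avg mean K n + mean_cost n"
proof -
 let ?Q = "partition_measure K n"
 let ?P = "\<lambda>q. pcost K r s n q"
 let ?S = "\<lambda>q. psize K n q"
 obtain B where "\<forall>n. AE q in partition_measure K n. 0 \<le> pcost K r s n q \<and> pcost K r s n q \<le> real K * real n + B"
  using AE_partition_cost by blast
 then have P0: "AE q in ?Q. 0 \<le> ?P q" by (auto elim: eventually_mono)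
 have mP: "(\<lambda>q. ennreal (?P q)) \<in> borel_measurable ?Q"
  by (rule measurable_compose[OF measurable_partition_cost_part[OF wf] measurable_ennreal])
 have mS: "(\<lambda>q. ennreal (mean (?S q i))) \<in> borel_measurable ?Q" for i
  by (rule measurable_compose[OF measurable_sublist_size_part]) simp
 have "0 \<le> mean_cost n" unfolding mean_cost_def by (rule integral_nonneg_AE[OF P0])
 moreover have "0 \<le> window_avg mean K n" by (simp add: window_avg_def mean_nonneg sum_nonneg)
 ultimately have nn: "0 \<le> mean_cost n" "0 \<le> real (K + 1) * window_avg mean K n" by simp_all
 have "ennreal (mean n) = (\<integral>\<^sup>+x. ennreal x \<partial>\<mu> n)" by (rule nn_integral_mean[symmetric])
 also have "... = (\<integral>\<^sup>+q. (\<integral>\<^sup>+x. ennreal ((\<Sum>i\<le>K. x i) + ?P q) \<partial>(\<Pi>\<^sub>M i\<in>{..K}. \<mu> (?S q i))) \<partial>?Q)"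
  by (rule rec[OF n]) (rule measurable_ennreal)
 also have "... = (\<integral>\<^sup>+q. (\<Sum>i\<le>K. ennreal (mean (?S q i))) + ennreal (?P q) \<partial>?Q)"
 proof (rule nn_integral_cong_AE, rule eventually_mono[OF P0])
  fix q assume q: "0 \<le> ?P q"
  let ?N = "\<Pi>\<^sub>M i\<in>{..K}. \<mu> (?S q i)"
  interpret N: prob_space ?N by (rule prob_space_PiM) (rule prob_\<mu>)
  have c: "(\<lambda>x. ennreal (x i)) \<in> borel_measurable ?N" if "i \<in> {..K}" for i
   by (rule measurable_PiM_coordinate[OF that]) (simp only: measurable_cong_sets[OF sets_\<mu> refl] measurable_ennreal)
  have "AE x in ?N. \<forall>i\<in>{..K}. 0 \<le> x i"
   by (rule AE_finite_allI, simp, rule AE_PiM_component[where P = "\<lambda>x. 0 \<le> x"]) (auto simp: prob_\<mu> AE_nonneg)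
  then have "(\<integral>\<^sup>+x. ennreal ((\<Sum>i\<le>K. x i) + ?P q) \<partial>?N) = (\<integral>\<^sup>+x. (\<Sum>i\<le>K. ennreal (x i)) + ennreal (?P q) \<partial>?N)"
  proof (intro nn_integral_cong_AE, elim eventually_mono)
   fix x :: "nat \<Rightarrow> real" assume x: "\<forall>i\<in>{..K}. 0 \<le> x i"
   then have "(\<Sum>i\<le>K. ennreal (x i)) = ennreal (\<Sum>i\<le>K. x i)" by (intro sum_ennreal) blast
   moreover have "0 \<le> (\<Sum>i\<le>K. x i)" by (rule sum_nonneg) (use x in blast)
   ultimately show "ennreal ((\<Sum>i\<le>K. x i) + ?P q) = (\<Sum>i\<le>K. ennreal (x i)) + ennreal (?P q)"
    using q by (simp only: ennreal_plus)
  qed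
  also have "... = (\<integral>\<^sup>+x. (\<Sum>i\<le>K. ennreal (x i)) \<partial>?N) + ennreal (?P q)"
  proof (subst nn_integral_add)
   show "(\<lambda>x. \<Sum>i\<le>K. ennreal (x i)) \<in> borel_measurable ?N" by (intro borel_measurable_sum c)
  qed (simp_all only: N.nn_integral_prob_const borel_measurable_const)
  also have "(\<integral>\<^sup>+x. (\<Sum>i\<le>K. ennreal (x i)) \<partial>?N) = (\<Sum>i\<le>K. \<integral>\<^sup>+x. ennreal (x i) \<partial>?N)"
   by (rule nn_integral_sum[OF c])
  also have "... = (\<Sum>i\<le>K. ennreal (mean (?S q i)))"
  proof (rule sum.cong[OF refl])
   fix i assume i: "i \<in> {..K}"
   have "(\<integral>\<^sup>+x. ennreal (x i) \<partial>?N) = (\<integral>\<^sup>+x. ennreal x \<partial>\<mu> (?S q i))"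
    by (rule nn_integral_PiM_component[where \<nu> = "\<lambda>i. \<mu> (?S q i)", OF prob_\<mu> i]) (simp only: measurable_cong_sets[OF sets_\<mu> refl] measurable_ennreal)
   then show "(\<integral>\<^sup>+x. ennreal (x i) \<partial>?N) = ennreal (mean (?S q i))" by (simp only: nn_integral_mean)
  qed
  finally show "(\<integral>\<^sup>+x. ennreal ((\<Sum>i\<le>K. x i) + ?P q) \<partial>?N) = (\<Sum>i\<le>K. ennreal (mean (?S q i))) + ennreal (?P q)" .
 qed
 also have "... = (\<integral>\<^sup>+q. (\<Sum>i\<le>K. ennreal (mean (?S q i))) \<partial>?Q) + (\<integral>\<^sup>+q. ennreal (?P q) \<partial>?Q)"
  by (rule nn_integral_add) (intro borel_measurable_sum mS, rule mP)
 also have "(\<integral>\<^sup>+q. ennreal (?P q) \<partial>?Q) = ennreal (mean_cost n)"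
  unfolding mean_cost_def by (rule nn_integral_eq_integral[OF integrable_partition_cost P0])
 also have "(\<integral>\<^sup>+q. (\<Sum>i\<le>K. ennreal (mean (?S q i))) \<partial>?Q) = (\<integral>\<^sup>+v. \<integral>\<^sup>+a. (\<Sum>i\<le>K. ennreal (mean (class_count K v a (n - K) i))) \<partial>item_measure (n - K) \<partial>pivot_measure K)"
  by (subst nn_integral_partition_measure, intro borel_measurable_sum mS) (simp only: sublist_size_def fst_conv snd_conv)
 also have "... = (\<integral>\<^sup>+v. (\<Sum>i\<le>K. \<integral>\<^sup>+a. ennreal (mean (class_count K v a (n - K) i)) \<partial>item_measure (n - K)) \<partial>pivot_measure K)"
  by (intro nn_integral_cong nn_integral_sum measurable_compose[OF measurable_class_count_items[OF order_refl]]) simp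
 also have "... = ennreal (real (K + 1) * window_avg mean K (n - K + K))"
  by (rule sublist_sizes_law[OF K mean_nonneg])
 also have "n - K + K = n" using n by simp
 also have "ennreal (real (K + 1) * window_avg mean K n) + ennreal (mean_cost n) = ennreal (real (K + 1) * window_avg mean K n + mean_cost n)"
  by (simp only: ennreal_plus nn)
 finally show ?thesis by (simp only: ennreal_inj[OF mean_nonneg add_nonneg_nonneg[OF nn(2) nn(1)]])
qed

lemma measurable_opt_cost_part: "(\<lambda>q. opt_cost K (spacing K (fst q))) \<in> borel_measurable (partition_measure K n)"
 by (rule measurable_opt_cost) (rule measurable_spacing_part)

lemma steps_moment:
 assumes p: "p \<ge> 1"
 shows "\<exists>C\<ge>0. \<forall>n. (\<integral>\<^sup>+q. ennreal (sdev n q ^ p) \<partial>partition_measure K n)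
  \<le> ennreal (C * sqrt (real n) ^ p)"
proof -
 obtain C where C: "C \<ge> 0" and *: "\<And>N v. generic_pivots K v ==>
  (\<integral>\<^sup>+a. ennreal (steps_dev K r N v a ^ p) \<partial>item_measure N) \<le> ennreal (C * sqrt (real N) ^ p)"
  using partition_steps_moment[OF tie p] by blast
 have "(\<integral>\<^sup>+q. ennreal (sdev n q ^ p) \<partial>partition_measure K n)
  \<le> ennreal (C * sqrt (real n) ^ p)" for n
 proof (rule partition_integral_le)
  show "(\<lambda>q. ennreal (sdev n q ^ p)) \<in> borel_measurable (partition_measure K n)"
   by (intro borel_rules measurable_partition_steps measurable_opt_cost_part)
  fix v assume v: "generic_pivots K v"
  have "(\<integral>\<^sup>+a. ennreal (steps_dev K r (n - K) v a ^ p) \<partial>item_measure (n - K)) \<le> ennreal (C * sqrt (real (n - K)) ^ p)"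
   by (rule *[OF v])
  also have "... \<le> ennreal (C * sqrt (real n) ^ p)" using C by (intro ennreal_leI mult_left_mono power_mono) auto
  finally show "(\<integral>\<^sup>+a. ennreal (\<bar>partition_steps K r (n - K) (fst (v, a)) (snd (v, a)) - real (n - K) * opt_cost K (spacing K (fst (v, a)))\<bar> ^ p) \<partial>item_measure (n - K))
   \<le> ..." by (simp only: fst_conv snd_conv)
 qed
 with C show ?thesis by blast
qed

text \<open>Replacing n - K by n changes the limit cost by at most K l_opt(D) <= K^2, and sorting
  the pivots adds a bounded amount.\<close>

lemma partition_cost_near:
 "\<exists>B\<ge>0. \<forall>n v a. n > K \<longrightarrow> generic_pivots K v \<longrightarrow>
  \<bar>partition_cost K r s n v a - real n * opt_cost K (spacing K v)\<bar> \<le> steps_dev K r (n - K) v a + B"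
proof -
 obtain B :: nat where B: "\<And>xs :: real list. comparisons s xs \<le> B" using comparisons_bounded by blast
 have "\<bar>partition_cost K r s n v a - real n * opt_cost K (spacing K v)\<bar>
   \<le> steps_dev K r (n - K) v a + (real B + real K * real K)"
  if n: "n > K" and v: "generic_pivots K v" for n v a
 proof -
  have "1 \<le> opt_cost K (spacing K v)" "opt_cost K (spacing K v) \<le> real K" by (rule opt_cost_spacing_bounds[OF v K])+
  then have "0 \<le> real K * opt_cost K (spacing K v)" "real K * opt_cost K (spacing K v) \<le> real K * real K" by (auto intro: mult_left_mono)
  moreover have "real (comparisons s (map v [1..<Suc K])) \<le> real B" using B by (simp only: of_nat_le_iff)
  moreover have "real (n - K) * opt_cost K (spacing K v) = real n * opt_cost K (spacing K v) - real K * opt_cost K (spacing K v)"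
   using n by (simp add: of_nat_diff algebra_simps)
  ultimately show ?thesis unfolding partition_cost_eq abs_le_iff abs_if by (auto split: if_splits)
 qed
 then show ?thesis by (intro exI[of _ "real B + real K * real K"]) auto
qed

text \<open>The mean of l_opt(D) is \<open>gamma_K\<close> by definition; the error is the first
  moment of the deviation of the steps, of order sqrt n.\<close>

lemma mean_cost_bound: "\<exists>C. \<forall>n>K. \<bar>mean_cost n - gamma_K K * real n\<bar> \<le> C * sqrt (real n)"
proof -
 obtain C where C: "C \<ge> 0" and st: "\<And>n. (\<integral>\<^sup>+q. ennreal (sdev n q ^ 1) \<partial>partition_measure K n)
  \<le> ennreal (C * sqrt (real n) ^ 1)" using steps_moment[of 1] by auto
 obtain B where B: "B \<ge> 0" and near: "\<And>n v a. n > K ==> generic_pivots K v ==>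
  \<bar>partition_cost K r s n v a - real n * opt_cost K (spacing K v)\<bar> \<le> steps_dev K r (n - K) v a + B"
  using partition_cost_near by blast
 have "\<bar>mean_cost n - gamma_K K * real n\<bar> \<le> (C + B) * sqrt (real n)" if n: "n > K" for n
 proof -
  let ?Q = "partition_measure K n"
  interpret Q: prob_space ?Q by (rule prob_space_partition_measure)
  interpret I: prob_space "item_measure (n - K)" by (rule prob_space_item_measure)
  let ?o = "\<lambda>q. opt_cost K (spacing K (fst q))" and ?P = "\<lambda>q. pcost K r s n q"
  have "norm (?o q) \<le> real K" if "generic_pivots K (fst q)" for q :: "(nat \<Rightarrow> real) \<times> (nat \<Rightarrow> real)"
   using opt_cost_spacing_bounds[OF that K] by simp
  then have "AE q in ?Q. norm (?o q) \<le> real K" by (rule eventually_mono[OF AE_partition_generic])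
  then have io: "integrable ?Q ?o" by (rule Q.integrable_const_bound) (rule measurable_opt_cost_part)
  have oint: "(\<integral>q. ?o q \<partial>?Q) = gamma_K K"
  proof -
   have "(\<integral>q. ?o q \<partial>?Q) = (\<integral>v. opt_cost K (spacing K v) \<partial>distr ?Q (pivot_measure K) fst)"
    by (rule integral_distr[symmetric, OF measurable_fst]) (rule measurable_opt_cost, rule pivot_spacing_measurable)
   then show ?thesis by (simp only: I.distr_pair_fst gamma_K_def)
  qed
  let ?f = "\<lambda>q. ?P q - real n * ?o q"
  have f: "integrable ?Q ?f" by (intro Bochner_Integration.integrable_diff integrable_partition_cost integrable_mult_right io)
  have "mean_cost n - gamma_K K * real n = (\<integral>q. ?f q \<partial>?Q)"
   by (subst Bochner_Integration.integral_diff[OF integrable_partition_cost integrable_mult_right[OF io]])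
    (simp only: mean_cost_def integral_mult_right_zero oint mult.commute)
  then have "\<bar>mean_cost n - gamma_K K * real n\<bar> \<le> (\<integral>q. \<bar>?f q\<bar> \<partial>?Q)"
   using integral_norm_bound[of ?Q ?f] by (simp only: real_norm_def)
  also have "... \<le> C * sqrt (real n) + B"
  proof -
   have "ennreal (\<integral>q. \<bar>?f q\<bar> \<partial>?Q) = (\<integral>\<^sup>+q. ennreal \<bar>?f q\<bar> \<partial>?Q)"
    by (rule nn_integral_eq_integral[symmetric]) (use f in auto)
   also have "... \<le> (\<integral>\<^sup>+q. ennreal (sdev n q ^ 1) + ennreal B \<partial>?Q)"
   proof (rule nn_integral_mono_AE, rule eventually_mono[OF AE_partition_generic])
    fix q :: "(nat \<Rightarrow> real) \<times> (nat \<Rightarrow> real)" assume q: "generic_pivots K (fst q)"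
    have "ennreal \<bar>?f q\<bar> \<le> ennreal (sdev n q + B)"
     by (rule ennreal_leI[OF near[OF n q]])
    then show "ennreal \<bar>?f q\<bar> \<le> ennreal (sdev n q ^ 1) + ennreal B"
     using B by (simp add: ennreal_plus)
   qed
   also have "... = (\<integral>\<^sup>+q. ennreal (sdev n q ^ 1) \<partial>?Q) + ennreal B"
   proof (subst nn_integral_add)
    show "(\<lambda>q. ennreal (sdev n q ^ 1)) \<in> borel_measurable ?Q"
     by (intro borel_rules measurable_partition_steps measurable_opt_cost_part)
   qed (simp_all only: Q.nn_integral_prob_const borel_measurable_const)
   also have "... \<le> ennreal (C * sqrt (real n) ^ 1) + ennreal B" by (intro add_right_mono st)
   also have "... = ennreal (C * sqrt (real n) + B)" using C B by (simp add: ennreal_plus)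
   finally show ?thesis using C B by (subst (asm) ennreal_le_iff) auto
  qed
  also have "... \<le> (C + B) * sqrt (real n)" using B n mult_left_mono[of 1 "sqrt (real n)" B] by (simp add: algebra_simps)
  finally show ?thesis .
 qed
 then show ?thesis by blast
qed

lemma mean_asymptotics:
 assumes "K \<in> {2, 3, 4}" and \<beta>: "1 / 2 \<le> \<beta>" "\<beta> < 1"
 shows "log_linear \<beta> (alpha_K K) mean"
proof -
 obtain C where C: "\<And>n. n > K ==> \<bar>mean_cost n - gamma_K K * real n\<bar> \<le> C * sqrt (real n)" using mean_cost_bound by blast
 have *: "\<bar>mean_cost n - gamma_K K * real n\<bar> \<le> \<bar>C\<bar> * real n powr \<beta>" if n: "n > K" for n
 proof -
  have "sqrt (real n) \<le> real n powr \<beta>"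
   using powr_mono[of "1 / 2" \<beta> "real n"] \<beta> n by (simp add: powr_half_sqrt)
  then have "\<bar>C\<bar> * sqrt (real n) \<le> \<bar>C\<bar> * real n powr \<beta>" by (rule mult_left_mono) simp
  moreover have "C * sqrt (real n) \<le> \<bar>C\<bar> * sqrt (real n)" by (intro mult_right_mono) auto
  ultimately show ?thesis using C[OF n] by linarith
 qed
 show ?thesis unfolding alpha_K_def by (rule mean_log_linear[OF assms(1) mean_rec *]) (use \<beta> in auto)
qed

end

section \<open>Moments of the deviations\<close>

context limit_coupling
begin

text \<open>The coupled difference for c = 1 and the plain centered cost for c = 0. Both satisfy the
  same recursion, so that one moment argument serves twice.\<close>

definition dev :: "real \<Rightarrow> nat \<Rightarrow> real \<times> real \<Rightarrow> real" where
 "dev c n y = fst y - mean n - c * real n * snd y"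

text \<open>What the deviations of the sublists do not account for. The last sum arises because
  sublist i is compared with I_i Z^(i), while the fixed-point equation, multiplied by n, contains n
  D_i Z^(i).\<close>

definition resid :: "real \<Rightarrow> nat \<Rightarrow> (nat \<Rightarrow> real) \<times> (nat \<Rightarrow> real) \<Rightarrow> (nat \<Rightarrow> real \<times> real) \<Rightarrow> real" where
 "resid c n q x = pcost K r s n q + (\<Sum>i\<le>K. mean (sz n q i)) - mean n - c * real n * limit_toll K (fst q)
   + c * (\<Sum>i\<le>K. (real (sz n q i) - real n * spacing K (fst q) i) * snd (x i))"

definition dev_moment :: "real \<Rightarrow> nat \<Rightarrow> nat \<Rightarrow> ennreal" where
 "dev_moment c p n = (\<integral>\<^sup>+y. ennreal (\<bar>dev c n y\<bar> ^ p) \<partial>\<pi> n)"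

abbreviation resid_moment :: "real \<Rightarrow> nat \<Rightarrow> nat \<Rightarrow> ennreal" where
 "resid_moment c p n \<equiv> \<integral>\<^sup>+q. (\<integral>\<^sup>+x. ennreal (\<bar>resid c n q x\<bar> ^ p) \<partial>(inputs n q)) \<partial>partition_measure K n"

lemma dev_combine: "dev c n (combine n q x) = (\<Sum>i\<le>K. dev c (sz n q i) (x i)) + resid c n q x"
 by (simp add: dev_def combine_def resid_def sum_subtractf sum.distrib sum_distrib_left algebra_simps)

lemma measurable_dev: "dev c n \<in> borel_measurable pair_borel"
 unfolding dev_def by (intro borel_rules measurable_fst measurable_snd)

lemma measurable_dev_power: "(\<lambda>y. ennreal (\<bar>dev c n y\<bar> ^ p)) \<in> borel_measurable pair_borel"
 by (intro borel_rules measurable_dev)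

lemma measurable_resid:
 "(\<lambda>z. resid c n (fst z) (snd z)) \<in> borel_measurable (partition_measure K n \<Otimes>\<^sub>M (\<Pi>\<^sub>M i\<in>{..K}. pair_borel))"
proof -
 let ?M = "partition_measure K n \<Otimes>\<^sub>M (\<Pi>\<^sub>M i\<in>{..K}. pair_borel)"
 have x: "(\<lambda>z. snd (snd z i)) \<in> borel_measurable ?M" if "i \<in> {..K}" for i
  by (rule measurable_compose[OF measurable_snd measurable_compose[OF measurable_component_singleton[OF that] measurable_snd]])
 have e: "(\<lambda>z. mean (sz n (fst z) i)) \<in> borel_measurable ?M" for i
  by (rule measurable_compose[OF measurable_fst measurable_compose[OF measurable_sublist_size_part]]) simp
 have s: "(\<lambda>z. real (sz n (fst z) i)) \<in> borel_measurable ?M" for i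
  by (rule measurable_compose[OF measurable_fst measurable_compose[OF measurable_sublist_size_part]]) simp
 have P: "(\<lambda>z. partition_cost K r s n (fst (fst z)) (snd (fst z))) \<in> borel_measurable ?M"
  by (rule measurable_compose[OF measurable_fst measurable_partition_cost_part[OF wf]])
 have S: "(\<lambda>z. spacing K (fst (fst z)) i) \<in> borel_measurable ?M" for i
  by (rule measurable_compose[OF measurable_fst measurable_spacing_part])
 have T: "(\<lambda>z. limit_toll K (fst (fst z))) \<in> borel_measurable ?M"
  by (rule measurable_compose[OF measurable_fst measurable_compose[OF measurable_fst measurable_limit_toll]])
 show ?thesis unfolding resid_def
  by (intro borel_rules P e T s S x)
qed

lemma nn_integral_fst_\<pi>: "f \<in> borel_measurable borel ==> (\<integral>\<^sup>+y. f (fst y) \<partial>\<pi> n) = (\<integral>\<^sup>+x. f x \<partial>\<mu> n)"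
 using nn_integral_distr[of fst "\<pi> n" borel f] by (simp only: fst_\<pi> measurable_\<pi> measurable_fst measurable_cong_sets[OF sets_\<mu> refl])

lemma nn_integral_snd_\<pi>: "f \<in> borel_measurable borel ==> (\<integral>\<^sup>+y. f (snd y) \<partial>\<pi> n) = (\<integral>\<^sup>+x. f x \<partial>\<zeta>)"
 using nn_integral_distr[of snd "\<pi> n" borel f] by (simp only: snd_\<pi> measurable_\<pi> measurable_snd measurable_cong_sets[OF sets_\<zeta> refl])

lemma dev_0: "AE y in \<pi> 0. dev c 0 y = 0"
proof -
 obtain k where k: "AE x in \<mu> 0. x = k" using zero by blast
 interpret prob_space "\<mu> 0" by (rule prob_\<mu>)
 have "mean 0 = (\<integral>x. k \<partial>\<mu> 0)" unfolding mean_def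
  by (rule integral_cong_AE) (use k in \<open>simp_all add: measurable_ident_sets[OF sets_\<mu>]\<close>)
 then have "mean 0 = k" by (simp add: prob_space)
 moreover have "AE y in \<pi> 0. fst y = k"
  by (rule AE_distrD[of fst _ borel]) (simp_all only: fst_\<pi> measurable_\<pi> measurable_fst k)
 ultimately show ?thesis by (auto simp: dev_def elim: eventually_mono)
qed

lemma dev_moment_0: "p \<ge> 1 ==> dev_moment c p 0 = 0"
proof -
 assume "p \<ge> 1"
 then have "dev_moment c p 0 = (\<integral>\<^sup>+y. 0 \<partial>\<pi> 0)" unfolding dev_moment_def
  by (intro nn_integral_cong_AE eventually_mono[OF dev_0[of c]]) simp
 then show ?thesis by simp
qed

text \<open>The part with the comparisons is finite since these are bounded for fixed n. The part
  with Z carries the factor |c n|^p, so that c = 0 requires no moment of Z.\<close>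

lemma dev_moment_finite:
 assumes "c = 0 \<or> (\<integral>\<^sup>+z. ennreal (\<bar>z\<bar> ^ p) \<partial>\<zeta>) < \<infinity>" and p: "p \<ge> 1"
 shows "dev_moment c p n < \<infinity>"
proof -
 let ?k = "\<bar>c * real n\<bar> ^ p"
 have le: "\<bar>dev c n y\<bar> ^ p \<le> 2 ^ p * \<bar>fst y - mean n\<bar> ^ p + 2 ^ p * (?k * \<bar>snd y\<bar> ^ p)" for y
 proof -
  have "\<bar>dev c n y\<bar> \<le> \<bar>fst y - mean n\<bar> + \<bar>c * real n * snd y\<bar>" by (simp add: dev_def)
  then have "\<bar>dev c n y\<bar> ^ p \<le> (\<bar>fst y - mean n\<bar> + \<bar>c * real n * snd y\<bar>) ^ p" by (rule power_mono) simp
  also have "... \<le> (1 + 1) ^ p * \<bar>fst y - mean n\<bar> ^ p + (1 + 1 / 1) ^ p * \<bar>c * real n * snd y\<bar> ^ p"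
   by (rule power_add_le) auto
  finally show ?thesis by (simp add: abs_mult power_mult_distrib)
 qed
 have m1: "(\<lambda>x. ennreal (\<bar>x - mean n\<bar> ^ p)) \<in> borel_measurable borel" and m2: "(\<lambda>z. ennreal (\<bar>z\<bar> ^ p)) \<in> borel_measurable borel"
  by (intro borel_rules measurable_ident_sets refl)+
 have m1': "(\<lambda>y. ennreal (\<bar>fst y - mean n\<bar> ^ p)) \<in> borel_measurable (\<pi> n)" and m2': "(\<lambda>y. ennreal (\<bar>snd y\<bar> ^ p)) \<in> borel_measurable (\<pi> n)"
  unfolding measurable_\<pi> by (rule measurable_compose[OF measurable_fst m1], rule measurable_compose[OF measurable_snd m2])
 have "dev_moment c p n \<le> (\<integral>\<^sup>+y. ennreal (2 ^ p) * ennreal (\<bar>fst y - mean n\<bar> ^ p) + ennreal (2 ^ p * ?k) * ennreal (\<bar>snd y\<bar> ^ p) \<partial>\<pi> n)"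
  unfolding dev_moment_def
 proof (rule nn_integral_mono)
  fix y :: "real \<times> real"
  show "ennreal (\<bar>dev c n y\<bar> ^ p) \<le> ennreal (2 ^ p) * ennreal (\<bar>fst y - mean n\<bar> ^ p) + ennreal (2 ^ p * ?k) * ennreal (\<bar>snd y\<bar> ^ p)"
   using ennreal_leI[OF le[of y]] by (simp add: ennreal_plus ennreal_mult mult.assoc del: abs_mult)
 qed
 also have "... = ennreal (2 ^ p) * (\<integral>\<^sup>+y. ennreal (\<bar>fst y - mean n\<bar> ^ p) \<partial>\<pi> n) + ennreal (2 ^ p * ?k) * (\<integral>\<^sup>+y. ennreal (\<bar>snd y\<bar> ^ p) \<partial>\<pi> n)"
  by (subst nn_integral_add, intro borel_measurable_times_ennreal borel_measurable_const m1', intro borel_measurable_times_ennreal borel_measurable_const m2')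
   (simp only: nn_integral_cmult[OF m1'] nn_integral_cmult[OF m2'])
 also have "... < \<infinity>"
 proof -
  have a: "(\<integral>\<^sup>+y. ennreal (\<bar>fst y - mean n\<bar> ^ p) \<partial>\<pi> n) < \<infinity>"
   unfolding nn_integral_fst_\<pi>[OF m1] by (subst nn_integral_eq_integral[OF integrable_power]) simp_all
  have b: "ennreal (2 ^ p * ?k) * (\<integral>\<^sup>+y. ennreal (\<bar>snd y\<bar> ^ p) \<partial>\<pi> n) < \<infinity>"
   unfolding nn_integral_snd_\<pi>[OF m2] using assms by (auto simp: ennreal_mult_less_top power_0_left)
  show ?thesis using a b by (simp add: ennreal_mult_less_top)
 qed
 finally show ?thesis .
qed

lemma \<zeta>_second_moment: "(\<integral>\<^sup>+z. ennreal (\<bar>z\<bar> ^ 2) \<partial>\<zeta>) < \<infinity>"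
proof -
 have i: "integrable \<zeta> (\<lambda>x. x\<^sup>2)" using limit by (simp add: is_limit_law_def)
 show ?thesis using nn_integral_eq_integral[OF i] by simp
qed

lemma dev_square_integrable: "integrable (\<pi> n) (\<lambda>y. (dev c n y)\<^sup>2)"
proof (rule integrableI_bounded)
 show "(\<lambda>y. (dev c n y)\<^sup>2) \<in> borel_measurable (\<pi> n)" unfolding measurable_\<pi> by (intro borel_measurable_power measurable_dev)
 show "(\<integral>\<^sup>+y. ennreal (norm ((dev c n y)\<^sup>2)) \<partial>\<pi> n) < \<infinity>"
  using dev_moment_finite[of c 2 n] \<zeta>_second_moment by (simp add: dev_moment_def)
qed

lemma dev_centered: "(\<integral>y. dev c n y \<partial>\<pi> n) = 0"
proof -
 interpret P: prob_space "\<pi> n" by (rule prob_\<pi>)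
 have f: "fst \<in> measurable (\<pi> n) borel" and g: "snd \<in> measurable (\<pi> n) borel"
  by (simp_all only: measurable_\<pi> measurable_fst measurable_snd)
 have iz: "integrable \<zeta> (\<lambda>x. x)" and z: "(\<integral>x. x \<partial>\<zeta>) = 0" using limit by (auto simp: is_limit_law_def)
 have 1: "integrable (\<pi> n) (\<lambda>y. fst y)"
  by (rule integrable_distr[OF f, where f = "\<lambda>x. x"]) (simp only: fst_\<pi> integrable_id)
 have 2: "integrable (\<pi> n) (\<lambda>y. snd y)"
  by (rule integrable_distr[OF g, where f = "\<lambda>x. x"]) (simp only: snd_\<pi> iz)
 have "(\<integral>y. fst y \<partial>\<pi> n) = mean n"
  using integral_distr[OF f, of "\<lambda>x. x"] by (simp add: fst_\<pi> mean_def)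
 moreover have "(\<integral>y. snd y \<partial>\<pi> n) = 0"
  using integral_distr[OF g, of "\<lambda>x. x"] by (simp add: snd_\<pi> z)
 ultimately show ?thesis unfolding dev_def using 1 2 by (simp add: P.prob_space)
qed

lemma dev_sum_second_moment:
 "(\<integral>\<^sup>+x. ennreal (\<bar>\<Sum>i\<le>K. dev c (J i) (x i)\<bar> ^ 2) \<partial>(\<Pi>\<^sub>M i\<in>{..K}. \<pi> (J i))) = (\<Sum>i\<le>K. dev_moment c 2 (J i))"
proof -
 have "(\<integral>\<^sup>+x. ennreal ((\<Sum>i\<in>{..K}. dev c (J i) (x i))\<^sup>2) \<partial>(\<Pi>\<^sub>M i\<in>{..K}. \<pi> (J i))) = (\<Sum>i\<le>K. \<integral>\<^sup>+y. ennreal ((dev c (J i) y)\<^sup>2) \<partial>\<pi> (J i))"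
  by (rule second_moment_PiM[where \<nu> = "\<lambda>i. \<pi> (J i)" and u = "\<lambda>i. dev c (J i)"])
   (simp_all only: prob_\<pi> finite_atMost measurable_\<pi> measurable_dev dev_square_integrable dev_centered)
 then show ?thesis by (simp only: dev_moment_def power2_abs)
qed

text \<open>From |t| <= N + t^2 / N with N = n^\<tau>. Sizes m <= n are bounded at the scale of n,
  the form in which the mixed terms need it.\<close>

lemma dev_first_moment:
 assumes D: "dev_moment c 2 m \<le> ennreal (D * real m powr (2 * \<tau>))" "D \<ge> 0" and m: "m \<le> n" "n \<ge> 1" and \<tau>: "\<tau> \<ge> 0"
 shows "(\<integral>\<^sup>+y. ennreal \<bar>dev c m y\<bar> \<partial>\<pi> m) \<le> ennreal ((1 + D) * real n powr \<tau>)"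
proof -
 interpret P: prob_space "\<pi> m" by (rule prob_\<pi>)
 define N where "N = real n powr \<tau>"
 have N: "N > 0" using m by (simp add: N_def)
 have le: "\<bar>t\<bar> \<le> N + 1 / N * \<bar>t\<bar> ^ 2" for t :: real
 proof -
  have "0 \<le> (\<bar>t\<bar> - N)\<^sup>2 + N * \<bar>t\<bar>" using N by simp
  then have "N * \<bar>t\<bar> \<le> N * N + \<bar>t\<bar> ^ 2" by (simp add: power2_eq_square algebra_simps)
  then show ?thesis using N by (simp add: field_simps power2_eq_square)
 qed
 have "(\<integral>\<^sup>+y. ennreal \<bar>dev c m y\<bar> \<partial>\<pi> m) \<le> (\<integral>\<^sup>+y. ennreal N + ennreal (1 / N) * ennreal (\<bar>dev c m y\<bar> ^ 2) \<partial>\<pi> m)"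
 proof (rule nn_integral_mono)
  fix y
  show "ennreal \<bar>dev c m y\<bar> \<le> ennreal N + ennreal (1 / N) * ennreal (\<bar>dev c m y\<bar> ^ 2)"
  proof -
   have "0 \<le> N" "0 \<le> 1 / N" using N by auto
   then show ?thesis
    using ennreal_leI[OF le[of "dev c m y"]] by (simp only: ennreal_plus ennreal_mult mult_nonneg_nonneg zero_le_power abs_ge_zero)
  qed
 qed
 also have "... = ennreal N + ennreal (1 / N) * dev_moment c 2 m"
  unfolding dev_moment_def
  by (subst nn_integral_add, simp, intro borel_measurable_times_ennreal borel_measurable_const, simp only: measurable_\<pi> measurable_dev_power,
    subst nn_integral_cmult, simp only: measurable_\<pi> measurable_dev_power) (simp only: P.nn_integral_prob_const)
 also have "... \<le> ennreal N + ennreal (1 / N) * ennreal (D * N ^ 2)"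
 proof (intro add_left_mono mult_left_mono order_trans[OF D(1)] ennreal_leI)
  have "real m powr (2 * \<tau>) \<le> real n powr (2 * \<tau>)" by (rule powr_mono2) (use m \<tau> in auto)
  also have "real n powr (2 * \<tau>) = N ^ 2" by (simp only: N_def power2_eq_square mult_2 powr_add)
  finally show "real m powr (2 * \<tau>) \<le> N ^ 2" .
 qed (use D in auto)
 also have "... = ennreal (N + 1 / N * (D * N ^ 2))"
 proof -
  have "0 \<le> N" "0 \<le> 1 / N" using N by auto
  then show ?thesis using D(2) by (simp only: ennreal_plus ennreal_mult mult_nonneg_nonneg zero_le_power)
 qed
 also have "N + 1 / N * (D * N ^ 2) = (1 + D) * N" using N by (simp add: field_simps power2_eq_square)
 finally show ?thesis by (simp only: N_def)
qed

text \<open>By \<open>power_sum_le\<close> the p-th moment of the sum is the sum of the p-th moments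
  plus mixed terms. Independence factors each of these into a (p-1)-th and a first moment, both
  already known to have the right order.\<close>

lemma dev_sum_high_moment:
 assumes p: "p \<ge> 2" and \<tau>: "\<tau> \<ge> 0"
  and D1: "\<And>m. dev_moment c (p - 1) m \<le> ennreal (D1 * real m powr (\<tau> * real (p - 1)))" "D1 \<ge> 0"
  and D2: "\<And>m. dev_moment c 2 m \<le> ennreal (D2 * real m powr (2 * \<tau>))" "D2 \<ge> 0"
  and J: "\<And>i. i \<le> K ==> J i \<le> n" and n: "n \<ge> 1"
 shows "(\<integral>\<^sup>+x. ennreal (\<bar>\<Sum>i\<le>K. dev c (J i) (x i)\<bar> ^ p) \<partial>(\<Pi>\<^sub>M i\<in>{..K}. \<pi> (J i)))
  \<le> (\<Sum>i\<le>K. dev_moment c p (J i)) + ennreal (real p * real (K + 1) ^ (p - 1) * (real (K + 1) * real K * (D1 * (1 + D2))) * real n powr (\<tau> * real p))"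
proof -
 let ?N = "\<Pi>\<^sub>M i\<in>{..K}. \<pi> (J i)"
 let ?u = "\<lambda>i x. \<bar>dev c (J i) (x i)\<bar>"
 let ?V = "\<lambda>x. \<Sum>i\<in>{..K}. \<Sum>j\<in>{..K} - {i}. ?u i x ^ (p - 1) * ?u j x"
 define A where "A = real p * real (K + 1) ^ (p - 1)"
 have A: "A \<ge> 0" by (simp add: A_def)
 have md: "(\<lambda>y. ennreal (\<bar>dev c (J i) y\<bar> ^ k)) \<in> borel_measurable (\<pi> (J i))" for i k
  by (simp only: measurable_\<pi> measurable_dev_power)
 have md1: "(\<lambda>y. ennreal \<bar>dev c (J i) y\<bar>) \<in> borel_measurable (\<pi> (J i))" for i
  using md[of i 1] by (simp only: power_one_right)
 have mc: "(\<lambda>x. ennreal (?u i x ^ k)) \<in> borel_measurable ?N" if "i \<in> {..K}" for i k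
  by (rule measurable_PiM_coordinate[where \<nu> = "\<lambda>i. \<pi> (J i)", OF that md])
 have mc1: "(\<lambda>x. ennreal (?u i x)) \<in> borel_measurable ?N" if "i \<in> {..K}" for i
  by (rule measurable_PiM_coordinate[where \<nu> = "\<lambda>i. \<pi> (J i)", OF that md1])
 let ?S1 = "\<lambda>x. \<Sum>i\<in>{..K}. ennreal (?u i x ^ p)"
 let ?S2 = "\<lambda>x. \<Sum>i\<in>{..K}. \<Sum>j\<in>{..K} - {i}. ennreal (?u i x ^ (p - 1)) * ennreal (?u j x)"
 have m1: "?S1 \<in> borel_measurable ?N" by (intro borel_measurable_sum mc)
 have m2: "?S2 \<in> borel_measurable ?N" by (intro borel_measurable_sum borel_measurable_times_ennreal mc mc1) auto
 have "(\<integral>\<^sup>+x. ennreal (\<bar>\<Sum>i\<le>K. dev c (J i) (x i)\<bar> ^ p) \<partial>?N) \<le> (\<integral>\<^sup>+x. ?S1 x + ennreal A * ?S2 x \<partial>?N)"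
 proof (rule nn_integral_mono)
  fix x :: "nat \<Rightarrow> real \<times> real"
  have "\<bar>\<Sum>i\<le>K. dev c (J i) (x i)\<bar> ^ p \<le> (\<Sum>i\<le>K. ?u i x) ^ p" by (intro power_mono sum_abs) simp
  also have "... \<le> (\<Sum>i\<in>{..K}. ?u i x ^ p) + real p * real (card {..K}) ^ (p - 1) * (?V x)"
   by (rule power_sum_le) (use p in auto)
  also have "... = (\<Sum>i\<in>{..K}. ?u i x ^ p) + A * (?V x)"
   by (simp add: A_def)
  finally have "ennreal (\<bar>\<Sum>i\<le>K. dev c (J i) (x i)\<bar> ^ p) \<le> ennreal ((\<Sum>i\<in>{..K}. ?u i x ^ p) + A * (?V x))"
   by (rule ennreal_leI)
  also have "... = ennreal (\<Sum>i\<in>{..K}. ?u i x ^ p) + ennreal A * ennreal (?V x)"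
  proof -
   have "0 \<le> (\<Sum>i\<in>{..K}. ?u i x ^ p)" "0 \<le> (?V x)"
    by (intro sum_nonneg mult_nonneg_nonneg zero_le_power abs_ge_zero)+
   then show ?thesis using A by (simp only: ennreal_plus ennreal_mult mult_nonneg_nonneg)
  qed
  also have "ennreal (\<Sum>i\<in>{..K}. ?u i x ^ p) = ?S1 x" by (rule sum_ennreal[symmetric]) simp
  also have "ennreal (?V x) = ?S2 x"
  proof (subst sum_ennreal[symmetric])
   show "(\<Sum>i\<in>{..K}. ennreal (\<Sum>j\<in>{..K} - {i}. ?u i x ^ (p - 1) * ?u j x)) = ?S2 x"
   proof (rule sum.cong[OF refl])
    fix i
    have "ennreal (\<Sum>j\<in>{..K} - {i}. ?u i x ^ (p - 1) * ?u j x) = (\<Sum>j\<in>{..K} - {i}. ennreal (?u i x ^ (p - 1) * ?u j x))"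
     by (rule sum_ennreal[symmetric]) simp
    also have "... = (\<Sum>j\<in>{..K} - {i}. ennreal (?u i x ^ (p - 1)) * ennreal (?u j x))"
     by (intro sum.cong refl ennreal_mult) simp_all
    finally show "ennreal (\<Sum>j\<in>{..K} - {i}. ?u i x ^ (p - 1) * ?u j x) = ..." .
   qed
  qed (auto intro!: sum_nonneg)
  finally show "ennreal (\<bar>\<Sum>i\<le>K. dev c (J i) (x i)\<bar> ^ p) \<le> ?S1 x + ennreal A * ?S2 x" .
 qed
 also have "... = (\<integral>\<^sup>+x. ?S1 x \<partial>?N) + ennreal A * (\<integral>\<^sup>+x. ?S2 x \<partial>?N)"
  by (subst nn_integral_add, rule m1, intro borel_measurable_times_ennreal borel_measurable_const m2) (simp only: nn_integral_cmult[OF m2])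
 also have "(\<integral>\<^sup>+x. ?S1 x \<partial>?N) = (\<Sum>i\<le>K. dev_moment c p (J i))"
 proof (subst nn_integral_sum)
  show "(\<Sum>i\<le>K. \<integral>\<^sup>+x. ennreal (?u i x ^ p) \<partial>?N) = (\<Sum>i\<le>K. dev_moment c p (J i))"
   unfolding dev_moment_def
  proof (rule sum.cong[OF refl])
   fix i assume i: "i \<in> {..K}"
   show "(\<integral>\<^sup>+x. ennreal (?u i x ^ p) \<partial>?N) = (\<integral>\<^sup>+y. ennreal (\<bar>dev c (J i) y\<bar> ^ p) \<partial>\<pi> (J i))"
    by (rule nn_integral_PiM_component[where \<nu> = "\<lambda>i. \<pi> (J i)" and f = "\<lambda>y. ennreal (\<bar>dev c (J i) y\<bar> ^ p)", OF prob_\<pi> i md])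
  qed
 qed (rule mc)
 also have "(\<integral>\<^sup>+x. ?S2 x \<partial>?N) \<le> ennreal (real (K + 1) * real K * (D1 * (1 + D2)) * real n powr (\<tau> * real p))"
 proof -
  let ?B = "D1 * (1 + D2) * real n powr (\<tau> * real p)"
  have "(\<integral>\<^sup>+x. ?S2 x \<partial>?N) = (\<Sum>i\<in>{..K}. \<integral>\<^sup>+x. (\<Sum>j\<in>{..K} - {i}. ennreal (?u i x ^ (p - 1)) * ennreal (?u j x)) \<partial>?N)"
   by (rule nn_integral_sum) (intro borel_measurable_sum borel_measurable_times_ennreal mc mc1, auto)
  also have "... = (\<Sum>i\<in>{..K}. \<Sum>j\<in>{..K} - {i}. \<integral>\<^sup>+x. ennreal (?u i x ^ (p - 1)) * ennreal (?u j x) \<partial>?N)"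
   by (intro sum.cong refl nn_integral_sum borel_measurable_times_ennreal mc mc1) auto
  also have "... \<le> (\<Sum>i\<in>{..K}. \<Sum>j\<in>{..K} - {i}. ennreal ?B)"
  proof (intro sum_mono)
   fix i j assume i: "i \<in> {..K}" and j: "j \<in> {..K} - {i}"
   have "(\<integral>\<^sup>+x. ennreal (?u i x ^ (p - 1)) * ennreal (?u j x) \<partial>?N) = dev_moment c (p - 1) (J i) * (\<integral>\<^sup>+y. ennreal \<bar>dev c (J j) y\<bar> \<partial>\<pi> (J j))"
    unfolding dev_moment_def
    by (rule nn_integral_PiM_pair[where \<nu> = "\<lambda>i. \<pi> (J i)" and f = "\<lambda>y. ennreal (\<bar>dev c (J i) y\<bar> ^ (p - 1))" and g = "\<lambda>y. ennreal \<bar>dev c (J j) y\<bar>",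
       OF prob_\<pi> _ _ _ _ md md1]) (use i j in auto)
   also have "... \<le> ennreal (D1 * real n powr (\<tau> * real (p - 1))) * ennreal ((1 + D2) * real n powr \<tau>)"
   proof (rule mult_mono)
    have "real (J i) powr (\<tau> * real (p - 1)) \<le> real n powr (\<tau> * real (p - 1))" by (rule powr_mono2) (use J[of i] i \<tau> in auto)
    then show "dev_moment c (p - 1) (J i) \<le> ennreal (D1 * real n powr (\<tau> * real (p - 1)))"
     using D1(2) by (intro order_trans[OF D1(1)] ennreal_leI mult_left_mono)
    show "(\<integral>\<^sup>+y. ennreal \<bar>dev c (J j) y\<bar> \<partial>\<pi> (J j)) \<le> ennreal ((1 + D2) * real n powr \<tau>)"
     by (rule dev_first_moment[OF D2 _ n \<tau>]) (use J j in auto)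
   qed simp_all
   also have "... = ennreal ?B"
   proof -
    have "real n powr (\<tau> * real (p - 1)) * real n powr \<tau> = real n powr (\<tau> * real p)"
     using p by (simp add: of_nat_diff algebra_simps flip: powr_add)
    then show ?thesis using D1(2) D2(2) by (simp add: ennreal_mult[symmetric] mult_ac)
   qed
   finally show "(\<integral>\<^sup>+x. ennreal (?u i x ^ (p - 1)) * ennreal (?u j x) \<partial>?N) \<le> ennreal ?B" .
  qed
  also have "... = ennreal (real (K + 1) * real K * ?B)"
   using D1(2) D2(2) by (simp add: ennreal_of_nat_eq_real_of_nat ennreal_mult[symmetric] mult.assoc flip: of_nat_Suc)
  finally show ?thesis by (simp only: mult_ac)
 qed
 finally show ?thesis unfolding A_def[symmetric] using A D1(2) D2(2)
  by (simp add: ennreal_mult[symmetric] add_left_mono mult_left_mono mult.assoc)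
qed

lemma exists_small_factor:
 fixes \<kappa> :: real
 assumes "\<kappa> < 1"
 shows "\<exists>\<theta>>0. (1 + \<theta>) ^ p * \<kappa> < 1"
proof -
 have "((\<lambda>\<theta>::real. (1 + \<theta>) ^ p * \<kappa>) \<longlongrightarrow> (1 + 0) ^ p * \<kappa>) (at_right 0)" by (intro tendsto_intros)
 then have "eventually (\<lambda>\<theta>. (1 + \<theta>) ^ p * \<kappa> < 1) (at_right 0)" using assms by (intro order_tendstoD(2)) auto
 then obtain b where "b > 0" "\<And>\<theta>. 0 < \<theta> ==> \<theta> < b ==> (1 + \<theta>) ^ p * \<kappa> < 1"
  unfolding eventually_at_right_field by auto
 then show ?thesis by (intro exI[of _ "b / 2"]) auto
qed

text \<open>Splits the deviation into the sum over the sublists, which keeps a coefficient close to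
  1, and the residual toll, and applies \<open>contraction_bound\<close> with exponent \<tau>
  p.\<close>

lemma dev_moment_step:
 assumes p: "p \<ge> 2" and \<tau>: "\<tau> > 1 / 2"
  and fin: "\<And>n. dev_moment c p n < \<infinity>"
  and sum: "\<And>n q. n > K ==> (\<integral>\<^sup>+x. ennreal (\<bar>\<Sum>i\<le>K. dev c (sz n q i) (x i)\<bar> ^ p) \<partial>(inputs n q))
   \<le> (\<Sum>i\<le>K. dev_moment c p (sz n q i)) + ennreal (C1 * real n powr (\<tau> * real p))" and C1: "C1 \<ge> 0"
  and toll: "\<And>n. n > K ==> resid_moment c p n
   \<le> ennreal (C2 * real n powr (\<tau> * real p))" and C2: "C2 \<ge> 0"
 shows "\<exists>D\<ge>0. \<forall>n. dev_moment c p n \<le> ennreal (D * real n powr (\<tau> * real p))"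
proof -
 \<comment> \<open>The contraction of the sizes needs an exponent above 1; p >= 2 and \<tau> > 1/2
   provide it.\<close>
 have \<sigma>: "\<tau> * real p > 1"
 proof -
  have "1 / 2 * 2 < \<tau> * 2" using \<tau> by simp
  also have "\<tau> * 2 \<le> \<tau> * real p" using p \<tau> by (intro mult_left_mono) auto
  finally show ?thesis by simp
 qed
 obtain \<kappa> n0 where \<kappa>: "\<kappa> \<ge> 0" "\<kappa> < 1" and contr: "\<And>n. n \<ge> n0 ==>
  (\<integral>\<^sup>+q. (\<Sum>i\<le>K. ennreal (real (sz n q i) powr (\<tau> * real p))) \<partial>partition_measure K n) \<le> ennreal (\<kappa> * real n powr (\<tau> * real p))"
  using sizes_contraction[OF K \<sigma>] by blast
 \<comment> \<open>The splitting must cost less than the gap between \<kappa> and 1.\<close>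
 obtain \<theta> where \<theta>: "\<theta> > 0" "(1 + \<theta>) ^ p * \<kappa> < 1" using exists_small_factor[OF \<kappa>(2)] by blast
 let ?a = "(1 + \<theta>) ^ p" and ?b = "(1 + 1 / \<theta>) ^ p"
 have ab: "?a \<ge> 0" "?b \<ge> 0" using \<theta> by auto
 have rec: "dev_moment c p n \<le> ennreal ?a * (\<integral>\<^sup>+q. (\<Sum>i\<le>K. dev_moment c p (sz n q i)) \<partial>partition_measure K n)
   + ennreal ((?a * C1 + ?b * C2) * real n powr (\<tau> * real p))" if n: "n > K" for n
 proof -
  let ?Q = "partition_measure K n" and ?N = "\<lambda>q. inputs n q"
  let ?\<sigma> = "real n powr (\<tau> * real p)"
  interpret Q: prob_space ?Q by (rule prob_space_partition_measure)
  let ?S = "\<lambda>q x. \<Sum>i\<le>K. dev c (sz n q i) (x i)"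
  let ?R = "\<lambda>q. \<integral>\<^sup>+x. ennreal (\<bar>resid c n q x\<bar> ^ p) \<partial>?N q"
  let ?H = "\<lambda>q. \<Sum>i\<le>K. dev_moment c p (sz n q i)"
  have sets: "sets (?N q) = sets (\<Pi>\<^sub>M i\<in>{..K}. pair_borel)" for q
   by (rule sets_PiM_cong) (simp_all only: sets_\<pi>)
  have mN: "measurable (?N q) M' = measurable (\<Pi>\<^sub>M i\<in>{..K}. pair_borel) M'" for q and M' :: "ennreal measure"
   by (rule measurable_cong_sets[OF sets refl])
  have mG: "(\<lambda>z. ennreal (\<bar>resid c n (fst z) (snd z)\<bar> ^ p)) \<in> borel_measurable (?Q \<Otimes>\<^sub>M (\<Pi>\<^sub>M i\<in>{..K}. pair_borel))"
   by (intro borel_rules measurable_resid)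
  have mR: "?R \<in> borel_measurable ?Q" using mixture_measurable[OF n mG] by (simp only: fst_conv snd_conv)
  have mH: "?H \<in> borel_measurable ?Q"
   by (intro borel_measurable_sum measurable_compose[OF measurable_sublist_size_part]) simp
  have "dev_moment c p n = (\<integral>\<^sup>+q. (\<integral>\<^sup>+x. ennreal (\<bar>?S q x + resid c n q x\<bar> ^ p) \<partial>?N q) \<partial>?Q)"
   unfolding dev_moment_def nn_integral_\<pi>[OF n measurable_dev_power] dev_combine ..
  also have "... \<le> (\<integral>\<^sup>+q. ennreal ?a * (?H q + ennreal (C1 * ?\<sigma>)) + ennreal ?b * ?R q \<partial>?Q)"
  proof (rule nn_integral_mono)
   fix q assume q: "q \<in> space ?Q"
   have mr: "(\<lambda>x. ennreal (\<bar>resid c n q x\<bar> ^ p)) \<in> borel_measurable (?N q)"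
    unfolding mN using measurable_compose[OF measurable_Pair1'[OF q] mG] by (simp only: fst_conv snd_conv)
   have ms: "(\<lambda>x. ennreal (\<bar>?S q x\<bar> ^ p)) \<in> borel_measurable (?N q)"
   proof -
    have "(\<lambda>x. dev c (sz n q i) (x i)) \<in> borel_measurable (\<Pi>\<^sub>M i\<in>{..K}. pair_borel)" if "i \<in> {..K}" for i
     by (rule measurable_PiM_coordinate[where \<nu> = "\<lambda>_. pair_borel" and f = "dev c (sz n q i)", OF that measurable_dev])
    then show ?thesis unfolding mN
     by (intro borel_rules)
   qed
   have "(\<integral>\<^sup>+x. ennreal (\<bar>?S q x + resid c n q x\<bar> ^ p) \<partial>?N q)
     \<le> (\<integral>\<^sup>+x. ennreal ?a * ennreal (\<bar>?S q x\<bar> ^ p) + ennreal ?b * ennreal (\<bar>resid c n q x\<bar> ^ p) \<partial>?N q)"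
   proof (rule nn_integral_mono)
    fix x
    have "\<bar>?S q x + resid c n q x\<bar> ^ p \<le> (\<bar>?S q x\<bar> + \<bar>resid c n q x\<bar>) ^ p" by (intro power_mono abs_triangle_ineq) simp
    also have "... \<le> ?a * \<bar>?S q x\<bar> ^ p + ?b * \<bar>resid c n q x\<bar> ^ p" by (rule power_add_le) (use \<theta> in auto)
    finally have "ennreal (\<bar>?S q x + resid c n q x\<bar> ^ p) \<le> ennreal (?a * \<bar>?S q x\<bar> ^ p + ?b * \<bar>resid c n q x\<bar> ^ p)" by (rule ennreal_leI)
    also have "... = ennreal ?a * ennreal (\<bar>?S q x\<bar> ^ p) + ennreal ?b * ennreal (\<bar>resid c n q x\<bar> ^ p)"
     using ab by (simp only: ennreal_plus ennreal_mult mult_nonneg_nonneg zero_le_power abs_ge_zero)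
    finally show "ennreal (\<bar>?S q x + resid c n q x\<bar> ^ p) \<le> ..." .
   qed
   also have "... = ennreal ?a * (\<integral>\<^sup>+x. ennreal (\<bar>?S q x\<bar> ^ p) \<partial>?N q) + ennreal ?b * ?R q"
    by (subst nn_integral_add, intro borel_measurable_times_ennreal borel_measurable_const ms, intro borel_measurable_times_ennreal borel_measurable_const mr)
     (simp only: nn_integral_cmult[OF ms] nn_integral_cmult[OF mr])
   also have "... \<le> ennreal ?a * (?H q + ennreal (C1 * ?\<sigma>)) + ennreal ?b * ?R q"
    by (intro add_right_mono mult_left_mono sum[OF n]) simp
   finally show "(\<integral>\<^sup>+x. ennreal (\<bar>?S q x + resid c n q x\<bar> ^ p) \<partial>?N q) \<le> ..." .
  qed
  also have "... = ennreal ?a * ((\<integral>\<^sup>+q. ?H q \<partial>?Q) + ennreal (C1 * ?\<sigma>)) + ennreal ?b * (\<integral>\<^sup>+q. ?R q \<partial>?Q)"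
  proof -
   have m: "(\<lambda>q. ?H q + ennreal (C1 * ?\<sigma>)) \<in> borel_measurable ?Q" by (intro borel_rules mH)
   have "(\<integral>\<^sup>+q. ?H q + ennreal (C1 * ?\<sigma>) \<partial>?Q) = (\<integral>\<^sup>+q. ?H q \<partial>?Q) + ennreal (C1 * ?\<sigma>)"
    by (subst nn_integral_add[OF mH borel_measurable_const]) (simp only: Q.nn_integral_prob_const)
   then show ?thesis
    by (subst nn_integral_add, intro borel_measurable_times_ennreal borel_measurable_const m, intro borel_measurable_times_ennreal borel_measurable_const mR)
     (simp only: nn_integral_cmult[OF m] nn_integral_cmult[OF mR])
  qed
  also have "... \<le> ennreal ?a * ((\<integral>\<^sup>+q. ?H q \<partial>?Q) + ennreal (C1 * ?\<sigma>)) + ennreal ?b * ennreal (C2 * ?\<sigma>)"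
   by (intro add_left_mono mult_left_mono toll[OF n]) simp
  also have "... = ennreal ?a * (\<integral>\<^sup>+q. ?H q \<partial>?Q) + (ennreal ?a * ennreal (C1 * ?\<sigma>) + ennreal ?b * ennreal (C2 * ?\<sigma>))"
   by (simp only: distrib_left add.assoc)
  also have "ennreal ?a * ennreal (C1 * ?\<sigma>) + ennreal ?b * ennreal (C2 * ?\<sigma>) = ennreal (?a * (C1 * ?\<sigma>) + ?b * (C2 * ?\<sigma>))"
   using ab C1 C2 by (simp only: ennreal_plus ennreal_mult mult_nonneg_nonneg powr_ge_zero)
  also have "?a * (C1 * ?\<sigma>) + ?b * (C2 * ?\<sigma>) = (?a * C1 + ?b * C2) * ?\<sigma>" by (simp add: algebra_simps)
  finally show ?thesis .
 qed
 show ?thesis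
 proof (rule contraction_bound[where Q = "partition_measure K" and J = "\<lambda>n i q. sz n q i" and K = K])
  show "dev_moment c p 0 = 0" by (rule dev_moment_0) (use p in simp)
  show "?a * \<kappa> < 1" by (rule \<theta>(2))
  show "0 \<le> ?a * C1 + ?b * C2" using ab C1 C2 by simp
  show "0 \<le> \<tau> * real p" using \<sigma> by simp
 qed (use prob_space_partition_measure sz_less measurable_sublist_size_part fin rec contr ab \<kappa> in blast)+
qed

end

section \<open>The residual toll\<close>

text \<open>One error bound for all sizes m <= n. It includes m = 0, since sublists may be empty:
  there m ln m is 0 and f 0 goes into the constant.\<close>

lemma log_linear_defectE:
 assumes "log_linear \<beta> \<alpha> f" "\<beta> \<ge> 0"
 obtains c C where "C \<ge> 0" "\<And>m n. m \<le> n ==> n \<ge> 1 ==> \<bar>f m - \<alpha> * (real m * ln (real m)) - c * real m\<bar> \<le> C * real n powr \<beta>"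
proof -
 obtain c C where cC: "\<And>n. n \<ge> 1 ==> \<bar>f n - \<alpha> * real n * ln (real n) - c * real n\<bar> \<le> C * real n powr \<beta>"
  using assms(1) unfolding log_linear_def by blast
 have "\<bar>f m - \<alpha> * (real m * ln (real m)) - c * real m\<bar> \<le> (\<bar>C\<bar> + \<bar>f 0\<bar>) * real n powr \<beta>" if mn: "m \<le> n" "n \<ge> 1" for m n
 proof (cases "m = 0")
  case True
  have "1 powr \<beta> \<le> real n powr \<beta>" by (rule powr_mono2) (use mn assms(2) in auto)
  then have "(\<bar>C\<bar> + \<bar>f 0\<bar>) * 1 \<le> (\<bar>C\<bar> + \<bar>f 0\<bar>) * real n powr \<beta>" by (intro mult_left_mono) auto
  then show ?thesis using True by simp
 next
  case False
  have "real m powr \<beta> \<le> real n powr \<beta>" by (rule powr_mono2) (use mn assms(2) in auto)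
  then have "(\<bar>C\<bar> + \<bar>f 0\<bar>) * real m powr \<beta> \<le> (\<bar>C\<bar> + \<bar>f 0\<bar>) * real n powr \<beta>" by (rule mult_left_mono) simp
  moreover have "C * real m powr \<beta> \<le> (\<bar>C\<bar> + \<bar>f 0\<bar>) * real m powr \<beta>" by (intro mult_right_mono) auto
  moreover have "\<bar>f m - \<alpha> * (real m * ln (real m)) - c * real m\<bar> \<le> C * real m powr \<beta>"
   using cC[of m] False by (simp add: mult.assoc)
  ultimately show ?thesis by linarith
 qed
 then show ?thesis by (intro that[of "\<bar>C\<bar> + \<bar>f 0\<bar>" c]) auto
qed

lemma abs_x_ln_x_le_1:
 fixes x :: real
 assumes "0 \<le> x" "x \<le> 1"
 shows "\<bar>x * ln x\<bar> \<le> 1"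
proof (cases "x = 0")
 case False
 then have x: "x > 0" using assms by simp
 have "ln (1 / x) \<le> 1 / x - 1" by (rule ln_le_minus_one) (use x in simp)
 then have "x * (- ln x) \<le> x * (1 / x - 1)" using x by (intro mult_left_mono) (auto simp: ln_div)
 also have "... \<le> 1" using x by (simp add: field_simps)
 finally have "- (x * ln x) \<le> 1" by simp
 moreover have "x * ln x \<le> 0" using x assms by (intro mult_nonneg_nonpos) auto
 ultimately show ?thesis by linarith
qed simp

text \<open>\<open>- x ln x\<close> is subadditive, so its modulus of continuity at \<open>d\<close> is \<open>- d ln d\<close>, up to a linear term.\<close>

lemma x_ln_x_diff_le:
 fixes a b N :: real
 assumes ab: "0 \<le> a" "a < b" "b \<le> 1" and N: "N \<ge> 1"
 shows "\<bar>b * ln b - a * ln a\<bar> \<le> (1 + ln N) * (b - a) + 1 / N"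
proof -
 define d where "d = b - a"
 have d: "d > 0" "d \<le> b" using ab by (auto simp: d_def)
 have lnN: "ln N \<ge> 0" using N by simp
 have up: "b * ln b - a * ln a \<le> d"
 proof (cases "a = 0")
  case True
  have "b * ln b \<le> 0" using ab by (intro mult_nonneg_nonpos) auto
  then show ?thesis using True d by simp
 next
  case False
  then have a: "a > 0" using ab by simp
  have "ln (b / a) \<le> b / a - 1" by (rule ln_le_minus_one) (use a ab in simp)
  then have "a * (ln b - ln a) \<le> a * (b / a - 1)" using a ab by (intro mult_left_mono) (auto simp: ln_div)
  also have "... = d" using a by (simp add: d_def field_simps)
  finally have "a * (ln b - ln a) \<le> d" .
  moreover have "d * ln b \<le> 0" using ab d by (intro mult_nonneg_nonpos) auto
  moreover have "b * ln b - a * ln a = d * ln b + a * (ln b - ln a)" by (simp add: d_def algebra_simps)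
  ultimately show ?thesis by linarith
 qed
 have low: "a * ln a - b * ln b \<le> d * ln N + 1 / N"
 proof -
  have 1: "a * ln a \<le> a * ln b"
  proof (cases "a = 0")
   case False
   then show ?thesis using ab by (intro mult_left_mono) auto
  qed simp
  have "d * ln d \<le> d * ln b" using d by (intro mult_left_mono) auto
  moreover have "b * ln b = a * ln b + d * ln b" by (simp add: d_def algebra_simps)
  ultimately have "a * ln a - b * ln b \<le> - (d * ln d)" using 1 by linarith
  also have "... \<le> d * ln N + 1 / N"
  proof -
   have "ln (1 / (d * N)) \<le> 1 / (d * N) - 1" by (rule ln_le_minus_one) (use d N in simp)
   then have "d * ln (1 / (d * N)) \<le> d * (1 / (d * N) - 1)" using d by (intro mult_left_mono) auto
   also have "d * (1 / (d * N) - 1) = 1 / N - d" using d N by (simp add: field_simps)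
   also have "ln (1 / (d * N)) = - ln d - ln N" using d N by (simp add: ln_div ln_mult)
   finally show ?thesis using d by (simp add: algebra_simps)
  qed
  finally show ?thesis .
 qed
 have "(1 + ln N) * (b - a) + 1 / N = d + d * ln N + 1 / N" by (simp add: d_def algebra_simps)
 moreover have "0 \<le> d * ln N" "0 \<le> 1 / N" using d lnN N by auto
 ultimately show ?thesis using up low d by linarith
qed

lemma x_ln_x_modulus:
 fixes x y N :: real
 assumes "0 \<le> x" "x \<le> 1" "0 \<le> y" "y \<le> 1" "N \<ge> 1"
 shows "\<bar>x * ln x - y * ln y\<bar> \<le> (1 + ln N) * \<bar>x - y\<bar> + 1 / N"
proof -
 consider "x < y" | "x = y" | "y < x" by linarith
 then show ?thesis
 proof cases
  case 1
  then show ?thesis using x_ln_x_diff_le[of x y N] assms by (simp add: abs_minus_commute)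
 next
  case 2
  then show ?thesis using assms by simp
 next
  case 3
  then show ?thesis using x_ln_x_diff_le[of y x N] assms by simp
 qed
qed

lemma power_mean_shift:
 assumes N: "prob_space N" and m: "f \<in> borel_measurable N" and f: "\<And>x. f x \<ge> 0" and s: "s \<ge> 0" and C: "C \<ge> 0"
  and le: "(\<integral>\<^sup>+x. ennreal (f x ^ p) \<partial>N) \<le> ennreal (C * s ^ p)"
 shows "(\<integral>\<^sup>+x. ennreal ((f x + s) ^ p) \<partial>N) \<le> ennreal (2 ^ p * (C + 1) * s ^ p)"
proof -
 interpret prob_space N by (rule N)
 have mp: "(\<lambda>x. ennreal (f x ^ p)) \<in> borel_measurable N"
  by (intro borel_rules m)
 have "(\<integral>\<^sup>+x. ennreal ((f x + s) ^ p) \<partial>N) \<le> (\<integral>\<^sup>+x. ennreal (2 ^ p) * (ennreal (f x ^ p) + ennreal (s ^ p)) \<partial>N)"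
 proof (rule nn_integral_mono)
  fix x
  have "(f x + s) ^ p \<le> (1 + 1) ^ p * f x ^ p + (1 + 1 / 1) ^ p * s ^ p" by (rule power_add_le) (use f s in auto)
  then have "(f x + s) ^ p \<le> 2 ^ p * (f x ^ p + s ^ p)" by (simp add: algebra_simps)
  then have "ennreal ((f x + s) ^ p) \<le> ennreal (2 ^ p * (f x ^ p + s ^ p))" by (rule ennreal_leI)
  then show "ennreal ((f x + s) ^ p) \<le> ennreal (2 ^ p) * (ennreal (f x ^ p) + ennreal (s ^ p))"
   using f[of x] s by (simp add: ennreal_mult ennreal_plus)
 qed
 also have "... = ennreal (2 ^ p) * ((\<integral>\<^sup>+x. ennreal (f x ^ p) \<partial>N) + ennreal (s ^ p))"
  by (subst nn_integral_cmult, intro borel_measurable_add borel_measurable_const mp, subst nn_integral_add[OF mp borel_measurable_const])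
   (simp only: nn_integral_prob_const)
 also have "... \<le> ennreal (2 ^ p) * (ennreal (C * s ^ p) + ennreal (s ^ p))"
  by (intro mult_left_mono add_right_mono le) simp
 also have "... = ennreal (2 ^ p * (C * s ^ p + s ^ p))"
 proof -
  have "0 \<le> C * s ^ p" "0 \<le> s ^ p" using s C by auto
  then show ?thesis by (simp add: ennreal_mult ennreal_plus)
 qed
 also have "2 ^ p * (C * s ^ p + s ^ p) = 2 ^ p * (C + 1) * s ^ p" by (simp add: algebra_simps)
 finally show ?thesis .
qed

context limit_coupling
begin

text \<open>The three sources of toll: fluctuation of the partitioning cost, the x ln x terms of the
  sizes against those of the spacings, and the mismatch of I_i and n D_i in front of Z^(i).\<close>

abbreviation resid_main :: "real \<Rightarrow> nat \<Rightarrow> (nat \<Rightarrow> real) \<times> (nat \<Rightarrow> real) \<Rightarrow> (nat \<Rightarrow> real \<times> real) \<Rightarrow> real" where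
 "resid_main c n q x \<equiv> pcost K r s n q - c * real n * opt_cost K (spacing K (fst q))
  + alpha_K K * real n * (\<Sum>i\<le>K. real (sz n q i) / real n * ln (real (sz n q i) / real n) - c * (spacing K (fst q) i * ln (spacing K (fst q) i)))
  + c * (\<Sum>i\<le>K. (real (sz n q i) - real n * spacing K (fst q) i) * snd (x i))"

text \<open>Since the sizes sum to n - K, the linear parts of the means cancel up to m K and the
  terms n ln n up to \<alpha> K ln n. What is left are the errors O(n^\<beta>) of K + 2
  means.\<close>

lemma resid_expansion:
 assumes K4: "K \<in> {2, 3, 4}" and \<beta>: "1 / 2 \<le> \<beta>" "\<beta> < 1"
 shows "\<exists>C\<ge>0. \<forall>n>K. \<forall>c q x. (\<Sum>i\<le>K. sz n q i) = n - K \<longrightarrow>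
  \<bar>resid c n q x - resid_main c n q x\<bar> \<le> C * real n powr \<beta>"
proof -
 let ?g = "\<lambda>n q c. \<Sum>i\<le>K. real (sz n q i) / real n * ln (real (sz n q i) / real n) - c * (spacing K (fst q) i * ln (spacing K (fst q) i))"
 let ?\<alpha> = "alpha_K K"
 obtain m C where C: "C \<ge> 0" and mean: "\<And>k n. k \<le> n ==> n \<ge> 1 ==> \<bar>mean k - ?\<alpha> * (real k * ln (real k)) - m * real k\<bar> \<le> C * real n powr \<beta>"
  using log_linear_defectE[OF mean_asymptotics[OF K4 \<beta>]] \<beta> by (metis less_eq_real_def half_gt_zero_iff order_trans zero_less_one)
 have \<beta>0: "\<beta> > 0" using \<beta> by simp
 define B where "B = real (K + 1) * C + C + \<bar>?\<alpha>\<bar> * real K / \<beta> + \<bar>m\<bar> * real K"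
 have "B \<ge> 0" using C \<beta>0 by (simp add: B_def)
 moreover have "\<bar>resid c n q x - (pcost K r s n q - c * real n * opt_cost K (spacing K (fst q))
   + ?\<alpha> * real n * ?g n q c
   + c * (\<Sum>i\<le>K. (real (sz n q i) - real n * spacing K (fst q) i) * snd (x i)))\<bar> \<le> B * real n powr \<beta>"
  if n: "n > K" and sum: "(\<Sum>i\<le>K. sz n q i) = n - K" for n c q x
 proof -
  have n1: "n \<ge> 1" "real n > 0" using n by auto
  define \<delta> where "\<delta> k = mean k - ?\<alpha> * (real k * ln (real k)) - m * real k" for k
  have \<delta>: "\<bar>\<delta> k\<bar> \<le> C * real n powr \<beta>" if "k \<le> n" for k unfolding \<delta>_def using mean that n1 by simp
  have meaneq: "mean k = ?\<alpha> * (real k * ln (real k)) + m * real k + \<delta> k" for k by (simp add: \<delta>_def)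
  have rsum: "(\<Sum>i\<le>K. real (sz n q i)) = real n - real K" using sum n by (simp flip: of_nat_sum)
  let ?I = "\<lambda>i. real (sz n q i)"
  \<comment> \<open>Moves ln n out of the entropy of the sizes; an empty sublist contributes 0 on
    both sides.\<close>
  have ent: "?I i * ln (?I i) = real n * (?I i / real n * ln (?I i / real n)) + ?I i * ln (real n)" for i
  proof (cases "sz n q i = 0")
   case False
   then have "ln (?I i) = ln (?I i / real n) + ln (real n)" using n1 by (simp add: ln_div)
   then have "?I i * ln (?I i) = ?I i * ln (?I i / real n) + ?I i * ln (real n)" by (simp only: distrib_left)
   then show ?thesis using n1 by simp
  qed simp
  have Esum: "(\<Sum>i\<le>K. ?I i * ln (?I i)) = real n * (\<Sum>i\<le>K. ?I i / real n * ln (?I i / real n)) + (real n - real K) * ln (real n)"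
   unfolding ent sum.distrib sum_distrib_left[symmetric] sum_distrib_right[symmetric] rsum ..
  have Msum: "(\<Sum>i\<le>K. mean (sz n q i)) = ?\<alpha> * (\<Sum>i\<le>K. ?I i * ln (?I i)) + m * (real n - real K) + (\<Sum>i\<le>K. \<delta> (sz n q i))"
   unfolding meaneq sum.distrib sum_distrib_left[symmetric] rsum ..
  have T: "limit_toll K (fst q) = ?\<alpha> * (\<Sum>i\<le>K. spacing K (fst q) i * ln (spacing K (fst q) i)) + opt_cost K (spacing K (fst q))"
   by (simp add: limit_toll_def sum_distrib_left mult.assoc)
  have Dsum: "?g n q c
   = (\<Sum>i\<le>K. ?I i / real n * ln (?I i / real n)) - c * (\<Sum>i\<le>K. spacing K (fst q) i * ln (spacing K (fst q) i))"
   by (simp add: sum_subtractf sum_distrib_left)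
  have eq: "resid c n q x - (pcost K r s n q - c * real n * opt_cost K (spacing K (fst q))
   + ?\<alpha> * real n * ?g n q c
   + c * (\<Sum>i\<le>K. (real (sz n q i) - real n * spacing K (fst q) i) * snd (x i)))
   = (\<Sum>i\<le>K. \<delta> (sz n q i)) - \<delta> n - ?\<alpha> * real K * ln (real n) - m * real K"
   unfolding resid_def Msum Dsum Esum T meaneq[of n] by (simp add: algebra_simps)
  have 1: "\<bar>\<Sum>i\<le>K. \<delta> (sz n q i)\<bar> \<le> real (K + 1) * C * real n powr \<beta>"
  proof -
   have "\<bar>\<Sum>i\<le>K. \<delta> (sz n q i)\<bar> \<le> (\<Sum>i\<le>K. \<bar>\<delta> (sz n q i)\<bar>)" by (rule sum_abs)
   also have "... \<le> (\<Sum>i\<le>K. C * real n powr \<beta>)" by (intro sum_mono \<delta> less_imp_le sz_less n)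
   finally show ?thesis by (simp add: mult.assoc)
  qed
  have 2: "\<bar>?\<alpha> * real K * ln (real n)\<bar> \<le> \<bar>?\<alpha>\<bar> * real K / \<beta> * real n powr \<beta>"
  proof -
   have "ln (real n) \<le> real n powr \<beta> / \<beta>" by (rule ln_powr_bound) (use n1 \<beta>0 in auto)
   moreover have "ln (real n) \<ge> 0" using n1 by simp
   ultimately have "\<bar>?\<alpha>\<bar> * real K * \<bar>ln (real n)\<bar> \<le> \<bar>?\<alpha>\<bar> * real K * (real n powr \<beta> / \<beta>)" by (intro mult_left_mono) auto
   then show ?thesis by (simp add: abs_mult)
  qed
  have 3: "\<bar>m * real K\<bar> \<le> \<bar>m\<bar> * real K * real n powr \<beta>"
  proof -
   have "1 \<le> real n powr \<beta>" using n1 \<beta>0 by (intro ge_one_powr_ge_zero) auto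
   from mult_left_mono[OF this, of "\<bar>m\<bar> * real K"] show ?thesis by (simp add: abs_mult)
  qed
  have "\<bar>\<delta> n\<bar> \<le> C * real n powr \<beta>" by (rule \<delta>) simp
  then have "\<bar>(\<Sum>i\<le>K. \<delta> (sz n q i)) - \<delta> n - ?\<alpha> * real K * ln (real n) - m * real K\<bar>
    \<le> real (K + 1) * C * real n powr \<beta> + C * real n powr \<beta> + \<bar>?\<alpha>\<bar> * real K / \<beta> * real n powr \<beta> + \<bar>m\<bar> * real K * real n powr \<beta>"
   using 1 2 3 by linarith
  also have "... = B * real n powr \<beta>" by (simp add: B_def algebra_simps)
  finally show ?thesis unfolding eq .
 qed
 ultimately show ?thesis by blast
qed

lemma AE_partition_regular:
 "AE q in partition_measure K n. generic_pivots K (fst q) \<and> (\<Sum>i\<le>K. sz n q i) = n - K"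
 using AE_partition_generic[of K n] sizes_sum[of K n] by (rule AE_conjI)

text \<open>For c = 0 nothing in the residual is small, but it is almost surely at most of order n,
  as |x ln x| <= 1 on [0, 1]. Hence the scale \<tau> = 1.\<close>

lemma resid_centred_moment:
 assumes K4: "K \<in> {2, 3, 4}"
 shows "\<exists>C\<ge>0. \<forall>n>K. resid_moment 0 p n
  \<le> ennreal (C * real n powr (1 * real p))"
proof -
 let ?\<alpha> = "alpha_K K"
 obtain C where C: "C \<ge> 0" and exp: "\<And>n q x. n > K ==> (\<Sum>i\<le>K. sz n q i) = n - K ==>
  \<bar>resid 0 n q x - resid_main 0 n q x\<bar> \<le> C * real n powr (1 / 2)"
 proof -
  have "(1 / 2 :: real) \<le> 1 / 2" "(1 / 2 :: real) < 1" by simp_all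
  from resid_expansion[OF K4 this] show ?thesis using that by blast
 qed
 obtain B where B: "\<And>n. AE q in partition_measure K n. 0 \<le> pcost K r s n q \<and> pcost K r s n q \<le> real K * real n + B"
  using AE_partition_cost by blast
 define D where "D = real K + \<bar>B\<bar> + \<bar>?\<alpha>\<bar> * real (K + 1) + C"
 have D: "D \<ge> 0" using C by (simp add: D_def)
 have "resid_moment 0 p n \<le> ennreal (D ^ p * real n powr (1 * real p))"
  if n: "n > K" for n
 proof -
  interpret Q: prob_space "partition_measure K n" by (rule prob_space_partition_measure)
  have n1: "real n \<ge> 1" using n by simp
  have "resid_moment 0 p n
   \<le> (\<integral>\<^sup>+q. ennreal ((D * real n) ^ p) \<partial>partition_measure K n)"
  proof (rule nn_integral_mono_AE, rule eventually_mono[OF AE_conjI[OF AE_partition_regular B]])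
   fix q :: "(nat \<Rightarrow> real) \<times> (nat \<Rightarrow> real)"
   assume q: "(generic_pivots K (fst q) \<and> (\<Sum>i\<le>K. sz n q i) = n - K) \<and> 0 \<le> pcost K r s n q \<and> pcost K r s n q \<le> real K * real n + B"
   let ?N = "inputs n q"
   interpret N: prob_space ?N by (rule prob_space_PiM) (rule prob_\<pi>)
   have le: "\<bar>resid 0 n q x\<bar> \<le> D * real n" for x
   proof -
    let ?E = "\<Sum>i\<le>K. real (sz n q i) / real n * ln (real (sz n q i) / real n)"
    have "\<bar>?E\<bar> \<le> (\<Sum>i\<le>K. \<bar>real (sz n q i) / real n * ln (real (sz n q i) / real n)\<bar>)" by (rule sum_abs)
    also have "... \<le> (\<Sum>i\<le>K. 1)"
    proof (intro sum_mono abs_x_ln_x_le_1)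
     fix i show "real (sz n q i) / real n \<le> 1" using sz_less[OF n, of q i] by simp
    qed simp
    finally have "\<bar>?E\<bar> \<le> real (K + 1)" by simp
    then have "\<bar>?\<alpha>\<bar> * real n * \<bar>?E\<bar> \<le> \<bar>?\<alpha>\<bar> * real n * real (K + 1)" by (rule mult_left_mono) simp
    then have E: "\<bar>?\<alpha> * real n * ?E\<bar> \<le> \<bar>?\<alpha>\<bar> * real (K + 1) * real n" by (simp add: abs_mult mult_ac)
    have "real n powr (1 / 2) \<le> real n powr 1" using n1 by (intro powr_mono) auto
    then have "C * real n powr (1 / 2) \<le> C * real n" using C n1 by (intro mult_left_mono) auto
    moreover have "\<bar>resid 0 n q x - (pcost K r s n q + ?\<alpha> * real n * ?E)\<bar> \<le> C * real n powr (1 / 2)"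
     using exp[OF n, of q x] q by simp
    moreover have "B \<le> \<bar>B\<bar> * real n" using mult_left_mono[of 1 "real n" "\<bar>B\<bar>"] n1 by simp
    moreover have "D * real n = real K * real n + \<bar>B\<bar> * real n + \<bar>?\<alpha>\<bar> * real (K + 1) * real n + C * real n" by (simp add: D_def algebra_simps)
    ultimately show ?thesis using E q by linarith
   qed
   have "(\<integral>\<^sup>+x. ennreal (\<bar>resid 0 n q x\<bar> ^ p) \<partial>?N) \<le> (\<integral>\<^sup>+x. ennreal ((D * real n) ^ p) \<partial>?N)"
    by (intro nn_integral_mono ennreal_leI power_mono le abs_ge_zero)
   then show "(\<integral>\<^sup>+x. ennreal (\<bar>resid 0 n q x\<bar> ^ p) \<partial>?N) \<le> ennreal ((D * real n) ^ p)"
    by (simp only: N.nn_integral_prob_const)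
  qed
  also have "... = ennreal ((D * real n) ^ p)" by (simp only: Q.nn_integral_prob_const)
  also have "(D * real n) ^ p = D ^ p * real n powr (1 * real p)" using n1 by (simp add: power_mult_distrib powr_realpow)
  finally show ?thesis .
 qed
 then show ?thesis using D by (intro exI[of _ "D ^ p"]) auto
qed

text \<open>The modulus of continuity of x ln x at resolution 1/n bounds n times the x ln x
  difference by (1 + ln n) |I_i - n D_i| + 1, and n^(\<tau>-1/2) swallows the logarithm. The result
  is a product form: one factor depends on the partitioning data only, the other on Z^(i)
  only.\<close>

lemma resid_pointwise:
 assumes K4: "K \<in> {2, 3, 4}" and \<tau>: "1 / 2 < \<tau>" "\<tau> < 1"
 shows "\<exists>C\<ge>0. \<forall>n>K. \<forall>q x. generic_pivots K (fst q) \<longrightarrow> (\<Sum>i\<le>K. sz n q i) = n - K \<longrightarrow>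
  \<bar>resid 1 n q x\<bar> \<le> C * real n powr (\<tau> - 1 / 2) *
   ((sdev n q + sqrt (real n))
    + (\<Sum>i\<le>K. (\<bar>real (sz n q i) - real (n - K) * spacing K (fst q) i\<bar> + sqrt (real n)) * (1 + \<bar>snd (x i)\<bar>)))"
proof -
 let ?\<alpha> = "alpha_K K"
 define a where "a = \<tau> - 1 / 2"
 have a: "a > 0" using \<tau> by (simp add: a_def)
 obtain C where C: "C \<ge> 0" and exp: "\<And>n q x. n > K ==> (\<Sum>i\<le>K. sz n q i) = n - K ==>
  \<bar>resid 1 n q x - resid_main 1 n q x\<bar> \<le> C * real n powr \<tau>"
  using resid_expansion[OF K4 less_imp_le[OF \<tau>(1)] \<tau>(2)] by blast
 obtain B where B: "B \<ge> 0" and near: "\<And>n v a. n > K ==> generic_pivots K v ==>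
  \<bar>partition_cost K r s n v a - real n * opt_cost K (spacing K v)\<bar> \<le> steps_dev K r (n - K) v a + B"
  using partition_cost_near by blast
 \<comment> \<open>From ln n <= n^a / a and 1 <= n^a, so that 1 + ln n <= L n^a.\<close>
 define L where "L = 1 + 1 / a"
 have L: "L \<ge> 1" using a by (simp add: L_def)
 define C1 where "C1 = \<bar>?\<alpha>\<bar> * (L * real K + 1) + real K"
 define E where "E = 1 + B + C + C1"
 have C1: "C1 \<ge> 0" using L by (simp add: C1_def)
 have E: "E \<ge> 0" using B C C1 by (simp add: E_def)
 have main: "\<bar>resid 1 n q x\<bar> \<le> E * real n powr a * ((T + sqrt (real n)) + (\<Sum>i\<le>K. (\<Delta> i + sqrt (real n)) * (1 + \<bar>snd (x i)\<bar>)))"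
  if n: "n > K" and q: "generic_pivots K (fst q)" and sum: "(\<Sum>i\<le>K. sz n q i) = n - K"
   and T: "T = sdev n q"
   and \<Delta>: "\<Delta> = (\<lambda>i. \<bar>real (sz n q i) - real (n - K) * spacing K (fst q) i\<bar>)" for n q x T \<Delta>
 proof -
  have n1: "real n \<ge> 1" using n by simp
  define A where "A = real n powr a"
  define R where "R = sqrt (real n)"
  have A: "A \<ge> 1" unfolding A_def using n1 a by (intro ge_one_powr_ge_zero) auto
  have R: "R \<ge> 1" using n1 by (simp add: R_def)
  have AR: "real n powr \<tau> = A * R" using n1 by (simp add: A_def R_def a_def powr_half_sqrt[symmetric] flip: powr_add)
  have AR1: "A * R \<ge> 1" using mult_mono[of 1 A 1 R] A R by simp
  have lnA: "1 + ln (real n) \<le> L * A"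
  proof -
   have "ln (real n) \<le> A / a" unfolding A_def by (rule ln_powr_bound) (use n1 a in auto)
   then show ?thesis using A by (simp add: L_def algebra_simps)
  qed
  have K1: "real K \<ge> 1" using K by simp
  let ?I = "\<lambda>i. real (sz n q i)" and ?D = "\<lambda>i. spacing K (fst q) i"
  have T0: "T \<ge> 0" and \<Delta>0: "\<Delta> i \<ge> 0" for i by (simp_all add: T \<Delta>)
  have d: "\<bar>?I i - real n * ?D i\<bar> \<le> real K * (\<Delta> i + R)" if i: "i \<le> K" for i
  proof -
   have D: "0 < ?D i" "?D i \<le> 1" using spacing_pos[OF q i] spacing_le_1[OF q i] by auto
   have "?I i - real n * ?D i = (?I i - real (n - K) * ?D i) - real K * ?D i" using n by (simp add: of_nat_diff algebra_simps)
   moreover have "0 \<le> real K * ?D i" "real K * ?D i \<le> real K * 1" using D mult_left_mono[OF D(2), of "real K"] by simp_all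
   ultimately have "\<bar>?I i - real n * ?D i\<bar> \<le> \<Delta> i + real K" unfolding \<Delta> by linarith
   also have "... \<le> real K * \<Delta> i + real K * R"
    using mult_right_mono[OF K1 \<Delta>0[of i]] mult_left_mono[OF R, of "real K"] by simp
   finally show ?thesis by (simp add: algebra_simps)
  qed
  have each: "\<bar>?\<alpha> * real n * (?I i / real n * ln (?I i / real n) - ?D i * ln (?D i)) + (?I i - real n * ?D i) * snd (x i)\<bar>
    \<le> C1 * A * ((\<Delta> i + R) * (1 + \<bar>snd (x i)\<bar>))" if i: "i \<le> K" for i
  proof -
   have D: "0 < ?D i" "?D i \<le> 1" using spacing_pos[OF q i] spacing_le_1[OF q i] by auto
   have "\<bar>?I i / real n * ln (?I i / real n) - ?D i * ln (?D i)\<bar> \<le> (1 + ln (real n)) * \<bar>?I i / real n - ?D i\<bar> + 1 / real n"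
    by (rule x_ln_x_modulus) (use D n1 sz_less[OF n, of q i] in auto)
   then have "real n * \<bar>?I i / real n * ln (?I i / real n) - ?D i * ln (?D i)\<bar> \<le> real n * ((1 + ln (real n)) * \<bar>?I i / real n - ?D i\<bar> + 1 / real n)"
    by (rule mult_left_mono) simp
   also have "... = (1 + ln (real n)) * (real n * \<bar>?I i / real n - ?D i\<bar>) + 1" using n1 by (simp add: algebra_simps)
   also have "real n * \<bar>?I i / real n - ?D i\<bar> = \<bar>real n * (?I i / real n - ?D i)\<bar>" by (simp add: abs_mult)
   also have "real n * (?I i / real n - ?D i) = ?I i - real n * ?D i" using n1 by (simp add: algebra_simps)
   also have "(1 + ln (real n)) * \<bar>?I i - real n * ?D i\<bar> + 1 \<le> (L * A) * (real K * (\<Delta> i + R)) + A * (\<Delta> i + R)"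
   proof (rule add_mono[OF mult_mono[OF lnA d[OF i]]])
    show "1 \<le> A * (\<Delta> i + R)" using AR1 mult_nonneg_nonneg[OF order_trans[OF zero_le_one A] \<Delta>0[of i]] unfolding distrib_left by linarith
   qed (use L A in auto)
   also have "... = (L * real K + 1) * A * (\<Delta> i + R)" by (simp add: algebra_simps)
   finally have "\<bar>?\<alpha>\<bar> * (real n * \<bar>?I i / real n * ln (?I i / real n) - ?D i * ln (?D i)\<bar>) \<le> \<bar>?\<alpha>\<bar> * ((L * real K + 1) * A * (\<Delta> i + R))"
    by (rule mult_left_mono) simp
   then have 1: "\<bar>?\<alpha> * real n * (?I i / real n * ln (?I i / real n) - ?D i * ln (?D i))\<bar> \<le> \<bar>?\<alpha>\<bar> * (L * real K + 1) * (A * (\<Delta> i + R))"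
    by (simp add: abs_mult mult.assoc)
   have "\<bar>?I i - real n * ?D i\<bar> * \<bar>snd (x i)\<bar> \<le> real K * (\<Delta> i + R) * \<bar>snd (x i)\<bar>" by (intro mult_right_mono d i) simp
   also have "... \<le> A * (real K * (\<Delta> i + R) * \<bar>snd (x i)\<bar>)"
    using mult_right_mono[OF A, of "real K * (\<Delta> i + R) * \<bar>snd (x i)\<bar>"] \<Delta>0[of i] R by simp
   finally have 2: "\<bar>(?I i - real n * ?D i) * snd (x i)\<bar> \<le> real K * (A * (\<Delta> i + R)) * \<bar>snd (x i)\<bar>" by (simp add: abs_mult mult_ac)
   have W: "A * (\<Delta> i + R) \<ge> 0" using A \<Delta>0[of i] R by simp
   have "\<bar>?\<alpha>\<bar> * (L * real K + 1) * (A * (\<Delta> i + R)) \<le> C1 * (A * (\<Delta> i + R))" using W by (intro mult_right_mono) (simp_all add: C1_def)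
   moreover have "real K * (A * (\<Delta> i + R)) * \<bar>snd (x i)\<bar> \<le> C1 * (A * (\<Delta> i + R)) * \<bar>snd (x i)\<bar>"
    using W L by (intro mult_right_mono) (simp_all add: C1_def)
   ultimately have "\<bar>?\<alpha> * real n * (?I i / real n * ln (?I i / real n) - ?D i * ln (?D i)) + (?I i - real n * ?D i) * snd (x i)\<bar>
    \<le> C1 * (A * (\<Delta> i + R)) + C1 * (A * (\<Delta> i + R)) * \<bar>snd (x i)\<bar>" using 1 2 by linarith
   then show ?thesis by (simp add: algebra_simps)
  qed
  let ?V = "\<Sum>i\<le>K. (\<Delta> i + R) * (1 + \<bar>snd (x i)\<bar>)"
  let ?G = "?\<alpha> * real n * (\<Sum>i\<le>K. ?I i / real n * ln (?I i / real n) - 1 * (?D i * ln (?D i))) + 1 * (\<Sum>i\<le>K. (?I i - real n * ?D i) * snd (x i))"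
  have V: "?V \<ge> 0" using \<Delta>0 R by (intro sum_nonneg mult_nonneg_nonneg) (auto intro: add_nonneg_nonneg)
  have "\<bar>?G\<bar> = \<bar>\<Sum>i\<le>K. ?\<alpha> * real n * (?I i / real n * ln (?I i / real n) - ?D i * ln (?D i)) + (?I i - real n * ?D i) * snd (x i)\<bar>"
   by (simp only: sum_distrib_left sum.distrib mult_1_left)
  also have "... \<le> (\<Sum>i\<le>K. \<bar>?\<alpha> * real n * (?I i / real n * ln (?I i / real n) - ?D i * ln (?D i)) + (?I i - real n * ?D i) * snd (x i)\<bar>)" by (rule sum_abs)
  also have "... \<le> (\<Sum>i\<le>K. C1 * A * ((\<Delta> i + R) * (1 + \<bar>snd (x i)\<bar>)))" by (intro sum_mono each) simp
  also have "... = C1 * A * ?V" by (rule sum_distrib_left[symmetric])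
  finally have G: "\<bar>?G\<bar> \<le> C1 * A * ?V" .
  have P: "\<bar>pcost K r s n q - 1 * real n * opt_cost K (spacing K (fst q))\<bar> \<le> T + B"
   using near[OF n q, of "snd q"] by (simp add: T)
  have "\<bar>resid 1 n q x\<bar> \<le> T + B + C1 * A * ?V + C * (A * R)"
   using exp[OF n sum, of x] P G unfolding AR by linarith
  also have "... \<le> E * A * (T + R) + E * A * ?V"
  proof -
   have "T \<le> A * T" using mult_right_mono[OF A T0] by simp
   moreover have "B \<le> B * (A * R)" using mult_left_mono[OF AR1 B] by simp
   moreover have "0 \<le> A * R" "0 \<le> A * ?V" "0 \<le> A * T" using A R V T0 by (simp_all add: mult_nonneg_nonneg)
   moreover have "E * A * (T + R) + E * A * ?V = A * T + (B + C + C1) * (A * T) + A * R + B * (A * R) + C * (A * R) + C1 * (A * R) + (1 + B + C) * (A * ?V) + C1 * (A * ?V)"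
    by (simp add: E_def algebra_simps)
   moreover have "0 \<le> (B + C + C1) * (A * T)" "0 \<le> C1 * (A * R)" "0 \<le> (1 + B + C) * (A * ?V)"
    using B C C1 \<open>0 \<le> A * R\<close> \<open>0 \<le> A * ?V\<close> \<open>0 \<le> A * T\<close> by (simp_all add: mult_nonneg_nonneg)
   moreover have "C1 * A * ?V = C1 * (A * ?V)" by simp
   ultimately show ?thesis by linarith
  qed
  finally show ?thesis unfolding A_def R_def by (simp add: distrib_left)
 qed
 show ?thesis using E main unfolding a_def by blast
qed

end

section \<open>Moments of the coupled difference and of the limit law\<close>

context limit_coupling
begin

text \<open>With the partitioning data fixed, every Z^(i) has law \<zeta> whatever the size, so the
  p-th moment of 1 + |Z^(i)| comes out as a constant. The remaining factors are deviations of order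
  sqrt n, and n^(\<tau>-1/2) sqrt n = n^\<tau>.\<close>

lemma resid_moment:
 assumes K4: "K \<in> {2, 3, 4}" and \<tau>: "1 / 2 < \<tau>" "\<tau> < 1" and p: "p \<ge> 1"
  and Z: "(\<integral>\<^sup>+z. ennreal (\<bar>z\<bar> ^ p) \<partial>\<zeta>) < \<infinity>"
 shows "\<exists>C\<ge>0. \<forall>n>K. resid_moment 1 p n
  \<le> ennreal (C * real n powr (\<tau> * real p))"
proof -
 let ?T = "\<lambda>n q. sdev n q"
 let ?\<Delta> = "\<lambda>n q i. \<bar>real (sz n q i) - real (n - K) * spacing K (fst q) i\<bar>"
 obtain C0 where C0: "C0 \<ge> 0" and pt: "\<And>n q x. n > K ==> generic_pivots K (fst q) ==> (\<Sum>i\<le>K. sz n q i) = n - K ==>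
  \<bar>resid 1 n q x\<bar> \<le> C0 * real n powr (\<tau> - 1 / 2) * ((?T n q + sqrt (real n)) + (\<Sum>i\<le>K. (?\<Delta> n q i + sqrt (real n)) * (1 + \<bar>snd (x i)\<bar>)))"
  using resid_pointwise[OF K4 \<tau>] by blast
 obtain Cs where Cs: "Cs \<ge> 0" and st: "\<And>n. (\<integral>\<^sup>+q. ennreal (?T n q ^ p) \<partial>partition_measure K n) \<le> ennreal (Cs * sqrt (real n) ^ p)"
  using steps_moment[OF p] by blast
 define Cz where "Cz = (2 * fact p * exp (1 / 8) :: real)"
 have Cz: "Cz \<ge> 0" by (simp add: Cz_def)
 interpret \<zeta>: prob_space \<zeta> by (rule prob_\<zeta>)
 have mid: "(\<lambda>z. z) \<in> borel_measurable \<zeta>" by (rule measurable_ident_sets[OF sets_\<zeta>])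
 obtain m where m: "m \<ge> 0" and mz: "(\<integral>\<^sup>+z. ennreal ((1 + \<bar>z\<bar>) ^ p) \<partial>\<zeta>) \<le> ennreal m"
 proof -
  obtain C' where C': "C' \<ge> 0" "(\<integral>\<^sup>+z. ennreal (\<bar>z\<bar> ^ p) \<partial>\<zeta>) = ennreal C'"
   using Z by (cases "\<integral>\<^sup>+z. ennreal (\<bar>z\<bar> ^ p) \<partial>\<zeta>") auto
  have "(\<integral>\<^sup>+z. ennreal ((\<bar>z\<bar> + 1) ^ p) \<partial>\<zeta>) \<le> ennreal (2 ^ p * (C' + 1) * 1 ^ p)"
   by (rule power_mean_shift[OF prob_\<zeta> _ _ _ C'(1), where f = "\<lambda>z. \<bar>z\<bar>" and s = 1])
    (intro borel_measurable_abs mid, simp, simp, simp only: C'(2) power_one mult_1_right order_refl)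
  then show ?thesis using C' by (intro that[of "2 ^ p * (C' + 1)"]) (simp_all add: add.commute)
 qed
 define F where "F = 2 ^ p * (2 ^ p * (Cs + 1) + real (K + 1) ^ p * m * (real (K + 1) * (2 ^ p * (Cz + 1))))"
 have F: "F \<ge> 0" using Cs Cz m by (simp add: F_def)
 have "resid_moment 1 p n
  \<le> ennreal (C0 ^ p * F * real n powr (\<tau> * real p))" if n: "n > K" for n
 proof -
  let ?Q = "partition_measure K n"
  have Qp: "prob_space ?Q" by (rule prob_space_partition_measure)
  define S where "S = sqrt (real n)"
  define E where "E = C0 * real n powr (\<tau> - 1 / 2)"
  have S: "S \<ge> 0" and E: "E \<ge> 0" using C0 by (simp_all add: S_def E_def)
  let ?U = "\<lambda>q. ennreal ((?T n q + S) ^ p)" and ?W = "\<lambda>q i. ennreal ((?\<Delta> n q i + S) ^ p)"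
  let ?k = "real (K + 1) ^ p"
  have mT: "?T n \<in> borel_measurable ?Q"
   by (intro borel_rules measurable_partition_steps measurable_opt_cost_part)
  have ms: "(\<lambda>q. real (sz n q i)) \<in> borel_measurable ?Q" for i
   by (rule measurable_compose[OF measurable_sublist_size_part]) simp
  have m\<Delta>: "(\<lambda>q. ?\<Delta> n q i) \<in> borel_measurable ?Q" for i
   by (intro borel_rules ms measurable_spacing_part)
  have mU: "?U \<in> borel_measurable ?Q"
   by (intro borel_rules mT)
  have mW: "(\<lambda>q. ?W q i) \<in> borel_measurable ?Q" for i
   by (intro borel_rules m\<Delta>)
  have inner: "(\<integral>\<^sup>+x. ennreal (\<bar>resid 1 n q x\<bar> ^ p) \<partial>(inputs n q))
    \<le> ennreal (E ^ p * 2 ^ p) * (?U q + ennreal (?k * m) * (\<Sum>i\<in>{..K}. ?W q i))"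
   if q: "generic_pivots K (fst q) \<and> (\<Sum>i\<le>K. sz n q i) = n - K" for q
  proof -
   let ?N = "inputs n q"
   interpret N: prob_space ?N by (rule prob_space_PiM) (rule prob_\<pi>)
   let ?Z = "\<lambda>x i. ennreal ((1 + \<bar>snd (x i)\<bar>) ^ p)"
   have mz1: "(\<lambda>y. ennreal ((1 + \<bar>snd y\<bar>) ^ p)) \<in> borel_measurable (\<pi> (sz n q i))" for i
    unfolding measurable_\<pi>
    by (intro borel_rules measurable_snd)
   have mZ: "(\<lambda>x. ?Z x i) \<in> borel_measurable ?N" if "i \<in> {..K}" for i
    by (rule measurable_PiM_coordinate[where \<nu> = "\<lambda>i. \<pi> (sz n q i)" and f = "\<lambda>y. ennreal ((1 + \<bar>snd y\<bar>) ^ p)", OF that mz1])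
   have Zle: "(\<integral>\<^sup>+x. ?Z x i \<partial>?N) \<le> ennreal m" if i: "i \<in> {..K}" for i
   proof -
    have "(\<integral>\<^sup>+x. ?Z x i \<partial>?N) = (\<integral>\<^sup>+y. ennreal ((1 + \<bar>snd y\<bar>) ^ p) \<partial>\<pi> (sz n q i))"
     by (rule nn_integral_PiM_component[where \<nu> = "\<lambda>i. \<pi> (sz n q i)" and f = "\<lambda>y. ennreal ((1 + \<bar>snd y\<bar>) ^ p)", OF prob_\<pi> i mz1])
    also have "... = (\<integral>\<^sup>+z. ennreal ((1 + \<bar>z\<bar>) ^ p) \<partial>\<zeta>)"
     by (rule nn_integral_snd_\<pi>[where f = "\<lambda>z. ennreal ((1 + \<bar>z\<bar>) ^ p)"])
      (intro borel_rules measurable_ident_sets refl)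
    finally show ?thesis using mz by simp
   qed
   have "(\<integral>\<^sup>+x. ennreal (\<bar>resid 1 n q x\<bar> ^ p) \<partial>?N)
     \<le> (\<integral>\<^sup>+x. ennreal (E ^ p * 2 ^ p) * (?U q + ennreal ?k * (\<Sum>i\<in>{..K}. ?W q i * ?Z x i)) \<partial>?N)"
   proof (rule nn_integral_mono)
    fix x :: "nat \<Rightarrow> real \<times> real"
    let ?v = "\<lambda>i. (?\<Delta> n q i + S) * (1 + \<bar>snd (x i)\<bar>)"
    have v: "?v i \<ge> 0" for i using S by (intro mult_nonneg_nonneg add_nonneg_nonneg) auto
    have "\<bar>resid 1 n q x\<bar> ^ p \<le> (E * ((?T n q + S) + (\<Sum>i\<in>{..K}. ?v i))) ^ p"
     using pt[OF n conjunct1[OF q] conjunct2[OF q], of x] unfolding E_def S_def by (rule power_mono) simp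
    also have "... = E ^ p * ((?T n q + S) + (\<Sum>i\<in>{..K}. ?v i)) ^ p" by (rule power_mult_distrib)
    also have "... \<le> E ^ p * (2 ^ p * ((?T n q + S) ^ p + ?k * (\<Sum>i\<in>{..K}. ?v i ^ p)))"
    proof (rule mult_left_mono)
     have "((?T n q + S) + (\<Sum>i\<in>{..K}. ?v i)) ^ p \<le> (1 + 1) ^ p * (?T n q + S) ^ p + (1 + 1 / 1) ^ p * (\<Sum>i\<in>{..K}. ?v i) ^ p"
      by (rule power_add_le) (use S v in \<open>auto intro!: sum_nonneg add_nonneg_nonneg\<close>)
     also have "... = 2 ^ p * ((?T n q + S) ^ p + (\<Sum>i\<in>{..K}. ?v i) ^ p)" by (simp add: distrib_left)
     also have "... \<le> 2 ^ p * ((?T n q + S) ^ p + ?k * (\<Sum>i\<in>{..K}. ?v i ^ p))"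
     proof (intro mult_left_mono add_left_mono)
      have "(\<Sum>i\<in>{..K}. ?v i) ^ p \<le> real (card {..K}) ^ p * (\<Sum>i\<in>{..K}. ?v i ^ p)" by (rule power_sum_le_card) (use v p in auto)
      then show "(\<Sum>i\<in>{..K}. ?v i) ^ p \<le> ?k * (\<Sum>i\<in>{..K}. ?v i ^ p)" by simp
     qed simp
     finally show "((?T n q + S) + (\<Sum>i\<in>{..K}. ?v i)) ^ p \<le> ..." .
    qed (use E in simp)
    finally have "ennreal (\<bar>resid 1 n q x\<bar> ^ p) \<le> ennreal (E ^ p * (2 ^ p * ((?T n q + S) ^ p + ?k * (\<Sum>i\<in>{..K}. ?v i ^ p))))" by (rule ennreal_leI)
    also have "... = ennreal (E ^ p * 2 ^ p) * (?U q + ennreal ?k * ennreal (\<Sum>i\<in>{..K}. ?v i ^ p))"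
    proof -
     have "0 \<le> (\<Sum>i\<in>{..K}. ?v i ^ p)" using v by (intro sum_nonneg zero_le_power)
     moreover have "0 \<le> (?T n q + S) ^ p" using S by (intro zero_le_power add_nonneg_nonneg) auto
     moreover have "0 \<le> E ^ p * 2 ^ p" "0 \<le> ?k" using E by simp_all
     ultimately show ?thesis by (simp only: mult.assoc[symmetric] ennreal_mult[where a = "E ^ p * 2 ^ p"] ennreal_mult[where a = ?k] ennreal_plus mult_nonneg_nonneg add_nonneg_nonneg)
    qed
    also have "ennreal (\<Sum>i\<in>{..K}. ?v i ^ p) = (\<Sum>i\<in>{..K}. ennreal (?v i ^ p))"
     by (rule sum_ennreal[symmetric]) (use v in \<open>intro zero_le_power\<close>)
    also have "... = (\<Sum>i\<in>{..K}. ?W q i * ?Z x i)"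
     by (rule sum.cong[OF refl], subst power_mult_distrib, rule ennreal_mult) (use S in \<open>auto intro!: zero_le_power add_nonneg_nonneg\<close>)
    finally show "ennreal (\<bar>resid 1 n q x\<bar> ^ p) \<le> ennreal (E ^ p * 2 ^ p) * (?U q + ennreal ?k * (\<Sum>i\<in>{..K}. ?W q i * ?Z x i))" .
   qed
   also have "... = ennreal (E ^ p * 2 ^ p) * (?U q + ennreal ?k * (\<Sum>i\<in>{..K}. ?W q i * (\<integral>\<^sup>+x. ?Z x i \<partial>?N)))"
   proof -
    have m1: "(\<lambda>x. \<Sum>i\<in>{..K}. ?W q i * ?Z x i) \<in> borel_measurable ?N"
     by (intro borel_rules mZ)
    have m2: "(\<lambda>x. ennreal ?k * (\<Sum>i\<in>{..K}. ?W q i * ?Z x i)) \<in> borel_measurable ?N"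
     by (intro borel_rules m1)
    have "(\<integral>\<^sup>+x. (\<Sum>i\<in>{..K}. ?W q i * ?Z x i) \<partial>?N) = (\<Sum>i\<in>{..K}. \<integral>\<^sup>+x. ?W q i * ?Z x i \<partial>?N)"
     by (rule nn_integral_sum) (intro borel_rules mZ)
    also have "... = (\<Sum>i\<in>{..K}. ?W q i * (\<integral>\<^sup>+x. ?Z x i \<partial>?N))"
     by (intro sum.cong refl nn_integral_cmult mZ)
    finally show ?thesis
     by (subst nn_integral_cmult, intro borel_measurable_add borel_measurable_const m2, subst nn_integral_add[OF borel_measurable_const m2])
      (simp only: N.nn_integral_prob_const nn_integral_cmult[OF m1])
   qed
   also have "... \<le> ennreal (E ^ p * 2 ^ p) * (?U q + ennreal ?k * (\<Sum>i\<in>{..K}. ?W q i * ennreal m))"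
    by (intro mult_left_mono add_left_mono sum_mono Zle) simp_all
   also have "ennreal ?k * (\<Sum>i\<in>{..K}. ?W q i * ennreal m) = ennreal (?k * m) * (\<Sum>i\<in>{..K}. ?W q i)"
   proof -
    have 1: "ennreal (?k * m) = ennreal ?k * ennreal m" using m by (intro ennreal_mult) simp_all
    have 2: "(\<Sum>i\<in>{..K}. ?W q i * ennreal m) = (\<Sum>i\<in>{..K}. ?W q i) * ennreal m" by (rule sum_distrib_right[symmetric])
    show ?thesis unfolding 1 2 by (simp only: mult_ac)
   qed
   finally show ?thesis .
  qed
  have "(\<integral>\<^sup>+q. (\<integral>\<^sup>+x. ennreal (\<bar>resid 1 n q x\<bar> ^ p) \<partial>(inputs n q)) \<partial>?Q)
    \<le> (\<integral>\<^sup>+q. ennreal (E ^ p * 2 ^ p) * (?U q + ennreal (?k * m) * (\<Sum>i\<in>{..K}. ?W q i)) \<partial>?Q)"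
   by (rule nn_integral_mono_AE, rule eventually_mono[OF AE_partition_regular]) (rule inner)
  also have "... = ennreal (E ^ p * 2 ^ p) * ((\<integral>\<^sup>+q. ?U q \<partial>?Q) + ennreal (?k * m) * (\<Sum>i\<in>{..K}. \<integral>\<^sup>+q. ?W q i \<partial>?Q))"
  proof -
   have m1: "(\<lambda>q. \<Sum>i\<in>{..K}. ?W q i) \<in> borel_measurable ?Q" by (intro borel_measurable_sum mW)
   have m2: "(\<lambda>q. ennreal (?k * m) * (\<Sum>i\<in>{..K}. ?W q i)) \<in> borel_measurable ?Q"
    by (intro borel_rules m1)
   show ?thesis
    by (subst nn_integral_cmult, intro borel_measurable_add mU m2, subst nn_integral_add[OF mU m2], subst nn_integral_cmult[OF m1], subst nn_integral_sum[OF mW]) (rule refl)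
  qed
  also have "... \<le> ennreal (E ^ p * 2 ^ p) * (ennreal (2 ^ p * (Cs + 1) * S ^ p) + ennreal (?k * m) * (\<Sum>i\<in>{..K}. ennreal (2 ^ p * (Cz + 1) * S ^ p)))"
  proof (intro mult_left_mono add_mono sum_mono)
   show "(\<integral>\<^sup>+q. ?U q \<partial>?Q) \<le> ennreal (2 ^ p * (Cs + 1) * S ^ p)"
    by (rule power_mean_shift[OF Qp mT _ S Cs]) (simp, simp only: S_def st)
   fix i assume i: "i \<in> {..K}"
   show "(\<integral>\<^sup>+q. ?W q i \<partial>?Q) \<le> ennreal (2 ^ p * (Cz + 1) * S ^ p)"
    by (rule power_mean_shift[OF Qp m\<Delta> _ S Cz]) (simp, simp only: S_def Cz_def, rule size_moment[OF p], use i in simp)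
  qed simp_all
  also have "... = ennreal (E ^ p * 2 ^ p * (2 ^ p * (Cs + 1) * S ^ p + ?k * m * (real (K + 1) * (2 ^ p * (Cz + 1) * S ^ p))))"
  proof -
   have nn: "0 \<le> E ^ p * 2 ^ p" "0 \<le> 2 ^ p * (Cs + 1) * S ^ p" "0 \<le> ?k * m" "0 \<le> 2 ^ p * (Cz + 1) * S ^ p" "0 \<le> real (K + 1)"
    using E Cs Cz S m by simp_all
   have "(\<Sum>i\<in>{..K}. ennreal (2 ^ p * (Cz + 1) * S ^ p)) = ennreal (real (K + 1) * (2 ^ p * (Cz + 1) * S ^ p))"
    using nn(4) by (simp only: sum_constant card_atMost Suc_eq_plus1 ennreal_mult nn(5) ennreal_of_nat_eq_real_of_nat)
   then show ?thesis using nn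
    by (simp only: ennreal_mult[OF nn(1)] ennreal_plus ennreal_mult[OF nn(3)] mult_nonneg_nonneg add_nonneg_nonneg)
  qed
  also have "E ^ p * 2 ^ p * (2 ^ p * (Cs + 1) * S ^ p + ?k * m * (real (K + 1) * (2 ^ p * (Cz + 1) * S ^ p))) = F * (E * S) ^ p"
   by (simp add: F_def power_mult_distrib algebra_simps)
  also have "F * (E * S) ^ p = C0 ^ p * F * real n powr (\<tau> * real p)"
  proof -
   have n1: "real n > 0" using n by simp
   have "E * S = C0 * (real n powr (\<tau> - 1 / 2) * real n powr (1 / 2))" using n1 by (simp add: E_def S_def powr_half_sqrt)
   also have "real n powr (\<tau> - 1 / 2) * real n powr (1 / 2) = real n powr \<tau>" by (simp flip: powr_add)
   finally have "(E * S) ^ p = C0 ^ p * (real n powr \<tau>) ^ p" by (simp add: power_mult_distrib)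
   also have "(real n powr \<tau>) ^ p = real n powr (\<tau> * real p)" using n1 by (simp add: powr_powr flip: powr_realpow)
   finally show ?thesis by simp
  qed
  finally show ?thesis .
 qed
 then show ?thesis using C0 F by (intro exI[of _ "C0 ^ p * F"]) auto
qed

text \<open>Here centering makes the sum over the sublists exactly additive, so no lower moments are
  needed. This is the start of the induction.\<close>

lemma dev_moment_two:
 assumes \<tau>: "\<tau> > 1 / 2"
  and toll: "\<exists>C\<ge>0. \<forall>n>K. resid_moment c 2 n
   \<le> ennreal (C * real n powr (\<tau> * real 2))"
 shows "\<exists>D\<ge>0. \<forall>n. dev_moment c 2 n \<le> ennreal (D * real n powr (\<tau> * real 2))"
proof -
 obtain C where C: "C \<ge> 0" and t: "\<And>n. n > K ==> resid_moment c 2 n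
   \<le> ennreal (C * real n powr (\<tau> * real 2))" using toll by blast
 show ?thesis
 proof (rule dev_moment_step[OF _ \<tau>])
  show "dev_moment c 2 n < \<infinity>" for n using dev_moment_finite[of c 2 n] \<zeta>_second_moment by simp
  show "(\<integral>\<^sup>+x. ennreal (\<bar>\<Sum>i\<le>K. dev c (sz n q i) (x i)\<bar> ^ 2) \<partial>(inputs n q))
   \<le> (\<Sum>i\<le>K. dev_moment c 2 (sz n q i)) + ennreal (0 * real n powr (\<tau> * real 2))" for n q
   by (simp only: dev_sum_second_moment) simp
 qed (use C t in auto)
qed

text \<open>In the step from p to p + 1 the mixed terms need the p-th moment from the induction
  hypothesis and the first moment, which is taken from the second.\<close>

lemma dev_moment_all:
 assumes \<tau>: "\<tau> > 1 / 2" and fin: "\<And>p n. p \<ge> 2 ==> dev_moment c p n < \<infinity>"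
  and toll: "\<And>p. p \<ge> 2 ==> \<exists>C\<ge>0. \<forall>n>K. resid_moment c p n
   \<le> ennreal (C * real n powr (\<tau> * real p))"
  and p: "p \<ge> 2"
 shows "\<exists>D\<ge>0. \<forall>n. dev_moment c p n \<le> ennreal (D * real n powr (\<tau> * real p))"
 using p
proof (induction p rule: nat_induct_at_least)
 case base
 show ?case by (rule dev_moment_two[OF \<tau> toll]) simp
next
 case (Suc p)
 obtain D2 where D2: "D2 \<ge> 0" "\<And>n. dev_moment c 2 n \<le> ennreal (D2 * real n powr (\<tau> * real 2))"
  using dev_moment_two[OF \<tau> toll] by auto
 then have D2': "\<And>n. dev_moment c 2 n \<le> ennreal (D2 * real n powr (2 * \<tau>))" by (simp add: mult.commute)
 obtain D1 where D1: "D1 \<ge> 0" "\<And>n. dev_moment c p n \<le> ennreal (D1 * real n powr (\<tau> * real p))"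
  using Suc.IH by blast
 have "Suc p \<ge> 2" using Suc by simp
 then obtain C where C: "C \<ge> 0" and t: "\<And>n. n > K ==> resid_moment c (Suc p) n
   \<le> ennreal (C * real n powr (\<tau> * real (Suc p)))" using toll by blast
 show ?case
 proof (rule dev_moment_step[OF \<open>Suc p \<ge> 2\<close> \<tau> fin[OF \<open>Suc p \<ge> 2\<close>]])
  fix n q assume n: "n > K"
  show "(\<integral>\<^sup>+x. ennreal (\<bar>\<Sum>i\<le>K. dev c (sz n q i) (x i)\<bar> ^ Suc p) \<partial>(inputs n q))
   \<le> (\<Sum>i\<le>K. dev_moment c (Suc p) (sz n q i))
    + ennreal (real (Suc p) * real (K + 1) ^ (Suc p - 1) * (real (K + 1) * real K * (D1 * (1 + D2))) * real n powr (\<tau> * real (Suc p)))"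
  proof (rule dev_sum_high_moment[OF \<open>Suc p \<ge> 2\<close>])
   show "dev_moment c (Suc p - 1) m \<le> ennreal (D1 * real m powr (\<tau> * real (Suc p - 1)))" for m using D1(2)[of m] by simp
  qed (use \<tau> D1 D2 D2' n less_imp_le[OF sz_less[OF n]] in auto)
 qed (use C t D1 D2 in auto)
qed

lemma dev_0_moment:
 assumes "K \<in> {2, 3, 4}" "p \<ge> 2"
 shows "\<exists>D\<ge>0. \<forall>n. dev_moment 0 p n \<le> ennreal (D * real n powr (1 * real p))"
 by (rule dev_moment_all) (use assms dev_moment_finite[of 0] resid_centred_moment in auto)

text \<open>Truncated moments of \<open>z\<close> are compared with those of the
 coupled \<open>y\<close> via \<open>\<bar>z\<bar>^p \<le> (2\<bar>y\<bar>)^p + 4 L^(p-2) (z - y)^2\<close> for \<open>\<bar>z\<bar> \<le> L\<close>.\<close>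

lemma truncated_power_le:
 fixes y z L :: real
 assumes z: "\<bar>z\<bar> \<le> L" and p: "p \<ge> 2"
 shows "\<bar>z\<bar> ^ p \<le> 2 ^ p * \<bar>y\<bar> ^ p + 4 * L ^ (p - 2) * \<bar>y - z\<bar> ^ 2"
proof (cases "\<bar>z\<bar> \<le> 2 * \<bar>y\<bar>")
 case True
 have "\<bar>z\<bar> ^ p \<le> (2 * \<bar>y\<bar>) ^ p" by (rule power_mono[OF True]) simp
 moreover have "0 \<le> 4 * L ^ (p - 2) * \<bar>y - z\<bar> ^ 2" using z by (intro mult_nonneg_nonneg zero_le_power) auto
 ultimately show ?thesis by (simp add: power_mult_distrib)
next
 case False
 moreover have "\<bar>z\<bar> - \<bar>y\<bar> \<le> \<bar>y - z\<bar>" using abs_triangle_ineq2[of z y] by (simp only: abs_minus_commute)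
 moreover have "u \<le> 2 * w" if "\<not> u \<le> 2 * v" "u - v \<le> w" for u v w :: real using that by linarith
 ultimately have "\<bar>z\<bar> \<le> 2 * \<bar>y - z\<bar>" by blast
 then have "\<bar>z\<bar> ^ 2 \<le> (2 * \<bar>y - z\<bar>) ^ 2" by (rule power_mono) simp
 moreover have "\<bar>z\<bar> ^ (p - 2) \<le> L ^ (p - 2)" by (rule power_mono[OF z]) simp
 ultimately have "\<bar>z\<bar> ^ (p - 2) * \<bar>z\<bar> ^ 2 \<le> L ^ (p - 2) * (2 * \<bar>y - z\<bar>) ^ 2" using z by (intro mult_mono) auto
 moreover have "\<bar>z\<bar> ^ (p - 2) * \<bar>z\<bar> ^ 2 = \<bar>z\<bar> ^ p" by (simp only: power_add[symmetric] le_add_diff_inverse2[OF p])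
 ultimately have "\<bar>z\<bar> ^ p \<le> L ^ (p - 2) * (2 * \<bar>y - z\<bar>) ^ 2" by (simp only:)
 also have "... = 4 * L ^ (p - 2) * \<bar>y - z\<bar> ^ 2" by (simp add: power_mult_distrib)
 finally have "\<bar>z\<bar> ^ p \<le> ..." .
 moreover have "0 \<le> 2 ^ p * \<bar>y\<bar> ^ p" by simp
 ultimately show ?thesis by linarith
qed

text \<open>The deviation with c = 0, divided by n, has p-th moments bounded uniformly in n, and the
  one with c = 1 tends to 0 in mean square after division by n. For a truncation level L, n is
  chosen so large that the mean square difference beats the factor 4 L^(p-2); the resulting bound
  2^p D + 1 is free of L, and monotone convergence removes the truncation.\<close>

lemma \<zeta>_moments:
 assumes K4: "K \<in> {2, 3, 4}" and p: "p \<ge> 2"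
 shows "(\<integral>\<^sup>+z. ennreal (\<bar>z\<bar> ^ p) \<partial>\<zeta>) < \<infinity>"
proof -
 obtain D where D: "D \<ge> 0" "\<And>n. dev_moment 0 p n \<le> ennreal (D * real n powr (1 * real p))" using dev_0_moment[OF K4 p] by blast
 obtain E where E: "E \<ge> 0" "\<And>n. dev_moment 1 2 n \<le> ennreal (E * real n powr (3 / 4 * real 2))"
 proof -
  have "\<exists>D\<ge>0. \<forall>n. dev_moment 1 2 n \<le> ennreal (D * real n powr (3 / 4 * real 2))"
   by (rule dev_moment_two, simp, rule resid_moment[OF K4]) (use \<zeta>_second_moment in auto)
  then show ?thesis using that by blast
 qed
 have mp: "(\<lambda>z. ennreal (\<bar>z\<bar> ^ p)) \<in> borel_measurable borel"
  by (intro borel_rules measurable_ident_sets refl)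
 define f where "f L z = ennreal (\<bar>z\<bar> ^ p) * indicator {z. \<bar>z\<bar> \<le> real L} z" for L :: nat and z :: real
 have S: "{z::real. \<bar>z\<bar> \<le> real L} \<in> sets borel" for L by simp
 have mf: "f L \<in> borel_measurable borel" for L
  unfolding f_def by (intro borel_measurable_times_ennreal mp borel_measurable_indicator S)
 have trunc: "(\<integral>\<^sup>+z. f L z \<partial>\<zeta>) \<le> ennreal (2 ^ p * D + 1)" for L
 proof -
  define k where "k = 4 * real L ^ (p - 2)"
  have k: "k \<ge> 0" by (simp add: k_def)
  \<comment> \<open>The mean square difference has order n^(3/2) / n^2; the n obtained from this
    limit depends on L through k.\<close>
  have "(\<lambda>n. (k * E) * real n powr (- 1 / 2)) \<longlonglongrightarrow> 0" by (rule tendsto_mult_right_zero) real_asymp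
  then have "eventually (\<lambda>n. (k * E) * real n powr (- 1 / 2) < 1) sequentially" by (rule order_tendstoD(2)) simp
  then have "eventually (\<lambda>n. (k * E) * real n powr (- 1 / 2) < 1 \<and> n \<ge> 1) sequentially"
   using eventually_ge_at_top[of 1] by (rule eventually_conj)
  then obtain n :: nat where n: "(k * E) * real n powr (- 1 / 2) < 1" "n \<ge> 1" by (auto simp: eventually_sequentially)
  have n0: "real n > 0" using n by simp
  let ?a = "2 ^ p / real n ^ p" and ?b = "k / real n ^ 2"
  have ab: "?a \<ge> 0" "?b \<ge> 0" using k by auto
  have "(\<integral>\<^sup>+z. f L z \<partial>\<zeta>) = (\<integral>\<^sup>+y. f L (snd y) \<partial>\<pi> n)" by (rule nn_integral_snd_\<pi>[OF mf, symmetric])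
  also have "... \<le> (\<integral>\<^sup>+y. ennreal ?a * ennreal (\<bar>dev 0 n y\<bar> ^ p) + ennreal ?b * ennreal (\<bar>dev 1 n y\<bar> ^ 2) \<partial>\<pi> n)"
  proof (rule nn_integral_mono)
   fix y :: "real \<times> real"
   let ?y = "(fst y - mean n) / real n"
   have d0: "\<bar>?y\<bar> ^ p = \<bar>dev 0 n y\<bar> ^ p / real n ^ p" using n0 by (simp add: dev_def power_divide)
   have d1: "\<bar>?y - snd y\<bar> ^ 2 = \<bar>dev 1 n y\<bar> ^ 2 / real n ^ 2"
   proof -
    have "?y - snd y = dev 1 n y / real n" using n0 by (simp add: dev_def field_simps)
    then show ?thesis by (simp add: power_divide)
   qed
   have nn: "0 \<le> ?a * \<bar>dev 0 n y\<bar> ^ p" "0 \<le> ?b * \<bar>dev 1 n y\<bar> ^ 2" by (rule mult_nonneg_nonneg[OF ab(1) zero_le_power[OF abs_ge_zero]], rule mult_nonneg_nonneg[OF ab(2) zero_le_power[OF abs_ge_zero]])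
   show "f L (snd y) \<le> ennreal ?a * ennreal (\<bar>dev 0 n y\<bar> ^ p) + ennreal ?b * ennreal (\<bar>dev 1 n y\<bar> ^ 2)"
   proof (cases "\<bar>snd y\<bar> \<le> real L")
    case True
    have "\<bar>snd y\<bar> ^ p \<le> 2 ^ p * \<bar>?y\<bar> ^ p + k * \<bar>?y - snd y\<bar> ^ 2" unfolding k_def by (rule truncated_power_le[OF True p])
    also have "... = ?a * \<bar>dev 0 n y\<bar> ^ p + ?b * \<bar>dev 1 n y\<bar> ^ 2" unfolding d0 d1 by simp
    finally have "ennreal (\<bar>snd y\<bar> ^ p) \<le> ennreal (?a * \<bar>dev 0 n y\<bar> ^ p + ?b * \<bar>dev 1 n y\<bar> ^ 2)" by (rule ennreal_leI)
    also have "... = ennreal ?a * ennreal (\<bar>dev 0 n y\<bar> ^ p) + ennreal ?b * ennreal (\<bar>dev 1 n y\<bar> ^ 2)"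
     using nn ab by (simp only: ennreal_plus ennreal_mult[OF ab(1)] ennreal_mult[OF ab(2)] zero_le_power abs_ge_zero)
    finally show ?thesis using True by (simp only: f_def indicator_simps mem_Collect_eq mult_1_right)
   qed (simp add: f_def)
  qed
  also have "... = ennreal ?a * dev_moment 0 p n + ennreal ?b * dev_moment 1 2 n"
   unfolding dev_moment_def
   by (subst nn_integral_add, intro borel_measurable_times_ennreal borel_measurable_const, simp only: measurable_\<pi> measurable_dev_power,
     intro borel_measurable_times_ennreal borel_measurable_const, simp only: measurable_\<pi> measurable_dev_power)
    (simp only: nn_integral_cmult measurable_\<pi> measurable_dev_power)
  also have "... \<le> ennreal ?a * ennreal (D * real n powr (1 * real p)) + ennreal ?b * ennreal (E * real n powr (3 / 4 * real 2))"
   by (intro add_mono mult_left_mono D(2) E(2)) simp_all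
  also have "... = ennreal (?a * (D * real n powr (1 * real p)) + ?b * (E * real n powr (3 / 4 * real 2)))"
   using D(1) E(1) ab by (simp only: ennreal_plus ennreal_mult[OF ab(1)] ennreal_mult[OF ab(2)] mult_nonneg_nonneg powr_ge_zero)
  also have "?a * (D * real n powr (1 * real p)) = 2 ^ p * D" using n0 by (simp add: powr_realpow)
  also have "?b * (E * real n powr (3 / 4 * real 2)) = (k * E) * real n powr (- 1 / 2)"
  proof -
   have "real n powr (3 / 4 * real 2) = real n powr (- 1 / 2) * real n powr 2" by (simp only: powr_add[symmetric]) simp
   also have "real n powr 2 = real n ^ 2" using n0 by simp
   finally show ?thesis using n0 by simp
  qed
  also have "ennreal (2 ^ p * D + (k * E) * real n powr (- 1 / 2)) \<le> ennreal (2 ^ p * D + 1)" using n(1) by (intro ennreal_leI) simp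
  finally show ?thesis .
 qed
 have "(\<lambda>L. \<integral>\<^sup>+z. f L z \<partial>\<zeta>) \<longlonglongrightarrow> (\<integral>\<^sup>+z. ennreal (\<bar>z\<bar> ^ p) \<partial>\<zeta>)"
 proof (rule nn_integral_LIMSEQ)
  show "incseq f"
  proof (rule incseq_SucI, rule le_funI)
   fix L z show "f L z \<le> f (Suc L) z" by (auto simp: f_def indicator_def)
  qed
  show "f L \<in> borel_measurable \<zeta>" for L using mf by (simp only: measurable_cong_sets[OF sets_\<zeta> refl])
  fix z :: real
  obtain L0 :: nat where "\<bar>z\<bar> \<le> real L0" using real_arch_simple by blast
  then have "f L z = ennreal (\<bar>z\<bar> ^ p)" if "L \<ge> L0" for L using that by (auto simp: f_def indicator_def)
  then show "(\<lambda>L. f L z) \<longlonglongrightarrow> ennreal (\<bar>z\<bar> ^ p)" by (intro tendsto_eventually eventually_sequentiallyI)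
 qed
 then have "(\<integral>\<^sup>+z. ennreal (\<bar>z\<bar> ^ p) \<partial>\<zeta>) \<le> ennreal (2 ^ p * D + 1)"
  by (rule LIMSEQ_le_const2) (use trunc in blast)
 then show ?thesis by (rule order.strict_trans1) simp
qed

lemma dev_1_moment:
 assumes K4: "K \<in> {2, 3, 4}" and \<tau>: "1 / 2 < \<tau>" "\<tau> < 1" and p: "p \<ge> 2"
 shows "\<exists>D\<ge>0. \<forall>n. dev_moment 1 p n \<le> ennreal (D * real n powr (\<tau> * real p))"
 by (rule dev_moment_all[OF \<tau>(1) dev_moment_finite resid_moment[OF K4 \<tau>] p]) (use \<zeta>_moments[OF K4] in auto)

end

text \<open>The function x ln x - x^2 / 2 is still convex on (0, 1], its second derivative being 1/x
  - 1; the subtracted square supplies the quadratic gain.\<close>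

lemma x_ln_x_strongly_convex:
 fixes a b t :: real
 assumes a: "0 < a" "a \<le> 1" and b: "0 < b" "b \<le> 1" and t: "0 < t" "t < 1"
 shows "((1 - t) * a + t * b) * ln ((1 - t) * a + t * b)
  \<le> (1 - t) * (a * ln a) + t * (b * ln b) - t * (1 - t) * (a - b)\<^sup>2 / 2"
proof -
 define \<phi> where "\<phi> x = x * ln x - x\<^sup>2 / 2" for x :: real
 have "convex_on {0<..1} \<phi>"
 proof (rule f''_ge0_imp_convex)
  show "convex {0<..1::real}" by simp
  fix x :: real assume x: "x \<in> {0<..1}"
  show "DERIV \<phi> x :> ln x + 1 - x" unfolding \<phi>_def using x by (auto intro!: derivative_eq_intros)
  show "DERIV (\<lambda>x. ln x + 1 - x) x :> 1 / x - 1" using x by (auto intro!: derivative_eq_intros)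
  show "0 \<le> 1 / x - 1" using x by simp
 qed
 then have "\<phi> ((1 - t) *\<^sub>R a + t *\<^sub>R b) \<le> (1 - t) * \<phi> a + t * \<phi> b"
  by (rule convex_onD) (use a b t in auto)
 then have "((1 - t) * a + t * b) * ln ((1 - t) * a + t * b)
   \<le> (1 - t) * \<phi> a + t * \<phi> b + ((1 - t) * a + t * b)\<^sup>2 / 2" by (simp add: \<phi>_def)
 also have "... = (1 - t) * (a * ln a) + t * (b * ln b) - ((1 - t) * a\<^sup>2 + t * b\<^sup>2 - ((1 - t) * a + t * b)\<^sup>2) / 2"
 proof -
  have "(1 - t) * (P - A / 2) + t * (Q - B / 2) + X / 2 = (1 - t) * P + t * Q - ((1 - t) * A + t * B - X) / 2" for P Q A B X :: real
   by (simp add: field_simps)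
  then show ?thesis unfolding \<phi>_def by blast
 qed
 also have "(1 - t) * a\<^sup>2 + t * b\<^sup>2 - ((1 - t) * a + t * b)\<^sup>2 = t * (1 - t) * (a - b)\<^sup>2"
  by (simp add: power2_eq_square algebra_simps)
 finally show ?thesis .
qed

section \<open>The limit law has a bounded density\<close>

text \<open>Two pivots vary and the others, the order of the pivots and the classification tree are fixed:
 \<open>w\<close> lists the pivots in increasing order.\<close>

locale pivot_slice =
 fixes K :: nat and \<sigma> :: "nat \<Rightarrow> nat" and y :: "nat \<Rightarrow> real" and \<beta> :: "nat \<Rightarrow> real" and \<alpha> :: real
 assumes \<alpha>: "\<alpha> > 0" and \<sigma>: "{1, 2} \<subseteq> \<sigma> ` {1..K}"
begin

text \<open>The first coordinate of u is pivot 2 and the second is pivot 1, in accordance with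
  \<open>nn_integral_two_pivots\<close>. The order prescribed by \<sigma> is respected exactly on
  \<open>S\<close>, where all increments are positive.\<close>

definition w :: "nat \<Rightarrow> real \<times> real \<Rightarrow> real" where
 "w j u = (if j = 0 then 0 else if j \<le> K then (y(2 := fst u, 1 := snd u)) (\<sigma> j) else 1)"

definition d :: "nat \<Rightarrow> real \<times> real \<Rightarrow> real" where "d i u = w (Suc i) u - w i u"

definition S :: "(real \<times> real) set" where "S = {u. \<forall>i\<le>K. 0 < d i u}"

definition G :: "real \<times> real \<Rightarrow> real" where
 "G u = (\<Sum>i\<le>K. d i u * \<beta> i) + \<alpha> * (\<Sum>i\<le>K. d i u * ln (d i u))"

lemma w_mix: "w j ((1 - t) *\<^sub>R u + t *\<^sub>R v) = (1 - t) * w j u + t * w j v"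
 by (simp add: w_def algebra_simps)

lemma d_mix: "d i ((1 - t) *\<^sub>R u + t *\<^sub>R v) = (1 - t) * d i u + t * d i v"
 unfolding d_def w_mix by (simp add: algebra_simps)

lemma w_eq_sum: "j \<le> Suc K ==> w j u = (\<Sum>i<j. d i u)"
 unfolding d_def by (subst sum_lessThan_telescope) (simp add: w_def)

lemma sum_d: "(\<Sum>i\<le>K. d i u) = 1"
 using w_eq_sum[of "Suc K" u] by (simp add: lessThan_Suc_atMost w_def)

lemma d_bounds: "u \<in> S ==> i \<le> K ==> 0 < d i u \<and> d i u \<le> 1"
proof -
 assume u: "u \<in> S" and i: "i \<le> K"
 have "d i u \<le> (\<Sum>i\<le>K. d i u)" by (rule member_le_sum) (use u i in \<open>auto simp: S_def intro: less_imp_le\<close>)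
 then show ?thesis using u i by (auto simp: S_def sum_d)
qed

lemma convex_S: "convex S"
 unfolding convex_alt
proof (intro ballI allI impI)
 fix u v and t :: real assume u: "u \<in> S" and v: "v \<in> S" and t: "0 \<le> t \<and> t \<le> 1"
 have "0 < (1 - t) * d i u + t * d i v" if "i \<le> K" for i
 proof (cases "t = 0")
  case False
  then have "0 < t * d i v" using v t that by (simp add: S_def)
  moreover have "0 \<le> (1 - t) * d i u" by (rule mult_nonneg_nonneg) (use u t that in \<open>auto simp: S_def intro: less_imp_le\<close>)
  ultimately show ?thesis by linarith
 qed (use u that in \<open>simp add: S_def\<close>)
 then show "(1 - t) *\<^sub>R u + t *\<^sub>R v \<in> S" by (simp add: S_def d_mix)
qed

text \<open>Each of the two free pivots is a partial sum of increments, so Cauchy-Schwarz bounds its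
  displacement. Thus strong convexity in the increments becomes strong convexity in the
  plane.\<close>

lemma norm_le_increments: "(norm (u - v))\<^sup>2 \<le> 2 * real (K + 1) * (\<Sum>i\<le>K. (d i u - d i v)\<^sup>2)"
proof -
 have inc: "(w j u - w j v)\<^sup>2 \<le> real (K + 1) * (\<Sum>i\<le>K. (d i u - d i v)\<^sup>2)" if "j \<le> Suc K" for j
 proof -
  have "(w j u - w j v)\<^sup>2 = (\<Sum>i<j. d i u - d i v)\<^sup>2" using that by (simp add: w_eq_sum sum_subtractf)
  also have "... \<le> real (card {..<j}) * (\<Sum>i<j. (d i u - d i v)\<^sup>2)"
   using sum_squared_le_sum_of_squares[of "\<lambda>i. d i u - d i v" "{..<j}"] by (simp add: mult.commute)
  also have "... \<le> real (K + 1) * (\<Sum>i\<le>K. (d i u - d i v)\<^sup>2)"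
   using that by (intro mult_mono sum_mono2) (auto intro: sum_nonneg)
  finally show ?thesis .
 qed
 obtain j1 j2 where j: "j1 \<in> {1..K}" "\<sigma> j1 = 1" "j2 \<in> {1..K}" "\<sigma> j2 = 2" using \<sigma> by force
 have "(norm (u - v))\<^sup>2 = (fst u - fst v)\<^sup>2 + (snd u - snd v)\<^sup>2" by (simp add: norm_prod_def)
 also have "... = (w j2 u - w j2 v)\<^sup>2 + (w j1 u - w j1 v)\<^sup>2" using j by (simp add: w_def)
 also have "... \<le> real (K + 1) * (\<Sum>i\<le>K. (d i u - d i v)\<^sup>2) + real (K + 1) * (\<Sum>i\<le>K. (d i u - d i v)\<^sup>2)"
  by (intro add_mono inc) (use j in auto)
 also have "... = 2 * real (K + 1) * (\<Sum>i\<le>K. (d i u - d i v)\<^sup>2)" by simp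
 finally show ?thesis .
qed

text \<open>The linear part is affine in u. The x ln x part gains \<alpha> / 2 times the squared
  increments, and dividing by the 2 (K+1) of \<open>norm_le_increments\<close> gives the
  constant.\<close>

lemma G_strongly_convex:
 assumes u: "u \<in> S" and v: "v \<in> S" and t: "0 < t" "t < 1"
 shows "G ((1 - t) *\<^sub>R u + t *\<^sub>R v) \<le> (1 - t) * G u + t * G v - \<alpha> / (4 * real (K + 1)) * t * (1 - t) * (norm (u - v))\<^sup>2"
proof -
 let ?m = "(1 - t) *\<^sub>R u + t *\<^sub>R v"
 let ?X = "\<Sum>i\<le>K. (d i u - d i v)\<^sup>2"
 have "(\<Sum>i\<le>K. d i ?m * ln (d i ?m))
  \<le> (\<Sum>i\<le>K. (1 - t) * (d i u * ln (d i u)) + t * (d i v * ln (d i v)) - t * (1 - t) / 2 * (d i u - d i v)\<^sup>2)"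
 proof (rule sum_mono)
  fix i assume "i \<in> {..K}"
  then show "d i ?m * ln (d i ?m)
   \<le> (1 - t) * (d i u * ln (d i u)) + t * (d i v * ln (d i v)) - t * (1 - t) / 2 * (d i u - d i v)\<^sup>2"
   using x_ln_x_strongly_convex[of "d i u" "d i v" t] d_bounds[OF u, of i] d_bounds[OF v, of i] t by (simp add: d_mix)
 qed
 also have "... = (1 - t) * (\<Sum>i\<le>K. d i u * ln (d i u)) + t * (\<Sum>i\<le>K. d i v * ln (d i v)) - t * (1 - t) / 2 * ?X"
  by (simp only: sum_subtractf sum.distrib sum_distrib_left)
 finally have "\<alpha> * (\<Sum>i\<le>K. d i ?m * ln (d i ?m))
  \<le> \<alpha> * ((1 - t) * (\<Sum>i\<le>K. d i u * ln (d i u)) + t * (\<Sum>i\<le>K. d i v * ln (d i v)) - t * (1 - t) / 2 * ?X)"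
  using \<alpha> by (intro mult_left_mono) auto
 moreover have "(\<Sum>i\<le>K. d i ?m * \<beta> i) = (1 - t) * (\<Sum>i\<le>K. d i u * \<beta> i) + t * (\<Sum>i\<le>K. d i v * \<beta> i)"
  by (simp only: d_mix distrib_right sum.distrib sum_distrib_left mult.assoc)
 ultimately have "G ?m \<le> (1 - t) * G u + t * G v - \<alpha> * (t * (1 - t) / 2 * ?X)"
  unfolding G_def by (simp add: algebra_simps)
 moreover have "\<alpha> / (4 * real (K + 1)) * t * (1 - t) * (norm (u - v))\<^sup>2 \<le> \<alpha> * (t * (1 - t) / 2 * ?X)"
 proof -
  have "\<alpha> / (4 * real (K + 1)) * t * (1 - t) * (norm (u - v))\<^sup>2 \<le> \<alpha> / (4 * real (K + 1)) * t * (1 - t) * (2 * real (K + 1) * ?X)"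
   using \<alpha> t by (intro mult_left_mono norm_le_increments) auto
  also have "... = \<alpha> * (t * (1 - t) / 2 * ?X)" by (simp add: field_simps)
  finally show ?thesis .
 qed
 ultimately show ?thesis by linarith
qed

lemma measurable_d: "d i \<in> borel_measurable borel"
proof -
 have m: "w j \<in> borel_measurable borel" for j
 proof (cases "j = 0 \<or> \<not> j \<le> K")
  case True
  then have "w j = (\<lambda>u. if j = 0 then 0 else 1)" by (auto simp: w_def fun_eq_iff)
  moreover have "(\<lambda>u. if j = 0 then 0 else 1 :: real) \<in> borel_measurable (borel :: (real \<times> real) measure)" by (rule borel_measurable_const)
  ultimately show ?thesis by (simp only:)
 next
  case False
  then have "w j = (if \<sigma> j = 1 then snd else if \<sigma> j = 2 then fst else (\<lambda>u. y (\<sigma> j)))" by (auto simp: w_def fun_eq_iff)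
  moreover have "(fst :: real \<times> real \<Rightarrow> real) \<in> borel_measurable borel" "(snd :: real \<times> real \<Rightarrow> real) \<in> borel_measurable borel"
   by (rule borel_measurable_continuous_onI, rule continuous_on_fst[OF continuous_on_id])
    (rule borel_measurable_continuous_onI, rule continuous_on_snd[OF continuous_on_id])
  moreover have "(\<lambda>u. y (\<sigma> j)) \<in> borel_measurable (borel :: (real \<times> real) measure)" by (rule borel_measurable_const)
  ultimately show ?thesis by (simp only: split: if_split) blast
 qed
 have "(\<lambda>u. w (Suc i) u - w i u) \<in> borel_measurable borel" by (rule borel_measurable_diff[OF m m])
 moreover have "d i = (\<lambda>u. w (Suc i) u - w i u)" by (rule ext) (rule d_def)
 ultimately show ?thesis by (simp only:)
qed

lemma measurable_G: "G \<in> borel_measurable borel"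
proof -
 have 1: "(\<lambda>u. \<Sum>i\<le>K. d i u * \<beta> i) \<in> borel_measurable borel"
  by (rule borel_measurable_sum, rule borel_measurable_times[OF measurable_d borel_measurable_const])
 have 2: "(\<lambda>u. \<Sum>i\<le>K. d i u * ln (d i u)) \<in> borel_measurable borel"
  by (rule borel_measurable_sum, rule borel_measurable_times[OF measurable_d borel_measurable_ln[OF measurable_d]])
 have "G = (\<lambda>u. (\<Sum>i\<le>K. d i u * \<beta> i) + \<alpha> * (\<Sum>i\<le>K. d i u * ln (d i u)))" by (rule ext) (rule G_def)
 then show ?thesis using borel_measurable_add[OF 1 borel_measurable_times[OF borel_measurable_const 2]] by (simp only:)
qed

lemma sets_S: "S \<in> sets borel"
proof -
 have "S = (\<Inter>i\<in>{..K}. d i -` {0<..} \<inter> space borel)" by (auto simp: S_def)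
 also have "... \<in> sets borel" by (intro sets.finite_INT measurable_sets[OF measurable_d]) auto
 finally show ?thesis .
qed

text \<open>The bound does not involve the linear coefficients \<beta>, which only enter the finite
  lower bound for G. This uniformity permits \<beta> to contain the random values Z^(i).\<close>

lemma level_area:
 assumes h: "h \<ge> 0"
 shows "{u \<in> S. x < G u \<and> G u \<le> x + h} \<in> sets borel"
  and "emeasure lborel {u \<in> S. x < G u \<and> G u \<le> x + h} \<le> ennreal (256 * real (K + 1) / \<alpha> * h)"
proof -
 have lev: "{u \<in> S. G u \<in> A} \<in> sets borel" if "A \<in> sets borel" for A
 proof -
  have "{u \<in> S. G u \<in> A} = S \<inter> (G -` A \<inter> space borel)" by auto
  then show ?thesis using sets.Int[OF sets_S measurable_sets[OF measurable_G that]] by (simp only:)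
 qed
 have "{u \<in> S. x < G u \<and> G u \<le> x + h} = {u \<in> S. G u \<in> {x<..x + h}}" by auto
 moreover have "{x<..x + h} \<in> sets borel" by simp
 ultimately show "{u \<in> S. x < G u \<and> G u \<le> x + h} \<in> sets borel" using lev[of "{x<..x + h}"] by (simp only:)
 have "emeasure lborel {u \<in> S. x < G u \<and> G u \<le> x + h} \<le> ennreal (64 / (\<alpha> / (4 * real (K + 1))) * h)"
 proof (rule strongly_convex_level_area[OF convex_S])
  show "{u \<in> S. G u \<le> z} \<in> sets borel" for z
  proof -
   have "{..z} \<in> sets borel" by simp
   from lev[OF this] show ?thesis by (simp only: atMost_iff)
  qed
  show "- (\<Sum>i\<le>K. \<bar>\<beta> i\<bar>) - \<alpha> * real (K + 1) \<le> G u" if u: "u \<in> S" for u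
  proof -
   have "- (\<Sum>i\<le>K. \<bar>\<beta> i\<bar>) \<le> (\<Sum>i\<le>K. d i u * \<beta> i)"
    unfolding sum_negf[symmetric]
   proof (rule sum_mono)
    fix i assume "i \<in> {..K}"
    then have "0 < d i u" "d i u \<le> 1" using d_bounds[OF u] by auto
    then have "\<bar>d i u * \<beta> i\<bar> \<le> 1 * \<bar>\<beta> i\<bar>" unfolding abs_mult by (intro mult_right_mono) auto
    then show "- \<bar>\<beta> i\<bar> \<le> d i u * \<beta> i" by linarith
   qed
   moreover have "(\<Sum>i\<le>K. - 1) \<le> (\<Sum>i\<le>K. d i u * ln (d i u))"
   proof (rule sum_mono)
    fix i assume "i \<in> {..K}"
    then show "- 1 \<le> d i u * ln (d i u)" using abs_x_ln_x_le_1[of "d i u"] d_bounds[OF u, of i] by (simp add: abs_le_iff)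
   qed
   then have "\<alpha> * (- real (K + 1)) \<le> \<alpha> * (\<Sum>i\<le>K. d i u * ln (d i u))" using \<alpha> by (intro mult_left_mono) auto
   ultimately show ?thesis unfolding G_def mult_minus_right by linarith
  qed
  show "0 < \<alpha> / (4 * real (K + 1))" using \<alpha> by simp
 qed (use h G_strongly_convex in auto)
 also have "64 / (\<alpha> / (4 * real (K + 1))) * h = 256 * real (K + 1) / \<alpha> * h" using \<alpha> by (simp add: field_simps)
 finally show "emeasure lborel {u \<in> S. x < G u \<and> G u \<le> x + h} \<le> ennreal (256 * real (K + 1) / \<alpha> * h)" .
qed

end

section \<open>From planar areas to the law of the pivots\<close>

lemma nn_integral_unif01_le:
 assumes f: "f \<in> borel_measurable borel"
 shows "(\<integral>\<^sup>+x. f x \<partial>unif01) \<le> (\<integral>\<^sup>+x. f x \<partial>lborel)"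
proof -
 have f': "f \<in> borel_measurable lborel" using f by (simp only: measurable_cong_sets[OF sets_lborel refl])
 have I: "{0..1::real} \<in> sets lborel" by simp
 have "(\<integral>\<^sup>+x. f x \<partial>unif01) = (\<integral>\<^sup>+x. f x * indicator {0..1} x \<partial>lborel) / emeasure lborel {0..1::real}"
  by (rule nn_integral_uniform_measure[OF f' I])
 also have "... = (\<integral>\<^sup>+x. f x * indicator {0..1} x \<partial>lborel)" by (simp add: divide_ennreal_def)
 also have "... \<le> (\<integral>\<^sup>+x. f x \<partial>lborel)" by (rule nn_integral_mono) (simp add: indicator_def)
 finally show ?thesis .
qed

lemma nn_integral_two_pivots:
 assumes K: "K \<ge> 2" and f: "f \<in> borel_measurable (pivot_measure K)"
 shows "(\<integral>\<^sup>+v. f v \<partial>pivot_measure K) = (\<integral>\<^sup>+y. (\<integral>\<^sup>+b. (\<integral>\<^sup>+a. f (y(2 := b, 1 := a)) \<partial>unif01) \<partial>unif01) \<partial>(\<Pi>\<^sub>M j\<in>{3..K}. unif01))"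
proof -
 interpret U: prob_space unif01 by (rule prob_space_unif01)
 interpret product_sigma_finite "\<lambda>_::nat. unif01" by (rule product_sigma_finite_prob) (rule prob_space_unif01)
 have I: "{1..K} = insert 1 (insert 2 {3..K})" using K by auto
 have f': "f \<in> borel_measurable (PiM (insert 1 (insert 2 {3..K})) (\<lambda>_. unif01))" using f unfolding I .
 have "(\<integral>\<^sup>+v. f v \<partial>pivot_measure K) = (\<integral>\<^sup>+v. f v \<partial>PiM (insert 1 (insert 2 {3..K})) (\<lambda>_. unif01))" unfolding I ..
 also have "... = (\<integral>\<^sup>+y. (\<integral>\<^sup>+a. f (y(1 := a)) \<partial>unif01) \<partial>PiM (insert 2 {3..K}) (\<lambda>_. unif01))"
  by (rule product_nn_integral_insert) (use f' in auto)
 also have "... = (\<integral>\<^sup>+y. (\<integral>\<^sup>+b. (\<integral>\<^sup>+a. f ((y(2 := b))(1 := a)) \<partial>unif01) \<partial>unif01) \<partial>PiM {3..K} (\<lambda>_. unif01))"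
 proof (rule product_nn_integral_insert)
  have "(\<lambda>z. f ((\<lambda>(g, y). g(1 := y)) z)) \<in> borel_measurable (PiM (insert 2 {3..K}) (\<lambda>_. unif01) \<Otimes>\<^sub>M unif01)"
   by (rule measurable_compose[OF measurable_add_dim f'])
  then have "case_prod (\<lambda>y a. f (y(1 := a))) \<in> borel_measurable (PiM (insert 2 {3..K}) (\<lambda>_. unif01) \<Otimes>\<^sub>M unif01)"
   by (simp add: case_prod_beta)
  then show "(\<lambda>y. \<integral>\<^sup>+a. f (y(1 := a)) \<partial>unif01) \<in> borel_measurable (PiM (insert 2 {3..K}) (\<lambda>_. unif01))"
   by (rule U.borel_measurable_nn_integral)
 qed auto
 finally show ?thesis .
qed

lemma nn_integral_indicator_square_le:
 assumes W: "W \<in> sets (borel :: (real \<times> real) measure)"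
 shows "(\<integral>\<^sup>+b. (\<integral>\<^sup>+a. indicator W (b, a) \<partial>unif01) \<partial>unif01) \<le> emeasure lborel W"
proof -
 have W': "W \<in> sets (lborel \<Otimes>\<^sub>M lborel)" using W by (simp only: lborel_prod sets_lborel)
 have ind: "indicator W \<in> borel_measurable (lborel \<Otimes>\<^sub>M lborel :: (real \<times> real) measure)"
  by (rule borel_measurable_indicator[OF W'])
 have sec: "(\<lambda>a. indicator W (b, a) :: ennreal) \<in> borel_measurable borel" for b :: real
 proof -
  have "b \<in> space lborel" by simp
  from measurable_compose[OF measurable_Pair1'[OF this] ind]
  show ?thesis by (simp only: measurable_cong_sets[OF sets_lborel refl])
 qed
 have "(\<integral>\<^sup>+b. (\<integral>\<^sup>+a. indicator W (b, a) \<partial>unif01) \<partial>unif01) \<le> (\<integral>\<^sup>+b. (\<integral>\<^sup>+a. indicator W (b, a) \<partial>lborel) \<partial>unif01)"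
  by (rule nn_integral_mono, rule nn_integral_unif01_le, rule sec)
 also have "... \<le> (\<integral>\<^sup>+b. (\<integral>\<^sup>+a. indicator W (b, a) \<partial>lborel) \<partial>lborel)"
 proof (rule nn_integral_unif01_le)
  from lborel.borel_measurable_nn_integral_fst[OF ind]
  show "(\<lambda>b. \<integral>\<^sup>+a. indicator W (b, a) \<partial>lborel) \<in> borel_measurable borel" by (simp only: measurable_cong_sets[OF sets_lborel refl])
 qed
 also have "... = emeasure (lborel \<Otimes>\<^sub>M lborel) W" by (rule lborel.emeasure_pair_measure[OF W', symmetric])
 finally show ?thesis by (simp only: lborel_prod)
qed

text \<open>Every leaf has depth at least 1, so l_opt(D) >= 1 almost surely and
  \<open>gamma_K\<close> is at least 1. Positivity makes the entropy part of the toll convex rather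
  than concave.\<close>

lemma alpha_pos: "K \<ge> 1 ==> alpha_K K > 0"
proof -
 assume K: "K \<ge> 1"
 interpret P: prob_space "pivot_measure K" by (rule prob_space_pivot_measure)
 have m: "(\<lambda>v. opt_cost K (spacing K v)) \<in> borel_measurable (pivot_measure K)" by (rule measurable_opt_cost) (rule pivot_spacing_measurable)
 have b: "AE v in pivot_measure K. 1 \<le> opt_cost K (spacing K v) \<and> opt_cost K (spacing K v) \<le> real K"
  by (rule eventually_mono[OF AE_generic_pivots]) (use opt_cost_spacing_bounds K in blast)
 have int: "integrable (pivot_measure K) (\<lambda>v. opt_cost K (spacing K v))"
  by (rule P.integrable_const_bound[of _ "real K"], rule eventually_mono[OF b]) (simp, rule m)
 have "(\<integral>v. 1 \<partial>pivot_measure K) \<le> gamma_K K" unfolding gamma_K_def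
  by (rule integral_mono_AE[OF P.integrable_const int], rule eventually_mono[OF b]) simp
 then have "gamma_K K \<ge> 1" by (simp only: lebesgue_integral_const P.prob_space scaleR_one)
 moreover have "harm (K + 1) > (1 :: real)"
 proof -
  have "harm 2 \<le> (harm (K + 1) :: real)" by (rule harm_mono) (use K in simp)
  then show ?thesis by (simp add: harm_expand)
 qed
 ultimately show ?thesis by (simp add: alpha_K_def)
qed

context limit_coupling
begin

definition order_w :: "(nat \<Rightarrow> nat) \<Rightarrow> (nat \<Rightarrow> real) \<Rightarrow> nat \<Rightarrow> real" where
 "order_w \<sigma> v j = (if j = 0 then 0 else if j \<le> K then v (\<sigma> j) else 1)"

definition order_d :: "(nat \<Rightarrow> nat) \<Rightarrow> (nat \<Rightarrow> real) \<Rightarrow> nat \<Rightarrow> real" where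
 "order_d \<sigma> v i = order_w \<sigma> v (Suc i) - order_w \<sigma> v i"

text \<open>The window event for one prescribed order of the pivots and one prescribed tree. The
  tree need not be optimal at v: this replaces the minimum over trees, which is not convex, by a
  finite union of convex problems.\<close>

definition order_set :: "real \<Rightarrow> real \<Rightarrow> (nat \<Rightarrow> real) \<Rightarrow> nat tree \<Rightarrow> (nat \<Rightarrow> nat) \<Rightarrow> (nat \<Rightarrow> real) set" where
 "order_set x h z t \<sigma> = {v. (\<forall>i\<le>K. 0 < order_d \<sigma> v i) \<and>
   (\<Sum>i\<le>K. order_d \<sigma> v i * (z i + real (leaf_depth t i))) + alpha_K K * (\<Sum>i\<le>K. order_d \<sigma> v i * ln (order_d \<sigma> v i)) \<in> {x<..x + h}}"

definition orders :: "(nat \<Rightarrow> nat) set" where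
 "orders = {\<sigma> \<in> {1..K} \<rightarrow>\<^sub>E {1..K}. \<sigma> ` {1..K} = {1..K}}"

lemma finite_orders: "finite orders"
 unfolding orders_def by (rule finite_subset[OF _ finite_PiE[of "{1..K}" "\<lambda>_. {1..K}"]]) auto

lemma measurable_order_d:
 assumes "\<sigma> \<in> orders"
 shows "(\<lambda>v. order_d \<sigma> v i) \<in> borel_measurable (pivot_measure K)"
proof -
 have m: "(\<lambda>v. order_w \<sigma> v j) \<in> borel_measurable (pivot_measure K)" for j
 proof (cases "j = 0 \<or> \<not> j \<le> K")
  case True
  then have "(\<lambda>v. order_w \<sigma> v j) = (\<lambda>v. if j = 0 then 0 else 1)" by (auto simp: order_w_def fun_eq_iff)
  then show ?thesis by (simp only: borel_measurable_const)
 next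
  case False
  then have j: "j \<in> {1..K}" by simp
  have "\<sigma> \<in> {1..K} \<rightarrow>\<^sub>E {1..K}" using assms unfolding orders_def by blast
  then have "\<sigma> j \<in> {1..K}" using j by (rule PiE_mem)
  then have "(\<lambda>v. v (\<sigma> j)) \<in> borel_measurable (pivot_measure K)" by (rule measurable_coord)
  moreover have "(\<lambda>v. order_w \<sigma> v j) = (\<lambda>v. v (\<sigma> j))" using False by (simp add: order_w_def)
  ultimately show ?thesis by (simp only:)
 qed
 show ?thesis unfolding order_d_def by (rule borel_measurable_diff[OF m m])
qed

lemma measurable_order_set:
 assumes \<sigma>: "\<sigma> \<in> orders"
 shows "indicator (order_set x h z t \<sigma>) \<in> borel_measurable (pivot_measure K)"
proof -
 let ?P = "pivot_measure K"
 have F: "(\<lambda>v. (\<Sum>i\<le>K. order_d \<sigma> v i * (z i + real (leaf_depth t i))) + alpha_K K * (\<Sum>i\<le>K. order_d \<sigma> v i * ln (order_d \<sigma> v i))) \<in> borel_measurable ?P"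
  (is "?F \<in> _")
 proof -
  note m = measurable_order_d[OF \<sigma>]
  have 1: "(\<lambda>v. \<Sum>i\<le>K. order_d \<sigma> v i * (z i + real (leaf_depth t i))) \<in> borel_measurable ?P"
   by (rule borel_measurable_sum, rule borel_measurable_times[OF m borel_measurable_const])
  have 2: "(\<lambda>v. \<Sum>i\<le>K. order_d \<sigma> v i * ln (order_d \<sigma> v i)) \<in> borel_measurable ?P"
   by (rule borel_measurable_sum, rule borel_measurable_times[OF m borel_measurable_ln[OF m]])
  show ?thesis by (rule borel_measurable_add[OF 1 borel_measurable_times[OF borel_measurable_const 2]])
 qed
 have "order_set x h z t \<sigma> \<inter> space ?P = (\<Inter>i\<in>{..K}. (\<lambda>v. order_d \<sigma> v i) -` {0<..} \<inter> space ?P) \<inter> (?F -` {x<..x + h} \<inter> space ?P)"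
  by (auto simp: order_set_def)
 also have "... \<in> sets ?P"
  by (intro sets.Int sets.finite_INT measurable_sets[OF measurable_order_d[OF \<sigma>]] measurable_sets[OF F]) auto
 finally have "order_set x h z t \<sigma> \<inter> space ?P \<in> sets ?P" .
 then have "indicator (order_set x h z t \<sigma> \<inter> space ?P) \<in> borel_measurable ?P" by simp
 then show ?thesis by (rule measurable_cong[THEN iffD1, rotated]) (simp add: indicator_def)
qed

text \<open>With all pivots but the first two fixed, the event is a level window of the function G
  on the slice, and the uniform density is at most 1.\<close>

lemma order_set_mass:
 assumes K2: "K \<ge> 2" and \<sigma>: "\<sigma> \<in> orders" and h: "h \<ge> 0"
 shows "(\<integral>\<^sup>+v. indicator (order_set x h z t \<sigma>) v \<partial>pivot_measure K) \<le> ennreal (256 * real (K + 1) / alpha_K K * h)"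
proof -
 let ?O = "\<lambda>y. \<integral>\<^sup>+b. (\<integral>\<^sup>+a. indicator (order_set x h z t \<sigma>) (y(2 := b, 1 := a)) \<partial>unif01) \<partial>unif01"
 let ?B = "ennreal (256 * real (K + 1) / alpha_K K * h)"
 have "(\<integral>\<^sup>+v. indicator (order_set x h z t \<sigma>) v \<partial>pivot_measure K)
  = (\<integral>\<^sup>+y. ?O y \<partial>(\<Pi>\<^sub>M j\<in>{3..K}. unif01))"
  by (rule nn_integral_two_pivots[where f = "indicator (order_set x h z t \<sigma>)", OF K2 measurable_order_set[OF \<sigma>]])
 also have "... \<le> (\<integral>\<^sup>+y. ?B \<partial>(\<Pi>\<^sub>M j\<in>{3..K}. unif01))"
 proof (rule nn_integral_mono)
  fix y :: "nat \<Rightarrow> real"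
  interpret P: pivot_slice K \<sigma> y "\<lambda>i. z i + real (leaf_depth t i)" "alpha_K K"
   by unfold_locales (use alpha_pos[OF K] \<sigma> K2 in \<open>auto simp: orders_def\<close>)
  have w: "order_w \<sigma> (y(2 := b, 1 := a)) j = P.w j (b, a)" for a b j by (simp only: order_w_def P.w_def fst_conv snd_conv)
  have "indicator (order_set x h z t \<sigma>) (y(2 := b, 1 := a)) = (indicator {u \<in> P.S. x < P.G u \<and> P.G u \<le> x + h} (b, a) :: ennreal)" for a b
  proof -
   have "(y(2 := b, 1 := a) \<in> order_set x h z t \<sigma>) = ((b, a) \<in> {u \<in> P.S. x < P.G u \<and> P.G u \<le> x + h})"
    by (simp only: order_set_def P.S_def P.G_def P.d_def order_d_def w mem_Collect_eq greaterThanAtMost_iff)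
   then show ?thesis by (simp only: indicator_def)
  qed
  then have "?O y
    = (\<integral>\<^sup>+b. (\<integral>\<^sup>+a. indicator {u \<in> P.S. x < P.G u \<and> P.G u \<le> x + h} (b, a) \<partial>unif01) \<partial>unif01)" by (simp only:)
  also have "... \<le> emeasure lborel {u \<in> P.S. x < P.G u \<and> P.G u \<le> x + h}"
   by (rule nn_integral_indicator_square_le[OF P.level_area(1)[OF h]])
  also have "... \<le> ?B" by (rule P.level_area(2)[OF h])
  finally show "?O y \<le> ?B" .
 qed
 also have "... = ?B"
 proof -
  interpret Y: prob_space "\<Pi>\<^sub>M j\<in>{3..K}. unif01" by (rule prob_space_PiM) (rule prob_space_unif01)
  show ?thesis by (simp only: Y.nn_integral_prob_const)
 qed
 finally show ?thesis .
qed

text \<open>The sorting permutation and a tree attaining the minimum witness the event. The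
  permutation is restricted to {1..K} so that it lies in the finite set
  \<open>orders\<close>.\<close>

lemma limit_map_in_order_set:
 assumes v: "generic_pivots K v" and x: "(\<Sum>i\<le>K. spacing K v i * z i) + limit_toll K v \<in> {x<..x + h}"
 shows "\<exists>t\<in>class_trees K. \<exists>\<sigma>\<in>orders. v \<in> order_set x h z t \<sigma>"
proof -
 obtain \<sigma> where \<sigma>: "bij_betw \<sigma> {1..K} {1..K}" "strict_mono_on {1..K} (v \<circ> \<sigma>)"
  "\<And>j. j \<in> {1..K} ==> pivot K v j = v (\<sigma> j)" by (rule pivot_order[OF v]) blast
 define \<rho> where "\<rho> = restrict \<sigma> {1..K}"
 have \<rho>: "\<rho> \<in> orders" 
 proof -
  have "\<sigma> ` {1..K} = {1..K}" by (rule bij_betw_imp_surj_on[OF \<sigma>(1)])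
  moreover have "restrict \<sigma> {1..K} \<in> {1..K} \<rightarrow>\<^sub>E {1..K}" unfolding restrict_PiE_iff using calculation by blast
  ultimately show ?thesis unfolding orders_def \<rho>_def by (simp only: mem_Collect_eq image_restrict_eq)
 qed
 have w: "order_w \<rho> v j = pivot K v j" if "j \<le> Suc K" for j
 proof -
  consider "j = 0" | "j \<in> {1..K}" | "j = Suc K" using \<open>j \<le> Suc K\<close> by force
  then show ?thesis by cases (simp_all add: order_w_def \<rho>_def \<sigma>(3))
 qed
 have d: "order_d \<rho> v i = spacing K v i" if "i \<le> K" for i using that by (simp add: order_d_def spacing_def w)
 obtain t where t: "t \<in> class_trees K" "opt_cost K (spacing K v) = tree_cost K t (spacing K v)" by (rule opt_cost_attained)
 have "(\<Sum>i\<le>K. order_d \<rho> v i * (z i + real (leaf_depth t i))) + alpha_K K * (\<Sum>i\<le>K. order_d \<rho> v i * ln (order_d \<rho> v i))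
   = (\<Sum>i\<le>K. spacing K v i * z i) + limit_toll K v"
  by (simp add: d limit_toll_def t(2) tree_cost_def distrib_left sum.distrib sum_distrib_left mult.assoc)
 then have "v \<in> order_set x h z t \<rho>" using x spacing_pos[OF v] by (simp add: order_set_def d)
 then show ?thesis using t(1) \<rho> by blast
qed

text \<open>The fixed point is integrated over the pivots with the values Z^(i) = z_i held fixed.
  These change the toll only by a function linear in the spacings, so the bound from
  \<open>order_set_mass\<close> is uniform in z. The constant counts the trees and the
  orders.\<close>

lemma \<zeta>_interval_mass:
 assumes K2: "K \<ge> 2"
 shows "\<exists>C\<ge>0. \<forall>x h. h \<ge> 0 \<longrightarrow> emeasure \<zeta> {x<..x + h} \<le> ennreal (C * h)"
proof -
 define C where "C = real (card (class_trees K)) * (real (card orders) * (256 * real (K + 1) / alpha_K K))"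
 have C: "C \<ge> 0" using alpha_pos[OF K] by (simp add: C_def)
 have "emeasure \<zeta> {x<..x + h} \<le> ennreal (C * h)" if h: "h \<ge> 0" for x h
 proof -
  let ?Z = "\<Pi>\<^sub>M i\<in>{..K}. \<zeta>" and ?P = "pivot_measure K"
  let ?g = "\<lambda>v z. (\<Sum>i\<le>K. spacing K v i * z i) + limit_toll K v"
  interpret P: prob_space ?P by (rule prob_space_pivot_measure)
  interpret Z: prob_space ?Z by (rule prob_space_PiM) (rule prob_\<zeta>)
  interpret PZ: pair_sigma_finite ?P ?Z ..
  have co: "(\<lambda>z. z i) \<in> borel_measurable ?Z" if "i \<in> {..K}" for i
   using measurable_component_singleton[OF that, of "\<lambda>_. \<zeta>"] measurable_cong_sets[OF refl sets_\<zeta>] by auto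
  have g: "(\<lambda>y. ?g (fst y) (snd y)) \<in> borel_measurable (?P \<Otimes>\<^sub>M ?Z)"
   by (intro borel_rules measurable_compose[OF measurable_fst pivot_spacing_measurable] measurable_compose[OF measurable_snd co] measurable_compose[OF measurable_fst measurable_limit_toll]) simp_all
  have ind: "(\<lambda>y. indicator {x<..x + h} (?g (fst y) (snd y)) :: ennreal) \<in> borel_measurable (?P \<Otimes>\<^sub>M ?Z)"
   by (rule measurable_compose[OF g]) simp
  have "emeasure \<zeta> {x<..x + h} = (\<integral>\<^sup>+x'. indicator {x<..x + h} x' \<partial>\<zeta>)" by (simp add: sets_\<zeta>)
  also have "... = (\<integral>\<^sup>+v. (\<integral>\<^sup>+z. indicator {x<..x + h} (?g v z) \<partial>?Z) \<partial>?P)" by (rule \<zeta>_fixed_point(1)) simp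
  also have "... = (\<integral>\<^sup>+z. (\<integral>\<^sup>+v. indicator {x<..x + h} (?g v z) \<partial>?P) \<partial>?Z)"
   using PZ.Fubini[OF ind] by (simp only: fst_conv snd_conv)
  also have "... \<le> (\<integral>\<^sup>+z. ennreal (C * h) \<partial>?Z)"
  proof (rule nn_integral_mono)
   fix z :: "nat \<Rightarrow> real"
   let ?i = "\<lambda>t \<sigma> v. indicator (order_set x h z t \<sigma>) v :: ennreal"
   have "(\<integral>\<^sup>+v. indicator {x<..x + h} (?g v z) \<partial>?P) \<le> (\<integral>\<^sup>+v. (\<Sum>t\<in>class_trees K. \<Sum>\<sigma>\<in>orders. ?i t \<sigma> v) \<partial>?P)"
   proof (rule nn_integral_mono_AE, rule eventually_mono[OF AE_generic_pivots])
    fix v assume v: "generic_pivots K v"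
    show "indicator {x<..x + h} (?g v z) \<le> (\<Sum>t\<in>class_trees K. \<Sum>\<sigma>\<in>orders. ?i t \<sigma> v)"
    proof (cases "?g v z \<in> {x<..x + h}")
     case True
     obtain t \<sigma> where t: "t \<in> class_trees K" and \<sigma>: "\<sigma> \<in> orders" and m: "v \<in> order_set x h z t \<sigma>"
      using limit_map_in_order_set[OF v True] by blast
     have "(1::ennreal) = ?i t \<sigma> v" using m by simp
     also have "... \<le> (\<Sum>\<sigma>\<in>orders. ?i t \<sigma> v)" by (rule member_le_sum[OF \<sigma> _ finite_orders]) simp
     also have "... \<le> (\<Sum>t\<in>class_trees K. \<Sum>\<sigma>\<in>orders. ?i t \<sigma> v)"
      by (rule member_le_sum[OF t _ finite_class_trees]) simp
     finally show ?thesis using True by simp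
    qed simp
   qed
   also have "... = (\<Sum>t\<in>class_trees K. \<Sum>\<sigma>\<in>orders. \<integral>\<^sup>+v. ?i t \<sigma> v \<partial>?P)"
    by (subst nn_integral_sum, intro borel_measurable_sum measurable_order_set, assumption)
     (intro sum.cong refl nn_integral_sum measurable_order_set)
   also have "... \<le> (\<Sum>t\<in>class_trees K. \<Sum>\<sigma>\<in>orders. ennreal (256 * real (K + 1) / alpha_K K * h))"
    by (intro sum_mono order_set_mass[OF K2 _ h])
   also have "... = ennreal (C * h)"
    using alpha_pos[OF K] h by (simp add: C_def ennreal_of_nat_eq_real_of_nat ennreal_mult[symmetric] mult.assoc)
   finally show "(\<integral>\<^sup>+v. indicator {x<..x + h} (?g v z) \<partial>?P) \<le> ..." .
  qed
  also have "... = ennreal (C * h)" by (simp only: Z.nn_integral_prob_const)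
  finally show ?thesis .
 qed
 with C show ?thesis by blast
qed

end

section \<open>Rates of convergence\<close>

context limit_coupling
begin

definition scaled_law :: "nat \<Rightarrow> real measure" where
 "scaled_law n = distr (\<mu> n) borel (\<lambda>x. (x - mean n) / real n)"

definition scaled_coupling :: "nat \<Rightarrow> (real \<times> real) measure" where
 "scaled_coupling n = distr (\<pi> n) pair_borel (\<lambda>y. ((fst y - mean n) / real n, snd y))"

lemma measurable_scale: "(\<lambda>x. (x - mean n) / real n) \<in> borel_measurable borel"
 by (intro borel_rules borel_measurable_divide measurable_ident_sets refl)

lemma measurable_scale_pair: "(\<lambda>y. ((fst y - mean n) / real n, snd y)) \<in> measurable (\<pi> n) pair_borel"
 unfolding measurable_\<pi>
 by (rule measurable_Pair[OF measurable_compose[OF measurable_fst measurable_scale] measurable_snd])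

lemma scaled_coupling: "scaled_coupling n \<in> couplings (scaled_law n) \<zeta>"
proof -
 interpret P: prob_space "\<pi> n" by (rule prob_\<pi>)
 have f: "fst \<in> measurable (\<pi> n) borel" by (simp only: measurable_\<pi> measurable_fst)
 have f': "fst \<in> measurable (\<pi> n) (\<mu> n)" using f by (simp only: measurable_cong_sets[OF refl sets_\<mu>])
 have "distr (scaled_coupling n) borel fst = distr (\<pi> n) borel (fst \<circ> (\<lambda>y. ((fst y - mean n) / real n, snd y)))"
  unfolding scaled_coupling_def by (rule distr_distr[OF measurable_fst measurable_scale_pair])
 also have "... = distr (\<pi> n) borel ((\<lambda>x. (x - mean n) / real n) \<circ> fst)" by (simp add: comp_def)
 also have "... = distr (distr (\<pi> n) borel fst) borel (\<lambda>x. (x - mean n) / real n)"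
  by (rule distr_distr[OF measurable_scale f, symmetric])
 also have "... = scaled_law n" by (simp only: fst_\<pi> scaled_law_def)
 finally have 1: "distr (scaled_coupling n) borel fst = scaled_law n" .
 have "distr (scaled_coupling n) borel snd = distr (\<pi> n) borel (snd \<circ> (\<lambda>y. ((fst y - mean n) / real n, snd y)))"
  unfolding scaled_coupling_def by (rule distr_distr[OF measurable_snd measurable_scale_pair])
 also have "... = distr (\<pi> n) borel snd" by (simp add: comp_def)
 also have "... = \<zeta>" by (rule snd_\<pi>)
 finally have 2: "distr (scaled_coupling n) borel snd = \<zeta>" .
 have 3: "prob_space (scaled_coupling n)" unfolding scaled_coupling_def by (rule P.prob_space_distr[OF measurable_scale_pair])
 have 4: "sets (scaled_coupling n) = sets pair_borel" unfolding scaled_coupling_def by (rule sets_distr)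
 show ?thesis unfolding couplings_def using 1 2 3 4 by blast
qed

text \<open>Passes from an integer moment q to a real exponent p <= q at a prescribed scale l, by
  (u/l)^p <= 1 + (u/l)^q.\<close>

lemma powr_le_power:
 fixes u l p :: real
 assumes u: "u \<ge> 0" and l: "l > 0" and q: "p \<le> real q" and p: "p \<ge> 0"
 shows "u powr p \<le> l powr p * (1 + (u / l) ^ q)"
proof -
 have "(u / l) powr p \<le> 1 + (u / l) ^ q"
 proof (cases "u / l \<le> 1")
  case True
  have "(u / l) powr p \<le> 1 powr p" by (rule powr_mono2) (use True u l p in auto)
  moreover have "0 \<le> (u / l) ^ q" using u l by simp
  ultimately show ?thesis by simp
 next
  case False
  then have "(u / l) powr p \<le> (u / l) powr real q" using q by (intro powr_mono) auto
  also have "... = (u / l) ^ q" using False by (intro powr_realpow) simp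
  finally show ?thesis by simp
 qed
 then have "l powr p * (u / l) powr p \<le> l powr p * (1 + (u / l) ^ q)" by (rule mult_left_mono) simp
 moreover have "l powr p * (u / l) powr p = u powr p" using u l by (simp add: powr_divide)
 ultimately show ?thesis by simp
qed

text \<open>The coupling bounds the infimum. At the scale l = n^(\<tau>-1) the q-th moment of the
  difference is at most D l^q, which gives a p-th moment of at most (1 + D) l^p.\<close>

lemma lp_rate:
 assumes K4: "K \<in> {2, 3, 4}" and \<tau>: "1 / 2 < \<tau>" "\<tau> < 1" and p: "p \<ge> 1"
 shows "\<exists>C. \<forall>n\<ge>1. lp_dist p (scaled_law n) \<zeta> \<le> ennreal (C * real n powr (\<tau> - 1))"
proof -
 define q where "q = max 2 (nat \<lceil>p\<rceil>)"
 have q: "q \<ge> 2" "p \<le> real q" unfolding q_def by linarith+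
 obtain D where D: "D \<ge> 0" "\<And>n. dev_moment 1 q n \<le> ennreal (D * real n powr (\<tau> * real q))"
  using dev_1_moment[OF K4 \<tau> q(1)] by blast
 have "lp_dist p (scaled_law n) \<zeta> \<le> ennreal ((1 + D) powr (1 / p) * real n powr (\<tau> - 1))" if n: "n \<ge> 1" for n
 proof -
  interpret P: prob_space "\<pi> n" by (rule prob_\<pi>)
  define l where "l = real n powr (\<tau> - 1)"
  have n0: "real n > 0" using n by simp
  have l: "l > 0" using n0 by (simp add: l_def)
  have nl: "(real n * l) ^ q = real n powr (\<tau> * real q)"
  proof -
   have "real n * l = real n powr 1 * real n powr (\<tau> - 1)" using n0 by (simp add: l_def)
   also have "... = real n powr \<tau>" by (simp only: powr_add[symmetric]) simp
   finally show ?thesis using n0 by (simp add: powr_powr flip: powr_realpow)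
  qed
  define J where "J = (\<integral>\<^sup>+z. ennreal (\<bar>case z of (x, y) \<Rightarrow> x - y\<bar> powr p) \<partial>scaled_coupling n)"
  have mi: "(\<lambda>z. ennreal (\<bar>case z of (x, y) \<Rightarrow> x - y\<bar> powr p)) \<in> borel_measurable pair_borel"
   unfolding case_prod_beta
   by (intro borel_rules powr_real_measurable measurable_fst measurable_snd)
  have "J = (\<integral>\<^sup>+y. ennreal (\<bar>(fst y - mean n) / real n - snd y\<bar> powr p) \<partial>\<pi> n)"
   unfolding J_def scaled_coupling_def
   by (subst nn_integral_distr[OF measurable_scale_pair]) (simp_all only: mi measurable_distr_eq1 case_prod_conv)
  also have "... \<le> (\<integral>\<^sup>+y. ennreal (l powr p) * (1 + ennreal (1 / (real n * l) ^ q) * ennreal (\<bar>dev 1 n y\<bar> ^ q)) \<partial>\<pi> n)"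
  proof (rule nn_integral_mono)
   fix y :: "real \<times> real"
   have eq: "(fst y - mean n) / real n - snd y = dev 1 n y / real n" using n0 by (simp add: dev_def field_simps)
   have "\<bar>(fst y - mean n) / real n - snd y\<bar> powr p \<le> l powr p * (1 + (\<bar>(fst y - mean n) / real n - snd y\<bar> / l) ^ q)"
    by (rule powr_le_power) (use l q p in auto)
   also have "(\<bar>(fst y - mean n) / real n - snd y\<bar> / l) ^ q = 1 / (real n * l) ^ q * \<bar>dev 1 n y\<bar> ^ q"
    unfolding eq using n0 l by (simp add: abs_divide power_divide power_mult_distrib)
   finally have "ennreal (\<bar>(fst y - mean n) / real n - snd y\<bar> powr p) \<le> ennreal (l powr p * (1 + 1 / (real n * l) ^ q * \<bar>dev 1 n y\<bar> ^ q))"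
    by (rule ennreal_leI)
   also have "... = ennreal (l powr p) * (1 + ennreal (1 / (real n * l) ^ q) * ennreal (\<bar>dev 1 n y\<bar> ^ q))"
   proof -
    have "0 \<le> 1 / (real n * l) ^ q" "0 \<le> \<bar>dev 1 n y\<bar> ^ q" using n0 l by simp_all
    then show ?thesis by (simp only: ennreal_mult ennreal_plus mult_nonneg_nonneg powr_ge_zero add_nonneg_nonneg zero_le_one ennreal_1)
   qed
   finally show "ennreal (\<bar>(fst y - mean n) / real n - snd y\<bar> powr p) \<le> ..." .
  qed
  also have "... = ennreal (l powr p) * (1 + ennreal (1 / (real n * l) ^ q) * dev_moment 1 q n)"
  proof -
   have m1: "(\<lambda>y. ennreal (\<bar>dev 1 n y\<bar> ^ q)) \<in> borel_measurable (\<pi> n)" by (simp only: measurable_\<pi> measurable_dev_power)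
   have m2: "(\<lambda>y. ennreal (1 / (real n * l) ^ q) * ennreal (\<bar>dev 1 n y\<bar> ^ q)) \<in> borel_measurable (\<pi> n)"
    by (intro borel_rules m1)
   show ?thesis unfolding dev_moment_def
    by (subst nn_integral_cmult, intro borel_measurable_add borel_measurable_const m2, subst nn_integral_add[OF borel_measurable_const m2])
     (simp only: P.nn_integral_prob_const nn_integral_cmult[OF m1])
  qed
  also have "... \<le> ennreal (l powr p) * (1 + ennreal (1 / (real n * l) ^ q) * ennreal (D * real n powr (\<tau> * real q)))"
   by (intro mult_left_mono add_left_mono D(2)) simp_all
  also have "ennreal (1 / (real n * l) ^ q) * ennreal (D * real n powr (\<tau> * real q)) = ennreal D"
   unfolding nl using n0 D(1) by (simp add: ennreal_mult[symmetric])
  also have "ennreal (l powr p) * (1 + ennreal D) = ennreal (l powr p * (1 + D))"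
   using D(1) by (simp add: ennreal_mult ennreal_plus)
  finally have J: "J \<le> ..." .
  have "lp_dist p (scaled_law n) \<zeta> \<le> Lp_norm p (scaled_coupling n) (\<lambda>(x, y). x - y)"
   unfolding lp_dist_def by (rule INF_lower[OF scaled_coupling])
  also have "... = ennreal (enn2real J powr (1 / p))"
   using J by (auto simp: Lp_norm_def J_def[symmetric] Let_def top_unique)
  also have "... \<le> ennreal ((1 + D) powr (1 / p) * real n powr (\<tau> - 1))"
  proof (rule ennreal_leI)
   have "enn2real J \<le> l powr p * (1 + D)" by (rule enn2real_leI[OF _ J]) (use D(1) in simp)
   then have "enn2real J powr (1 / p) \<le> (l powr p * (1 + D)) powr (1 / p)" by (rule powr_mono2[rotated 2]) (use p in auto)
   also have "... = (1 + D) powr (1 / p) * l" using l D(1) p by (simp add: powr_mult powr_powr)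
   finally show "enn2real J powr (1 / p) \<le> (1 + D) powr (1 / p) * real n powr (\<tau> - 1)" by (simp only: l_def)
  qed
  finally show ?thesis .
 qed
 then show ?thesis by blast
qed

lemma dev_tail:
 assumes D: "dev_moment 1 q n \<le> ennreal D" "D \<ge> 0" and t: "t > 0"
 shows "{y. t \<le> \<bar>dev 1 n y\<bar>} \<in> sets (\<pi> n)" and "measure (\<pi> n) {y. t \<le> \<bar>dev 1 n y\<bar>} \<le> D / t ^ q"
proof -
 interpret P: prob_space "\<pi> n" by (rule prob_\<pi>)
 have m: "(\<lambda>y. \<bar>dev 1 n y\<bar>) \<in> borel_measurable (\<pi> n)" unfolding measurable_\<pi> by (rule borel_measurable_abs[OF measurable_dev])
 have "{y. t \<le> \<bar>dev 1 n y\<bar>} = (\<lambda>y. \<bar>dev 1 n y\<bar>) -` {t..} \<inter> space (\<pi> n)" by (auto simp: space_\<pi>)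
 moreover have "{t..} \<in> sets (borel :: real measure)" by simp
 ultimately show S: "{y. t \<le> \<bar>dev 1 n y\<bar>} \<in> sets (\<pi> n)" using measurable_sets[OF m, of "{t..}"] by (simp only:)
 have m1: "(\<lambda>y. ennreal (\<bar>dev 1 n y\<bar> ^ q)) \<in> borel_measurable (\<pi> n)" by (simp only: measurable_\<pi> measurable_dev_power)
 have "emeasure (\<pi> n) {y. t \<le> \<bar>dev 1 n y\<bar>} = (\<integral>\<^sup>+y. indicator {y. t \<le> \<bar>dev 1 n y\<bar>} y \<partial>\<pi> n)" by (rule nn_integral_indicator[OF S, symmetric])
 also have "... \<le> (\<integral>\<^sup>+y. ennreal (1 / t ^ q) * ennreal (\<bar>dev 1 n y\<bar> ^ q) \<partial>\<pi> n)"
 proof (rule nn_integral_mono)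
  fix y
  show "indicator {y. t \<le> \<bar>dev 1 n y\<bar>} y \<le> ennreal (1 / t ^ q) * ennreal (\<bar>dev 1 n y\<bar> ^ q)"
  proof (cases "t \<le> \<bar>dev 1 n y\<bar>")
   case True
   have "t ^ q \<le> \<bar>dev 1 n y\<bar> ^ q" by (rule power_mono[OF True]) (use t in simp)
   then have "1 \<le> 1 / t ^ q * \<bar>dev 1 n y\<bar> ^ q" using t by (simp add: field_simps)
   then have "ennreal 1 \<le> ennreal (1 / t ^ q * \<bar>dev 1 n y\<bar> ^ q)" by (rule ennreal_leI)
   also have "... = ennreal (1 / t ^ q) * ennreal (\<bar>dev 1 n y\<bar> ^ q)" by (rule ennreal_mult) (use t in auto)
   finally show ?thesis using True by simp
  qed simp
 qed
 also have "... = ennreal (1 / t ^ q) * dev_moment 1 q n" unfolding dev_moment_def by (rule nn_integral_cmult[OF m1])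
 also have "... \<le> ennreal (1 / t ^ q) * ennreal D" by (intro mult_left_mono D(1)) simp
 also have "... = ennreal (1 / t ^ q * D)" by (rule ennreal_mult[symmetric]) (use t D(2) in auto)
 also have "1 / t ^ q * D = D / t ^ q" by simp
 finally have "ennreal (measure (\<pi> n) {y. t \<le> \<bar>dev 1 n y\<bar>}) \<le> ennreal (D / t ^ q)" by (simp only: P.emeasure_eq_measure)
 then show "measure (\<pi> n) {y. t \<le> \<bar>dev 1 n y\<bar>} \<le> D / t ^ q" using D(2) t by (subst (asm) ennreal_le_iff) auto
qed

lemma cdf_scaled: "cdf (scaled_law n) x = measure (\<pi> n) {y. (fst y - mean n) / real n \<le> x}"
 and cdf_\<zeta>: "cdf \<zeta> x = measure (\<pi> n) {y. snd y \<le> x}"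
 and \<zeta>_interval: "measure \<zeta> {x<..x'} = measure (\<pi> n) {y. x < snd y \<and> snd y \<le> x'}"
proof -
 have f: "fst \<in> measurable (\<pi> n) borel" and g: "snd \<in> measurable (\<pi> n) borel"
  by (simp_all only: measurable_\<pi> measurable_fst measurable_snd)
 have h: "(\<lambda>y. (fst y - mean n) / real n) \<in> measurable (\<pi> n) borel" by (rule measurable_compose[OF f measurable_scale])
 have "scaled_law n = distr (distr (\<pi> n) borel fst) borel (\<lambda>x. (x - mean n) / real n)" by (simp only: fst_\<pi> scaled_law_def)
 also have "... = distr (\<pi> n) borel ((\<lambda>x. (x - mean n) / real n) \<circ> fst)" by (rule distr_distr[OF measurable_scale f])
 finally have s: "scaled_law n = distr (\<pi> n) borel (\<lambda>y. (fst y - mean n) / real n)" by (simp only: comp_def)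
 show "cdf (scaled_law n) x = measure (\<pi> n) {y. (fst y - mean n) / real n \<le> x}"
  unfolding s cdf_def by (subst measure_distr[OF h]) (auto simp: vimage_def space_\<pi>)
 show "cdf \<zeta> x = measure (\<pi> n) {y. snd y \<le> x}"
 proof -
  have "cdf \<zeta> x = measure (distr (\<pi> n) borel snd) {..x}" by (simp only: snd_\<pi> cdf_def)
  also have "... = measure (\<pi> n) (snd -` {..x} \<inter> space (\<pi> n))" by (rule measure_distr[OF g]) simp
  finally show ?thesis by (simp add: vimage_def space_\<pi>)
 qed
 show "measure \<zeta> {x<..x'} = measure (\<pi> n) {y. x < snd y \<and> snd y \<le> x'}"
 proof -
  have "measure \<zeta> {x<..x'} = measure (distr (\<pi> n) borel snd) {x<..x'}" by (simp only: snd_\<pi>)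
  also have "... = measure (\<pi> n) (snd -` {x<..x'} \<inter> space (\<pi> n))" by (rule measure_distr[OF g]) simp
  also have "snd -` {x<..x'} \<inter> space (\<pi> n) = {y. x < snd y \<and> snd y \<le> x'}" by (auto simp: space_\<pi>)
  finally show ?thesis .
 qed
qed

lemma sets_\<pi>_less: "{y. (fst y - mean n) / real n \<le> x} \<in> sets (\<pi> n)" "{y. snd y \<le> x} \<in> sets (\<pi> n)"
  "{y. x < snd y \<and> snd y \<le> x'} \<in> sets (\<pi> n)"
proof -
 have f: "fst \<in> measurable (\<pi> n) borel" and g: "snd \<in> measurable (\<pi> n) borel"
  by (simp_all only: measurable_\<pi> measurable_fst measurable_snd)
 have h: "(\<lambda>y. (fst y - mean n) / real n) \<in> measurable (\<pi> n) borel" by (rule measurable_compose[OF f measurable_scale])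
 have b: "{..x} \<in> sets (borel :: real measure)" "{x<..x'} \<in> sets (borel :: real measure)" by simp_all
 have "{y. (fst y - mean n) / real n \<le> x} = (\<lambda>y. (fst y - mean n) / real n) -` {..x} \<inter> space (\<pi> n)"
  "{y. snd y \<le> x} = snd -` {..x} \<inter> space (\<pi> n)" "{y. x < snd y \<and> snd y \<le> x'} = snd -` {x<..x'} \<inter> space (\<pi> n)"
  by (auto simp: space_\<pi>)
 then show "{y. (fst y - mean n) / real n \<le> x} \<in> sets (\<pi> n)" "{y. snd y \<le> x} \<in> sets (\<pi> n)"
  "{y. x < snd y \<and> snd y \<le> x'} \<in> sets (\<pi> n)"
  using measurable_sets[OF h b(1)] measurable_sets[OF g b(1)] measurable_sets[OF g b(2)] by (simp_all only:)
qed

text \<open>If \<open>Y \<le> x < Z\<close> or \<open>Z \<le> x < Y\<close>, then either \<open>\<bar>Y - Z\<bar> \<ge> h\<close> or \<open>Z\<close> lies within \<open>h\<close> of \<open>x\<close>.\<close>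

lemma cdf_diff_le:
 assumes n: "n \<ge> 1" and h: "h > 0" and D: "dev_moment 1 q n \<le> ennreal D" "D \<ge> 0"
  and C: "C \<ge> 0" "\<And>x h. h \<ge> 0 ==> emeasure \<zeta> {x<..x + h} \<le> ennreal (C * h)"
 shows "\<bar>cdf (scaled_law n) x - cdf \<zeta> x\<bar> \<le> D / (h * real n) ^ q + C * h"
proof -
 interpret P: prob_space "\<pi> n" by (rule prob_\<pi>)
 interpret Z: prob_space \<zeta> by (rule prob_\<zeta>)
 have n0: "real n > 0" using n by simp
 let ?A = "{y :: real \<times> real. (fst y - mean n) / real n \<le> x}" and ?B = "{y :: real \<times> real. snd y \<le> x}" and ?E = "{y. h * real n \<le> \<bar>dev 1 n y\<bar>}"
 let ?U = "{y :: real \<times> real. x < snd y \<and> snd y \<le> x + h}" and ?V = "{y :: real \<times> real. x - h < snd y \<and> snd y \<le> x - h + h}"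
 have t: "h * real n > 0" using h n0 by simp
 have E: "?E \<in> sets (\<pi> n)" "P.prob ?E \<le> D / (h * real n) ^ q" by (rule dev_tail[OF D t])+
 have eq: "(fst y - mean n) / real n = snd y + dev 1 n y / real n" for y using n0 by (simp add: dev_def field_simps)
 have small: "\<bar>dev 1 n y / real n\<bar> < h" if "y \<notin> ?E" for y using that n0 by (simp add: field_simps)
 have mass: "P.prob {y. z < snd y \<and> snd y \<le> z + h} \<le> C * h" for z
 proof -
  have "ennreal (measure \<zeta> {z<..z + h}) \<le> ennreal (C * h)" using C(2)[of h z] h by (simp add: Z.emeasure_eq_measure)
  then have "measure \<zeta> {z<..z + h} \<le> C * h" using C(1) h by (subst (asm) ennreal_le_iff) auto
  then show ?thesis by (simp only: \<zeta>_interval[of _ _ n])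
 qed
 have sub: "P.prob X \<le> P.prob Y + (P.prob ?E + P.prob W)" if "X \<subseteq> Y \<union> (?E \<union> W)" "Y \<in> sets (\<pi> n)" "W \<in> sets (\<pi> n)" for X Y W
 proof -
  have "P.prob X \<le> P.prob (Y \<union> (?E \<union> W))" by (rule P.finite_measure_mono[OF that(1)]) (intro sets.Un that E)
  also have "... \<le> P.prob Y + P.prob (?E \<union> W)" by (rule measure_Un_le) (intro sets.Un that E)+
  also have "... \<le> P.prob Y + (P.prob ?E + P.prob W)" by (intro add_left_mono measure_Un_le that E)
  finally show ?thesis .
 qed
 have "?A \<subseteq> ?B \<union> (?E \<union> ?U)"
 proof
  fix y assume y: "y \<in> ?A"
  show "y \<in> ?B \<union> (?E \<union> ?U)"
  proof (cases "y \<in> ?E")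
   case False
   then show ?thesis using small[OF False, unfolded abs_less_iff] y eq[of y] by auto
  qed simp
 qed
 then have 1: "P.prob ?A \<le> P.prob ?B + (P.prob ?E + P.prob ?U)" by (rule sub) (rule sets_\<pi>_less)+
 have "?B \<subseteq> ?A \<union> (?E \<union> ?V)"
 proof
  fix y assume y: "y \<in> ?B"
  show "y \<in> ?A \<union> (?E \<union> ?V)"
  proof (cases "y \<in> ?E")
   case False
   then show ?thesis using small[OF False, unfolded abs_less_iff] y eq[of y] by auto
  qed simp
 qed
 then have 2: "P.prob ?B \<le> P.prob ?A + (P.prob ?E + P.prob ?V)" by (rule sub) (rule sets_\<pi>_less)+
 show ?thesis unfolding cdf_scaled cdf_\<zeta>[of x n]
  using 1 2 mass[of x] mass[of "x - h"] E(2) by linarith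
qed

text \<open>With window h = n^(-1/2+\<epsilon>) and moments at scale \<tau> = 1/2 + \<epsilon>/2,
  the tail term of \<open>cdf_diff_le\<close> is D n^(-\<epsilon> q / 2). Choosing q >= 1/\<epsilon>
  makes it at most D n^(-1/2), hence at most D h; all moments are needed as \<epsilon>
  decreases.\<close>

lemma ks_rate:
 assumes K4: "K \<in> {2, 3, 4}" and \<epsilon>: "0 < \<epsilon>" "\<epsilon> < 1 / 2"
 shows "\<exists>C. \<forall>n\<ge>1. \<bar>ks_dist (scaled_law n) \<zeta>\<bar> \<le> C * real n powr (- 1 / 2 + \<epsilon>)"
proof -
 define q where "q = max 2 (nat \<lceil>1 / \<epsilon>\<rceil>)"
 have q: "q \<ge> 2" "1 / \<epsilon> \<le> real q" unfolding q_def by linarith+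
 have q\<epsilon>: "\<epsilon> * real q \<ge> 1" using q(2) \<epsilon> by (simp add: field_simps)
 define \<tau> where "\<tau> = 1 / 2 + \<epsilon> / 2"
 have \<tau>: "1 / 2 < \<tau>" "\<tau> < 1" using \<epsilon> by (simp_all add: \<tau>_def)
 obtain D where D: "D \<ge> 0" "\<And>n. dev_moment 1 q n \<le> ennreal (D * real n powr (\<tau> * real q))"
  using dev_1_moment[OF K4 \<tau> q(1)] by blast
 obtain C where C: "C \<ge> 0" "\<And>x h. h \<ge> 0 ==> emeasure \<zeta> {x<..x + h} \<le> ennreal (C * h)"
  using \<zeta>_interval_mass K4 by auto
 have "\<bar>ks_dist (scaled_law n) \<zeta>\<bar> \<le> (D + C) * real n powr (- 1 / 2 + \<epsilon>)" if n: "n \<ge> 1" for n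
 proof -
  have n1: "real n \<ge> 1" "real n > 0" using n by simp_all
  define h where "h = real n powr (- 1 / 2 + \<epsilon>)"
  have h: "h > 0" using n1 by (simp add: h_def)
  have D0: "0 \<le> D * real n powr (\<tau> * real q)" using D(1) by simp
  have le: "\<bar>cdf (scaled_law n) x - cdf \<zeta> x\<bar> \<le> (D + C) * h" for x
  proof -
   have "\<bar>cdf (scaled_law n) x - cdf \<zeta> x\<bar> \<le> D * real n powr (\<tau> * real q) / (h * real n) ^ q + C * h"
    by (rule cdf_diff_le[OF n h D(2) D0 C])
   moreover have "D * real n powr (\<tau> * real q) / (h * real n) ^ q \<le> D * h"
   proof -
    have "h * real n = real n powr (- 1 / 2 + \<epsilon>) * real n powr 1" using n1 by (simp add: h_def)
    also have "... = real n powr (1 / 2 + \<epsilon>)" by (simp only: powr_add[symmetric]) simp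
    finally have "(h * real n) ^ q = real n powr ((1 / 2 + \<epsilon>) * real q)" using n1 by (simp add: powr_powr flip: powr_realpow)
    then have "real n powr (\<tau> * real q) / (h * real n) ^ q = real n powr (\<tau> * real q - (1 / 2 + \<epsilon>) * real q)"
     by (simp only: powr_diff)
    also have "... \<le> real n powr (- 1 / 2 + \<epsilon>)"
    proof (rule powr_mono)
     have "\<tau> * real q - (1 / 2 + \<epsilon>) * real q = - (\<epsilon> * real q) / 2" by (simp add: \<tau>_def field_simps)
     then show "\<tau> * real q - (1 / 2 + \<epsilon>) * real q \<le> - 1 / 2 + \<epsilon>" using q\<epsilon> \<epsilon> by linarith
    qed (use n1 in simp)
    finally have "D * (real n powr (\<tau> * real q) / (h * real n) ^ q) \<le> D * h" unfolding h_def using D(1) by (intro mult_left_mono)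
    then show ?thesis by simp
   qed
   ultimately show ?thesis by (simp add: distrib_right)
  qed
  have "ks_dist (scaled_law n) \<zeta> \<le> (D + C) * h" unfolding ks_dist_def by (rule cSUP_least) (use le in auto)
  \<comment> \<open>Dominating one of its members, which is non-negative, the supremum is
    non-negative; this takes care of the absolute value.\<close>
  moreover have "\<bar>cdf (scaled_law n) 0 - cdf \<zeta> 0\<bar> \<le> ks_dist (scaled_law n) \<zeta>"
   unfolding ks_dist_def by (rule cSUP_upper[OF UNIV_I bdd_aboveI2]) (rule le)
  ultimately show ?thesis unfolding h_def by linarith
 qed
 then show ?thesis by blast
qed

end

section \<open>Transfer from the laws to the given random variables\<close>

theorem theorem7:
  fixes K :: nat
    and M :: "'a measure"
    and r :: "(nat tree \<times> nat tree) set"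
    and s :: sorter
    and b :: "nat \<Rightarrow> sorter"
    and V a X :: "nat \<Rightarrow> 'a \<Rightarrow> real"
    and Xc :: "nat \<Rightarrow> nat \<Rightarrow> 'a \<Rightarrow> real"
    and Y :: "nat \<Rightarrow> 'a \<Rightarrow> real"
    and \<zeta> :: "real measure"
    and p \<epsilon> :: real
  assumes "K \<in> {2, 3, 4}"
    and "optimal_quicksort M K r s b V a X Xc"
    and "\<And>n \<omega>. Y n \<omega> = (X n \<omega> - (\<integral>\<omega>'. X n \<omega>' \<partial>M)) / real n"
    and "is_limit_law K \<zeta>"
    and "p \<ge> 1"
    and "\<epsilon> > 0"
  shows "(\<exists>C. \<forall>\<^sub>F n in sequentially.
           lp_dist p (distr M borel (Y n)) \<zeta> \<le> ennreal (C * real n powr (- 1 / 2 + \<epsilon>))) \<and>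
         (\<lambda>n. ks_dist (distr M borel (Y n)) \<zeta>) \<in> O(\<lambda>n. real n powr (- 1 / 2 + \<epsilon>))"
proof -
 let ?\<mu> = "\<lambda>n. distr M borel (X n)"
 have K: "K \<ge> 1" using assms(1) by auto
 interpret quicksort_laws K r s ?\<mu> by (rule optimal_quicksort.laws[OF assms(2) K])
 interpret limit_coupling K r s ?\<mu> \<zeta> by unfold_locales (rule assms(4))
 have law: "distr M borel (Y n) = scaled_law n" for n
 proof -
  have X: "X n \<in> borel_measurable M" by (rule optimal_quicksort.X_measurable[OF assms(2)])
  have m: "mean n = (\<integral>\<omega>. X n \<omega> \<partial>M)" unfolding mean_def by (rule integral_distr[OF X]) simp
  have "scaled_law n = distr M borel ((\<lambda>x. (x - mean n) / real n) \<circ> X n)"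
   unfolding scaled_law_def by (rule distr_distr[OF measurable_scale X])
  also have "(\<lambda>x. (x - mean n) / real n) \<circ> X n = Y n" by (rule ext) (simp only: comp_apply assms(3) m)
  finally show ?thesis ..
 qed
 \<comment> \<open>The rates are proved for \<tau> = 1/2 + \<delta> below 1, so a large \<epsilon>
   is reduced; for n >= 1 a larger exponent only weakens the bound.\<close>
 define \<delta> where "\<delta> = min \<epsilon> (1 / 4)"
 have \<delta>: "0 < \<delta>" "\<delta> < 1 / 2" "\<delta> \<le> \<epsilon>" using assms(6) by (auto simp: \<delta>_def)
 have mono: "real n powr (- 1 / 2 + \<delta>) \<le> real n powr (- 1 / 2 + \<epsilon>)" if "n \<ge> 1" for n
  by (rule powr_mono) (use that \<delta> in auto)
 obtain C where C: "\<And>n. n \<ge> 1 \<Longrightarrow> lp_dist p (scaled_law n) \<zeta> \<le> ennreal (C * real n powr (1 / 2 + \<delta> - 1))"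
 proof -
  have "1 / 2 < 1 / 2 + \<delta>" "1 / 2 + \<delta> < 1" using \<delta> by auto
  from lp_rate[OF assms(1) this assms(5)] show ?thesis using that by blast
 qed
 have "lp_dist p (distr M borel (Y n)) \<zeta> \<le> ennreal (\<bar>C\<bar> * real n powr (- 1 / 2 + \<epsilon>))" if n: "n \<ge> 1" for n
 proof -
  have e: "1 / 2 + \<delta> - 1 = - 1 / 2 + \<delta>" by simp
  have "C * real n powr (- 1 / 2 + \<delta>) \<le> \<bar>C\<bar> * real n powr (- 1 / 2 + \<epsilon>)" by (rule mult_mono) (use mono[OF n] in auto)
  then have "ennreal (C * real n powr (- 1 / 2 + \<delta>)) \<le> ennreal (\<bar>C\<bar> * real n powr (- 1 / 2 + \<epsilon>))" by (rule ennreal_leI)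
  with C[OF n] show ?thesis unfolding law e by (rule order_trans)
 qed
 then have 1: "\<exists>C. \<forall>\<^sub>F n in sequentially. lp_dist p (distr M borel (Y n)) \<zeta> \<le> ennreal (C * real n powr (- 1 / 2 + \<epsilon>))"
  by (intro exI[of _ "\<bar>C\<bar>"] eventually_sequentiallyI[of 1])
 obtain B where B: "\<And>n. n \<ge> 1 \<Longrightarrow> \<bar>ks_dist (scaled_law n) \<zeta>\<bar> \<le> B * real n powr (- 1 / 2 + \<delta>)"
  using ks_rate[OF assms(1) \<delta>(1,2)] by blast
 have "\<bar>ks_dist (distr M borel (Y n)) \<zeta>\<bar> \<le> \<bar>B\<bar> * real n powr (- 1 / 2 + \<epsilon>)" if n: "n \<ge> 1" for n
 proof -
  have "B * real n powr (- 1 / 2 + \<delta>) \<le> \<bar>B\<bar> * real n powr (- 1 / 2 + \<epsilon>)" by (rule mult_mono) (use mono[OF n] in auto)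
  then show ?thesis using B[OF n] unfolding law by linarith
 qed
 then have 2: "(\<lambda>n. ks_dist (distr M borel (Y n)) \<zeta>) \<in> O(\<lambda>n. real n powr (- 1 / 2 + \<epsilon>))"
  by (intro bigoI[of _ "\<bar>B\<bar>"] eventually_sequentiallyI[of 1]) simp
 from 1 2 show ?thesis by blast
qed

end
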